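(* For every $k\ge1$, the following maps are all isomorphisms: (i) $\widetilde\eta_{2k-1}:\widetilde{\mathcal T}_{2k-1}\to\widetilde{\mathsf D}_{2k-1}$; (ii) $\eta_{2k-1}:\mathcal T^\infty_{2k-1}\to\mathsf D_{2k-1}$; (iii) $\eta_{4k}:\mathcal T^\infty_{4k}\to\mathsf D_{4k}$; (iv) $\eta^\infty_{4k-2}:\mathcal T^\infty_{4k-2}\to\mathsf D^\infty_{4k-2}$.
   Context: Trees. Fix $m\ge 1$. A tree is a finite unitrivalent tree with a cyclic ordering of the edges at each trivalent vertex (its orientation) and univalent vertices labeled by elements of $\{1,\dots,m\}$, up to isomorphism; its order is its number of trivalent vertices. A rooted tree has in addition one unlabeled univalent vertex, the root; $i$ also denotes the rooted edge labeled $i$. For rooted trees $I,J$, the rooted product $(I,J)$ glues the two roots to a new trivalent vertex with a new root edge, oriented according to the order $I,J$; the inner product $\langle I,J\rangle$ is the unrooted tree obtained by gluing the two roots to a single non-vertex point. $\mathcal T_n$ is the free abelian group on order $n$ trees modulo AS relations (reversing the cyclic order at one trivalent vertex changes the sign) and IHX relations $I-H+X=0$ for trees identical except that $I,H,X$ contain the rooted subtrees $((A,B),C)$, $(A,(B,C))$, $(B,(A,C))$ respectively. For a univalent vertex $v$ of a tree $t$, $\ell(v)$ is its label and $T_v(t)$ is the rooted tree obtained by replacing $v$ with a root. $\Delta_{2k-1}:\mathcal T_{k-1}\to\mathcal T_{2k-1}$ is defined by $\Delta_{2k-1}(t)=\sum_v\langle\ell(v),(T_v(t),T_v(t))\rangle$,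 and $\widetilde{\mathcal T}_{2k-1}=\mathcal T_{2k-1}/\operatorname{Im}\Delta_{2k-1}$. Twisted tree groups. For a rooted tree $J$, the $\infty$-tree $J^\infty$ is obtained by labeling the root with the twist symbol $\infty$. $\mathcal T^\infty_{2k-1}$ is the quotient of $\mathcal T_{2k-1}$ by the relations $\langle (i,J),J\rangle=0$ for all labels $i$ and order $k-1$ rooted trees $J$. $\mathcal T^\infty_{2k}$ is the free abelian group on order $2k$ trees and order $k$ $\infty$-trees modulo: AS and IHX relations on order $2k$ trees; $(-J)^\infty=J^\infty$, where $-J$ differs from $J$ by reversing the cyclic order at an odd number of vertices; $I^\infty=H^\infty+X^\infty-\langle H,X\rangle$ for order $k$ rooted trees $I,H,X$ identical except for containing the subtrees $((A,B),C)$, $(A,(B,C))$, $(B,(A,C))$ respectively; and $2\cdot J^\infty=\langle J,J\rangle$. Lie algebras. $\mathsf L_n$ is the degree $n$ part of the free Lie $\mathbb Z$-algebra on degree 1 generators $X_1,\dots,X_m$; $\mathsf L'_n$ is the abelian group generated by rooted trees of order $n-1$ modulo AS and IHX relations (with bracket given by the rooted product, $\mathsf L'_1=\mathsf L_1$, and $\mathsf L'_n\to\mathsf L_n$ the natural projection identifying rooted trees with brackets). $\mathsf D_n=\ker(\mathsf L_1\otimes\mathsf L_{n+1}\to\mathsf L_{n+2})$ and $\mathsf D'_n=\ker(\mathsf L'_1\otimes\mathsf L'_{n+1}\to\mathsf L'_{n+2})$ are the kernels of the bracket maps. The homomorphism $\eta_n:\mathcal T^\infty_n\to\mathsf D_n$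 is given by $\eta_n(t)=\sum_v X_{\ell(v)}\otimes T_v(t)$ on trees $t$, and $\eta_n(J^\infty)=\frac12\eta_n(\langle J,J\rangle)$ (all coefficients of $\eta_n(\langle J,J\rangle)$ are even). The homomorphism $\eta'_n:\mathcal T_n\to\mathsf D'_n$ is given by $\eta'_n(t)=\sum_v X_{\ell(v)}\otimes T_v(t)$ with $T_v(t)\in\mathsf L'_{n+1}$. $\widetilde{\mathsf D}_{2k-1}$ is the quotient of $\mathsf D'_{2k-1}$ by the subgroup $\eta'_{2k-1}(\operatorname{Im}\Delta_{2k-1})$, and $\widetilde\eta_{2k-1}$ is induced by $\eta'_{2k-1}$. The group $\mathsf D^\infty_{4k-2}$. The projection $\mathsf L'_{2k+1}\to\mathsf L_{2k+1}$ is an isomorphism and there is an exact sequence $0\to\mathbb Z_2\otimes\mathsf L_{k+1}\xrightarrow{sq}\mathsf L'_{2k+2}\to\mathsf L_{2k+2}\to0$, $sq(1\otimes X)=[X,X]$. The epimorphism $s\ell_{2k}:\mathsf D_{2k}\to\mathbb Z_2\otimes\mathsf L_{k+1}$ sends $Z$ to $sq^{-1}$ of the bracket in $\mathsf L'_{2k+2}$ of $Z$, viewed in $\mathsf L_1\otimes\mathsf L'_{2k+1}\cong\mathsf L_1\otimes\mathsf L_{2k+1}$. $\mathsf D^\infty_{4k-2}$ is the pullback of $s\ell_{4k-2}:\mathsf D_{4k-2}\to\mathbb Z_2\otimes\mathsf L_{2k}$ and the projection $p:\mathbb Z_2\otimes\mathsf L'_{2k}\to\mathbb Z_2\otimes\mathsf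 L_{2k}$. The map $\eta^\infty_{4k-2}:\mathcal T^\infty_{4k-2}\to\mathsf D^\infty_{4k-2}$ is the homomorphism into the pullback with components $\eta_{4k-2}:\mathcal T^\infty_{4k-2}\to\mathsf D_{4k-2}$ and the homomorphism $\mathcal T^\infty_{4k-2}\to\mathbb Z_2\otimes\mathsf L'_{2k}$ sending trees to $0$ and $J^\infty$ to $1\otimes J$ (these agree in $\mathbb Z_2\otimes\mathsf L_{2k}$). *)

theory Defs
  imports "HOL-Algebra.Free_Abelian_Groups"
begin

section \<open>Trees\<close>

text \<open>
  Up to isomorphism, a rooted tree with oriented trivalent vertices is a planar binary tree:
  \<open>Leaf i\<close> is the rooted edge labeled \<open>i\<close>, and \<open>Node I J\<close> is the rooted product \<open>(I,J)\<close>, whose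
  new vertex has the cyclic order (\<open>I\<close>, \<open>J\<close>, root).
\<close>

datatype rtree = Leaf nat | Node rtree rtree

primrec rorder :: "rtree \<Rightarrow> nat" where
  "rorder (Leaf i) = 0"
| "rorder (Node I J) = Suc (rorder I + rorder J)"

primrec rlabels :: "rtree \<Rightarrow> nat set" where
  "rlabels (Leaf i) = {i}"
| "rlabels (Node I J) = rlabels I \<union> rlabels J"

definition rtrees :: "nat \<Rightarrow> nat \<Rightarrow> rtree set" where
  "rtrees m n = {J. rlabels J \<subseteq> {1..m} \<and> rorder J = n}"

text \<open>\<open>reversal p J J'\<close>: \<open>J'\<close> arises from \<open>J\<close> by reversing the cyclic order at exactly \<open>p\<close> vertices.\<close>

inductive reversal :: "nat \<Rightarrow> rtree \<Rightarrow> rtree \<Rightarrow> bool" where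
  "reversal 0 (Leaf i) (Leaf i)"
| "reversal p I I' \<Longrightarrow> reversal q J J' \<Longrightarrow> reversal (p + q) (Node I J) (Node I' J')"
| "reversal p I I' \<Longrightarrow> reversal q J J' \<Longrightarrow> reversal (Suc (p + q)) (Node I J) (Node J' I')"

text \<open>
  \<open>IHX_triple I H X\<close>: the rooted trees \<open>I\<close>, \<open>H\<close>, \<open>X\<close> are identical except for containing the
  subtrees \<open>((A,B),C)\<close>, \<open>(A,(B,C))\<close>, \<open>(B,(A,C))\<close>.
\<close>

inductive IHX_triple :: "rtree \<Rightarrow> rtree \<Rightarrow> rtree \<Rightarrow> bool" where
  "IHX_triple (Node (Node A B) C) (Node A (Node B C)) (Node B (Node A C))"
| "IHX_triple I H X \<Longrightarrow> IHX_triple (Node I K) (Node H K) (Node X K)"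
| "IHX_triple I H X \<Longrightarrow> IHX_triple (Node K I) (Node K H) (Node K X)"

text \<open>
  Unrooted trees are finite graphs. At a trivalent vertex \<open>v\<close>, the map \<open>nxt t v\<close> sends each
  neighbor of \<open>v\<close> to the following one in the cyclic order. The values of \<open>nxt t v\<close> elsewhere,
  and those of \<open>lab t\<close> off the univalent vertices, are irrelevant; isomorphisms ignore them.
\<close>

record otree =
  verts :: "nat set"
  adj :: "nat \<Rightarrow> nat \<Rightarrow> bool"
  nxt :: "nat \<Rightarrow> nat \<Rightarrow> nat"
  lab :: "nat \<Rightarrow> nat"

definition univalent :: "otree \<Rightarrow> nat \<Rightarrow> bool" where
  "univalent t v \<longleftrightarrow> v \<in> verts t \<and> card {u. adj t v u} = 1"

definition trivalent :: "otree \<Rightarrow> nat \<Rightarrow> bool" where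
  "trivalent t v \<longleftrightarrow> v \<in> verts t \<and> card {u. adj t v u} = 3"

definition unitrivalent_tree :: "otree \<Rightarrow> bool" where
  "unitrivalent_tree t \<longleftrightarrow>
     finite (verts t) \<and> verts t \<noteq> {} \<and>
     (\<forall>u v. adj t u v \<longrightarrow> u \<in> verts t \<and> v \<in> verts t \<and> u \<noteq> v \<and> adj t v u) \<and>
     (\<forall>u\<in>verts t. \<forall>v\<in>verts t. (adj t)\<^sup>*\<^sup>* u v) \<and>
     (\<nexists>p. 3 \<le> length p \<and> distinct p \<and> successively (adj t) p \<and> adj t (last p) (hd p)) \<and>
     (\<forall>v\<in>verts t. univalent t v \<or> trivalent t v) \<and>
     (\<forall>v u. trivalent t v \<longrightarrow> adj t v u \<longrightarrow>
        adj t v (nxt t v u) \<and> nxt t v u \<noteq> u \<and> nxt t v (nxt t v (nxt t v u)) = u)"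

definition is_otree_iso :: "(nat \<Rightarrow> nat) \<Rightarrow> otree \<Rightarrow> otree \<Rightarrow> bool" where
  "is_otree_iso f s t \<longleftrightarrow>
     bij_betw f (verts s) (verts t) \<and>
     (\<forall>u\<in>verts s. \<forall>v\<in>verts s. adj s u v \<longleftrightarrow> adj t (f u) (f v)) \<and>
     (\<forall>v u. trivalent s v \<longrightarrow> adj s v u \<longrightarrow> f (nxt s v u) = nxt t (f v) (f u)) \<and>
     (\<forall>v. univalent s v \<longrightarrow> lab t (f v) = lab s v)"

definition otree_equiv :: "otree \<Rightarrow> otree \<Rightarrow> bool" where
  "otree_equiv s t \<longleftrightarrow> unitrivalent_tree s \<and> unitrivalent_tree t \<and> (\<exists>f. is_otree_iso f s t)"

definition reverse_vertex :: "nat \<Rightarrow> otree \<Rightarrow> otree" where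
  "reverse_vertex v t = t\<lparr>nxt := (nxt t)(v := nxt t v \<circ> nxt t v)\<rparr>"

text \<open>
  \<open>branch t u v J\<close>, for an edge \<open>uv\<close>: cutting that edge leaves the rooted tree \<open>J\<close> on the side of
  \<open>v\<close>, rooted at the cut.
\<close>

inductive branch :: "otree \<Rightarrow> nat \<Rightarrow> nat \<Rightarrow> rtree \<Rightarrow> bool" for t where
  "adj t u v \<Longrightarrow> univalent t v \<Longrightarrow> branch t u v (Leaf (lab t v))"
| "adj t u v \<Longrightarrow> trivalent t v \<Longrightarrow> branch t v (nxt t v u) I \<Longrightarrow>
     branch t v (nxt t v (nxt t v u)) J \<Longrightarrow> branch t u v (Node I J)"

text \<open>The tree \<open>T\<^sub>v(t)\<close>, for a univalent vertex \<open>v\<close>.\<close>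

definition root_at :: "otree \<Rightarrow> nat \<Rightarrow> rtree" where
  "root_at t v = (THE J. \<exists>w. adj t v w \<and> branch t v w J)"

lemma is_otree_isoD:
  assumes "is_otree_iso f s t" "unitrivalent_tree s" "unitrivalent_tree t"
  shows "v \<in> verts s \<Longrightarrow> {u. adj t (f v) u} = f ` {u. adj s v u}"
    and "v \<in> verts s \<Longrightarrow> univalent t (f v) \<longleftrightarrow> univalent s v"
    and "v \<in> verts s \<Longrightarrow> trivalent t (f v) \<longleftrightarrow> trivalent s v"
proof -
  have bij: "bij_betw f (verts s) (verts t)" using assms(1) by (simp add: is_otree_iso_def)
  have nb: "{u. adj t (f v) u} = f ` {u. adj s v u}" if v: "v \<in> verts s" for v
  proof (intro equalityI subsetI)
    fix u' assume "u' \<in> {u. adj t (f v) u}"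
    then have a: "adj t (f v) u'" by simp
    then have "u' \<in> verts t" using assms(3) unfolding unitrivalent_tree_def by blast
    then obtain u where "u \<in> verts s" "u' = f u" using bij by (auto simp: bij_betw_def)
    then show "u' \<in> f ` {u. adj s v u}"
      using a v assms(1) unfolding is_otree_iso_def by blast
  next
    fix u' assume "u' \<in> f ` {u. adj s v u}"
    then obtain u where u: "adj s v u" "u' = f u" by blast
    then have "u \<in> verts s" using assms(2) unfolding unitrivalent_tree_def by blast
    then show "u' \<in> {u. adj t (f v) u}"
      using u v assms(1) unfolding is_otree_iso_def by blast
  qed
  then show "v \<in> verts s \<Longrightarrow> {u. adj t (f v) u} = f ` {u. adj s v u}" .
  have c: "card {u. adj t (f v) u} = card {u. adj s v u}" if v: "v \<in> verts s" for v
  proof -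
    have "{u. adj s v u} \<subseteq> verts s" using assms(2) unfolding unitrivalent_tree_def by blast
    then have "inj_on f {u. adj s v u}" using bij inj_on_subset by (auto simp: bij_betw_def)
    then show ?thesis using nb[OF v] by (simp add: card_image)
  qed
  have "f v \<in> verts t" if "v \<in> verts s" for v using bij that by (auto simp: bij_betw_def)
  then show "v \<in> verts s \<Longrightarrow> univalent t (f v) \<longleftrightarrow> univalent s v"
    and "v \<in> verts s \<Longrightarrow> trivalent t (f v) \<longleftrightarrow> trivalent s v"
    using c by (simp_all add: univalent_def trivalent_def)
qed

lemma is_otree_iso_refl: "is_otree_iso id t t"
  by (simp add: is_otree_iso_def)

lemma is_otree_iso_trans:
  assumes "is_otree_iso f r s" "is_otree_iso g s t" "unitrivalent_tree r" "unitrivalent_tree s"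
  shows "is_otree_iso (g \<circ> f) r t"
proof -
  note tri = is_otree_isoD[OF assms(1,3,4)]
  have f: "bij_betw f (verts r) (verts s)" using assms(1) by (simp add: is_otree_iso_def)
  then have fin: "f v \<in> verts s" if "v \<in> verts r" for v using that by (auto simp: bij_betw_def)
  have vr: "v \<in> verts r \<and> u \<in> verts r" if "adj r v u" for u v
    using that assms(3) unfolding unitrivalent_tree_def by blast
  show ?thesis
    unfolding is_otree_iso_def
  proof (intro conjI allI ballI impI)
    show "bij_betw (g \<circ> f) (verts r) (verts t)"
      using f assms(2) by (auto simp: is_otree_iso_def intro: bij_betw_trans)
    show "adj r u v \<longleftrightarrow> adj t ((g \<circ> f) u) ((g \<circ> f) v)" if "u \<in> verts r" "v \<in> verts r" for u v
      using that fin assms(1,2) unfolding is_otree_iso_def by simp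
    show "(g \<circ> f) (nxt r v u) = nxt t ((g \<circ> f) v) ((g \<circ> f) u)"
      if "trivalent r v" "adj r v u" for v u
    proof -
      have "f (nxt r v u) = nxt s (f v) (f u)" "trivalent s (f v)" "adj s (f v) (f u)"
        using that vr tri(3) assms(1) unfolding is_otree_iso_def by blast+
      then show ?thesis using assms(2) unfolding is_otree_iso_def by simp
    qed
    show "lab t ((g \<circ> f) v) = lab r v" if "univalent r v" for v
    proof -
      have "v \<in> verts r" using that by (simp add: univalent_def)
      then have "univalent s (f v)" using that tri(2) by blast
      then show ?thesis using that assms(1,2) unfolding is_otree_iso_def by simp
    qed
  qed
qed

lemma is_otree_iso_sym:
  assumes "is_otree_iso f s t" "unitrivalent_tree s" "unitrivalent_tree t"
  shows "is_otree_iso (inv_into (verts s) f) t s"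
proof -
  define g where "g = inv_into (verts s) f"
  note tri = is_otree_isoD[OF assms]
  have f: "bij_betw f (verts s) (verts t)" using assms(1) by (simp add: is_otree_iso_def)
  have gf: "g (f v) = v" if "v \<in> verts s" for v
    using that f by (simp add: g_def bij_betw_def)
  have fg: "f (g v) = v" "g v \<in> verts s" if "v \<in> verts t" for v
    using that f by (auto simp: g_def bij_betw_def f_inv_into_f inv_into_into)
  have vt: "v \<in> verts t \<and> u \<in> verts t" if "adj t v u" for u v
    using that assms(3) unfolding unitrivalent_tree_def by blast
  have "is_otree_iso g t s"
    unfolding is_otree_iso_def
  proof (intro conjI allI ballI impI)
    show "bij_betw g (verts t) (verts s)" using f by (simp add: g_def bij_betw_inv_into)
    show "adj t u v \<longleftrightarrow> adj s (g u) (g v)" if "u \<in> verts t" "v \<in> verts t" for u v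
      using that fg assms(1) unfolding is_otree_iso_def by metis
    show "g (nxt t v u) = nxt s (g v) (g u)" if a: "trivalent t v" "adj t v u" for v u
    proof -
      have v: "g v \<in> verts s" "g u \<in> verts s" "f (g v) = v" "f (g u) = u"
        using fg vt[OF a(2)] by auto
      then have "trivalent s (g v)" "adj s (g v) (g u)"
        using a tri(3)[OF v(1)] assms(1) unfolding is_otree_iso_def by auto
      moreover from this have "nxt s (g v) (g u) \<in> verts s"
        using assms(2) unfolding unitrivalent_tree_def by blast
      ultimately show ?thesis
        using v gf assms(1) unfolding is_otree_iso_def by metis
    qed
    show "lab s (g v) = lab t v" if "univalent t v" for v
    proof -
      have "v \<in> verts t" using that by (simp add: univalent_def)
      then show ?thesis using that fg tri(2) assms(1) unfolding is_otree_iso_def by metis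
    qed
  qed
  then show ?thesis by (simp add: g_def)
qed

lemma otree_equiv_sym: "otree_equiv s t \<Longrightarrow> otree_equiv t s"
  using is_otree_iso_sym unfolding otree_equiv_def by blast

lemma otree_equiv_trans: "otree_equiv r s \<Longrightarrow> otree_equiv s t \<Longrightarrow> otree_equiv r t"
  using is_otree_iso_trans unfolding otree_equiv_def by blast

lemma unitrivalent_tree_edge:
  "unitrivalent_tree \<lparr>verts = {0, 1}, adj = (\<lambda>u v. (u, v) \<in> {(0, 1), (1, 0)}),
     nxt = (\<lambda>_ u. u), lab = (\<lambda>_. i)\<rparr>" (is "unitrivalent_tree ?t")
proof -
  have nb: "{u. adj ?t 0 u} = {1}" "{u. adj ?t (Suc 0) u} = {0}" by auto
  have uni: "univalent ?t 0" "univalent ?t (Suc 0)"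
    by (simp_all add: univalent_def nb del: otree.simps) auto
  have nt: "\<not> trivalent ?t v" for v
  proof
    assume v: "trivalent ?t v"
    then have "v = 0 \<or> v = Suc 0" by (auto simp: trivalent_def)
    then show False using v uni unfolding trivalent_def univalent_def by fastforce
  qed
  have nocyc: False
    if p: "3 \<le> length p" "distinct p" "successively (adj ?t) p" "adj ?t (last p) (hd p)" for p
  proof -
    obtain a b c q where "p = a # b # c # q"
      using p(1) by (auto simp: numeral_3_eq_3 Suc_le_length_iff)
    then show False using p(2,3) by auto
  qed
  show ?thesis
    unfolding unitrivalent_tree_def
  proof (intro conjI allI ballI impI)
    show "\<nexists>p. 3 \<le> length p \<and> distinct p \<and> successively (adj ?t) p \<and> adj ?t (last p) (hd p)"
      using nocyc by blast
    show "univalent ?t v \<or> trivalent ?t v" if "v \<in> verts ?t" for v using that uni by auto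
    show "(adj ?t)\<^sup>*\<^sup>* u v" if "u \<in> verts ?t" "v \<in> verts ?t" for u v
    proof (cases "u = v")
      case False
      then have "adj ?t u v" using that by auto
      then show ?thesis by blast
    qed simp
  qed (use nt in auto)
qed

quotient_type utree = otree / partial: otree_equiv
proof (rule part_equivpI)
  show "\<exists>t. otree_equiv t t"
    using unitrivalent_tree_edge is_otree_iso_refl unfolding otree_equiv_def by blast
  show "symp otree_equiv" by (rule sympI) (rule otree_equiv_sym)
  show "transp otree_equiv" by (rule transpI) (rule otree_equiv_trans)
qed

lemma branch_iso:
  assumes "is_otree_iso f s t" "unitrivalent_tree s" "unitrivalent_tree t" "branch s u v J"
  shows "branch t (f u) (f v) J"
  using assms(4)
proof induction
  case (1 u v)
  then have "u \<in> verts s" "v \<in> verts s" using assms(2) unfolding unitrivalent_tree_def by blast+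
  then have "adj t (f u) (f v)" "univalent t (f v)" "lab t (f v) = lab s v"
    using 1 is_otree_isoD(2)[OF assms(1-3)] assms(1) unfolding is_otree_iso_def by blast+
  then show ?case using branch.intros(1)[of t "f u" "f v"] by simp
next
  case (2 u v I J)
  have v: "u \<in> verts s" "v \<in> verts s" "adj s v u"
    using 2(1) assms(2) unfolding unitrivalent_tree_def by blast+
  then have n: "adj s v (nxt s v u)" using 2(2) assms(2) unfolding unitrivalent_tree_def by blast
  have "f (nxt s v u) = nxt t (f v) (f u)"
    "f (nxt s v (nxt s v u)) = nxt t (f v) (nxt t (f v) (f u))"
    using assms(1) 2(2) v(3) n unfolding is_otree_iso_def by metis+
  moreover have "adj t (f u) (f v)" "trivalent t (f v)"
    using v 2(1,2) is_otree_isoD(3)[OF assms(1-3)] assms(1) unfolding is_otree_iso_def by blast+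
  ultimately show ?case using 2 branch.intros(2)[of t "f u" "f v"] by simp
qed

lemma root_at_iso:
  assumes "is_otree_iso f s t" "unitrivalent_tree s" "unitrivalent_tree t" "v \<in> verts s"
  shows "root_at t (f v) = root_at s v"
proof -
  let ?g = "inv_into (verts s) f"
  have f: "bij_betw f (verts s) (verts t)" using assms(1) by (simp add: is_otree_iso_def)
  have gv: "?g (f v) = v" using f assms(4) by (simp add: bij_betw_def)
  have fv: "f v \<in> verts t" using f assms(4) by (auto simp: bij_betw_def)
  note g = is_otree_iso_sym[OF assms(1-3)]
  have "(\<exists>w. adj t (f v) w \<and> branch t (f v) w J) \<longleftrightarrow> (\<exists>w. adj s v w \<and> branch s v w J)" for J
  proof
    assume "\<exists>w. adj t (f v) w \<and> branch t (f v) w J"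
    then obtain w where w: "adj t (f v) w" "branch t (f v) w J" by blast
    then have "w \<in> verts t" using assms(3) unfolding unitrivalent_tree_def by blast
    then have "adj s v (?g w)" using w(1) g fv gv unfolding is_otree_iso_def by metis
    moreover have "branch s v (?g w) J" using branch_iso[OF g assms(3,2) w(2)] gv by simp
    ultimately show "\<exists>w. adj s v w \<and> branch s v w J" by blast
  next
    assume "\<exists>w. adj s v w \<and> branch s v w J"
    then obtain w where w: "adj s v w" "branch s v w J" by blast
    then have "w \<in> verts s" using assms(2) unfolding unitrivalent_tree_def by blast
    then have "adj t (f v) (f w)" using w(1) assms(1,4) unfolding is_otree_iso_def by blast
    then show "\<exists>w. adj t (f v) w \<and> branch t (f v) w J"
      using branch_iso[OF assms(1-3) w(2)] by blast
  qed
  then show ?thesis unfolding root_at_def by simp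
qed

lemma bij_betw_valence:
  assumes "is_otree_iso f s t" "unitrivalent_tree s" "unitrivalent_tree t"
  shows "bij_betw f {v. univalent s v} {v. univalent t v}"
    and "bij_betw f {v. trivalent s v} {v. trivalent t v}"
proof -
  have f: "inj_on f (verts s)" "f ` verts s = verts t"
    using assms(1) by (auto simp: is_otree_iso_def bij_betw_def)
  have "{v. univalent s v} \<subseteq> verts s" "{v. trivalent s v} \<subseteq> verts s"
    by (auto simp: univalent_def trivalent_def)
  then have "inj_on f {v. univalent s v}" "inj_on f {v. trivalent s v}"
    using f(1) inj_on_subset by blast+
  moreover have "f ` {v. univalent s v} = {v. univalent t v}"
  proof (intro equalityI subsetI)
    fix w assume w: "w \<in> {v. univalent t v}"
    then have "w \<in> f ` verts s" using f(2) by (simp add: univalent_def)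
    then show "w \<in> f ` {v. univalent s v}" using w is_otree_isoD(2)[OF assms] by blast
  qed (use is_otree_isoD(2)[OF assms] in \<open>auto simp: univalent_def\<close>)
  moreover have "f ` {v. trivalent s v} = {v. trivalent t v}"
  proof (intro equalityI subsetI)
    fix w assume w: "w \<in> {v. trivalent t v}"
    then have "w \<in> f ` verts s" using f(2) by (simp add: trivalent_def)
    then show "w \<in> f ` {v. trivalent s v}" using w is_otree_isoD(3)[OF assms] by blast
  qed (use is_otree_isoD(3)[OF assms] in \<open>auto simp: trivalent_def\<close>)
  ultimately show "bij_betw f {v. univalent s v} {v. univalent t v}"
    and "bij_betw f {v. trivalent s v} {v. trivalent t v}"
    by (auto simp: bij_betw_def)
qed

lift_definition uorder :: "utree \<Rightarrow> nat" is "\<lambda>t. card {v. trivalent t v}"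
  unfolding otree_equiv_def using bij_betw_valence(2) bij_betw_same_card by blast

lift_definition ulabels :: "utree \<Rightarrow> nat set" is "\<lambda>t. lab t ` {v. univalent t v}"
proof -
  fix s t assume "otree_equiv s t"
  then obtain f where f: "is_otree_iso f s t" "unitrivalent_tree s" "unitrivalent_tree t"
    unfolding otree_equiv_def by blast
  have "{v. univalent t v} = f ` {v. univalent s v}"
    using bij_betw_valence(1)[OF f] by (simp add: bij_betw_def)
  moreover have "lab t (f v) = lab s v" if "univalent s v" for v
    using f(1) that unfolding is_otree_iso_def by blast
  ultimately show "lab s ` {v. univalent s v} = lab t ` {v. univalent t v}"
    by (auto simp: image_image)
qed

text \<open>The formal sum over the univalent vertices \<open>v\<close> of \<open>t\<close> of the pairs \<open>(\<ell>(v), T\<^sub>v(t))\<close>.\<close>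

lift_definition vertex_sum :: "utree \<Rightarrow> (nat \<times> rtree) \<Rightarrow>\<^sub>0 int"
  is "\<lambda>t. \<Sum>v | univalent t v. frag_of (lab t v, root_at t v)"
proof -
  fix s t assume "otree_equiv s t"
  then obtain f where f: "is_otree_iso f s t" "unitrivalent_tree s" "unitrivalent_tree t"
    unfolding otree_equiv_def by blast
  have "lab t (f v) = lab s v" "root_at t (f v) = root_at s v" if "univalent s v" for v
    using f(1) that root_at_iso[OF f] unfolding is_otree_iso_def univalent_def by blast+
  then have "(\<Sum>v | univalent s v. frag_of (lab s v, root_at s v)) =
      (\<Sum>v | univalent s v. frag_of (lab t (f v), root_at t (f v)))"
    by (intro sum.cong) auto
  also have "\<dots> = (\<Sum>v | univalent t v. frag_of (lab t v, root_at t v))"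
    by (rule sum.reindex_bij_betw[OF bij_betw_valence(1)[OF f]])
  finally show "(\<Sum>v | univalent s v. frag_of (lab s v, root_at s v)) =
      (\<Sum>v | univalent t v. frag_of (lab t v, root_at t v))" .
qed

definition utrees :: "nat \<Rightarrow> nat \<Rightarrow> utree set" where
  "utrees m n = {t. ulabels t \<subseteq> {1..m} \<and> uorder t = n}"

text \<open>The inner product \<open>\<langle>I,J\<rangle>\<close>: the tree with an edge along which it cuts into \<open>I\<close> and \<open>J\<close>.\<close>

definition tree_inner :: "rtree \<Rightarrow> rtree \<Rightarrow> utree" where
  "tree_inner I J = (THE T. \<exists>t u v. unitrivalent_tree t \<and> T = abs_utree t \<and>
     adj t u v \<and> branch t u v I \<and> branch t v u J)"


section \<open>Presented abelian groups and tensor products\<close>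

definition relator_subgroup :: "'a set \<Rightarrow> ('a \<Rightarrow>\<^sub>0 int) set \<Rightarrow> ('a \<Rightarrow>\<^sub>0 int) set" where
  "relator_subgroup S R = generate (free_Abelian_group S) R"

definition presented :: "'a set \<Rightarrow> ('a \<Rightarrow>\<^sub>0 int) set \<Rightarrow> ('a \<Rightarrow>\<^sub>0 int) set monoid" where
  "presented S R = free_Abelian_group S Mod relator_subgroup S R"

definition presented_class :: "'a set \<Rightarrow> ('a \<Rightarrow>\<^sub>0 int) set \<Rightarrow> ('a \<Rightarrow>\<^sub>0 int) \<Rightarrow> ('a \<Rightarrow>\<^sub>0 int) set" where
  "presented_class S R x = relator_subgroup S R #>\<^bsub>free_Abelian_group S\<^esub> x"

text \<open>The homomorphism into the (multiplicatively written) abelian group \<open>K\<close> with values \<open>b\<close> on generators.\<close>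

definition lin_extend :: "('b, 'c) monoid_scheme \<Rightarrow> ('a \<Rightarrow> 'b) \<Rightarrow> ('a \<Rightarrow>\<^sub>0 int) \<Rightarrow> 'b" where
  "lin_extend K b x =
     finprod K (\<lambda>i. b i [^]\<^bsub>K\<^esub> Poly_Mapping.lookup x i) (Poly_Mapping.keys x)"

text \<open>The map induced on a quotient by a map that is constant on cosets.\<close>

definition induced :: "('a \<Rightarrow> 'b) \<Rightarrow> 'a set \<Rightarrow> 'b" where
  "induced f X = the_elem (f ` X)"

definition tensor_relators ::
  "('a, 'c) monoid_scheme \<Rightarrow> ('b, 'd) monoid_scheme \<Rightarrow> (('a \<times> 'b) \<Rightarrow>\<^sub>0 int) set" where
  "tensor_relators G H =
     {frag_of (x \<otimes>\<^bsub>G\<^esub> x', y) - frag_of (x, y) - frag_of (x', y) | x x' y.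
        x \<in> carrier G \<and> x' \<in> carrier G \<and> y \<in> carrier H} \<union>
     {frag_of (x, y \<otimes>\<^bsub>H\<^esub> y') - frag_of (x, y) - frag_of (x, y') | x y y'.
        x \<in> carrier G \<and> y \<in> carrier H \<and> y' \<in> carrier H}"

definition tensor ::
  "('a, 'c) monoid_scheme \<Rightarrow> ('b, 'd) monoid_scheme \<Rightarrow> (('a \<times> 'b) \<Rightarrow>\<^sub>0 int) set monoid" where
  "tensor G H = presented (carrier G \<times> carrier H) (tensor_relators G H)"

definition pure_tensor ::
  "('a, 'c) monoid_scheme \<Rightarrow> ('b, 'd) monoid_scheme \<Rightarrow> 'a \<Rightarrow> 'b \<Rightarrow> (('a \<times> 'b) \<Rightarrow>\<^sub>0 int) set" where
  "pure_tensor G H x y =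
     presented_class (carrier G \<times> carrier H) (tensor_relators G H) (frag_of (x, y))"

text \<open>The homomorphism \<open>x \<otimes> y \<mapsto> f x y\<close> into \<open>K\<close>, for biadditive \<open>f\<close>.\<close>

definition tensor_lift ::
  "('e, 'f) monoid_scheme \<Rightarrow> ('a \<Rightarrow> 'b \<Rightarrow> 'e) \<Rightarrow> (('a \<times> 'b) \<Rightarrow>\<^sub>0 int) set \<Rightarrow> 'e" where
  "tensor_lift K f = induced (lin_extend K (\<lambda>(x, y). f x y))"

text \<open>The homomorphism \<open>f \<otimes> g\<close> into \<open>G \<otimes> H\<close>.\<close>

definition tensor_map ::
  "('c, 'e) monoid_scheme \<Rightarrow> ('d, 'f) monoid_scheme \<Rightarrow> ('a \<Rightarrow> 'c) \<Rightarrow> ('b \<Rightarrow> 'd) \<Rightarrow>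
     (('a \<times> 'b) \<Rightarrow>\<^sub>0 int) set \<Rightarrow> (('c \<times> 'd) \<Rightarrow>\<^sub>0 int) set" where
  "tensor_map G H f g = tensor_lift (tensor G H) (\<lambda>x y. pure_tensor G H (f x) (g y))"

abbreviation Z2 :: "int monoid" where
  "Z2 \<equiv> integer_mod_group 2"

text \<open>Half of an element; it is unique in the torsion-free groups to which this is applied.\<close>

definition half :: "('a, 'c) monoid_scheme \<Rightarrow> 'a \<Rightarrow> 'a" where
  "half G x = (THE y. y \<in> carrier G \<and> y \<otimes>\<^bsub>G\<^esub> y = x)"


section \<open>Tree groups\<close>

definition AS_relators :: "nat \<Rightarrow> nat \<Rightarrow> (utree \<Rightarrow>\<^sub>0 int) set" where
  "AS_relators m n =
     {frag_of (abs_utree t) + frag_of (abs_utree (reverse_vertex v t)) | t v.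
        unitrivalent_tree t \<and> trivalent t v \<and> abs_utree t \<in> utrees m n}"

definition IHX_relators :: "nat \<Rightarrow> nat \<Rightarrow> (utree \<Rightarrow>\<^sub>0 int) set" where
  "IHX_relators m n =
     {frag_of (tree_inner (Node (Node A B) C) K) - frag_of (tree_inner (Node A (Node B C)) K)
        + frag_of (tree_inner (Node B (Node A C)) K) | A B C K.
        tree_inner (Node (Node A B) C) K \<in> utrees m n}"

definition T_group :: "nat \<Rightarrow> nat \<Rightarrow> (utree \<Rightarrow>\<^sub>0 int) set monoid" where
  "T_group m n = presented (utrees m n) (AS_relators m n \<union> IHX_relators m n)"

definition T_class :: "nat \<Rightarrow> nat \<Rightarrow> (utree \<Rightarrow>\<^sub>0 int) \<Rightarrow> (utree \<Rightarrow>\<^sub>0 int) set" where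
  "T_class m n = presented_class (utrees m n) (AS_relators m n \<union> IHX_relators m n)"

text \<open>\<open>Delta m k\<close> is \<open>\<Delta>\<close> from order \<open>k - 1\<close> to order \<open>2k - 1\<close>.\<close>

definition Delta_tree :: "utree \<Rightarrow> (utree \<Rightarrow>\<^sub>0 int)" where
  "Delta_tree t = frag_extend (\<lambda>(i, J). frag_of (tree_inner (Leaf i) (Node J J))) (vertex_sum t)"

definition Delta :: "nat \<Rightarrow> nat \<Rightarrow> (utree \<Rightarrow>\<^sub>0 int) set \<Rightarrow> (utree \<Rightarrow>\<^sub>0 int) set" where
  "Delta m k = induced (\<lambda>x. T_class m (2 * k - 1) (frag_extend Delta_tree x))"

definition Im_Delta :: "nat \<Rightarrow> nat \<Rightarrow> (utree \<Rightarrow>\<^sub>0 int) set set" where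
  "Im_Delta m k = Delta m k ` carrier (T_group m (k - 1))"

definition T_tilde :: "nat \<Rightarrow> nat \<Rightarrow> (utree \<Rightarrow>\<^sub>0 int) set set monoid" where
  "T_tilde m k = T_group m (2 * k - 1) Mod Im_Delta m k"

text \<open>The twisted tree groups of order \<open>2k - 1\<close> and \<open>2k\<close>, respectively.\<close>

definition Tinf_odd :: "nat \<Rightarrow> nat \<Rightarrow> (utree \<Rightarrow>\<^sub>0 int) set set monoid" where
  "Tinf_odd m k = T_group m (2 * k - 1) Mod
     generate (T_group m (2 * k - 1))
       {T_class m (2 * k - 1) (frag_of (tree_inner (Node (Leaf i) J) J)) | i J.
          i \<in> {1..m} \<and> J \<in> rtrees m (k - 1)}"

datatype tgen = Tree utree | Twisted rtree

definition tgens :: "nat \<Rightarrow> nat \<Rightarrow> tgen set" where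
  "tgens m k = Tree ` utrees m (2 * k) \<union> Twisted ` rtrees m k"

definition twisted_relators :: "nat \<Rightarrow> nat \<Rightarrow> (tgen \<Rightarrow>\<^sub>0 int) set" where
  "twisted_relators m k =
     frag_extend (\<lambda>t. frag_of (Tree t)) ` (AS_relators m (2 * k) \<union> IHX_relators m (2 * k)) \<union>
     {frag_of (Twisted J') - frag_of (Twisted J) | J J' p.
        J \<in> rtrees m k \<and> odd p \<and> reversal p J J'} \<union>
     {frag_of (Twisted I) - frag_of (Twisted H) - frag_of (Twisted X)
        + frag_of (Tree (tree_inner H X)) | I H X.
        I \<in> rtrees m k \<and> IHX_triple I H X} \<union>
     {frag_cmul 2 (frag_of (Twisted J)) - frag_of (Tree (tree_inner J J)) | J. J \<in> rtrees m k}"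

definition Tinf_even :: "nat \<Rightarrow> nat \<Rightarrow> (tgen \<Rightarrow>\<^sub>0 int) set monoid" where
  "Tinf_even m k = presented (tgens m k) (twisted_relators m k)"


section \<open>Lie algebras\<close>

text \<open>
  The free nonassociative ring on \<open>X\<^sub>1, \<dots>, X\<^sub>m\<close> has the rooted trees as an additive basis, a tree of
  order \<open>n\<close> being of degree \<open>n + 1\<close>. The free Lie ring is its quotient by the ideal generated
  by all squares and Jacobi expressions.
\<close>

definition magma_mult :: "(rtree \<Rightarrow>\<^sub>0 int) \<Rightarrow> (rtree \<Rightarrow>\<^sub>0 int) \<Rightarrow> (rtree \<Rightarrow>\<^sub>0 int)" where
  "magma_mult x y = frag_extend (\<lambda>I. frag_extend (\<lambda>J. frag_of (Node I J)) y) x"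

definition magma_ring :: "nat \<Rightarrow> (rtree \<Rightarrow>\<^sub>0 int) monoid" where
  "magma_ring m = free_Abelian_group {J. rlabels J \<subseteq> {1..m}}"

inductive_set Lie_ideal :: "nat \<Rightarrow> (rtree \<Rightarrow>\<^sub>0 int) set" for m where
  "0 \<in> Lie_ideal m"
| "x \<in> Lie_ideal m \<Longrightarrow> y \<in> Lie_ideal m \<Longrightarrow> x - y \<in> Lie_ideal m"
| "x \<in> Lie_ideal m \<Longrightarrow> y \<in> carrier (magma_ring m) \<Longrightarrow> magma_mult x y \<in> Lie_ideal m"
| "x \<in> Lie_ideal m \<Longrightarrow> y \<in> carrier (magma_ring m) \<Longrightarrow> magma_mult y x \<in> Lie_ideal m"
| "x \<in> carrier (magma_ring m) \<Longrightarrow> magma_mult x x \<in> Lie_ideal m"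
| "x \<in> carrier (magma_ring m) \<Longrightarrow> y \<in> carrier (magma_ring m) \<Longrightarrow> z \<in> carrier (magma_ring m) \<Longrightarrow>
     magma_mult (magma_mult x y) z + magma_mult (magma_mult y z) x + magma_mult (magma_mult z x) y
       \<in> Lie_ideal m"

definition free_Lie :: "nat \<Rightarrow> (rtree \<Rightarrow>\<^sub>0 int) set monoid" where
  "free_Lie m = magma_ring m Mod Lie_ideal m"

definition Lie_class :: "nat \<Rightarrow> (rtree \<Rightarrow>\<^sub>0 int) \<Rightarrow> (rtree \<Rightarrow>\<^sub>0 int) set" where
  "Lie_class m x = Lie_ideal m #>\<^bsub>magma_ring m\<^esub> x"

definition Lie_bracket ::
  "nat \<Rightarrow> (rtree \<Rightarrow>\<^sub>0 int) set \<Rightarrow> (rtree \<Rightarrow>\<^sub>0 int) set \<Rightarrow> (rtree \<Rightarrow>\<^sub>0 int) set" where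
  "Lie_bracket m X Y = the_elem ((\<lambda>(x, y). Lie_class m (magma_mult x y)) ` (X \<times> Y))"

text \<open>The degree \<open>n\<close> parts \<open>\<L>\<^sub>n\<close> and \<open>\<L>'\<^sub>n\<close> (\<open>n \<ge> 1\<close>).\<close>

definition L_group :: "nat \<Rightarrow> nat \<Rightarrow> (rtree \<Rightarrow>\<^sub>0 int) set monoid" where
  "L_group m n = (free_Lie m)
     \<lparr>carrier := Lie_class m ` carrier (free_Abelian_group (rtrees m (n - 1)))\<rparr>"

definition quasi_relators :: "nat \<Rightarrow> nat \<Rightarrow> (rtree \<Rightarrow>\<^sub>0 int) set" where
  "quasi_relators m n =
     {frag_of J + frag_of J' | J J'. J \<in> rtrees m (n - 1) \<and> reversal 1 J J'} \<union>
     {frag_of I - frag_of H + frag_of X | I H X. I \<in> rtrees m (n - 1) \<and> IHX_triple I H X}"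

definition quasiL_group :: "nat \<Rightarrow> nat \<Rightarrow> (rtree \<Rightarrow>\<^sub>0 int) set monoid" where
  "quasiL_group m n = presented (rtrees m (n - 1)) (quasi_relators m n)"

definition quasi_class :: "nat \<Rightarrow> nat \<Rightarrow> (rtree \<Rightarrow>\<^sub>0 int) \<Rightarrow> (rtree \<Rightarrow>\<^sub>0 int) set" where
  "quasi_class m n = presented_class (rtrees m (n - 1)) (quasi_relators m n)"

text \<open>The bracket from degrees \<open>a\<close>, \<open>b\<close> to degree \<open>a + b\<close>.\<close>

definition quasi_bracket ::
  "nat \<Rightarrow> nat \<Rightarrow> nat \<Rightarrow> (rtree \<Rightarrow>\<^sub>0 int) set \<Rightarrow> (rtree \<Rightarrow>\<^sub>0 int) set \<Rightarrow> (rtree \<Rightarrow>\<^sub>0 int) set" where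
  "quasi_bracket m a b X Y =
     the_elem ((\<lambda>(x, y). quasi_class m (a + b) (magma_mult x y)) ` (X \<times> Y))"

definition quasi_proj :: "nat \<Rightarrow> (rtree \<Rightarrow>\<^sub>0 int) set \<Rightarrow> (rtree \<Rightarrow>\<^sub>0 int) set" where
  "quasi_proj m = induced (Lie_class m)"

type_synonym rtensor = "(((rtree \<Rightarrow>\<^sub>0 int) set \<times> (rtree \<Rightarrow>\<^sub>0 int) set) \<Rightarrow>\<^sub>0 int) set"

definition LL_group :: "nat \<Rightarrow> nat \<Rightarrow> rtensor monoid" where
  "LL_group m n = tensor (L_group m 1) (L_group m (n + 1))"

definition D_group :: "nat \<Rightarrow> nat \<Rightarrow> rtensor monoid" where
  "D_group m n = (LL_group m n)
     \<lparr>carrier := kernel (LL_group m n) (L_group m (n + 2))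
        (tensor_lift (L_group m (n + 2)) (Lie_bracket m))\<rparr>"

definition quasiLL_group :: "nat \<Rightarrow> nat \<Rightarrow> rtensor monoid" where
  "quasiLL_group m n = tensor (quasiL_group m 1) (quasiL_group m (n + 1))"

definition quasiLL_bracket :: "nat \<Rightarrow> nat \<Rightarrow> rtensor \<Rightarrow> (rtree \<Rightarrow>\<^sub>0 int) set" where
  "quasiLL_bracket m n = tensor_lift (quasiL_group m (n + 2)) (quasi_bracket m 1 (n + 1))"

definition quasiD_group :: "nat \<Rightarrow> nat \<Rightarrow> rtensor monoid" where
  "quasiD_group m n = (quasiLL_group m n)
     \<lparr>carrier := kernel (quasiLL_group m n) (quasiL_group m (n + 2)) (quasiLL_bracket m n)\<rparr>"


section \<open>The maps \<open>\<eta>\<close>\<close>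

definition eta_tree :: "nat \<Rightarrow> nat \<Rightarrow> utree \<Rightarrow> rtensor" where
  "eta_tree m n t = lin_extend (LL_group m n)
     (\<lambda>(i, J). pure_tensor (L_group m 1) (L_group m (n + 1))
        (Lie_class m (frag_of (Leaf i))) (Lie_class m (frag_of J))) (vertex_sum t)"

definition quasi_eta_tree :: "nat \<Rightarrow> nat \<Rightarrow> utree \<Rightarrow> rtensor" where
  "quasi_eta_tree m n t = lin_extend (quasiLL_group m n)
     (\<lambda>(i, J). pure_tensor (quasiL_group m 1) (quasiL_group m (n + 1))
        (quasi_class m 1 (frag_of (Leaf i))) (quasi_class m (n + 1) (frag_of J))) (vertex_sum t)"

text \<open>The map \<open>\<eta>\<close> on the twisted tree groups of order \<open>2k - 1\<close> and \<open>2k\<close>, respectively.\<close>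

definition eta_odd :: "nat \<Rightarrow> nat \<Rightarrow> (utree \<Rightarrow>\<^sub>0 int) set set \<Rightarrow> rtensor" where
  "eta_odd m k =
     induced (induced (lin_extend (LL_group m (2 * k - 1)) (eta_tree m (2 * k - 1))))"

definition eta_even :: "nat \<Rightarrow> nat \<Rightarrow> (tgen \<Rightarrow>\<^sub>0 int) set \<Rightarrow> rtensor" where
  "eta_even m k = induced (lin_extend (LL_group m (2 * k))
     (\<lambda>g. case g of
            Tree t \<Rightarrow> eta_tree m (2 * k) t
          | Twisted J \<Rightarrow> half (LL_group m (2 * k)) (eta_tree m (2 * k) (tree_inner J J))))"

definition quasi_eta :: "nat \<Rightarrow> nat \<Rightarrow> (utree \<Rightarrow>\<^sub>0 int) set \<Rightarrow> rtensor" where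
  "quasi_eta m n = induced (lin_extend (quasiLL_group m n) (quasi_eta_tree m n))"

definition D_tilde :: "nat \<Rightarrow> nat \<Rightarrow> rtensor set monoid" where
  "D_tilde m k = quasiD_group m (2 * k - 1) Mod (quasi_eta m (2 * k - 1) ` Im_Delta m k)"

definition eta_tilde :: "nat \<Rightarrow> nat \<Rightarrow> (utree \<Rightarrow>\<^sub>0 int) set set \<Rightarrow> rtensor set" where
  "eta_tilde m k = induced (\<lambda>x. (quasi_eta m (2 * k - 1) ` Im_Delta m k)
     #>\<^bsub>quasiD_group m (2 * k - 1)\<^esub> quasi_eta m (2 * k - 1) x)"


section \<open>The pullback\<close>

type_synonym mod2_Lie = "((int \<times> (rtree \<Rightarrow>\<^sub>0 int) set) \<Rightarrow>\<^sub>0 int) set"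

text \<open>
  \<open>sq m k\<close> is the map from degree \<open>k + 1\<close> to degree \<open>2k + 2\<close>. The bracket \<open>[X,X]\<close> is formed in
  the target, from a preimage of \<open>X\<close> under the projection \<open>quasi_proj\<close>.
\<close>

definition sq :: "nat \<Rightarrow> nat \<Rightarrow> mod2_Lie \<Rightarrow> (rtree \<Rightarrow>\<^sub>0 int) set" where
  "sq m k = tensor_lift (quasiL_group m (2 * k + 2))
     (\<lambda>a X. let X' = inv_into (carrier (quasiL_group m (k + 1))) (quasi_proj m) X
        in quasi_bracket m (k + 1) (k + 1) X' X' [^]\<^bsub>quasiL_group m (2 * k + 2)\<^esub> a)"

text \<open>\<open>sl m k\<close> is the map defined on \<open>D_group m (2 * k)\<close>.\<close>

definition sl :: "nat \<Rightarrow> nat \<Rightarrow> rtensor \<Rightarrow> mod2_Lie" where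
  "sl m k Z = inv_into (carrier (tensor Z2 (L_group m (k + 1)))) (sq m k)
     (quasiLL_bracket m (2 * k)
       (inv_into (carrier (quasiLL_group m (2 * k)))
         (tensor_map (L_group m 1) (L_group m (2 * k + 1)) (quasi_proj m) (quasi_proj m)) Z))"

definition mod2_proj :: "nat \<Rightarrow> nat \<Rightarrow> mod2_Lie \<Rightarrow> mod2_Lie" where
  "mod2_proj m n = tensor_map Z2 (L_group m n) id (quasi_proj m)"

text \<open>The pullback \<open>D\<^sup>\<infinity>\<close> of order \<open>4k - 2 = 2 (2k - 1)\<close>, and the map \<open>\<eta>\<^sup>\<infinity>\<close> into it.\<close>

definition D_inf :: "nat \<Rightarrow> nat \<Rightarrow> (rtensor \<times> mod2_Lie) monoid" where
  "D_inf m k = (D_group m (4 * k - 2) \<times>\<times> tensor Z2 (quasiL_group m (2 * k)))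
     \<lparr>carrier := {(Z, W). Z \<in> carrier (D_group m (4 * k - 2)) \<and>
        W \<in> carrier (tensor Z2 (quasiL_group m (2 * k))) \<and>
        sl m (2 * k - 1) Z = mod2_proj m (2 * k) W}\<rparr>"

definition eta_inf :: "nat \<Rightarrow> nat \<Rightarrow> (tgen \<Rightarrow>\<^sub>0 int) set \<Rightarrow> rtensor \<times> mod2_Lie" where
  "eta_inf m k x =
     (eta_even m (2 * k - 1) x,
      induced (lin_extend (tensor Z2 (quasiL_group m (2 * k)))
        (\<lambda>g. case g of
               Tree t \<Rightarrow> \<one>\<^bsub>tensor Z2 (quasiL_group m (2 * k))\<^esub>
             | Twisted J \<Rightarrow> pure_tensor Z2 (quasiL_group m (2 * k)) 1
                 (quasi_class m (2 * k) (frag_of J)))) x)"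

end

theory Submission
  imports Defs Complex_Main "HOL-Library.Product_Plus" "HOL-Library.Multiset" "HOL-Library.Nat_Bijection" "HOL-Library.Z2"
begin

text \<open>
  All groups are compared inside types of trees and Lie elements with labels in the natural
  numbers, where \<open>m\<close> and the degree are recovered by grading projections. There \<open>L'\<close> is the free
  quasi-Lie ring \<open>qlie\<close>, \<open>L\<close> is its image under \<open>kap\<close> in the free associative ring, and a tree
  becomes its vertex sum, an element of \<open>W \<otimes> L'\<close>, where \<open>W\<close> is free on the labels. The core is
  the exactness of \<open>0 \<rightarrow> T \<rightarrow> W \<otimes> L' \<rightarrow> L'\<close>. In the middle it is formal; injectivity is proved
  by Lazard elimination of one label \<open>x\<close> at a time, which trades the other labels \<open>y\<close> for the
  labels \<open>ad(x)^k y\<close>. The same elimination shows that the kernel of \<open>L' \<rightarrow> L\<close> consists of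
  squares \<open>[y,y]\<close>, and that \<open>[u,u] = 0\<close> only if \<open>u\<close> is twice an element plus a square.

  The four isomorphisms then amount to following squares. Both \<open>\<langle>i,(J,J)\<rangle>\<close> and \<open>\<langle>(i,J),J\<rangle>\<close> have
  vertex sum \<open>X\<^sub>i \<otimes> [J,J]\<close>, while half of the vertex sum of \<open>\<langle>J,J\<rangle>\<close> has bracket \<open>[J,J]\<close>; and a
  square has even degree, namely twice the degree of its root, so the parity of the order decides
  which squares occur.
\<close>

section \<open>Additive maps out of free abelian groups\<close>

text \<open>The obstacle is torsion. Gluing each leaf labeled \<open>x\<close> back onto the rooted
  tree that it sees returns the original tree, so the vertex sum determines a tree up to
  multiplication by the multiplicity of each of its labels. Injectivity is thus clear over the
  rationals, and also when some label occurs only once; what remains are trees in which every label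
  is repeated. Elimination deals with them because the new labels absorb the leaves
  \<open>x\<close>: the number of leaves drops strictly, although infinitely many labels appear.
  This is why labels range over all natural numbers, with the bound \<open>m\<close> imposed only at
  the end. A quasi-Lie bracket is antisymmetric without [x,x] = 0, so elimination is exact only away
  from trees all of whose leaves are \<open>x\<close>. These vanish from three leaves on, and the
  survivor [x,x] is central and of order 2. Hence kernels are known only up to squares, and trees
  with few leaves need a separate argument. In the injectivity proof the ambiguity by squares ends
  up as a tree <x,[e,e]>, whose vertex sum is X_x tensor [e,e]; so it vanishes together with its
  vertex sum.\<close>

definition zmul :: "int \<Rightarrow> 'a::ab_group_add \<Rightarrow> 'a" where
  "zmul n x = (if 0 \<le> n then ((+) x ^^ nat n) 0 else - (((+) x ^^ nat (- n)) 0))"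

lemma zmul_0 [simp]: "zmul 0 x = 0"
  by (simp add: zmul_def)

lemma zmul_plus_one: "zmul (n + 1) x = zmul n x + x"
proof (cases "0 \<le> n")
  case True
  then have "nat (n + 1) = Suc (nat n)" by simp
  with True show ?thesis by (simp add: zmul_def)
next
  case False
  then have n: "nat (- n) = Suc (nat (- n - 1))" by simp
  show ?thesis
  proof (cases "n = - 1")
    case True
    then show ?thesis by (simp add: zmul_def)
  next
    case 2: False
    with False have "\<not> 0 \<le> n + 1" by simp
    then show ?thesis using False n by (simp add: zmul_def)
  qed
qed

lemma zmul_minus_one: "zmul (n - 1) x = zmul n x - x"
  using zmul_plus_one[of "n - 1" x] by simp

lemma zmul_1 [simp]: "zmul 1 x = x"
  using zmul_plus_one[of 0 x] by simp

lemma zmul_add_left: "zmul (m + n) x = zmul m x + zmul n x"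
proof (induction n rule: int_induct[of _ 0])
  case (step1 i)
  then show ?case using zmul_plus_one[of "m + i" x] zmul_plus_one[of i x] by (simp add: algebra_simps)
next
  case (step2 i)
  have "m + (i - 1) = (m + i) - 1" by simp
  then show ?case using step2 by (simp only: zmul_minus_one) simp
qed simp

lemma zmul_zero_right [simp]: "zmul n 0 = 0"
  by (induction n rule: int_induct[of _ 0]) (simp_all add: zmul_plus_one zmul_minus_one)

lemma zmul_add_right: "zmul n (x + y) = zmul n x + zmul n y"
  by (induction n rule: int_induct[of _ 0]) (simp_all add: zmul_plus_one zmul_minus_one)

lemma zmul_mult: "zmul (m * n) x = zmul m (zmul n x)"
  by (induction m rule: int_induct[of _ 0])
     (simp_all add: zmul_plus_one zmul_minus_one zmul_add_left algebra_simps, metis add_diff_cancel_left' diff_add_cancel zmul_add_left)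

text \<open>Subgroups generated by relators become spans over the integers,
  \<open>zmod.span\<close>, in any abelian group type.\<close>

interpretation zmod: module zmul
  by unfold_locales (simp_all add: zmul_add_left zmul_add_right zmul_mult)

lemma additive_zmul:
  assumes "additive f"
  shows "f (zmul n x) = zmul n (f x)"
  by (induction n rule: int_induct[of _ 0])
     (simp_all add: zmul_plus_one zmul_minus_one additive.zero[OF assms] additive.add[OF assms] additive.diff[OF assms])

lemma zmul_2: "zmul 2 x = x + x"
  using zmul_add_left[of 1 1 x] by simp

lemma zmul_frag [simp]: "zmul n x = frag_cmul n x"
  by (induction n rule: int_induct[of _ 0])
     (simp_all add: zmul_plus_one zmul_minus_one frag_cmul_distrib frag_cmul_diff_distrib)

lemma additive_comp: "additive f \<Longrightarrow> additive g \<Longrightarrow> additive (\<lambda>x. f (g x))"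
  by (simp add: additive_def)

lemma additive_plus: "additive f \<Longrightarrow> additive g \<Longrightarrow> additive (\<lambda>x. f x + g x)"
  by (simp add: additive_def)

lemma additive_ident: "additive (\<lambda>x. x)" and additive_0: "additive (\<lambda>x. 0)"
  by (simp_all add: additive_def)

text \<open>The analogue of \<open>frag_extend\<close> with values in an arbitrary abelian group
  instead of a free one.\<close>

definition ext :: "('a \<Rightarrow> 'b::ab_group_add) \<Rightarrow> ('a \<Rightarrow>\<^sub>0 int) \<Rightarrow> 'b" where
  "ext f z = (\<Sum>i\<in>Poly_Mapping.keys z. zmul (Poly_Mapping.lookup z i) (f i))"

lemma ext_superset:
  assumes "finite S" "Poly_Mapping.keys z \<subseteq> S"
  shows "ext f z = (\<Sum>i\<in>S. zmul (Poly_Mapping.lookup z i) (f i))"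
  unfolding ext_def using assms by (intro sum.mono_neutral_left) (auto simp: in_keys_iff)

lemma additive_ext: "additive (ext f)"
proof
  fix x y :: "'a \<Rightarrow>\<^sub>0 int"
  let ?S = "Poly_Mapping.keys x \<union> Poly_Mapping.keys y"
  have "Poly_Mapping.keys (x + y) \<subseteq> ?S" by (rule Poly_Mapping.keys_add)
  then show "ext f (x + y) = ext f x + ext f y"
    using ext_superset[of ?S _ f]
    by (simp add: lookup_add zmul_add_left sum.distrib)
qed

lemma ext_frag_of [simp]: "ext f (frag_of i) = f i"
  by (simp add: ext_def)

lemmas ext_simps [simp] = additive.zero[OF additive_ext] additive.add[OF additive_ext]
  additive.diff[OF additive_ext] additive.minus[OF additive_ext]

lemma ext_cmul [simp]: "ext f (frag_cmul n z) = zmul n (ext f z)"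
  using additive_zmul[OF additive_ext, of f n z] by simp

lemma frag_induct [case_names zero one diff]:
  assumes "P 0" "\<And>i. P (frag_of i)" "\<And>x y. P x \<Longrightarrow> P y \<Longrightarrow> P (x - y)"
  shows "P z"
  using frag_induction[of z UNIV P] assms by simp

lemma additive_eq_ext:
  assumes "additive g"
  shows "g z = ext (\<lambda>i. g (frag_of i)) z"
  by (induction z rule: frag_induct) (simp_all add: additive.zero[OF assms] additive.diff[OF assms])

lemma additive_eqI:
  assumes "additive f" "additive g" "\<And>i. f (frag_of i) = g (frag_of i)"
  shows "f z = g z"
  using additive_eq_ext[OF assms(1), of z] additive_eq_ext[OF assms(2), of z] assms(3) by simp

lemma additive_ext_apply: "additive g \<Longrightarrow> g (ext f z) = ext (\<lambda>i. g (f i)) z"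
  by (rule additive_eqI) (simp_all add: additive_comp additive_ext)

lemma ext_cong: "(\<And>i. i \<in> Poly_Mapping.keys z \<Longrightarrow> f i = g i) \<Longrightarrow> ext f z = ext g z"
  by (simp add: ext_def)

lemma ext_0 [simp]: "ext (\<lambda>_. 0) z = 0"
  by (simp add: ext_def)

lemma frag_extend_eq_ext: "frag_extend f = ext f"
  by (simp add: fun_eq_iff frag_extend_def ext_def)

lemma ext_plus_fun: "ext (\<lambda>i. f i + g i) z = ext f z + ext g z"
  by (simp add: ext_def zmul_add_right sum.distrib)

lemma ext_minus_fun: "ext (\<lambda>i. f i - g i) z = ext f z - ext g z"
  by (simp add: ext_def zmod.scale_right_diff_distrib sum_subtractf)

lemma ext_frag_of_id [simp]: "ext frag_of z = z"
  by (rule additive_eqI[OF additive_ext additive_ident]) simp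


text \<open>Truncation to the basis elements in \<open>S\<close>. The relations are first imposed in
  all degrees and on all labels at once; being homogeneous, they survive truncation to one degree
  and to the labels up to \<open>m\<close>.\<close>

definition restr :: "'a set \<Rightarrow> ('a \<Rightarrow>\<^sub>0 int) \<Rightarrow> ('a \<Rightarrow>\<^sub>0 int)" where
  "restr S = ext (\<lambda>i. if i \<in> S then frag_of i else 0)"

lemma additive_restr: "additive (restr S)"
  by (simp add: restr_def additive_ext)

lemmas restr_simps [simp] = additive.zero[OF additive_restr] additive.add[OF additive_restr]
  additive.diff[OF additive_restr] additive.minus[OF additive_restr]

lemma restr_frag_of: "restr S (frag_of i) = (if i \<in> S then frag_of i else 0)"
  by (simp add: restr_def)

lemma lookup_restr: "Poly_Mapping.lookup (restr S z) i = (if i \<in> S then Poly_Mapping.lookup z i else 0)"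
  by (induction z rule: frag_induct) (auto simp: lookup_minus restr_frag_of)

lemma restr_id: "Poly_Mapping.keys z \<subseteq> S \<Longrightarrow> restr S z = z"
  by (intro poly_mapping_eqI) (auto simp: lookup_restr in_keys_iff)

lemma restr_0: "Poly_Mapping.keys z \<inter> S = {} \<Longrightarrow> restr S z = 0"
  by (intro poly_mapping_eqI) (auto simp: lookup_restr in_keys_iff)

lemma keys_restr: "Poly_Mapping.keys (restr S z) = Poly_Mapping.keys z \<inter> S"
  by (auto simp: in_keys_iff lookup_restr split: if_splits)


section \<open>The free quasi-Lie ring\<close>

lemma mm_frag_of [simp]: "magma_mult (frag_of I) (frag_of J) = frag_of (Node I J)"
  by (simp add: magma_mult_def)

lemma additive_magma_mult: "additive (\<lambda>x. magma_mult x y)" "additive (magma_mult x)"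
  by standard (simp_all add: magma_mult_def frag_extend_eq_ext ext_plus_fun)

lemmas magma_mult_simps [simp] =
  additive.zero[OF additive_magma_mult(1)] additive.add[OF additive_magma_mult(1)]
  additive.diff[OF additive_magma_mult(1)] additive.minus[OF additive_magma_mult(1)]
  additive.zero[OF additive_magma_mult(2)] additive.add[OF additive_magma_mult(2)]
  additive.diff[OF additive_magma_mult(2)] additive.minus[OF additive_magma_mult(2)]

text \<open>For I = J the antisymmetry rule gives 2 [I,I] = 0 only; this is the difference between
  L' and a Lie ring. Multiplication by single trees suffices in the last two rules, since sums are
  supplied by closure under differences.\<close>

inductive_set qrel :: "(rtree \<Rightarrow>\<^sub>0 int) set" where
  qrel_0: "0 \<in> qrel"
| qrel_diff: "x \<in> qrel \<Longrightarrow> y \<in> qrel \<Longrightarrow> x - y \<in> qrel"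
| qrel_AS: "frag_of (Node I J) + frag_of (Node J I) \<in> qrel"
| qrel_IHX: "frag_of (Node (Node A B) C) - frag_of (Node A (Node B C)) + frag_of (Node B (Node A C)) \<in> qrel"
| qrel_left: "x \<in> qrel \<Longrightarrow> magma_mult x (frag_of J) \<in> qrel"
| qrel_right: "x \<in> qrel \<Longrightarrow> magma_mult (frag_of J) x \<in> qrel"

lemma qrel_minus: "x \<in> qrel \<Longrightarrow> - x \<in> qrel"
  using qrel_diff[OF qrel_0, of x] by simp

lemma qrel_add: "x \<in> qrel \<Longrightarrow> y \<in> qrel \<Longrightarrow> x + y \<in> qrel"
  using qrel_diff[OF _ qrel_minus, of x y] by simp

quotient_type qlie = "rtree \<Rightarrow>\<^sub>0 int" / "\<lambda>x y. x - y \<in> qrel"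
proof (rule equivpI)
  show "reflp (\<lambda>x y. x - y \<in> qrel)" by (rule reflpI) (simp add: qrel_0)
  show "symp (\<lambda>x y. x - y \<in> qrel)" by (rule sympI) (metis minus_diff_eq qrel_minus)
  show "transp (\<lambda>x y. x - y \<in> qrel)" 
  proof (rule transpI)
    fix x y z assume "x - y \<in> qrel" "y - z \<in> qrel"
    then have "(x - y) + (y - z) \<in> qrel" by (rule qrel_add)
    then show "x - z \<in> qrel" by simp
  qed
qed

instantiation qlie :: ab_group_add
begin
lift_definition zero_qlie :: qlie is 0 .
lift_definition plus_qlie :: "qlie \<Rightarrow> qlie \<Rightarrow> qlie" is "(+)"
  by (metis add_diff_add qrel_add)
lift_definition minus_qlie :: "qlie \<Rightarrow> qlie \<Rightarrow> qlie" is "(-)"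
proof -
  fix a b c d :: "rtree \<Rightarrow>\<^sub>0 int"
  assume "a - b \<in> qrel" "c - d \<in> qrel"
  then have "(a - b) - (c - d) \<in> qrel" by (rule qrel_diff)
  then show "a - c - (b - d) \<in> qrel" by (simp add: algebra_simps)
qed
lift_definition uminus_qlie :: "qlie \<Rightarrow> qlie" is "uminus"
proof -
  fix a b :: "rtree \<Rightarrow>\<^sub>0 int"
  assume "a - b \<in> qrel"
  then have "- (a - b) \<in> qrel" by (rule qrel_minus)
  then show "- a - - b \<in> qrel" by simp
qed
instance
  by standard (transfer; simp add: qrel_0 algebra_simps)+
end

definition qc :: "(rtree \<Rightarrow>\<^sub>0 int) \<Rightarrow> qlie" where "qc = abs_qlie"

definition qt :: "rtree \<Rightarrow> qlie" where "qt J = qc (frag_of J)"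

lemma additive_qc: "additive qc"
  by standard (simp add: qc_def plus_qlie.abs_eq)

lemmas qc_simps [simp] = additive.zero[OF additive_qc] additive.add[OF additive_qc]
  additive.diff[OF additive_qc] additive.minus[OF additive_qc]

lemma qc_frag_of [simp]: "qc (frag_of J) = qt J" by (simp add: qt_def)

lemma qc_cmul [simp]: "qc (frag_cmul n z) = zmul n (qc z)"
  using additive_zmul[OF additive_qc, of n z] by simp

lemma qc_eq_iff: "qc x = qc y \<longleftrightarrow> x - y \<in> qrel"
  by (simp add: qc_def qlie.abs_eq_iff)

lemma qc_eq_0_iff: "qc x = 0 \<longleftrightarrow> x \<in> qrel"
  using qc_eq_iff[of x 0] by simp

lemma qc_surj: "\<exists>z. u = qc z"
  by (metis qc_def Quotient_abs_rep Quotient_qlie)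

lemma qc_rep [simp]: "qc (rep_qlie u) = u"
  by (metis qc_def Quotient_abs_rep Quotient_qlie)

lemma qc_eq_ext: "qc z = ext qt z"
  using additive_eq_ext[OF additive_qc] by simp

lemma qlie_induct [case_names zero tree diff]:
  assumes "P 0" "\<And>J. P (qt J)" "\<And>x y. P x \<Longrightarrow> P y \<Longrightarrow> P (x - y)"
  shows "P u"
proof -
  obtain z where "u = qc z" using qc_surj by blast
  moreover have "P (qc z)" by (induction z rule: frag_induct) (simp_all add: assms)
  ultimately show ?thesis by simp
qed

lemma qlie_additive_eqI:
  assumes "additive f" "additive g" "\<And>J. f (qt J) = g (qt J)"
  shows "f u = g u"
  by (induction u rule: qlie_induct)
     (simp_all add: assms(3) additive.zero[OF assms(1)] additive.zero[OF assms(2)]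
       additive.diff[OF assms(1)] additive.diff[OF assms(2)])

lemma qlie_eq_0:
  assumes "additive f" "\<And>J. f (qt J) = 0"
  shows "f u = 0"
  using qlie_additive_eqI[OF assms(1) additive_0] assms(2) by blast

text \<open>Evaluates \<open>ext f\<close> on a chosen representative. It has a meaning only if
  \<open>f\<close> kills \<open>qrel\<close>, which every use has to establish.\<close>

definition qmap :: "(rtree \<Rightarrow> 'b::ab_group_add) \<Rightarrow> qlie \<Rightarrow> 'b" where
  "qmap f u = ext f (rep_qlie u)"

lemma qmap_qc:
  assumes "\<And>r. r \<in> qrel \<Longrightarrow> ext f r = 0"
  shows "qmap f (qc z) = ext f z"
proof -
  have "rep_qlie (qc z) - z \<in> qrel" using qc_eq_iff[of "rep_qlie (qc z)" z] by simp
  then show ?thesis using assms[of "rep_qlie (qc z) - z"] by (simp add: qmap_def)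
qed

lemma qmap_qt:
  assumes "\<And>r. r \<in> qrel \<Longrightarrow> ext f r = 0"
  shows "qmap f (qt J) = f J"
  using qmap_qc[OF assms, of "frag_of J"] by simp

lemma additive_qmap:
  assumes "\<And>r. r \<in> qrel \<Longrightarrow> ext f r = 0"
  shows "additive (qmap f)"
proof
  fix x y
  obtain a b where "x = qc a" "y = qc b" using qc_surj by blast
  then show "qmap f (x + y) = qmap f x + qmap f y"
    using qmap_qc[OF assms, of a] qmap_qc[OF assms, of b] qmap_qc[OF assms, of "a + b"] by simp
qed

lift_definition br :: "qlie \<Rightarrow> qlie \<Rightarrow> qlie" is magma_mult
proof -
  have l: "magma_mult r z \<in> qrel" if "r \<in> qrel" for r z
    by (induction z rule: frag_induct) (auto intro: qrel_0 qrel_diff qrel_left that)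
  have r: "magma_mult z r \<in> qrel" if "r \<in> qrel" for r z
    by (induction z rule: frag_induct) (auto intro: qrel_0 qrel_diff qrel_right that)
  fix a b c d
  assume "a - b \<in> qrel" "c - d \<in> qrel"
  then have "magma_mult (a - b) c + magma_mult b (c - d) \<in> qrel" by (intro qrel_add l r)
  then show "magma_mult a c - magma_mult b d \<in> qrel" by simp
qed

lemma br_qc: "br (qc x) (qc y) = qc (magma_mult x y)"
  by (simp add: qc_def br.abs_eq)

lemma br_qt [simp]: "br (qt I) (qt J) = qt (Node I J)"
  using br_qc[of "frag_of I" "frag_of J"] by simp

lemma additive_br: "additive (\<lambda>u. br u w)" "additive (br u)"
  by (standard; transfer; simp add: qrel_0)+

lemmas br_simps [simp] = 
  additive.zero[OF additive_br(1)] additive.add[OF additive_br(1)]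
  additive.diff[OF additive_br(1)] additive.minus[OF additive_br(1)]
  additive.zero[OF additive_br(2)] additive.add[OF additive_br(2)]
  additive.diff[OF additive_br(2)] additive.minus[OF additive_br(2)]

lemma br_zmul [simp]: "br (zmul n u) w = zmul n (br u w)" "br u (zmul n w) = zmul n (br u w)"
  using additive_zmul[OF additive_br(1)] additive_zmul[OF additive_br(2)] by auto

lemma br_anti: "br u w = - br w u"
proof -
  have "br u w + br w u = 0"
  proof (rule qlie_eq_0[of "\<lambda>u. br u w + br w u"])
    fix I
    show "br (qt I) w + br w (qt I) = 0"
    proof (rule qlie_eq_0[of "\<lambda>w. br (qt I) w + br w (qt I)"])
      fix J
      have "qc (frag_of (Node I J) + frag_of (Node J I)) = 0" by (simp only: qc_eq_0_iff qrel_AS)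
      then show "br (qt I) (qt J) + br (qt J) (qt I) = 0" by simp
    qed (simp add: additive_def algebra_simps)
  qed (simp add: additive_def algebra_simps)
  then show ?thesis by (simp add: eq_neg_iff_add_eq_0)
qed

lemma br_jacobi: "br (br a b) c = br a (br b c) - br b (br a c)"
proof -
  let ?f = "\<lambda>a b c. br (br a b) c - br a (br b c) + br b (br a c)"
  have "?f a b c = 0"
  proof (rule qlie_eq_0[of "\<lambda>a. ?f a b c"])
    fix A
    show "?f (qt A) b c = 0"
    proof (rule qlie_eq_0[of "\<lambda>b. ?f (qt A) b c"])
      fix B
      show "?f (qt A) (qt B) c = 0"
      proof (rule qlie_eq_0[of "?f (qt A) (qt B)"])
        fix C
        have "qc (frag_of (Node (Node A B) C) - frag_of (Node A (Node B C)) + frag_of (Node B (Node A C))) = 0"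
          by (simp only: qc_eq_0_iff qrel_IHX)
        then show "?f (qt A) (qt B) (qt C) = 0" by simp
      qed (simp add: additive_def algebra_simps)
    qed (simp add: additive_def algebra_simps)
  qed (simp add: additive_def algebra_simps)
  then show ?thesis by (simp add: algebra_simps)
qed

text \<open>The universal property of the free quasi-Lie ring. The target bracket may have [x,x]
  different from zero, which the test ring in \<open>square_leaf_neq_0\<close> exploits.\<close>

lemma ext_qrel_eq_0:
  assumes node: "\<And>I J. f (Node I J) = b (f I) (f J)"
    and add1: "\<And>y. additive (\<lambda>x. b x y)" and add2: "\<And>x. additive (b x)"
    and anti: "\<And>x y. b x y = - b y x"
    and jacobi: "\<And>x y z. b (b x y) z = b x (b y z) - b y (b x z)"
    and r: "r \<in> qrel"
  shows "ext f r = 0"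
proof -
  have mult: "ext f (magma_mult x y) = b (ext f x) (ext f y)" for x y
  proof (induction x rule: frag_induct)
    case (one I)
    show ?case
      by (induction y rule: frag_induct) (simp_all add: node additive.zero[OF add2] additive.diff[OF add2])
  qed (simp_all add: additive.zero[OF add1] additive.diff[OF add1])
  show ?thesis using r
  proof induction
    case (qrel_AS I J)
    then show ?case using anti[of "f I" "f J"] by (simp add: node)
  next
    case (qrel_IHX A B C)
    then show ?case by (simp add: node jacobi)
  qed (simp_all add: mult additive.zero[OF add1] additive.zero[OF add2])
qed

text \<open>For a = b the two terms on the right of the Jacobi identity cancel.\<close>

lemma square_central [simp]: "br (br y y) z = 0" "br z (br y y) = 0"
  using br_anti[of z "br y y"] by (simp_all add: br_jacobi)

lemma square_double: "br y y + br y y = 0"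
  using br_anti[of y y] by (simp add: eq_neg_iff_add_eq_0)

text \<open>The cross terms [x,y] + [y,x] cancel. Hence the squares form a subgroup, and statements
  about squares can be checked on trees.\<close>

lemma square_add: "br (x + y) (x + y) = br x x + br y y"
  using br_anti[of x y] by simp

lemma additive_square: "additive (\<lambda>y. br y y)"
  by standard (rule square_add)

lemma square_diff: "br (x - y) (x - y) = br x x - br y y"
  using additive.diff[OF additive_square] .

section \<open>Tensor products with the free abelian group on the labels\<close>

text \<open>W tensor B, for W free on the indices, is encoded as the finitely supported functions
  into B; a family of additive maps \<open>f i\<close> on B then induces a map on W tensor
  B.\<close>

definition vext :: "('a \<Rightarrow> 'b::ab_group_add \<Rightarrow> 'c::ab_group_add) \<Rightarrow> ('a \<Rightarrow>\<^sub>0 'b) \<Rightarrow> 'c" where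
  "vext f s = (\<Sum>i\<in>Poly_Mapping.keys s. f i (Poly_Mapping.lookup s i))"

lemma vext_superset:
  assumes "\<And>i. additive (f i)" "finite S" "Poly_Mapping.keys s \<subseteq> S"
  shows "vext f s = (\<Sum>i\<in>S. f i (Poly_Mapping.lookup s i))"
  unfolding vext_def using assms(2,3)
  by (intro sum.mono_neutral_left) (auto simp: in_keys_iff additive.zero[OF assms(1)])

lemma additive_vext:
  assumes "\<And>i. additive (f i)"
  shows "additive (vext f :: ('a \<Rightarrow>\<^sub>0 'b::ab_group_add) \<Rightarrow> 'c::ab_group_add)"
proof
  fix x y :: "'a \<Rightarrow>\<^sub>0 'b"
  let ?S = "Poly_Mapping.keys x \<union> Poly_Mapping.keys y"
  have "Poly_Mapping.keys (x + y) \<subseteq> ?S" by (rule Poly_Mapping.keys_add)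
  then show "vext f (x + y) = vext f x + vext f y"
    using vext_superset[OF assms, of ?S]
    by (simp add: lookup_add additive.add[OF assms] sum.distrib)
qed

lemma vext_single:
  assumes "\<And>i. additive (f i)"
  shows "vext f (Poly_Mapping.single i u) = f i u"
  using vext_superset[OF assms, of "{i}" "Poly_Mapping.single i u"] by simp

lemma additive_single: "additive (Poly_Mapping.single i)"
  by standard (rule single_add)

lemma v_induct [case_names zero single diff]:
  fixes s :: "'a \<Rightarrow>\<^sub>0 'b::ab_group_add"
  assumes "P 0" "\<And>i u. P (Poly_Mapping.single i u)" "\<And>x y. P x \<Longrightarrow> P y \<Longrightarrow> P (x - y)"
  shows "P s"
proof -
  have add: "P (x + y)" if "P x" "P y" for x y
    using assms(3)[OF that(1) assms(3)[OF assms(1) that(2)]] by simp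
  have "P (\<Sum>i\<in>S. Poly_Mapping.single i (Poly_Mapping.lookup s i))" if "finite S" for S
    using that by induction (simp_all add: assms(1,2) add)
  moreover have "(\<Sum>i\<in>Poly_Mapping.keys s. Poly_Mapping.single i (Poly_Mapping.lookup s i)) = s"
    by (intro poly_mapping_eqI)
       (simp add: lookup_sum lookup_single when_def sum.delta in_keys_iff)
  ultimately show ?thesis using finite_keys[of s] by metis
qed

lemma v_additive_eqI:
  assumes "additive f" "additive g" "\<And>i u. f (Poly_Mapping.single i u) = g (Poly_Mapping.single i u)"
  shows "f s = g s"
  by (induction s rule: v_induct)
     (simp_all add: assms(3) additive.zero[OF assms(1)] additive.zero[OF assms(2)]
       additive.diff[OF assms(1)] additive.diff[OF assms(2)])

type_synonym vlie = "nat \<Rightarrow>\<^sub>0 qlie"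

definition vbr :: "vlie \<Rightarrow> qlie" where
  "vbr = vext (\<lambda>i. br (qt (Leaf i)))"

lemma additive_vbr: "additive vbr"
  unfolding vbr_def by (intro additive_vext additive_br)

lemmas vbr_simps [simp] = additive.zero[OF additive_vbr] additive.add[OF additive_vbr]
  additive.diff[OF additive_vbr] additive.minus[OF additive_vbr]

lemma vbr_single [simp]: "vbr (Poly_Mapping.single i u) = br (qt (Leaf i)) u"
  unfolding vbr_def by (intro vext_single additive_br)

text \<open>
  \<open>ls J u\<close> is the sum, over the leaves of \<open>J\<close>, of the leaf's label tensored with the result of
  moving the root of \<open>J\<close> to that leaf and plugging \<open>u\<close> into the old root.
\<close>

primrec ls :: "rtree \<Rightarrow> qlie \<Rightarrow> vlie" where
  "ls (Leaf i) u = Poly_Mapping.single i u"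
| "ls (Node A B) u = ls A (br (qt B) u) + ls B (br u (qt A))"

lemma additive_ls: "additive (ls J)"
  by (induction J) (auto simp: additive_def single_add algebra_simps)

lemmas ls_simps [simp] = additive.zero[OF additive_ls] additive.add[OF additive_ls]
  additive.diff[OF additive_ls] additive.minus[OF additive_ls]

lemma ext_ls_magma_mult:
  "ext (\<lambda>J. ls J u) (magma_mult x y) = ext (\<lambda>J. ls J (br (qc y) u)) x + ext (\<lambda>J. ls J (br u (qc x))) y"
proof (induction x rule: frag_induct)
  case (one I)
  show ?case
  proof (induction y rule: frag_induct)
    case (diff x y)
    then show ?case by (simp add: algebra_simps)
  qed simp_all
next
  case (diff x y)
  then show ?case by (simp add: algebra_simps ext_minus_fun)
qed simp_all

text \<open>In the IHX case the leaves of \<open>A\<close>, of \<open>B\<close> and of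
  \<open>C\<close> are treated separately: what they see in the three trees adds up to zero by
  Jacobi. In the last two rules the leaves of \<open>J\<close> see a multiple of
  \<open>qc x\<close>, which is zero, and the leaves of \<open>x\<close> see \<open>u\<close>
  bracketed with \<open>J\<close>; so \<open>u\<close> has to stay arbitrary in the
  induction.\<close>

lemma ext_ls_qrel: "r \<in> qrel \<Longrightarrow> ext (\<lambda>J. ls J u) r = 0"
proof (induction arbitrary: u rule: qrel.induct)
  case (qrel_AS I J)
  show ?case using br_anti[of "qt J" u] br_anti[of u "qt I"] by simp
next
  case (qrel_IHX A B C)
  have j: "br b (br c u) - br (br b c) u + br c (br u b) = 0"
      "br (br c u) a - br c (br u a) + br (br a c) u = 0"
      "br u (br a b) - br (br u a) b + br (br u b) a = 0" for a b c
    using br_anti[of u b] br_anti[of u a] br_anti[of "br c u" a] br_jacobi[of a c u] br_jacobi[of u a b]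
      br_anti[of "br u b" a] by (simp_all add: br_jacobi)
  have "ls A (br (qt B) (br (qt C) u)) + ls B (br (br (qt C) u) (qt A)) + ls C (br u (br (qt A) (qt B)))
      - (ls A (br (br (qt B) (qt C)) u) + (ls B (br (qt C) (br u (qt A))) + ls C (br (br u (qt A)) (qt B))))
      + (ls B (br (br (qt A) (qt C)) u) + (ls A (br (qt C) (br u (qt B))) + ls C (br (br u (qt B)) (qt A))))
    = ls A (br (qt B) (br (qt C) u) - br (br (qt B) (qt C)) u + br (qt C) (br u (qt B)))
      + ls B (br (br (qt C) u) (qt A) - br (qt C) (br u (qt A)) + br (br (qt A) (qt C)) u)
      + ls C (br u (br (qt A) (qt B)) - br (br u (qt A)) (qt B) + br (br u (qt B)) (qt A))"
    unfolding additive.add[OF additive_ls] additive.diff[OF additive_ls] by (simp add: algebra_simps del: br_qt)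
  also have "\<dots> = 0" unfolding j by simp
  finally have "ls A (br (qt B) (br (qt C) u)) + ls B (br (br (qt C) u) (qt A)) + ls C (br u (br (qt A) (qt B)))
      - (ls A (br (br (qt B) (qt C)) u) + (ls B (br (qt C) (br u (qt A))) + ls C (br (br u (qt A)) (qt B))))
      + (ls B (br (br (qt A) (qt C)) u) + (ls A (br (qt C) (br u (qt B))) + ls C (br (br u (qt B)) (qt A)))) = 0" .
  then show ?case by simp
next
  case (qrel_left x J)
  then have "qc x = 0" by (simp add: qc_eq_0_iff)
  then show ?case by (simp add: ext_ls_magma_mult qrel_left.IH)
next
  case (qrel_right x J)
  then have "qc x = 0" by (simp add: qc_eq_0_iff)
  then show ?case by (simp add: ext_ls_magma_mult qrel_right.IH)
qed simp_all

text \<open>The part of the vertex sum of the inner product <u,w> that comes from the leaves of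
  \<open>u\<close>.\<close>

definition lq :: "qlie \<Rightarrow> qlie \<Rightarrow> vlie" where
  "lq u w = qmap (\<lambda>J. ls J w) u"

lemma lq_qc: "lq (qc z) w = ext (\<lambda>J. ls J w) z"
  unfolding lq_def by (intro qmap_qc ext_ls_qrel)

lemma lq_qt: "lq (qt J) w = ls J w"
  unfolding lq_def by (intro qmap_qt ext_ls_qrel)

lemma lq_leaf [simp]: "lq (qt (Leaf i)) w = Poly_Mapping.single i w"
  by (simp add: lq_qt)

lemma additive_lq: "additive (\<lambda>u. lq u w)" "additive (lq u)"
proof -
  show *: "additive (\<lambda>u. lq u w)" for w unfolding lq_def by (intro additive_qmap ext_ls_qrel)
  show "additive (lq u)"
  proof
    fix x y
    show "lq u (x + y) = lq u x + lq u y"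
      by (rule qlie_additive_eqI[of _ "\<lambda>u. lq u x + lq u y"])
         (auto intro!: * additive_plus simp: lq_qt)
  qed
qed

lemmas lq_simps [simp] = 
  additive.zero[OF additive_lq(1)] additive.add[OF additive_lq(1)]
  additive.diff[OF additive_lq(1)] additive.minus[OF additive_lq(1)]
  additive.zero[OF additive_lq(2)] additive.add[OF additive_lq(2)]
  additive.diff[OF additive_lq(2)] additive.minus[OF additive_lq(2)]

lemma lq_br: "lq (br a b) w = lq a (br b w) + lq b (br w a)"
proof -
  obtain x y where "a = qc x" "b = qc y" using qc_surj by blast
  then show ?thesis by (simp add: br_qc lq_qc ext_ls_magma_mult)
qed

text \<open>Bracketing every leaf with the tree that it sees reassembles the product; at a node this
  is Jacobi in the form [A,[B,w]] + [B,[w,A]] = [[A,B],w].\<close>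

lemma vbr_lq: "vbr (lq a b) = br a b"
proof (rule qlie_additive_eqI[of "\<lambda>a. vbr (lq a b)"])
  fix J show "vbr (lq (qt J) b) = br (qt J) b"
  proof (induction J arbitrary: b)
    case (Node A B)
    have "vbr (lq (br (qt A) (qt B)) b) = br (br (qt A) (qt B)) b"
      using Node.IH br_anti[of b "qt A"] by (simp add: lq_br br_jacobi del: br_qt)
    then show ?case by simp
  qed simp
qed (auto simp: additive_def)

section \<open>Pairs of rooted trees and their inner products\<close>

text \<open>An unrooted tree is presented by the pair of rooted trees at a cut edge. Symmetry and
  rotation express that the choice of the edge is immaterial; so the quotient is the target of the
  universal symmetric invariant bilinear form \<open>pr\<close> on L'. Relations in the second entry
  follow by symmetry.\<close>

inductive_set trel :: "(rtree \<times> rtree \<Rightarrow>\<^sub>0 int) set" where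
  trel_0: "0 \<in> trel"
| trel_diff: "x \<in> trel \<Longrightarrow> y \<in> trel \<Longrightarrow> x - y \<in> trel"
| trel_sym: "frag_of (I, J) - frag_of (J, I) \<in> trel"
| trel_rot: "frag_of (Node A B, C) - frag_of (A, Node B C) \<in> trel"
| trel_qrel: "r \<in> qrel \<Longrightarrow> ext (\<lambda>I. frag_of (I, J)) r \<in> trel"

lemma trel_minus: "x \<in> trel \<Longrightarrow> - x \<in> trel"
  using trel_diff[OF trel_0, of x] by simp

lemma trel_add: "x \<in> trel \<Longrightarrow> y \<in> trel \<Longrightarrow> x + y \<in> trel"
  using trel_diff[OF _ trel_minus, of x y] by simp

quotient_type tq = "rtree \<times> rtree \<Rightarrow>\<^sub>0 int" / "\<lambda>x y. x - y \<in> trel"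
proof (rule equivpI)
  show "reflp (\<lambda>x y. x - y \<in> trel)" by (rule reflpI) (simp add: trel_0)
  show "symp (\<lambda>x y. x - y \<in> trel)" by (rule sympI) (metis minus_diff_eq trel_minus)
  show "transp (\<lambda>x y. x - y \<in> trel)"
  proof (rule transpI)
    fix x y z assume "x - y \<in> trel" "y - z \<in> trel"
    then have "(x - y) + (y - z) \<in> trel" by (rule trel_add)
    then show "x - z \<in> trel" by simp
  qed
qed

instantiation tq :: ab_group_add
begin
lift_definition zero_tq :: tq is 0 .
lift_definition plus_tq :: "tq \<Rightarrow> tq \<Rightarrow> tq" is "(+)"
  by (metis add_diff_add trel_add)
lift_definition minus_tq :: "tq \<Rightarrow> tq \<Rightarrow> tq" is "(-)"
proof -
  fix a b c d :: "rtree \<times> rtree \<Rightarrow>\<^sub>0 int"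
  assume "a - b \<in> trel" "c - d \<in> trel"
  then have "(a - b) - (c - d) \<in> trel" by (rule trel_diff)
  then show "a - c - (b - d) \<in> trel" by (simp add: algebra_simps)
qed
lift_definition uminus_tq :: "tq \<Rightarrow> tq" is "uminus"
proof -
  fix a b :: "rtree \<times> rtree \<Rightarrow>\<^sub>0 int"
  assume "a - b \<in> trel"
  then have "- (a - b) \<in> trel" by (rule trel_minus)
  then show "- a - - b \<in> trel" by simp
qed
instance
  by standard (transfer; simp add: trel_0 algebra_simps)+
end

definition tc :: "(rtree \<times> rtree \<Rightarrow>\<^sub>0 int) \<Rightarrow> tq" where "tc = abs_tq"

lemma additive_tc: "additive tc"
  by standard (simp add: tc_def plus_tq.abs_eq)

lemmas tc_simps [simp] = additive.zero[OF additive_tc] additive.add[OF additive_tc]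
  additive.diff[OF additive_tc] additive.minus[OF additive_tc]

lemma tc_eq_iff: "tc x = tc y \<longleftrightarrow> x - y \<in> trel"
  by (simp add: tc_def tq.abs_eq_iff)

lemma tc_eq_0_iff: "tc x = 0 \<longleftrightarrow> x \<in> trel"
  using tc_eq_iff[of x 0] by simp

lemma tc_surj: "\<exists>z. t = tc z"
  using Quotient_abs_rep[OF Quotient_tq, of t] by (metis tc_def)

lemma tc_rep [simp]: "tc (rep_tq u) = u"
  using Quotient_abs_rep[OF Quotient_tq] by (simp add: tc_def)

lemma ext_tc1: "r \<in> qrel \<Longrightarrow> ext (\<lambda>I. tc (frag_of (I, J))) r = 0"
  using trel_qrel[of r J, folded tc_eq_0_iff] additive_ext_apply[OF additive_tc, of "\<lambda>I. frag_of (I, J)" r] by simp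

lemma tc_sym: "tc (frag_of (I, J)) = tc (frag_of (J, I))"
  by (simp add: tc_eq_iff trel_sym)

lemma ext_tc2: "r \<in> qrel \<Longrightarrow> ext (\<lambda>I. tc (frag_of (J, I))) r = 0"
  using ext_tc1[of r J] by (simp add: tc_sym[of J])

definition pr :: "qlie \<Rightarrow> qlie \<Rightarrow> tq" where
  "pr u w = qmap (\<lambda>I. qmap (\<lambda>J. tc (frag_of (I, J))) w) u"

lemma ext_pr_aux:
  assumes "r \<in> qrel" shows "ext (\<lambda>I. qmap (\<lambda>J. tc (frag_of (I, J))) w) r = 0"
proof (rule qlie_eq_0[of "\<lambda>w. ext (\<lambda>I. qmap (\<lambda>J. tc (frag_of (I, J))) w) r"])
  have "additive (qmap (\<lambda>J. tc (frag_of (I, J))))" for I by (intro additive_qmap ext_tc2)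
  then show "additive (\<lambda>w. ext (\<lambda>I. qmap (\<lambda>J. tc (frag_of (I, J))) w) r)"
    by (simp add: additive_def ext_plus_fun)
  fix J
  show "ext (\<lambda>I. qmap (\<lambda>J. tc (frag_of (I, J))) (qt J)) r = 0"
    using assms by (simp add: qmap_qt[OF ext_tc2] ext_tc1)
qed

lemma pr_qt: "pr (qt I) (qt J) = tc (frag_of (I, J))"
  by (simp add: pr_def qmap_qt[OF ext_pr_aux] qmap_qt[OF ext_tc1] qmap_qt[OF ext_tc2])

lemma additive_pr: "additive (\<lambda>u. pr u w)" "additive (pr u)"
proof -
  show *: "additive (\<lambda>u. pr u w)" for w unfolding pr_def by (intro additive_qmap ext_pr_aux)
  show "additive (pr u)"
  proof
    fix x y
    have q: "additive (qmap (\<lambda>J. tc (frag_of (I, J))))" for I by (intro additive_qmap ext_tc2)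
    have p: "pr (qt I) w = qmap (\<lambda>J. tc (frag_of (I, J))) w" for I w
      by (simp add: pr_def qmap_qt[OF ext_pr_aux])
    show "pr u (x + y) = pr u x + pr u y"
      by (rule qlie_additive_eqI[of _ "\<lambda>u. pr u x + pr u y"])
         (auto intro!: * additive_plus simp: p additive.add[OF q])
  qed
qed

lemmas pr_simps [simp] = 
  additive.zero[OF additive_pr(1)] additive.add[OF additive_pr(1)]
  additive.diff[OF additive_pr(1)] additive.minus[OF additive_pr(1)]
  additive.zero[OF additive_pr(2)] additive.add[OF additive_pr(2)]
  additive.diff[OF additive_pr(2)] additive.minus[OF additive_pr(2)]

lemma qlie_biadditive_eqI:
  assumes "\<And>w. additive (\<lambda>u. f u w)" "\<And>u. additive (f u)" 
    "\<And>w. additive (\<lambda>u. g u w)" "\<And>u. additive (g u)" 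
    "\<And>I J. f (qt I) (qt J) = g (qt I) (qt J)"
  shows "f u w = g u w"
  by (rule qlie_additive_eqI[OF assms(1,3)], rule qlie_additive_eqI[OF assms(2,4)], rule assms(5))

lemma pr_sym: "pr u w = pr w u"
  by (rule qlie_biadditive_eqI[of pr "\<lambda>u w. pr w u"]) (auto intro: additive_pr tc_sym simp: pr_qt)

lemma pr_inv: "pr (br a b) c = pr a (br b c)"
proof (rule qlie_additive_eqI[of "pr (br a b)" "\<lambda>c. pr a (br b c)"])
  fix C
  show "pr (br a b) (qt C) = pr a (br b (qt C))"
  proof (rule qlie_biadditive_eqI[of "\<lambda>a b. pr (br a b) (qt C)" "\<lambda>a b. pr a (br b (qt C))"])
    fix A B
    have "tc (frag_of (Node A B, C)) = tc (frag_of (A, Node B C))" by (simp add: tc_eq_iff trel_rot)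
    then show "pr (br (qt A) (qt B)) (qt C) = pr (qt A) (br (qt B) (qt C))" by (simp add: pr_qt)
  qed (auto simp: additive_def)
qed (auto simp: additive_def)

lemma tq_induct [case_names zero pr diff]:
  assumes "P 0" "\<And>I J. P (pr (qt I) (qt J))" "\<And>x y. P x \<Longrightarrow> P y \<Longrightarrow> P (x - y)"
  shows "P t"
proof -
  obtain z where "t = tc z" using tc_surj by blast
  moreover have "P (tc z)"
  proof (induction z rule: frag_induct)
    case (one p)
    then show ?case using assms(2)[of "fst p" "snd p"] by (simp add: pr_qt)
  qed (simp_all add: assms)
  ultimately show ?thesis by simp
qed

lemma tq_additive_eqI:
  assumes "additive f" "additive g" "\<And>I J. f (pr (qt I) (qt J)) = g (pr (qt I) (qt J))"
  shows "f t = g t"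
  by (induction t rule: tq_induct)
     (simp_all add: assms(3) additive.zero[OF assms(1)] additive.zero[OF assms(2)]
       additive.diff[OF assms(1)] additive.diff[OF assms(2)])

definition tmap :: "(rtree \<Rightarrow> rtree \<Rightarrow> 'b::ab_group_add) \<Rightarrow> tq \<Rightarrow> 'b" where
  "tmap f t = ext (\<lambda>(I, J). f I J) (rep_tq t)"

lemma tmap_tc:
  assumes "\<And>r. r \<in> trel \<Longrightarrow> ext (\<lambda>(I, J). f I J) r = 0"
  shows "tmap f (tc z) = ext (\<lambda>(I, J). f I J) z"
proof -
  have "rep_tq (tc z) - z \<in> trel" using tc_eq_iff[of "rep_tq (tc z)" z] by simp
  then show ?thesis using assms[of "rep_tq (tc z) - z"] by (simp add: tmap_def)
qed

lemma additive_tmap: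
  assumes "\<And>r. r \<in> trel \<Longrightarrow> ext (\<lambda>(I, J). f I J) r = 0"
  shows "additive (tmap f)"
proof
  fix x y
  obtain a b where "x = tc a" "y = tc b" using tc_surj by blast
  then show "tmap f (x + y) = tmap f x + tmap f y"
    using tmap_tc[OF assms, of a] tmap_tc[OF assms, of b] tmap_tc[OF assms, of "a + b"] by simp
qed

lemma tmap_kills_trel:
  assumes "\<And>I J. f I J = f J I" "\<And>A B C. f (Node A B) C = f A (Node B C)"
    "\<And>r J. r \<in> qrel \<Longrightarrow> ext (\<lambda>I. f I J) r = 0"
    "r \<in> trel"
  shows "ext (\<lambda>(I, J). f I J) r = 0"
  using assms(4)
proof induction
  case (trel_sym I J)
  then show ?case using assms(1)[of I J] by simp
next
  case (trel_qrel r J)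
  then show ?case using assms(3)[of r J] by (simp add: additive_ext_apply[OF additive_ext])
qed (simp_all add: assms(2))

definition tlift :: "(qlie \<Rightarrow> qlie \<Rightarrow> 'b::ab_group_add) \<Rightarrow> tq \<Rightarrow> 'b" where
  "tlift g = tmap (\<lambda>I J. g (qt I) (qt J))"

context
  fixes g :: "qlie \<Rightarrow> qlie \<Rightarrow> 'b::ab_group_add"
  assumes g: "\<And>w. additive (\<lambda>u. g u w)" "\<And>u w. g u w = g w u" "\<And>a b c. g (br a b) c = g a (br b c)"
begin

lemma tlift_aux: "r \<in> trel \<Longrightarrow> ext (\<lambda>(I, J). g (qt I) (qt J)) r = 0"
proof (erule tmap_kills_trel[of "\<lambda>I J. g (qt I) (qt J)", rotated 3])
  show "g (qt I) (qt J) = g (qt J) (qt I)" for I J by (rule g(2))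
  show "g (qt (Node A B)) (qt C) = g (qt A) (qt (Node B C))" for A B C
    using g(3)[of "qt A" "qt B" "qt C"] by simp
  fix r J assume "r \<in> qrel"
  then have "g (ext qt r) (qt J) = 0"
    using additive.zero[OF g(1)] by (metis qc_eq_0_iff qc_eq_ext)
  then show "ext (\<lambda>I. g (qt I) (qt J)) r = 0"
    using additive_ext_apply[OF g(1)[of "qt J"], of qt r] by simp
qed

lemma additive_tlift: "additive (tlift g)"
  unfolding tlift_def by (intro additive_tmap tlift_aux)

lemma tlift_pr: "tlift g (pr u w) = g u w"
proof (rule qlie_biadditive_eqI[of "\<lambda>u w. tlift g (pr u w)" g])
  show "additive (g u)" for u unfolding g(2)[of u] by (rule g(1))
  show "tlift g (pr (qt I) (qt J)) = g (qt I) (qt J)" for I J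
    unfolding pr_qt tlift_def by (subst tmap_tc) (simp_all add: tlift_aux)
qed (intro additive_comp[OF additive_tlift] additive_pr g(1))+

end

definition eta :: "tq \<Rightarrow> vlie" where
  "eta = tlift (\<lambda>u w. lq u w + lq w u)"

text \<open>Both sides of the invariance are lq a [b,c] + lq b [c,a] + lq c [a,b]: the leaves of
  three trees around a vertex.\<close>

lemma eta_aux:
  "additive (\<lambda>u. lq u w + lq w u)"
  "lq u w + lq w u = lq w u + lq u w"
  "lq (br a b) c + lq c (br a b) = lq a (br b c) + lq (br b c) a"
proof -
  show "additive (\<lambda>u. lq u w + lq w u)" by (intro additive_plus additive_lq)
  show "lq u w + lq w u = lq w u + lq u w" by (rule add.commute)
  show "lq (br a b) c + lq c (br a b) = lq a (br b c) + lq (br b c) a"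
    unfolding lq_br by (simp only: add.assoc)
qed

lemma additive_eta: "additive eta"
  unfolding eta_def by (rule additive_tlift; rule eta_aux)

lemmas eta_simps [simp] = additive.zero[OF additive_eta] additive.add[OF additive_eta]
  additive.diff[OF additive_eta] additive.minus[OF additive_eta]

lemma eta_pr: "eta (pr u w) = lq u w + lq w u"
  unfolding eta_def by (rule tlift_pr; rule eta_aux)

lemma vbr_eta [simp]: "vbr (eta t) = 0"
proof (rule tq_additive_eqI[of "\<lambda>t. vbr (eta t)" "\<lambda>_. 0"])
  show "vbr (eta (pr (qt I) (qt J))) = 0" for I J
    using br_anti[of "qt I" "qt J"] by (simp add: eta_pr vbr_lq del: br_qt)
qed (simp_all add: additive_def)

text \<open>Sending a rooted product \<open>(I,J)\<close> to \<open>ls I J\<close> inverts the bracket modulo inner products.\<close>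

theorem vbr_eq_0_iff: "vbr s = 0 \<longleftrightarrow> (\<exists>t. s = eta t)"
proof
  define l :: "rtree \<Rightarrow> vlie" where "l = rec_rtree (\<lambda>_. 0) (\<lambda>I J _ _. ls I (qt J))"
  have l: "l (Leaf i) = 0" "l (Node I J) = ls I (qt J)" for i I J by (simp_all add: l_def)
  have l_mult: "ext l (magma_mult x y) = lq (qc x) (qc y)" for x y
  proof (induction x rule: frag_induct)
    case (one I)
    show ?case by (induction y rule: frag_induct) (simp_all add: l lq_qt)
  qed simp_all
  \<comment> \<open>Antisymmetry goes to the vertex sum of <I,J>. The other relations go to zero:
    IHX by expanding at the leaves, the ideal rules because \<open>l\<close> of a product depends
    only on the classes of its factors.\<close>
  have l_qrel: "\<exists>t. ext l r = eta t" if "r \<in> qrel" for r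
    using that
  proof induction
    case qrel_0
    show ?case by (rule exI[of _ 0]) simp
  next
    case (qrel_diff x y)
    then obtain t t' where "ext l x = eta t" "ext l y = eta t'" by blast
    then show ?case by (intro exI[of _ "t - t'"]) simp
  next
    case (qrel_AS I J)
    show ?case by (rule exI[of _ "pr (qt I) (qt J)"]) (simp add: l eta_pr lq_qt)
  next
    case (qrel_IHX A B C)
    have "lq (br a b) c - lq a (br b c) + lq b (br a c) = 0" for a b c
      by (simp add: lq_br br_anti[of a c])
    from this[of "qt A" "qt B" "qt C"] show ?case
      by (intro exI[of _ 0]) (simp add: l lq_qt del: ls.simps)
  next
    case (qrel_left x J)
    then have "qc x = 0" by (simp add: qc_eq_0_iff)
    then show ?case by (intro exI[of _ 0]) (simp add: l_mult)
  next
    case (qrel_right x J)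
    then have "qc x = 0" by (simp add: qc_eq_0_iff)
    then show ?case by (intro exI[of _ 0]) (simp add: l_mult)
  qed
  assume s: "vbr s = 0"
  \<comment> \<open>Every \<open>s\<close> is the value of \<open>l\<close> on some lift of its own
    bracket. If the bracket is zero, that lift is a relation, and \<open>l_qrel\<close>
    applies.\<close>
  have "\<exists>z. qc z = vbr s \<and> ext l z = s"
  proof (induction s rule: v_induct)
    case zero
    show ?case by (rule exI[of _ 0]) simp
  next
    case (single i u)
    obtain y where "u = qc y" using qc_surj by blast
    then show ?case
      using br_qc[of "frag_of (Leaf i)" y] by (intro exI[of _ "magma_mult (frag_of (Leaf i)) y"]) (simp add: l_mult)
  next
    case (diff x y)
    then obtain z z' where "qc z = vbr x" "ext l z = x" "qc z' = vbr y" "ext l z' = y" by blast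
    then show ?case by (intro exI[of _ "z - z'"]) simp
  qed
  then obtain z where "qc z = vbr s" "ext l z = s" by blast
  then show "\<exists>t. s = eta t" using s l_qrel[of z] by (simp add: qc_eq_0_iff)
qed auto

section \<open>Gradings\<close>

text \<open>The multidegree. The total degree would not do: elimination has to know how often a
  single label occurs.\<close>

primrec lm :: "rtree \<Rightarrow> nat multiset" where
  "lm (Leaf i) = {#i#}"
| "lm (Node I J) = lm I + lm J"

lemma lm_neq_empty [simp]: "lm J \<noteq> {#}"
  by (induction J) auto

lemma size_lm_pos: "0 < size (lm J)"
  using lm_neq_empty[of J] by (simp add: nonempty_has_size[symmetric])

definition qproj :: "(nat multiset \<Rightarrow> bool) \<Rightarrow> qlie \<Rightarrow> qlie" where
  "qproj P = qmap (\<lambda>J. if P (lm J) then qt J else 0)"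

lemma ext_qproj_magma_mult:
  "ext (\<lambda>K. if P (lm K) then qt K else 0) (magma_mult x (frag_of J)) =
     br (ext (\<lambda>I. if P (lm I + lm J) then qt I else 0) x) (qt J)"
  "ext (\<lambda>K. if P (lm K) then qt K else 0) (magma_mult (frag_of J) x) =
     br (qt J) (ext (\<lambda>I. if P (lm J + lm I) then qt I else 0) x)"
  by (induction x rule: frag_induct; simp)+

lemma ext_qproj_qrel: "r \<in> qrel \<Longrightarrow> ext (\<lambda>J. if P (lm J) then qt J else 0) r = 0"
proof (induction arbitrary: P rule: qrel.induct)
  case (qrel_AS I J)
  show ?case using br_anti[of "qt I" "qt J"] by (simp add: add.commute)
next
  case (qrel_IHX A B C)
  show ?case using br_jacobi[of "qt A" "qt B" "qt C"] by (simp add: add_ac)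
next
  case (qrel_left x J)
  show ?case unfolding ext_qproj_magma_mult using qrel_left.IH[of "\<lambda>d. P (d + lm J)"] by simp
next
  case (qrel_right x J)
  show ?case unfolding ext_qproj_magma_mult using qrel_right.IH[of "\<lambda>d. P (lm J + d)"] by simp
qed simp_all

lemma additive_qproj: "additive (qproj P)"
  unfolding qproj_def by (intro additive_qmap ext_qproj_qrel)

lemmas qproj_simps [simp] = additive.zero[OF additive_qproj] additive.add[OF additive_qproj]
  additive.diff[OF additive_qproj] additive.minus[OF additive_qproj]

lemma qproj_qc: "qproj P (qc z) = qc (restr {J. P (lm J)} z)"
proof -
  have "qproj P (qc z) = ext (\<lambda>J. if P (lm J) then qt J else 0) z"
    unfolding qproj_def by (intro qmap_qc ext_qproj_qrel)
  also have "\<dots> = qc (restr {J. P (lm J)} z)"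
    by (rule additive_eqI) (auto simp: additive_def restr_frag_of)
  finally show ?thesis .
qed

lemma qproj_qt: "qproj P (qt J) = (if P (lm J) then qt J else 0)"
  using qproj_qc[of P "frag_of J"] by (simp add: restr_frag_of)

lemma qproj_qproj [simp]: "qproj P (qproj P u) = qproj P u"
  by (rule qlie_additive_eqI[of "\<lambda>u. qproj P (qproj P u)"])
     (auto simp: additive_def qproj_qt)

lemma qproj_induct [consumes 1, case_names zero tree diff]:
  assumes "qproj P u = u" "R 0" "\<And>J. P (lm J) \<Longrightarrow> R (qt J)" "\<And>x y. R x \<Longrightarrow> R y \<Longrightarrow> R (x - y)"
  shows "R u"
proof -
  have "R (qproj P u)"
    by (induction u rule: qlie_induct) (auto simp: qproj_qt assms)
  then show ?thesis using assms(1) by simp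
qed

lemma additive_eqI_on:
  assumes "qproj P u = u" "additive f" "additive g" "\<And>J. P (lm J) \<Longrightarrow> f (qt J) = g (qt J)"
  shows "f u = g u"
  using assms(1)
  by (induction u rule: qproj_induct)
     (simp_all add: assms(4) additive.zero[OF assms(2)] additive.zero[OF assms(3)]
       additive.diff[OF assms(2)] additive.diff[OF assms(3)])

lemma qproj_mono:
  assumes "qproj P u = u" "\<And>d. P d \<Longrightarrow> Q d"
  shows "qproj Q u = u"
  using assms(1) by (induction u rule: qproj_induct) (simp_all add: assms(2) qproj_qt)

lemma qproj_disjoint:
  assumes "qproj P u = u" "\<And>d. P d \<Longrightarrow> \<not> Q d"
  shows "qproj Q u = 0"
  using assms(1) by (induction u rule: qproj_induct) (simp_all add: assms(2) qproj_qt)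

lemma qproj_br:
  assumes "qproj P u = u" "qproj Q w = w" "\<And>d e. P d \<Longrightarrow> Q e \<Longrightarrow> R (d + e)"
  shows "qproj R (br u w) = br u w"
proof (rule additive_eqI_on[OF assms(1), of "\<lambda>u. qproj R (br u w)" "\<lambda>u. br u w"])
  fix I assume I: "P (lm I)"
  show "qproj R (br (qt I) w) = br (qt I) w"
    by (rule additive_eqI_on[OF assms(2), of "\<lambda>w. qproj R (br (qt I) w)" "br (qt I)"])
       (auto simp: additive_def qproj_qt assms(3) I)
qed (simp_all add: additive_def)

text \<open>The square of a tree of multidegree \<open>d\<close> has multidegree
  \<open>d + d\<close>, and squaring is additive.\<close>

lemma qproj_square: "qproj P (br y y) = br (qproj (\<lambda>d. P (d + d)) y) (qproj (\<lambda>d. P (d + d)) y)"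
proof (rule qlie_additive_eqI[of "\<lambda>y. qproj P (br y y)"])
  show "additive (\<lambda>y. qproj P (br y y))" by (rule additive_comp[OF additive_qproj additive_square])
  show "additive (\<lambda>y. br (qproj (\<lambda>d. P (d + d)) y) (qproj (\<lambda>d. P (d + d)) y))"
    by standard (simp only: additive.add[OF additive_qproj] square_add)
qed (auto simp: qproj_qt)

text \<open>Claimed for all finite supersets of \<open>D\<close>, so that the sets belonging to two
  elements can be united for their difference.\<close>

lemma qproj_decomp:
  "\<exists>D. finite D \<and> (\<forall>D'. finite D' \<longrightarrow> D \<subseteq> D' \<longrightarrow> u = (\<Sum>d\<in>D'. qproj ((=) d) u))"
proof (induction u rule: qlie_induct)
  case zero
  show ?case by (rule exI[of _ "{}"]) simp
next
  case (tree J)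
  show ?case by (rule exI[of _ "{lm J}"]) (auto simp: qproj_qt)
next
  case (diff x y)
  then obtain D D' where D: "finite D" "\<And>C. finite C \<Longrightarrow> D \<subseteq> C \<Longrightarrow> (\<Sum>d\<in>C. qproj ((=) d) x) = x"
    "finite D'" "\<And>C. finite C \<Longrightarrow> D' \<subseteq> C \<Longrightarrow> (\<Sum>d\<in>C. qproj ((=) d) y) = y" by metis
  then show ?case by (intro exI[of _ "D \<union> D'"]) (auto simp: sum_subtractf)
qed

lemma qproj_sum:
  obtains D where "finite D" "u = (\<Sum>d\<in>D. qproj ((=) d) u)"
  using qproj_decomp[of u] by blast

definition vproj :: "(nat multiset \<Rightarrow> bool) \<Rightarrow> vlie \<Rightarrow> vlie" where
  "vproj P = vext (\<lambda>i u. Poly_Mapping.single i (qproj (\<lambda>d. P (add_mset i d)) u))"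

lemma vproj_aux: "additive (\<lambda>u. Poly_Mapping.single i (qproj (\<lambda>d. P (add_mset i d)) u))"
  by (intro additive_comp[OF additive_single] additive_qproj)

lemma additive_vproj: "additive (vproj P)"
  unfolding vproj_def by (rule additive_vext) (rule vproj_aux)

lemma vproj_single: "vproj P (Poly_Mapping.single i u) = Poly_Mapping.single i (qproj (\<lambda>d. P (add_mset i d)) u)"
  unfolding vproj_def by (rule vext_single) (rule vproj_aux)

lemmas vproj_simps [simp] = additive.zero[OF additive_vproj] additive.add[OF additive_vproj]
  additive.diff[OF additive_vproj] additive.minus[OF additive_vproj]

lemma vproj_ls: "vproj P (ls I (qt J)) = (if P (lm I + lm J) then ls I (qt J) else 0)"
  by (induction I arbitrary: J) (auto simp: vproj_single qproj_qt ac_simps)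

definition tproj :: "(nat multiset \<Rightarrow> bool) \<Rightarrow> tq \<Rightarrow> tq" where
  "tproj P = tmap (\<lambda>I J. if P (lm I + lm J) then pr (qt I) (qt J) else 0)"

lemma tproj_aux: "r \<in> trel \<Longrightarrow> ext (\<lambda>(I, J). if P (lm I + lm J) then pr (qt I) (qt J) else 0) r = 0"
proof (erule tmap_kills_trel[of "\<lambda>I J. if P (lm I + lm J) then pr (qt I) (qt J) else 0", rotated 3])
  fix A B C
  show "(if P (lm (Node A B) + lm C) then pr (qt (Node A B)) (qt C) else 0) =
      (if P (lm A + lm (Node B C)) then pr (qt A) (qt (Node B C)) else 0)"
    using pr_inv[of "qt A" "qt B" "qt C"] by (simp add: add_ac)
next
  fix r J assume "r \<in> qrel"
  then have "pr (ext (\<lambda>I. if P (lm I + lm J) then qt I else 0) r) (qt J) = 0"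
    using ext_qproj_qrel[of r "\<lambda>d. P (d + lm J)"] by simp
  then show "ext (\<lambda>I. if P (lm I + lm J) then pr (qt I) (qt J) else 0) r = 0"
    by (simp add: additive_ext_apply[OF additive_pr(1)] if_distrib[of "\<lambda>u. pr u (qt J)"] cong: if_cong)
qed (simp add: add.commute pr_sym)

lemma additive_tproj: "additive (tproj P)"
  unfolding tproj_def by (intro additive_tmap tproj_aux)

lemma tproj_tc_ext: "tproj P (tc z) = ext (\<lambda>(I, J). if P (lm I + lm J) then pr (qt I) (qt J) else 0) z"
  unfolding tproj_def by (rule tmap_tc) (rule tproj_aux)

lemma tproj_pr_qt: "tproj P (pr (qt I) (qt J)) = (if P (lm I + lm J) then pr (qt I) (qt J) else 0)"
  using tproj_tc_ext[of P "frag_of (I, J)"] by (simp add: pr_qt)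

lemmas tproj_simps [simp] = additive.zero[OF additive_tproj] additive.add[OF additive_tproj]
  additive.diff[OF additive_tproj] additive.minus[OF additive_tproj]

lemma tproj_tc: "tproj P (tc z) = tc (restr {(I, J). P (lm I + lm J)} z)"
  by (rule additive_eqI[of "\<lambda>z. tproj P (tc z)"])
     (auto simp: additive_def restr_frag_of pr_qt[symmetric] tproj_pr_qt)

lemma eta_tproj: "eta (tproj P t) = vproj P (eta t)"
  by (rule tq_additive_eqI[of "\<lambda>t. eta (tproj P t)"])
     (auto simp: additive_def tproj_pr_qt eta_pr lq_qt vproj_ls add.commute)

lemma tproj_tproj [simp]: "tproj P (tproj P t) = tproj P t"
  by (rule tq_additive_eqI[of "\<lambda>t. tproj P (tproj P t)"])
     (auto simp: additive_def tproj_pr_qt)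

lemma tproj_induct [consumes 1, case_names zero pr diff]:
  assumes "tproj P t = t" "R 0" "\<And>I J. P (lm I + lm J) \<Longrightarrow> R (pr (qt I) (qt J))"
    "\<And>x y. R x \<Longrightarrow> R y \<Longrightarrow> R (x - y)"
  shows "R t"
proof -
  have "R (tproj P t)"
    by (induction t rule: tq_induct) (auto simp: tproj_pr_qt assms)
  then show ?thesis using assms(1) by simp
qed

lemma tproj_pr:
  assumes "qproj P u = u" "qproj Q w = w" "\<And>d e. P d \<Longrightarrow> Q e \<Longrightarrow> R (d + e)"
  shows "tproj R (pr u w) = pr u w"
proof (rule additive_eqI_on[OF assms(1), of "\<lambda>u. tproj R (pr u w)" "\<lambda>u. pr u w"])
  fix I assume I: "P (lm I)"
  show "tproj R (pr (qt I) w) = pr (qt I) w"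
    by (rule additive_eqI_on[OF assms(2), of "\<lambda>w. tproj R (pr (qt I) w)" "pr (qt I)"])
       (auto simp: additive_def tproj_pr_qt assms(3) I)
qed (simp_all add: additive_def)

lemma tproj_decomp:
  "\<exists>D. finite D \<and> (\<forall>D'. finite D' \<longrightarrow> D \<subseteq> D' \<longrightarrow> t = (\<Sum>d\<in>D'. tproj ((=) d) t))"
proof (induction t rule: tq_induct)
  case zero
  show ?case by (rule exI[of _ "{}"]) simp
next
  case (pr I J)
  show ?case by (rule exI[of _ "{lm I + lm J}"]) (auto simp: tproj_pr_qt)
next
  case (diff x y)
  then obtain D D' where D: "finite D" "\<And>C. finite C \<Longrightarrow> D \<subseteq> C \<Longrightarrow> (\<Sum>d\<in>C. tproj ((=) d) x) = x"
    "finite D'" "\<And>C. finite C \<Longrightarrow> D' \<subseteq> C \<Longrightarrow> (\<Sum>d\<in>C. tproj ((=) d) y) = y" by metis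
  then show ?case by (intro exI[of _ "D \<union> D'"]) (auto simp: sum_subtractf)
qed

lemma tproj_sum:
  obtains D where "finite D" "t = (\<Sum>d\<in>D. tproj ((=) d) t)"
  using tproj_decomp[of t] by blast

section \<open>Lazard elimination of a label\<close>

text \<open>
  The label \<open>n = prod_encode (k, v)\<close> of the smaller ring stands for \<open>ad(x)^k\<close> applied to the
  label \<open>skip x v\<close>, where \<open>skip x\<close> enumerates the labels other than \<open>x\<close>.
\<close>

definition skip :: "nat \<Rightarrow> nat \<Rightarrow> nat" where
  "skip x v = (if v < x then v else Suc v)"

definition unskip :: "nat \<Rightarrow> nat \<Rightarrow> nat" where
  "unskip x i = (if i < x then i else i - 1)"

lemma skip_neq [simp]: "skip x v \<noteq> x" and unskip_skip [simp]: "unskip x (skip x v) = v"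
  and skip_unskip: "i \<noteq> x \<Longrightarrow> skip x (unskip x i) = i"
  by (auto simp: skip_def unskip_def)

definition shift :: "nat \<Rightarrow> nat" where
  "shift n = (case prod_decode n of (k, v) \<Rightarrow> prod_encode (Suc k, v))"

lemma shift_encode [simp]: "shift (prod_encode (k, v)) = prod_encode (Suc k, v)"
  by (simp add: shift_def)

lemma label_cases: obtains k v where "n = prod_encode (k, v)"
  by (metis prod_decode_inverse surj_pair)

text \<open>The derivation that plays the role of \<open>ad(x)\<close> once \<open>x\<close> is
  gone: on the label for \<open>ad(x)^k y\<close> it raises \<open>k\<close> by one.\<close>

primrec Dtree :: "rtree \<Rightarrow> qlie" where
  "Dtree (Leaf n) = qt (Leaf (shift n))"
| "Dtree (Node I J) = br (Dtree I) (qt J) + br (qt I) (Dtree J)"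

lemma ext_Dtree_magma_mult:
  "ext Dtree (magma_mult x y) = br (ext Dtree x) (qc y) + br (qc x) (ext Dtree y)"
proof (induction x rule: frag_induct)
  case (one I)
  show ?case by (induction y rule: frag_induct) (simp_all add: algebra_simps)
qed (simp_all add: algebra_simps)

lemma ext_Dtree_qrel: "r \<in> qrel \<Longrightarrow> ext Dtree r = 0"
proof (induction rule: qrel.induct)
  case (qrel_AS I J)
  show ?case using br_anti[of "Dtree I" "qt J"] br_anti[of "qt I" "Dtree J"] by simp
next
  case (qrel_IHX A B C)
  have "(br (br a' b) c + br (br a b') c + br (br a b) c') - (br a' (br b c) + br a (br b' c) + br a (br b c'))
      + (br b' (br a c) + br b (br a' c) + br b (br a c')) = 0" for a b c a' b' c'
    by (simp add: br_jacobi)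
  from this[of "Dtree A" "qt B" "qt C" "qt A" "Dtree B" "Dtree C"] show ?case by (simp add: algebra_simps)
next
  case (qrel_left x J)
  then show ?case by (simp add: ext_Dtree_magma_mult qc_eq_0_iff[THEN iffD2])
next
  case (qrel_right x J)
  then show ?case by (simp add: ext_Dtree_magma_mult qc_eq_0_iff[THEN iffD2])
qed simp_all

definition D :: "qlie \<Rightarrow> qlie" where "D = qmap Dtree"

lemma additive_D: "additive D"
  unfolding D_def by (intro additive_qmap ext_Dtree_qrel)

lemmas D_simps [simp] = additive.zero[OF additive_D] additive.add[OF additive_D]
  additive.diff[OF additive_D] additive.minus[OF additive_D]

lemma D_qt: "D (qt J) = Dtree J"
  unfolding D_def by (intro qmap_qt ext_Dtree_qrel)

lemma D_leaf [simp]: "D (qt (Leaf n)) = qt (Leaf (shift n))"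
  by (simp add: D_qt)

lemma D_br: "D (br u w) = br (D u) w + br u (D w)"
  by (rule qlie_biadditive_eqI[of "\<lambda>u w. D (br u w)"])
     (auto simp: additive_def algebra_simps D_qt)

lemma D_pow_simps [simp]: "(D ^^ k) 0 = 0" "(D ^^ k) (u + w) = (D ^^ k) u + (D ^^ k) w"
    "(D ^^ k) (u - w) = (D ^^ k) u - (D ^^ k) w" "(D ^^ k) (- u) = - (D ^^ k) u"
  by (induction k) simp_all

text \<open>Labels change under \<open>D\<close>, so of the multidegree only the number of leaves is
  preserved.\<close>

lemma qproj_D: "qproj (\<lambda>d. P (size d)) (D u) = D (qproj (\<lambda>d. P (size d)) u)"
proof (rule qlie_additive_eqI[of "\<lambda>u. qproj (\<lambda>d. P (size d)) (D u)"])
  fix J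
  have "qproj (\<lambda>d. size d = size (lm J)) (D (qt J)) = D (qt J)"
  proof (induction J)
    case (Leaf n)
    then show ?case by (simp add: qproj_qt)
  next
    case (Node A B)
    have q: "qproj (\<lambda>d. size d = size (lm A)) (qt A) = qt A" "qproj (\<lambda>d. size d = size (lm B)) (qt B) = qt B"
      by (simp_all add: qproj_qt)
    show ?case
      using qproj_br[OF Node(1) q(2), of "\<lambda>d. size d = size (lm (Node A B))"]
        qproj_br[OF q(1) Node(2), of "\<lambda>d. size d = size (lm (Node A B))"]
      by (simp add: D_qt)
  qed
  from qproj_mono[OF this, of "\<lambda>d. P (size d)"] qproj_disjoint[OF this, of "\<lambda>d. P (size d)"]
  show "qproj (\<lambda>d. P (size d)) (D (qt J)) = D (qproj (\<lambda>d. P (size d)) (qt J))"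
    by (simp add: qproj_qt)
qed (simp_all add: additive_def)

definition vD :: "vlie \<Rightarrow> vlie" where
  "vD = vext (\<lambda>n u. Poly_Mapping.single (shift n) u + Poly_Mapping.single n (D u))"

lemma vD_aux: "additive (\<lambda>u. Poly_Mapping.single (shift n) u + Poly_Mapping.single n (D u))"
  by (simp add: additive_def single_add algebra_simps)

lemma additive_vD: "additive vD"
  unfolding vD_def by (intro additive_vext vD_aux)

lemma vD_single [simp]:
  "vD (Poly_Mapping.single n u) = Poly_Mapping.single (shift n) u + Poly_Mapping.single n (D u)"
  unfolding vD_def by (intro vext_single vD_aux)

lemmas vD_simps [simp] = additive.zero[OF additive_vD] additive.add[OF additive_vD]
  additive.diff[OF additive_vD] additive.minus[OF additive_vD]

lemma vD_ls: "vD (ls J w) = lq (Dtree J) w + ls J (D w)"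
  by (induction J arbitrary: w) (simp_all add: lq_br lq_qt D_br D_qt)

lemma vD_lq: "vD (lq u w) = lq (D u) w + lq u (D w)"
  by (rule qlie_additive_eqI[of "\<lambda>u. vD (lq u w)"])
     (simp_all add: additive_def lq_qt D_qt vD_ls)

lemma vbr_vD: "vbr (vD s) = D (vbr s)"
  by (rule v_additive_eqI[of "\<lambda>s. vbr (vD s)"]) (simp_all add: additive_def D_br)

lemma vproj_vD: "vproj (\<lambda>d. P (size d)) (vD s) = vD (vproj (\<lambda>d. P (size d)) s)"
proof (rule v_additive_eqI[of "\<lambda>s. vproj (\<lambda>d. P (size d)) (vD s)"])
  fix i u
  show "vproj (\<lambda>d. P (size d)) (vD (Poly_Mapping.single i u)) = vD (vproj (\<lambda>d. P (size d)) (Poly_Mapping.single i u))"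
    using qproj_D[of "\<lambda>n. P (Suc n)" u] by (simp add: vproj_single)
qed (simp_all add: additive_def)

definition tD :: "tq \<Rightarrow> tq" where
  "tD = tlift (\<lambda>u w. pr (D u) w + pr u (D w))"

lemma tD_aux: "additive (\<lambda>u. pr (D u) w + pr u (D w))"
  "pr (D u) w + pr u (D w) = pr (D w) u + pr w (D u)"
  "pr (D (br a b)) c + pr (br a b) (D c) = pr (D a) (br b c) + pr a (D (br b c))"
proof -
  show "additive (\<lambda>u. pr (D u) w + pr u (D w))" by (simp add: additive_def algebra_simps)
  show "pr (D u) w + pr u (D w) = pr (D w) u + pr w (D u)"
    using pr_sym[of "D u" w] pr_sym[of u "D w"] by simp
  show "pr (D (br a b)) c + pr (br a b) (D c) = pr (D a) (br b c) + pr a (D (br b c))"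
    by (simp add: D_br pr_inv)
qed

lemma additive_tD: "additive tD"
  unfolding tD_def by (rule additive_tlift; rule tD_aux)

lemma tD_pr: "tD (pr u w) = pr (D u) w + pr u (D w)"
  unfolding tD_def by (rule tlift_pr; rule tD_aux)

lemmas tD_simps [simp] = additive.zero[OF additive_tD] additive.add[OF additive_tD]
  additive.diff[OF additive_tD] additive.minus[OF additive_tD]

lemma eta_tD: "eta (tD t) = vD (eta t)"
  by (rule tq_additive_eqI[of "\<lambda>t. eta (tD t)"]) (simp_all add: additive_def tD_pr eta_pr vD_lq)

lemma tproj_tD: "tproj (\<lambda>d. P (size d)) (tD t) = tD (tproj (\<lambda>d. P (size d)) t)"
proof (rule tq_additive_eqI[of "\<lambda>t. tproj (\<lambda>d. P (size d)) (tD t)"])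
  fix I J
  let ?n = "size (lm I + lm J)"
  have D: "qproj (\<lambda>d. size d = size (lm I)) (D (qt I)) = D (qt I)" for I
    using qproj_D[of "\<lambda>n. n = size (lm I)" "qt I"] by (simp add: qproj_qt)
  have q: "qproj (\<lambda>d. size d = size (lm I)) (qt I) = qt I" for I by (simp add: qproj_qt)
  have a: "tproj (\<lambda>d. size d = ?n) (tD (pr (qt I) (qt J))) = tD (pr (qt I) (qt J))"
    unfolding tD_pr additive.add[OF additive_tproj]
    by (intro arg_cong2[where f = "(+)"] tproj_pr[OF D q] tproj_pr[OF q D]) simp_all
  have "tproj (\<lambda>d. P (size d)) t = (if P ?n then t else 0)" if "tproj (\<lambda>d. size d = ?n) t = t" for t
    using that by (induction t rule: tproj_induct) (auto simp: tproj_pr_qt)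
  from this[OF a] show "tproj (\<lambda>d. P (size d)) (tD (pr (qt I) (qt J))) = tD (tproj (\<lambda>d. P (size d)) (pr (qt I) (qt J)))"
    by (simp add: tproj_pr_qt)
qed (simp_all add: additive_def)


section \<open>The eliminated ring inside the original one, and a splitting of the inclusion\<close>

primrec Etree :: "nat \<Rightarrow> rtree \<Rightarrow> qlie" where
  "Etree x (Leaf n) = (case prod_decode n of (k, v) \<Rightarrow> (br (qt (Leaf x)) ^^ k) (qt (Leaf (skip x v))))"
| "Etree x (Node I J) = br (Etree x I) (Etree x J)"

lemma ext_Etree_qrel: "r \<in> qrel \<Longrightarrow> ext (Etree x) r = 0"
  by (rule ext_qrel_eq_0[where b = br]) (auto intro: additive_br br_anti br_jacobi)

definition E :: "nat \<Rightarrow> qlie \<Rightarrow> qlie" where "E x = qmap (Etree x)"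

lemma additive_E: "additive (E x)"
  unfolding E_def by (intro additive_qmap ext_Etree_qrel)

lemmas E_simps [simp] = additive.zero[OF additive_E] additive.add[OF additive_E]
  additive.diff[OF additive_E] additive.minus[OF additive_E]

lemma E_qt: "E x (qt J) = Etree x J"
  unfolding E_def by (intro qmap_qt ext_Etree_qrel)

lemma E_leaf [simp]: "E x (qt (Leaf (prod_encode (k, v)))) = (br (qt (Leaf x)) ^^ k) (qt (Leaf (skip x v)))"
  by (simp add: E_qt)

lemma E_br: "E x (br u w) = br (E x u) (E x w)"
  by (rule qlie_biadditive_eqI[of "\<lambda>u w. E x (br u w)"]) (auto simp: additive_def E_qt)

text \<open>On labels this is the choice of \<open>shift\<close>; on products it holds since
  \<open>ad(x)\<close> is a derivation, by Jacobi.\<close>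

lemma E_D: "E x (D u) = br (qt (Leaf x)) (E x u)"
proof (rule qlie_additive_eqI[of "\<lambda>u. E x (D u)"])
  fix J
  show "E x (D (qt J)) = br (qt (Leaf x)) (E x (qt J))"
  proof (induction J)
    case (Leaf n)
    then show ?case by (rule label_cases[of n]) simp
  next
    case (Node A B)
    have "E x (D (br (qt A) (qt B))) = br (qt (Leaf x)) (E x (br (qt A) (qt B)))"
      using br_jacobi[of "qt (Leaf x)" "E x (qt A)" "E x (qt B)"] Node by (simp add: D_br E_br del: br_qt)
    then show ?case by simp
  qed
qed (simp_all add: additive_def)

text \<open>The bracket of the semidirect product of the integers, spanned by \<open>x\<close>, with
  the eliminated ring, on which \<open>x\<close> acts as \<open>D\<close>.\<close>

definition phib :: "int \<times> qlie \<Rightarrow> int \<times> qlie \<Rightarrow> int \<times> qlie" where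
  "phib p q = (0, br (snd p) (snd q) + zmul (fst p) (D (snd q)) - zmul (fst q) (D (snd p)))"

primrec phit :: "nat \<Rightarrow> rtree \<Rightarrow> int \<times> qlie" where
  "phit x (Leaf i) = (if i = x then (1, 0) else (0, qt (Leaf (prod_encode (0, unskip x i)))))"
| "phit x (Node I J) = phib (phit x I) (phit x J)"

lemma D_zmul [simp]: "D (zmul n u) = zmul n (D u)"
  by (rule additive_zmul[OF additive_D])

lemma ext_phit_qrel: "r \<in> qrel \<Longrightarrow> ext (phit x) r = 0"
proof (rule ext_qrel_eq_0[where b = phib])
  show "additive (\<lambda>p. phib p q)" for q
    by (simp add: additive_def phib_def algebra_simps zmod.scale_left_distrib zmod.scale_right_distrib)
  show "additive (phib p)" for p
    by (simp add: additive_def phib_def algebra_simps zmod.scale_left_distrib zmod.scale_right_distrib)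
  show "phib p q = - phib q p" for p q
    using br_anti[of "snd p" "snd q"] by (simp add: phib_def)
  show "phib (phib p q) r = phib p (phib q r) - phib q (phib p r)" for p q r
    using br_anti[of "D (snd p)" "snd q"] br_anti[of "D (snd q)" "snd p"]
    by (simp add: phib_def br_jacobi D_br algebra_simps zmod.scale_right_distrib zmod.scale_right_diff_distrib)
qed simp_all

definition phi :: "nat \<Rightarrow> qlie \<Rightarrow> int \<times> qlie" where "phi x = qmap (phit x)"

lemma additive_phi: "additive (phi x)"
  unfolding phi_def by (intro additive_qmap ext_phit_qrel)

lemmas phi_simps [simp] = additive.zero[OF additive_phi] additive.add[OF additive_phi]
  additive.diff[OF additive_phi] additive.minus[OF additive_phi]

lemma phi_qt: "phi x (qt J) = phit x J"
  unfolding phi_def by (intro qmap_qt ext_phit_qrel)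

lemma phi_br: "phi x (br u w) = phib (phi x u) (phi x w)"
proof (rule qlie_biadditive_eqI[of "\<lambda>u w. phi x (br u w)"])
  show "additive (\<lambda>u. phib (phi x u) (phi x w))" for w
    by (simp add: additive_def phib_def algebra_simps zmod.scale_left_distrib zmod.scale_right_distrib)
  show "additive (\<lambda>w. phib (phi x u) (phi x w))" for u
    by (simp add: additive_def phib_def algebra_simps zmod.scale_left_distrib zmod.scale_right_distrib)
qed (simp_all add: additive_def phi_qt)

text \<open>Each bracket with \<open>x\<close> acts as \<open>D\<close> on the second component and
  so rebuilds the label. In particular \<open>E x\<close> is injective.\<close>

lemma phi_E: "phi x (E x u) = (0, u)"
proof (rule qlie_additive_eqI[of "\<lambda>u. phi x (E x u)"])
  fix J
  show "phi x (E x (qt J)) = (0, qt J)"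
  proof (induction J)
    case (Leaf n)
    obtain k v where n: "n = prod_encode (k, v)" by (rule label_cases)
    have "phi x ((br (qt (Leaf x)) ^^ k) (qt (Leaf (skip x v)))) = (0, qt (Leaf (prod_encode (k, v))))"
      by (induction k) (simp_all add: phi_br phi_qt phib_def)
    then show ?case by (simp add: n)
  next
    case (Node A B)
    have "phi x (E x (br (qt A) (qt B))) = (0, br (qt A) (qt B))"
      by (simp only: E_br phi_br Node) (simp add: phib_def)
    then show ?case by simp
  qed
qed (simp_all add: additive_def)

lemma size_lm_eq_1D: "size (lm J) = 1 \<Longrightarrow> \<exists>i. J = Leaf i"
proof (cases J)
  case (Node A B)
  then show "size (lm J) = 1 \<Longrightarrow> ?thesis" using size_lm_pos[of A] size_lm_pos[of B] by simp
qed simp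

text \<open>With two leaves the tree is the square [x,x], hence central. With more leaves one of its
  two factors is central by induction, so the tree itself is zero.\<close>

lemma br_pure_tree:
  assumes "set_mset (lm I) \<subseteq> {x}" "2 \<le> size (lm I)"
  shows "br (qt I) z = 0" "br z (qt I) = 0"
proof -
  have "br (qt I) z = 0" using assms
  proof (induction I arbitrary: z)
    case (Node A B)
    show ?case
    proof (cases "2 \<le> size (lm A) \<or> 2 \<le> size (lm B)")
      case True
      then have "br (qt A) (qt B) = 0"
        using Node.IH(1)[of "qt B"] Node.IH(2)[of "qt A"] Node.prems(1) br_anti[of "qt A" "qt B"]
        by (auto simp del: br_qt)
      then show ?thesis by simp
    next
      case False
      then have "size (lm A) = 1" "size (lm B) = 1"
        using size_lm_pos[of A] size_lm_pos[of B] by linarith+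
      then obtain i j where "A = Leaf i" "B = Leaf j" by (meson size_lm_eq_1D)
      then have "A = Leaf x" "B = Leaf x" using Node.prems(1) by auto
      then show ?thesis using square_central(1)[of "qt (Leaf x)" z] by simp
    qed
  qed simp
  then show "br (qt I) z = 0" "br z (qt I) = 0" using br_anti[of z "qt I"] by simp_all
qed

lemma pure_tree_eq_0:
  assumes "set_mset (lm I) \<subseteq> {x}" "3 \<le> size (lm I)"
  shows "qt I = 0"
proof (cases I)
  case (Node A B)
  then have "2 \<le> size (lm A) \<or> 2 \<le> size (lm B)" using assms by auto
  then have "br (qt A) (qt B) = 0"
    using br_pure_tree[of A x "qt B"] br_pure_tree[of B x "qt A"] assms(1) Node by (auto simp del: br_qt)
  then show ?thesis using Node by simp
qed (use assms in simp)

lemma fst_phit: "fst (phit x J) = (if J = Leaf x then 1 else 0)"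
  by (cases J) (simp_all add: phib_def)

lemma phit_pure: "set_mset (lm J) \<subseteq> {x} \<Longrightarrow> snd (phit x J) = 0"
  by (induction J) (auto simp: phib_def)

lemma E_zmul [simp]: "E x (zmul n u) = zmul n (E x u)"
  by (rule additive_zmul[OF additive_E])

text \<open>\<open>phi\<close> loses the subtrees with leaves \<open>x\<close> only, other than the
  leaf itself. This is harmless: such a subtree is central, so its product with anything vanishes. A
  leaf \<open>x\<close> acts as \<open>D\<close>, which \<open>E\<close> turns back into
  \<open>ad(x)\<close>.\<close>

lemma E_phit: "\<not> set_mset (lm J) \<subseteq> {x} \<Longrightarrow> E x (snd (phit x J)) = qt J"
proof (induction J)
  case (Leaf i)
  then show ?case by (simp add: skip_unskip)
next
  case (Node A B)
  have main: "E x (snd (phit x (Node A B))) = br (E x (snd (phit x A))) (E x (snd (phit x B)))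
      + (if A = Leaf x then br (qt (Leaf x)) (E x (snd (phit x B))) else 0)
      - (if B = Leaf x then br (qt (Leaf x)) (E x (snd (phit x A))) else 0)"
    by (simp add: phib_def fst_phit E_br E_D)
  have leaf: "I = Leaf x" if "set_mset (lm I) \<subseteq> {x}" "\<not> 2 \<le> size (lm I)" for I
  proof -
    have "size (lm I) = 1" using that(2) size_lm_pos[of I] by linarith
    then show ?thesis using that(1) size_lm_eq_1D[of I] by auto
  qed
  consider "\<not> set_mset (lm A) \<subseteq> {x}" "\<not> set_mset (lm B) \<subseteq> {x}"
    | "set_mset (lm A) \<subseteq> {x}" "\<not> set_mset (lm B) \<subseteq> {x}"
    | "\<not> set_mset (lm A) \<subseteq> {x}" "set_mset (lm B) \<subseteq> {x}"
    using Node.prems by auto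
  then show ?case
  proof cases
    case 1
    then show ?thesis unfolding main using Node.IH by auto
  next
    case 2
    show ?thesis
    proof (cases "A = Leaf x")
      case False
      then have "br (qt A) (qt B) = 0" using 2 leaf[of A] br_pure_tree[of A x "qt B"] by blast
      then show ?thesis unfolding main using 2 False by (auto simp: phit_pure)
    next
      case True
      then have "snd (phit x A) = 0" "B \<noteq> Leaf x" using 2 by auto
      then show ?thesis unfolding main using 2 Node.IH(2) True by simp
    qed
  next
    case 3
    show ?thesis
    proof (cases "B = Leaf x")
      case False
      then have "br (qt A) (qt B) = 0" using 3 leaf[of B] br_pure_tree[of B x "qt A"] by blast
      then show ?thesis unfolding main using 3 False by (auto simp: phit_pure)
    next
      case True
      then have "snd (phit x B) = 0" "A \<noteq> Leaf x" using 3 by auto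
      then show ?thesis unfolding main using 3 Node.IH(1) True br_anti[of "qt (Leaf x)" "qt A"] by simp
    qed
  qed
qed

text \<open>Exactly the leaves \<open>x\<close> disappear, because \<open>D\<close> keeps the number
  of leaves. The inductions rest on this drop.\<close>

lemma qproj_snd_phit:
  "qproj (\<lambda>d. size d + count (lm J) x = size (lm J)) (snd (phit x J)) = snd (phit x J)"
proof (induction J)
  case (Leaf i)
  then show ?case by (simp add: qproj_qt)
next
  case (Node A B)
  have b: "qproj (\<lambda>d. size d + count (lm (Node A B)) x = size (lm (Node A B)))
      (br (snd (phit x A)) (snd (phit x B))) = br (snd (phit x A)) (snd (phit x B))"
    by (rule qproj_br[OF Node]) simp
  have d: "qproj (\<lambda>d. size d + count (lm I) x = size (lm I)) (D (snd (phit x I))) = D (snd (phit x I))"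
     if "qproj (\<lambda>d. size d + count (lm I) x = size (lm I)) (snd (phit x I)) = snd (phit x I)" for I
    using qproj_D[of "\<lambda>n. n + count (lm I) x = size (lm I)" "snd (phit x I)"] that by simp
  show ?case using b d[OF Node(1)] d[OF Node(2)] by (auto simp: phib_def fst_phit)
qed

lemma pure_square: "set_mset (lm J) \<subseteq> {x} \<Longrightarrow> 2 \<le> size (lm J) \<Longrightarrow> \<exists>y. qt J = br y y"
proof (cases "3 \<le> size (lm J)")
  case True
  then show "set_mset (lm J) \<subseteq> {x} \<Longrightarrow> ?thesis" using pure_tree_eq_0[of J x] by (intro exI[of _ 0]) simp
next
  case False
  assume J: "set_mset (lm J) \<subseteq> {x}" "2 \<le> size (lm J)"
  then obtain A B where AB: "J = Node A B" by (cases J) auto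
  then have "size (lm A) = 1" "size (lm B) = 1"
    using False size_lm_pos[of A] size_lm_pos[of B] by auto
  then obtain i j where "A = Leaf i" "B = Leaf j" by (meson size_lm_eq_1D)
  then have "J = Node (Leaf x) (Leaf x)" using AB J(1) by auto
  then show ?thesis by (intro exI[of _ "qt (Leaf x)"]) simp
qed

text \<open>Elimination as an induction on the number of leaves. A multihomogeneous component
  containing \<open>x\<close> and another label is \<open>E x w\<close> with \<open>w\<close> of
  fewer leaves; one containing \<open>x\<close> alone is a multiple of the leaf or a square. So the
  hypothesis \<open>H\<close> must descend to components and along \<open>E\<close>, and the
  conclusion \<open>C\<close> must hold for squares and ascend along \<open>E\<close>.\<close>

lemma qlie_elim_induct:
  assumes "H u"
    and H_proj: "\<And>d u. H u \<Longrightarrow> H (qproj ((=) d) u)"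
    and H_E: "\<And>x w. H (E x w) \<Longrightarrow> H w"
    and C_add: "\<And>a b. C a \<Longrightarrow> C b \<Longrightarrow> C (a + b)"
    and C_E: "\<And>x w. C w \<Longrightarrow> C (E x w)"
    and C_square: "\<And>y. C (br y y)"
    and C_leaf: "\<And>x a. H (zmul a (qt (Leaf x))) \<Longrightarrow> C (zmul a (qt (Leaf x)))"
  shows "C u"
proof -
  have C_0: "C 0" using C_square[of 0] by simp
  have decomp: "C u" if "\<And>d. C (qproj ((=) d) u)" for u
  proof -
    obtain D where D: "finite D" "u = (\<Sum>d\<in>D. qproj ((=) d) u)" by (rule qproj_sum)
    have "C (\<Sum>d\<in>D. qproj ((=) d) u)" using D(1) by induction (simp_all add: C_0 C_add that)
    then show ?thesis using D(2) by simp
  qed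
  have main: "qproj (\<lambda>d. size d = n) u = u \<Longrightarrow> H u \<Longrightarrow> C u" for n u
  proof (induction n arbitrary: u rule: less_induct)
    case (less n)
    show ?case
    proof (rule decomp)
      fix d
      define v where "v = qproj ((=) d) u"
      have v: "qproj ((=) d) v = v" "H v" using H_proj[OF less(3)] by (simp_all add: v_def)
      show "C (qproj ((=) d) u)"
      proof (cases "size d = n \<and> d \<noteq> {#}")
        case False
        have "v = 0"
        proof (cases "size d = n")
          case True
          then have "d = {#}" using False by simp
          have "qproj (\<lambda>d. False) v = 0" using v(1) by (rule qproj_disjoint) simp
          moreover have "qproj (\<lambda>d. False) v = v"
            using v(1) by (induction v rule: qproj_induct) (simp_all add: \<open>d = {#}\<close> lm_neq_empty[symmetric])
          ultimately show ?thesis by simp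
        next
          case False
          then show ?thesis unfolding v_def using less(2) by (intro qproj_disjoint[where P = "\<lambda>d. size d = n"]) auto
        qed
        then show ?thesis using C_0 by (simp add: v_def)
      next
        case True
        then obtain x where x: "x \<in># d" by auto
        show ?thesis
        proof (cases "set_mset d \<subseteq> {x}")
          case pure: True
          show ?thesis
          proof (cases "size d = 1")
            case one: True
            then obtain i where "d = {#i#}" using size_1_singleton_mset by blast
            then have dx: "d = {#x#}" using x by simp
            have "\<exists>a. v = zmul a (qt (Leaf x))" using v(1)
            proof (induction v rule: qproj_induct)
              case zero
              show ?case by (rule exI[of _ 0]) simp
            next
              case (tree J)
              then obtain i where "J = Leaf i" using size_lm_eq_1D[of J] dx by force
              then show ?case using tree dx by (intro exI[of _ 1]) simp
            next
              case (diff a b)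
              then show ?case by (metis zmod.scale_left_diff_distrib)
            qed
            then show ?thesis using v(2) C_leaf v_def by metis
          next
            case False
            then have "2 \<le> size d" using True by (metis One_nat_def Suc_1 Suc_leI le_neq_implies_less nonempty_has_size)
            have "\<exists>y. v = br y y" using v(1)
            proof (induction v rule: qproj_induct)
              case zero
              show ?case by (rule exI[of _ 0]) simp
            next
              case (tree J)
              then show ?case using pure_square pure \<open>2 \<le> size d\<close> by metis
            next
              case (diff a b)
              then show ?case by (metis square_diff)
            qed
            then show ?thesis using C_square v_def by metis
          qed
        next
          case False
          define w where "w = snd (phi x v)"
          have E: "E x w = v" unfolding w_def
            by (rule additive_eqI_on[OF v(1), of "\<lambda>v. E x (snd (phi x v))" "\<lambda>v. v"])
               (use False in \<open>auto simp: additive_def phi_qt intro!: E_phit\<close>)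
          have "qproj (\<lambda>e. size e = n - count d x) w = w" unfolding w_def
          proof (rule additive_eqI_on[OF v(1), of "\<lambda>v. qproj (\<lambda>e. size e = n - count d x) (snd (phi x v))" "\<lambda>v. snd (phi x v)"])
            fix J assume J: "d = lm J"
            show "qproj (\<lambda>e. size e = n - count d x) (snd (phi x (qt J))) = snd (phi x (qt J))"
              unfolding phi_qt by (rule qproj_mono[OF qproj_snd_phit]) (use True J in auto)
          qed (auto simp: additive_def)
          moreover have "n - count d x < n" using x True by (auto simp: nonempty_has_size)
          ultimately have "C w" using less(1) H_E[of x w] E v(2) by simp
          then show ?thesis using C_E[of w x] E v_def by simp
        qed
      qed
    qed
  qed
  show "C u"
  proof (rule decomp)
    fix d
    show "C (qproj ((=) d) u)"
      using main[of "size d" "qproj ((=) d) u"] H_proj[OF assms(1)] qproj_mono[of "(=) d" "qproj ((=) d) u" "\<lambda>e. size e = size d"]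
      by simp
  qed
qed

section \<open>The free associative ring\<close>

text \<open>With concatenation as the addition of a monoid, the convolution product of finitely
  supported functions is the product of noncommutative polynomials.\<close>

datatype word = Word (letters: "nat list")

instantiation word :: monoid_add
begin
definition zero_word :: word where "zero_word = Word []"
definition plus_word :: "word \<Rightarrow> word \<Rightarrow> word" where "plus_word v w = Word (letters v @ letters w)"
instance by standard (simp_all add: zero_word_def plus_word_def)
end

type_synonym assoc = "word \<Rightarrow>\<^sub>0 int"

definition letter :: "nat \<Rightarrow> assoc" where "letter i = frag_of (Word [i])"

lemma word_mult: "frag_of v * frag_of w = frag_of (v + w)"
  by (simp add: mult_single)

lemma letter_mult_word: "letter i * frag_of (Word l) = frag_of (Word (i # l))"
  by (simp add: letter_def word_mult plus_word_def)

lemma lookup_letter_mult: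
  "Poly_Mapping.lookup (letter i * b) (Word (j # l)) = (if i = j then Poly_Mapping.lookup b (Word l) else 0)"
proof (induction b rule: frag_induct)
  case (one w)
  then show ?case by (cases w) (simp add: letter_mult_word)
qed (simp_all add: right_diff_distrib lookup_minus)

primrec ktree :: "rtree \<Rightarrow> assoc" where
  "ktree (Leaf i) = letter i"
| "ktree (Node I J) = ktree I * ktree J - ktree J * ktree I"

lemma ext_ktree_qrel: "r \<in> qrel \<Longrightarrow> ext ktree r = 0"
  by (rule ext_qrel_eq_0[where b = "\<lambda>x y. x * y - y * x"]) (simp_all add: additive_def algebra_simps)

definition kap :: "qlie \<Rightarrow> assoc" where "kap = qmap ktree"

lemma additive_kap: "additive kap"
  unfolding kap_def by (intro additive_qmap ext_ktree_qrel)

lemmas kap_simps [simp] = additive.zero[OF additive_kap] additive.add[OF additive_kap]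
  additive.diff[OF additive_kap] additive.minus[OF additive_kap]

lemma kap_qt: "kap (qt J) = ktree J"
  unfolding kap_def by (intro qmap_qt ext_ktree_qrel)

lemma kap_leaf [simp]: "kap (qt (Leaf i)) = letter i"
  by (simp add: kap_qt)

lemma kap_br: "kap (br u w) = kap u * kap w - kap w * kap u"
  by (rule qlie_biadditive_eqI[of "\<lambda>u w. kap (br u w)"])
     (auto simp: additive_def algebra_simps kap_qt)

lemma kap_zmul [simp]: "kap (zmul n u) = frag_cmul n (kap u)"
  using additive_zmul[OF additive_kap, of n u] by simp

lemma keys_ktree: "Poly_Mapping.keys (ktree J) \<subseteq> {w. mset (letters w) = lm J}"
proof (induction J)
  case (Leaf i)
  then show ?case by (auto simp: letter_def)
next
  case (Node A B)
  have "Poly_Mapping.keys (ktree I * ktree J) \<subseteq> {w. mset (letters w) = lm I + lm J}"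
    if "Poly_Mapping.keys (ktree I) \<subseteq> {w. mset (letters w) = lm I}"
       "Poly_Mapping.keys (ktree J) \<subseteq> {w. mset (letters w) = lm J}" for I J
    using keys_mult[of "ktree I" "ktree J"] that by (fastforce simp: plus_word_def)
  from this[OF Node] this[OF Node(2,1)] show ?case
    using keys_diff[of "ktree A * ktree B" "ktree B * ktree A"] by (fastforce simp: add.commute)
qed

lemma kap_qproj: "kap (qproj P u) = restr {w. P (mset (letters w))} (kap u)"
proof (rule qlie_additive_eqI[of "\<lambda>u. kap (qproj P u)"])
  fix J
  show "kap (qproj P (qt J)) = restr {w. P (mset (letters w))} (kap (qt J))"
  proof (cases "P (lm J)")
    case True
    then have "restr {w. P (mset (letters w))} (ktree J) = ktree J"
      using keys_ktree[of J] by (intro restr_id) auto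
    then show ?thesis using True by (simp add: qproj_qt kap_qt)
  next
    case False
    then have "restr {w. P (mset (letters w))} (ktree J) = 0"
      using keys_ktree[of J] by (intro restr_0) auto
    then show ?thesis using False by (simp add: qproj_qt kap_qt)
  qed
qed (auto simp: additive_def)

section \<open>The shift derivation on the free associative ring\<close>

primrec dlist :: "nat list \<Rightarrow> assoc" where
  "dlist [] = 0"
| "dlist (i # l) = frag_of (Word (shift i # l)) + letter i * dlist l"

definition dA :: "assoc \<Rightarrow> assoc" where "dA = ext (\<lambda>w. dlist (letters w))"

lemma additive_dA: "additive dA"
  unfolding dA_def by (rule additive_ext)

lemmas dA_simps [simp] = additive.zero[OF additive_dA] additive.add[OF additive_dA]
  additive.diff[OF additive_dA] additive.minus[OF additive_dA]

lemma dA_word: "dA (frag_of w) = dlist (letters w)"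
  by (simp add: dA_def)

lemma dlist_append: "dlist (l @ l') = dlist l * frag_of (Word l') + frag_of (Word l) * dlist l'"
proof (induction l)
  case Nil
  have "frag_of (Word []) = 1" by (simp add: zero_word_def[symmetric])
  then show ?case by simp
next
  case (Cons i l)
  have "frag_of (Word (i # l)) = letter i * frag_of (Word l)" by (simp add: letter_mult_word)
  moreover have "frag_of (Word (shift i # l @ l')) = frag_of (Word (shift i # l)) * frag_of (Word l')"
    by (simp add: word_mult plus_word_def)
  ultimately show ?case using Cons by (simp add: algebra_simps)
qed

lemma dA_mult: "dA (a * b) = dA a * b + a * dA b"
proof (induction a rule: frag_induct)
  case (one v)
  show ?case
  proof (induction b rule: frag_induct)
    case (one w)
    show ?case by (cases v; cases w) (simp add: word_mult plus_word_def dA_word dlist_append)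
  qed (simp_all add: algebra_simps)
qed (simp_all add: algebra_simps)

lemma dA_letter: "dA (letter i) = letter (shift i)"
  by (simp add: letter_def dA_word)

lemma kap_D: "kap (D u) = dA (kap u)"
proof (rule qlie_additive_eqI[of "\<lambda>u. kap (D u)"])
  show "kap (D (qt J)) = dA (kap (qt J))" for J
  proof (induction J)
    case (Leaf i)
    then show ?case by (simp add: dA_letter)
  next
    case (Node A B)
    have "kap (D (br (qt A) (qt B))) = dA (kap (br (qt A) (qt B)))"
      by (simp add: D_br kap_br dA_mult Node algebra_simps del: br_qt)
    then show ?case by simp
  qed
qed (auto simp: additive_def)

lemma shift_eq_iff [simp]: "shift i = shift j \<longleftrightarrow> i = j"
  by (rule label_cases[of i]; rule label_cases[of j]) simp

lemma lookup_ext: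
  "Poly_Mapping.lookup (ext f a) v = (\<Sum>w\<in>Poly_Mapping.keys a. Poly_Mapping.lookup a w * Poly_Mapping.lookup (f w) v)"
  by (simp add: ext_def lookup_sum)

text \<open>
  Shifting the first letter is the leading term of \<open>dA\<close> on the words whose first letter has
  the largest shift index.
\<close>

lemma dA_eq_0D:
  assumes "dA a = 0" "Poly_Mapping.lookup a (Word []) = 0"
  shows "a = 0"
proof (rule ccontr)
  assume "a \<noteq> 0"
  define K where "K = (\<lambda>w. fst (prod_decode (hd (letters w))))"
  let ?S = "Poly_Mapping.keys a"
  have "finite (K ` ?S)" "K ` ?S \<noteq> {}" using \<open>a \<noteq> 0\<close> by simp_all
  then obtain w where w: "w \<in> ?S" "\<And>v. v \<in> ?S \<Longrightarrow> K v \<le> K w"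
    using Max_in[of "K ` ?S"] Max_ge[of "K ` ?S"] by (metis (no_types, lifting) image_iff)
  have ne: "letters v \<noteq> []" if "v \<in> ?S" for v
    using that assms(2) by (cases v) (auto simp: in_keys_iff)
  then obtain i l where il: "letters w = i # l" using w(1) by (cases "letters w") auto
  have K_shift: "fst (prod_decode (shift j)) = Suc (fst (prod_decode j))" for j
    by (rule label_cases[of j]) simp
  \<comment> \<open>A word already beginning with \<open>shift i\<close> would exceed the maximal
    index \<open>K w\<close>, so it is not in the support. Hence the coefficient comes from shifting
    a first letter, and only \<open>w\<close> yields this word. The empty word has no first letter,
    whence the assumption on the constant term.\<close>
  have "Poly_Mapping.lookup (dlist (letters v)) (Word (shift i # l)) = (if v = w then 1 else 0)" if v: "v \<in> ?S" for v
  proof -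
    obtain j l' where jl: "letters v = j # l'" using ne[OF v] by (cases "letters v") auto
    then have "j \<noteq> shift i" using w(2)[OF v] il K_shift[of i] by (auto simp: K_def)
    then show ?thesis using jl il
      by (cases v; cases w) (auto simp: lookup_add lookup_letter_mult lookup_single when_def)
  qed
  then have "Poly_Mapping.lookup (dA a) (Word (shift i # l)) = (\<Sum>v\<in>?S. Poly_Mapping.lookup a v * (if v = w then 1 else 0))"
    unfolding dA_def lookup_ext by (intro sum.cong) auto
  also have "\<dots> = (\<Sum>v\<in>?S. if v = w then Poly_Mapping.lookup a v else 0)" by (intro sum.cong) auto
  also have "\<dots> = Poly_Mapping.lookup a w" using w(1) by (subst sum.delta) auto
  finally show False using assms(1) w(1) by (simp add: in_keys_iff)
qed

lemma kap_no_constant: "Poly_Mapping.lookup (kap u) (Word []) = 0"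
proof (induction u rule: qlie_induct)
  case (tree J)
  then show ?case using keys_ktree[of J] lm_neq_empty[of J] by (auto simp: kap_qt in_keys_iff subset_iff)
qed (simp_all add: lookup_minus)

text \<open>
  The free associative ring acts on that of the eliminated labels, \<open>x\<close> acting as the derivation
  \<open>dA\<close> and the other labels by multiplication. Evaluation at \<open>1\<close> splits \<open>E x\<close>.
\<close>

primrec rlist :: "nat \<Rightarrow> nat list \<Rightarrow> assoc" where
  "rlist x [] = 1"
| "rlist x (i # l) = (if i = x then dA (rlist x l) else letter (prod_encode (0, unskip x i)) * rlist x l)"

definition rho :: "nat \<Rightarrow> assoc \<Rightarrow> assoc" where "rho x = ext (\<lambda>w. rlist x (letters w))"

lemma additive_rho: "additive (rho x)"
  unfolding rho_def by (rule additive_ext)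

lemmas rho_simps [simp] = additive.zero[OF additive_rho] additive.add[OF additive_rho]
  additive.diff[OF additive_rho] additive.minus[OF additive_rho]

lemma rho_letter_mult:
  "rho x (letter i * b) = (if i = x then dA (rho x b) else letter (prod_encode (0, unskip x i)) * rho x b)"
proof (induction b rule: frag_induct)
  case (one w)
  then show ?case by (cases w) (simp add: letter_mult_word rho_def)
qed (simp_all add: right_diff_distrib)

text \<open>The commutator of \<open>dA\<close> with multiplication by a letter is multiplication by
  the shifted letter. Thus \<open>ad(x)^k y\<close> acts as the letter that stands for it. The
  factor \<open>b\<close> keeps the claim usable for both orders of a product in a
  commutator.\<close>

lemma rho_kap_E_mult: "rho x (kap (E x u) * b) = kap u * rho x b"
proof (rule qlie_additive_eqI[of "\<lambda>u. rho x (kap (E x u) * b)"])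
  show "rho x (kap (E x (qt J)) * b) = kap (qt J) * rho x b" for J
  proof (induction J arbitrary: b)
    case (Leaf n)
    obtain k v where n: "n = prod_encode (k, v)" by (rule label_cases)
    have "rho x (kap ((br (qt (Leaf x)) ^^ k) (qt (Leaf (skip x v)))) * b) = letter (prod_encode (k, v)) * rho x b" for b
    proof (induction k arbitrary: b)
      case 0
      then show ?case by (simp add: rho_letter_mult)
    next
      case (Suc k)
      then show ?case by (simp add: kap_br left_diff_distrib mult.assoc rho_letter_mult dA_mult dA_letter)
    qed
    then show ?case by (simp add: n)
  next
    case (Node A B)
    have "rho x (kap (E x (br (qt A) (qt B))) * b) = kap (br (qt A) (qt B)) * rho x b"
      by (simp add: E_br kap_br left_diff_distrib mult.assoc Node del: br_qt)
    then show ?case by simp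
  qed
qed (auto simp: additive_def algebra_simps)

lemma rho_kap_E: "rho x (kap (E x u)) = kap u"
proof -
  have "rho x 1 = 1"
    by (subst single_one[symmetric]) (simp add: rho_def zero_word_def)
  then show ?thesis using rho_kap_E_mult[of x u 1] by simp
qed

text \<open>Elimination with the kernel of \<open>kap\<close> as hypothesis: it descends along
  \<open>E x\<close> because of \<open>rho_kap_E\<close>, and nonzero multiples of a leaf are
  detected by a one-letter word. Only the squares are left.\<close>

theorem kap_eq_0D:
  assumes "kap u = 0"
  shows "\<exists>y. u = br y y"
proof (rule qlie_elim_induct[where H = "\<lambda>u. kap u = 0" and C = "\<lambda>u. \<exists>y. u = br y y"], goal_cases)
  case 1
  show ?case by (rule assms)
next
  case (2 d u)
  then show ?case by (simp add: kap_qproj)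
next
  case (3 x w)
  then show ?case using rho_kap_E[of x w] by simp
next
  case (4 a b)
  then obtain y y' where "a = br y y" "b = br y' y'" by blast
  then show ?case by (intro exI[of _ "y + y'"]) (simp only: square_add)
next
  case (5 x w)
  then obtain y where "w = br y y" by blast
  then show ?case by (intro exI[of _ "E x y"]) (simp only: E_br)
next
  case (7 x a)
  then have "frag_cmul a (letter x) = 0" by simp
  then show ?case by (intro exI[of _ 0]) (simp add: letter_def)
qed blast

text \<open>\<open>kap\<close> translates \<open>D\<close> into \<open>dA\<close>, which is
  injective on elements without constant term; so \<open>u\<close> lies in the kernel of
  \<open>kap\<close>.\<close>

corollary D_eq_0D: "D u = 0 \<Longrightarrow> \<exists>y. u = br y y"
  using kap_eq_0D dA_eq_0D[OF _ kap_no_constant] kap_D by (metis additive.zero[OF additive_kap])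

text \<open>The test ring is the product of the integers and the field with two elements, with
  bracket (a,s),(b,t) to (0, a b mod 2). It is symmetric, hence antisymmetric in characteristic 2,
  and double brackets vanish, so Jacobi is trivial. All leaves go to (1,0), hence [x,x] to
  (0,1).\<close>

lemma square_leaf_neq_0:
  assumes "zmul a (br (qt (Leaf x)) (qt (Leaf x))) = 0"
  shows "even a"
proof -
  define g where "g = (of_int :: int \<Rightarrow> bit)"
  have g: "g (m + n) = g m + g n" "g 0 = 0" "g m = - g m" for m n by (simp_all add: g_def)
  define b where "b = (\<lambda>p q. (0 :: int, g (fst (p :: int \<times> bit) * fst (q :: int \<times> bit))))"
  define f where "f = rec_rtree (\<lambda>_. (1, 0)) (\<lambda>_ _. b)"
  have f: "f (Leaf i) = (1, 0)" "f (Node I J) = b (f I) (f J)" for i I J by (simp_all add: f_def)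
  have "ext f r = 0" if "r \<in> qrel" for r
  proof (rule ext_qrel_eq_0[where b = b])
    show "additive (\<lambda>p. b p q)" "additive (b q)" for q
      by (simp_all add: additive_def b_def ring_distribs g(1))
    show "b p q = - b q p" for p q using g(3)[of "fst p * fst q"] by (simp add: b_def mult.commute)
    show "b (b p q) r = b p (b q r) - b q (b p r)" for p q r by (simp add: b_def g(2) zero_prod_def)
  qed (use f(2) that in simp_all)
  from qmap_qc[OF this] have "qmap f (zmul a (qt (Node (Leaf x) (Leaf x)))) = zmul a (0, 1)"
    using qmap_qc[OF \<open>\<And>r. r \<in> qrel \<Longrightarrow> ext f r = 0\<close>, of "frag_cmul a (frag_of (Node (Leaf x) (Leaf x)))"]
    by (simp add: f b_def g_def)
  moreover have "qmap f 0 = 0" using qmap_qc[OF \<open>\<And>r. r \<in> qrel \<Longrightarrow> ext f r = 0\<close>, of 0] by simp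
  moreover have "zmul n (0 :: int, 1 :: bit) = (0, of_int n)" for n
    by (induction n rule: int_induct[of _ 0]) (simp_all add: zmul_plus_one zmul_minus_one zero_prod_def)
  ultimately have "(of_int a :: bit) = 0" using assms by (simp add: zero_prod_def)
  moreover have "(of_int a :: bit) = 1" if "odd a"
  proof -
    obtain c where "a = 2 * c + 1" using \<open>odd a\<close> by (auto elim: oddE)
    then show ?thesis by simp
  qed
  ultimately show ?thesis by fastforce
qed

text \<open>Elimination with the vanishing of the square as hypothesis. It passes to components
  because a multiset has at most one half, so the part of [u,u] of degree \<open>d + d\<close> is
  the square of the part of \<open>u\<close> of degree \<open>d\<close>; it descends along
  \<open>E x\<close> by injectivity. The square of a multiple \<open>a\<close> of \<open>x\<close>
  is a^2 [x,x], which forces \<open>a\<close> to be even.\<close>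

theorem square_eq_0D:
  assumes "br u u = 0"
  shows "\<exists>z y. u = z + z + br y y"
proof (rule qlie_elim_induct[where H = "\<lambda>u. br u u = 0" and C = "\<lambda>u. \<exists>z y. u = z + z + br y y"], goal_cases)
  case 1
  show ?case by (rule assms)
next
  case (2 d u)
  have "e = d" if "e + e = d + d" for d e :: "nat multiset"
  proof (rule multiset_eqI)
    show "count e x = count d x" for x using arg_cong[OF that, of "\<lambda>m. count m x"] by simp
  qed
  then have "(\<lambda>e. d + d = e + e) = (=) d" by (intro ext) metis
  then show ?case using qproj_square[of "(=) (d + d)" u] 2 by simp
next
  case (3 x w)
  then have "E x (br w w) = 0" by (simp add: E_br)
  then show ?case using phi_E[of x "br w w"] by (simp add: zero_prod_def)
next
  case (4 a b)
  then obtain z y z' y' where "a = z + z + br y y" "b = z' + z' + br y' y'" by blast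
  then have "a + b = (z + z') + (z + z') + br (y + y') (y + y')" using square_add[of y y'] by simp
  then show ?case by blast
next
  case (5 x w)
  then obtain z y where "w = z + z + br y y" by blast
  then have "E x w = E x z + E x z + br (E x y) (E x y)" by (simp add: E_br)
  then show ?case by blast
next
  case (6 y)
  then show ?case by (rule exI[of _ 0], rule exI[of _ y]) simp
next
  case (7 x a)
  then have "zmul (a * a) (br (qt (Leaf x)) (qt (Leaf x))) = 0" by simp
  then have "even a" using square_leaf_neq_0 by fastforce
  then obtain c where "a = 2 * c" by blast
  then have "zmul a (qt (Leaf x)) = zmul c (qt (Leaf x)) + zmul c (qt (Leaf x)) + br 0 0"
    by (simp add: zmul_2[symmetric])
  then show ?case by blast
qed

section \<open>Injectivity of \<open>eta\<close>\<close>

definition cx :: "nat \<Rightarrow> vlie \<Rightarrow> tq" where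
  "cx x = vext (\<lambda>i u. if i = x then pr (qt (Leaf x)) u else 0)"

lemma cx_aux: "additive (\<lambda>u. if i = x then pr (qt (Leaf x)) u else 0)"
  by (simp add: additive_def)

lemma additive_cx: "additive (cx x)"
  unfolding cx_def by (rule additive_vext) (rule cx_aux)

lemma cx_single: "cx x (Poly_Mapping.single i u) = (if i = x then pr (qt (Leaf x)) u else 0)"
  unfolding cx_def by (rule vext_single) (rule cx_aux)

lemmas cx_simps [simp] = additive.zero[OF additive_cx] additive.add[OF additive_cx]
  additive.diff[OF additive_cx] additive.minus[OF additive_cx]

lemma cx_ls: "cx x (ls J w) = zmul (int (count (lm J) x)) (pr (qt J) w)"
proof (induction J arbitrary: w)
  case (Node A B)
  have "pr (qt A) (br (qt B) w) = pr (qt (Node A B)) w" 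
    using pr_inv[of "qt A" "qt B" w] by simp
  moreover have "pr (qt B) (br w (qt A)) = pr (qt (Node A B)) w"
    using pr_inv[of "qt A" "qt B" w] pr_inv[of "qt B" w "qt A"] pr_sym[of "br (qt B) w" "qt A"] by simp
  ultimately show ?case using Node by (simp add: zmul_add_left)
qed (simp add: cx_single)

lemma cx_eta_pr: "cx x (eta (pr (qt I) (qt J))) = zmul (int (count (lm I + lm J) x)) (pr (qt I) (qt J))"
  by (simp add: eta_pr lq_qt cx_ls zmul_add_left pr_sym[of "qt J"])

text \<open>An Euler identity: gluing any leaf \<open>x\<close> back gives the same tree again.
  Consequently an element with vertex sum zero is annihilated by the multiplicity of each
  label.\<close>

lemma cx_eta:
  assumes "tproj ((=) d) t = t"
  shows "cx x (eta t) = zmul (int (count d x)) t"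
  using assms
  by (induction t rule: tproj_induct)
     (simp_all add: cx_eta_pr zmod.scale_right_diff_distrib)

definition tE :: "nat \<Rightarrow> tq \<Rightarrow> tq" where
  "tE x = tlift (\<lambda>u w. pr (E x u) (E x w))"

lemma tE_aux: "additive (\<lambda>u. pr (E x u) (E x w))" "pr (E x u) (E x w) = pr (E x w) (E x u)"
  "pr (E x (br a b)) (E x c) = pr (E x a) (E x (br b c))"
proof -
  show "additive (\<lambda>u. pr (E x u) (E x w))" by (simp add: additive_def)
  show "pr (E x u) (E x w) = pr (E x w) (E x u)" by (rule pr_sym)
  show "pr (E x (br a b)) (E x c) = pr (E x a) (E x (br b c))" by (simp add: E_br pr_inv)
qed

lemma additive_tE: "additive (tE x)"
  unfolding tE_def by (rule additive_tlift; rule tE_aux)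

lemma tE_pr: "tE x (pr u w) = pr (E x u) (E x w)"
  unfolding tE_def by (rule tlift_pr; rule tE_aux)

lemmas tE_simps [simp] = additive.zero[OF additive_tE] additive.add[OF additive_tE]
  additive.diff[OF additive_tE] additive.minus[OF additive_tE]

text \<open>\<open>E x\<close> turns \<open>D\<close> into \<open>ad(x)\<close>, and invariance of
  the form gives <[x,a],b> + <a,[x,b]> = 0.\<close>

lemma tE_tD: "tE x (tD t) = 0"
proof (rule tq_additive_eqI[of "\<lambda>t. tE x (tD t)" "\<lambda>_. 0"])
  fix I J
  have "pr (br (qt (Leaf x)) a) b + pr a (br (qt (Leaf x)) b) = 0" for a b
  proof -
    have "pr a (br (qt (Leaf x)) b) = pr (br a (qt (Leaf x))) b" by (rule pr_inv[symmetric])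
    also have "\<dots> = - pr (br (qt (Leaf x)) a) b" using br_anti[of a "qt (Leaf x)"] by simp
    finally show ?thesis by simp
  qed
  then show "tE x (tD (pr (qt I) (qt J))) = 0" by (simp add: tD_pr tE_pr E_D)
qed (simp_all add: additive_def)

text \<open>Drops the leaves \<open>x\<close> of a vertex sum and rewrites in the eliminated ring
  what the remaining leaves see. Such a leaf is a bare label, without a power of
  \<open>ad(x)\<close>; this is why only coinvariants can be recovered.\<close>

definition Theta :: "nat \<Rightarrow> vlie \<Rightarrow> vlie" where
  "Theta x = vext (\<lambda>i u. if i = x then 0 else Poly_Mapping.single (unskip x i) (snd (phi x u)))"

lemma Theta_aux: "additive (\<lambda>u. if i = x then 0 else Poly_Mapping.single (unskip x i) (snd (phi x u)))"
  by (simp add: additive_def single_add)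

lemma additive_Theta: "additive (Theta x)"
  unfolding Theta_def by (rule additive_vext) (rule Theta_aux)

lemma Theta_single [simp]: "Theta x (Poly_Mapping.single i u) =
    (if i = x then 0 else Poly_Mapping.single (unskip x i) (snd (phi x u)))"
  unfolding Theta_def by (rule vext_single) (rule Theta_aux)

lemmas Theta_simps [simp] = additive.zero[OF additive_Theta] additive.add[OF additive_Theta]
  additive.diff[OF additive_Theta] additive.minus[OF additive_Theta]

text \<open>\<open>Gam\<close> is the projection of \<open>W \<otimes> L\<close> to its coinvariants under \<open>D\<close>, where \<open>W\<close> is the span of the labels.\<close>

definition mD :: "qlie \<Rightarrow> qlie" where "mD u = - D u"

lemma mD_pow_simps [simp]: "(mD ^^ k) 0 = 0" "(mD ^^ k) (u + w) = (mD ^^ k) u + (mD ^^ k) w"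
    "(mD ^^ k) (u - w) = (mD ^^ k) u - (mD ^^ k) w" "(mD ^^ k) (- u) = - (mD ^^ k) u"
  by (induction k) (simp_all add: mD_def)

definition Gam :: "vlie \<Rightarrow> vlie" where
  "Gam = vext (\<lambda>n u. case prod_decode n of (k, v) \<Rightarrow> Poly_Mapping.single v ((mD ^^ k) u))"

lemma Gam_aux: "additive (\<lambda>u. case prod_decode n of (k, v) \<Rightarrow> Poly_Mapping.single v ((mD ^^ k) u))"
  by (simp add: additive_def single_add split: prod.split)

lemma additive_Gam: "additive Gam"
  unfolding Gam_def by (rule additive_vext) (rule Gam_aux)

lemma Gam_single [simp]: "Gam (Poly_Mapping.single (prod_encode (k, v)) u) = Poly_Mapping.single v ((mD ^^ k) u)"
proof -
  have "Gam (Poly_Mapping.single n u) = (case prod_decode n of (k, v) \<Rightarrow> Poly_Mapping.single v ((mD ^^ k) u))" for n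
    unfolding Gam_def by (rule vext_single) (rule Gam_aux)
  then show ?thesis by simp
qed

lemmas Gam_simps [simp] = additive.zero[OF additive_Gam] additive.add[OF additive_Gam]
  additive.diff[OF additive_Gam] additive.minus[OF additive_Gam]

text \<open>Seen from the leaf y of \<open>ad(x)^k y\<close>, each of the \<open>k\<close> brackets
  with \<open>x\<close> moves to the other side, where [w,x] is \<open>E x\<close> of minus
  \<open>D\<close>. This produces the power of \<open>mD\<close> in \<open>Gam\<close>; the leaves
  \<open>x\<close> themselves are dropped by \<open>Theta\<close>.\<close>

lemma Theta_lq_E: "Theta x (lq (E x u) (E x w)) = Gam (lq u w)"
proof (rule qlie_additive_eqI[of "\<lambda>u. Theta x (lq (E x u) (E x w))"])
  show "Theta x (lq (E x (qt J)) (E x w)) = Gam (lq (qt J) w)" for J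
  proof (induction J arbitrary: w)
    case (Leaf n)
    obtain k v where n: "n = prod_encode (k, v)" by (rule label_cases)
    have "Theta x (lq ((br (qt (Leaf x)) ^^ k) (qt (Leaf (skip x v)))) (E x w)) = Poly_Mapping.single v ((mD ^^ k) w)" for w
    proof (induction k arbitrary: w)
      case 0
      then show ?case by (simp add: phi_E)
    next
      case (Suc k)
      have "br (E x w) (qt (Leaf x)) = E x (mD w)"
        using br_anti[of "E x w" "qt (Leaf x)"] by (simp add: mD_def E_D)
      then show ?case using Suc[of "mD w"] by (simp add: lq_br funpow_swap1[of mD] del: br_qt)
    qed
    then show ?case by (simp add: n)
  next
    case (Node A B)
    have "Theta x (lq (E x (br (qt A) (qt B))) (E x w)) = Gam (lq (br (qt A) (qt B)) w)"
      using Node(1)[of "br (qt B) w"] Node(2)[of "br w (qt A)"]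
      by (simp add: lq_br E_br del: br_qt)
    then show ?case by simp
  qed
qed (auto simp: additive_def)

lemma Theta_eta_tE: "Theta x (eta (tE x t)) = Gam (eta t)"
  by (rule tq_additive_eqI[of "\<lambda>t. Theta x (eta (tE x t))"])
     (simp_all add: additive_def tE_pr eta_pr Theta_lq_E)

text \<open>Modulo the image of \<open>vD\<close>, the label (k + 1, v) tensor u equals minus (k, v)
  tensor D u. So everything reduces to labels with k = 0; \<open>Gam\<close> computes the result of
  the reduction and \<open>G\<close> embeds it again.\<close>

lemma Gam_eq_0D:
  assumes "Gam s = 0"
  shows "\<exists>r. s = vD r"
proof -
  define G where "G = vext (\<lambda>v u. Poly_Mapping.single (prod_encode (0, v)) (u :: qlie))"
  have aG: "additive G" unfolding G_def by (rule additive_vext) (rule additive_single)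
  have G: "G (Poly_Mapping.single v u) = Poly_Mapping.single (prod_encode (0, v)) u" for v u
    unfolding G_def by (rule vext_single) (rule additive_single)
  have "\<exists>r. s - G (Gam s) = vD r"
  proof (induction s rule: v_induct)
    case zero
    show ?case by (rule exI[of _ 0]) (simp add: additive.zero[OF aG])
  next
    case (single n u)
    obtain k v where n: "n = prod_encode (k, v)" by (rule label_cases)
    have "\<exists>r. Poly_Mapping.single (prod_encode (k, v)) u - G (Poly_Mapping.single v ((mD ^^ k) u)) = vD r" for u
    proof (induction k arbitrary: u)
      case 0
      show ?case by (rule exI[of _ 0]) (simp add: G)
    next
      case (Suc k)
      obtain r where "Poly_Mapping.single (prod_encode (k, v)) (mD u) - G (Poly_Mapping.single v ((mD ^^ k) (mD u))) = vD r"
        using Suc by blast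
      then have "Poly_Mapping.single (prod_encode (Suc k, v)) u - G (Poly_Mapping.single v ((mD ^^ Suc k) u))
          = vD (r + Poly_Mapping.single (prod_encode (k, v)) u)"
        by (simp add: funpow_swap1 mD_def single_uminus additive.minus[OF aG] algebra_simps)
      then show ?case by blast
    qed
    then show ?case by (simp add: n)
  next
    case (diff x y)
    then obtain r r' where "x - G (Gam x) = vD r" "y - G (Gam y) = vD r'" by blast
    moreover have "(x - y) - G (Gam (x - y)) = (x - G (Gam x)) - (y - G (Gam y))"
      by (simp add: additive.diff[OF aG])
    ultimately have "(x - y) - G (Gam (x - y)) = vD (r - r')" by simp
    then show ?case by blast
  qed
  then show ?thesis using assms by (simp add: additive.zero[OF aG])
qed

text \<open>With three leaves \<open>I\<close> is zero. With two leaves it is central, and the bound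
  4 leaves at least two for \<open>J\<close>, so one branch of \<open>J\<close> can be rotated onto
  \<open>I\<close>.\<close>

lemma br_pr_pure:
  assumes "set_mset (lm I) \<subseteq> {x}" "2 \<le> size (lm I)" "4 \<le> size (lm I) + size (lm J)"
  shows "pr (qt I) (qt J) = 0"
proof (cases "3 \<le> size (lm I)")
  case True
  then show ?thesis using pure_tree_eq_0[of I x] assms(1) by simp
next
  case False
  then obtain A B where J: "J = Node A B" using assms(3) by (cases J) auto
  have "pr (qt I) (br (qt A) (qt B)) = pr (br (qt I) (qt A)) (qt B)" by (rule pr_inv[symmetric])
  then show ?thesis using br_pure_tree[of I x "qt A"] assms J by simp
qed

text \<open>A pair lies in the image if both halves involve a label other than \<open>x\<close>. The
  critical pairs are (x, [A,B]): rotation to ([x,A], B) helps unless \<open>A\<close> or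
  \<open>B\<close> has leaves \<open>x\<close> only, and then \<open>br_pr_pure\<close> makes the
  tree zero, in the case of \<open>B\<close> after exchanging \<open>A\<close> and \<open>B\<close>.
  The bound of four leaves comes from there.\<close>

lemma pr_in_image_tE:
  assumes "4 \<le> size (lm I + lm J)" "\<not> set_mset (lm I + lm J) \<subseteq> {x}"
  shows "\<exists>s. pr (qt I) (qt J) = tE x s \<and>
     tproj (\<lambda>d. size d + count (lm I + lm J) x = size (lm I + lm J)) s = s"
proof -
  define R where "R = (\<lambda>I J. \<exists>s. pr (qt I) (qt J) = tE x s \<and>
     tproj (\<lambda>d. size d + count (lm I + lm J) x = size (lm I + lm J)) s = s)"
  have R_sym: "R I J" if "R J I" for I J
    using that unfolding R_def by (simp add: pr_sym[of "qt J"] add.commute)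
  have R_0: "R I J" if "pr (qt I) (qt J) = 0" for I J
    using that unfolding R_def by (intro exI[of _ 0]) simp
  have both: "R I J" if "\<not> set_mset (lm I) \<subseteq> {x}" "\<not> set_mset (lm J) \<subseteq> {x}" for I J
  proof -
    have "pr (qt I) (qt J) = tE x (pr (snd (phit x I)) (snd (phit x J)))"
      using that by (simp add: tE_pr E_phit)
    moreover have "tproj (\<lambda>d. size d + count (lm I + lm J) x = size (lm I + lm J))
        (pr (snd (phit x I)) (snd (phit x J))) = pr (snd (phit x I)) (snd (phit x J))"
      by (rule tproj_pr[OF qproj_snd_phit[of I x] qproj_snd_phit[of J x]]) simp
    ultimately show ?thesis unfolding R_def by blast
  qed
  have leaf: "I = Leaf x" if "set_mset (lm I) \<subseteq> {x}" "\<not> 2 \<le> size (lm I)" for I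
  proof -
    have "size (lm I) = 1" using that(2) size_lm_pos[of I] by linarith
    then show ?thesis using that(1) size_lm_eq_1D[of I] by auto
  qed
  have pure: "R I J" if p: "set_mset (lm I) \<subseteq> {x}" "\<not> set_mset (lm J) \<subseteq> {x}" "4 \<le> size (lm I) + size (lm J)" for I J
  proof (cases "2 \<le> size (lm I)")
    case True
    then show ?thesis using R_0 br_pr_pure p by blast
  next
    case False
    then have I: "I = Leaf x" using leaf p(1) by blast
    then obtain A B where J: "J = Node A B" using p(3) by (cases J) auto
    have eq: "pr (qt I) (qt J) = pr (qt (Node (Leaf x) A)) (qt B)"
      using pr_inv[of "qt (Leaf x)" "qt A" "qt B"] I J by simp
    have eq': "pr (qt I) (qt J) = - pr (qt (Node (Leaf x) B)) (qt A)"
      using pr_inv[of "qt (Leaf x)" "qt B" "qt A"] br_anti[of "qt A" "qt B"] I J by simp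
    have sz: "3 \<le> size (lm A) + size (lm B)" using p(3) I J by simp
    consider "\<not> set_mset (lm A) \<subseteq> {x}" "\<not> set_mset (lm B) \<subseteq> {x}"
      | "set_mset (lm A) \<subseteq> {x}" | "set_mset (lm B) \<subseteq> {x}" by blast
    then show ?thesis
    proof cases
      case 1
      then have "R (Node (Leaf x) A) B" by (intro both) auto
      then show ?thesis unfolding R_def eq by (simp add: I J add_ac)
    next
      case 2
      then have "pr (qt (Node (Leaf x) A)) (qt B) = 0"
        using sz size_lm_pos[of A] by (intro br_pr_pure) auto
      then show ?thesis using R_0 eq by simp
    next
      case 3
      then have "pr (qt (Node (Leaf x) B)) (qt A) = 0"
        using sz size_lm_pos[of B] by (intro br_pr_pure) auto
      then show ?thesis using R_0 eq' by simp
    qed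
  qed
  have "R I J"
    using both pure[of I J] pure[of J I] R_sym assms
    by (cases "set_mset (lm I) \<subseteq> {x}"; cases "set_mset (lm J) \<subseteq> {x}") (auto simp: add.commute)
  then show ?thesis unfolding R_def .
qed

text \<open>By the number of leaves. From four on everything is zero. With three, \<open>t\<close>
  is killed by 2, as one half is the square [x,x], and by 3, the multiplicity of \<open>x\<close>.
  With two, \<open>t\<close> is a multiple \<open>a\<close> of <x,x> and its vertex sum is X_x
  tensor 2 a x.\<close>

lemma eta_pure_eq_0D:
  assumes "tproj ((=) d) t = t" "set_mset d \<subseteq> {x}" "eta t = 0"
  shows "t = 0"
proof -
  have leaf: "I = Leaf x" if "lm I \<subseteq># d" "size (lm I) = 1" for I
    using that assms(2) size_lm_eq_1D[of I] by (auto dest: mset_subset_eqD)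
  have pure: "set_mset (lm I) \<subseteq> {x}" if "lm I \<subseteq># d" for I
    using that assms(2) by (meson set_mset_mono subset_trans)
  consider "4 \<le> size d" | "size d = 3" | "size d = 2" | "size d < 2" by linarith
  then show ?thesis
  proof cases
    case 1
    show ?thesis using assms(1)
    proof (induction t rule: tproj_induct)
      case (pr I J)
      have sub: "lm I \<subseteq># d" "lm J \<subseteq># d" using pr by simp_all
      show ?case
      proof (cases "2 \<le> size (lm I)")
        case True
        then show ?thesis using br_pr_pure[OF pure[OF sub(1)]] 1 pr by simp
      next
        case False
        then have "2 \<le> size (lm J)" using 1 pr by simp
        then show ?thesis using br_pr_pure[OF pure[OF sub(2)], of I] 1 pr pr_sym[of "qt I" "qt J"] by simp
      qed
    qed simp_all
  next
    case 2
    have "t + t = 0" using assms(1)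
    proof (induction t rule: tproj_induct)
      case (pr I J)
      have sub: "lm I \<subseteq># d" "lm J \<subseteq># d" using pr by simp_all
      have double: "qt K + qt K = 0" if "lm K \<subseteq># d" "size (lm K) = 2" for K
        using pure_square[OF pure[OF that(1)]] that(2) square_double by fastforce
      have "size (lm I) = 2 \<or> size (lm J) = 2"
        using pr 2 size_lm_pos[of I] size_lm_pos[of J] by auto
      then show ?case
      proof
        assume "size (lm I) = 2"
        then have "pr (qt I + qt I) (qt J) = 0" using double[OF sub(1)] by simp
        then show ?thesis by simp
      next
        assume "size (lm J) = 2"
        then have "pr (qt I) (qt J + qt J) = 0" using double[OF sub(2)] by simp
        then show ?thesis by simp
      qed
    next
      case (diff x y)
      have "x - y + (x - y) = (x + x) - (y + y)" by simp
      then show ?case using diff by simp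
    qed simp
    moreover have "zmul 3 t = 0"
    proof -
      have "d = replicate_mset 3 x" using set_mset_subset_singletonD[OF assms(2)] 2 by simp
      then have "count d x = 3" by simp
      then show ?thesis using cx_eta[OF assms(1), of x] assms(3) by simp
    qed
    then have "t + t + t = 0" using zmul_add_left[of 2 1 t] by (simp add: zmul_2)
    ultimately show ?thesis by simp
  next
    case 3
    have "\<exists>a. t = zmul a (pr (qt (Leaf x)) (qt (Leaf x)))" using assms(1)
    proof (induction t rule: tproj_induct)
      case zero
      show ?case by (rule exI[of _ 0]) simp
    next
      case (pr I J)
      have sub: "lm I \<subseteq># d" "lm J \<subseteq># d" using pr by simp_all
      have "size (lm I) = 1" "size (lm J) = 1" using pr 3 size_lm_pos[of I] size_lm_pos[of J] by auto
      then have "I = Leaf x" "J = Leaf x" using leaf sub by blast+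
      then show ?case by (intro exI[of _ 1]) simp
    next
      case (diff y z)
      then obtain a b where "y = zmul a (pr (qt (Leaf x)) (qt (Leaf x)))" "z = zmul b (pr (qt (Leaf x)) (qt (Leaf x)))" by blast
      then show ?case by (intro exI[of _ "a - b"]) (simp add: zmod.scale_left_diff_distrib)
    qed
    then obtain a where a: "t = zmul a (pr (qt (Leaf x)) (qt (Leaf x)))" by blast
    let ?y = "eta (pr (qt (Leaf x)) (qt (Leaf x)))"
    have y: "?y = Poly_Mapping.single x (zmul 2 (qt (Leaf x)))"
      by (simp add: eta_pr zmul_2 single_add)
    have "0 = zmul a ?y" using assms(3) unfolding a additive_zmul[OF additive_eta] by simp
    also have "\<dots> = Poly_Mapping.single x (zmul (a * 2) (qt (Leaf x)))"
      unfolding y additive_zmul[OF additive_single, symmetric] by simp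
    finally have "zmul (a * 2) (qt (Leaf x)) = 0" by (metis lookup_single_eq lookup_zero)
    then have "frag_cmul (a * 2) (letter x) = 0" using kap_zmul[of "a * 2" "qt (Leaf x)"] by simp
    then have "a = 0" by (simp add: letter_def)
    then show ?thesis using a by simp
  next
    case 4
    show ?thesis using assms(1)
    proof (induction t rule: tproj_induct)
      case (pr I J)
      then show ?case using 4 size_lm_pos[of I] size_lm_pos[of J] by auto
    qed simp_all
  qed
qed

text \<open>Induction on the number of leaves, for multihomogeneous components. By
  \<open>cx_eta\<close> each of two distinct labels may be assumed to occur twice; then there are at
  least four leaves and the component is \<open>tE x r\<close> with \<open>r\<close> smaller. The
  vertex sum of \<open>r\<close> need not vanish, so the induction hypothesis applies only after
  \<open>r\<close> is corrected by an element of the image of \<open>tD\<close>, which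
  \<open>tE\<close> kills, and by a term <D Y,Y>.\<close>

theorem eta_eq_0D:
  assumes "eta t = 0"
  shows "t = 0"
proof -
  have decomp: "t = 0" if "\<And>d. tproj ((=) d) t = 0" for t
  proof -
    obtain D where "finite D" "t = (\<Sum>d\<in>D. tproj ((=) d) t)" by (rule tproj_sum)
    then show ?thesis using that by simp
  qed
  have main: "tproj (\<lambda>d. size d = n) t = t \<Longrightarrow> eta t = 0 \<Longrightarrow> t = 0" for n t
  proof (induction n arbitrary: t rule: less_induct)
    case (less n)
    show ?case
    proof (rule decomp)
      fix d
      define s where "s = tproj ((=) d) t"
      have s: "tproj ((=) d) s = s" "eta s = 0"
        using less(3) by (simp_all add: s_def eta_tproj)
      have "s = 0"
      proof (cases "size d = n")
        case False
        have "tproj ((=) d) t = 0" using less(2)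
          by (induction t rule: tproj_induct) (use False in \<open>auto simp: tproj_pr_qt\<close>)
        then show ?thesis by (simp add: s_def)
      next
        case n: True
        show ?thesis
        proof (cases "\<exists>x. set_mset d \<subseteq> {x}")
          case True
          then show ?thesis using eta_pure_eq_0D s by blast
        next
          case False
          then obtain x where x: "x \<in># d" by fastforce
          obtain y where y: "y \<in># d" "y \<noteq> x" using False by fastforce
          have count0: "zmul (int (count d z)) s = 0" for z
            using cx_eta[OF s(1), of z] s(2) by simp
          show ?thesis
          proof (cases "count d x = 1 \<or> count d y = 1")
            case True
            then show ?thesis using count0[of x] count0[of y] by auto
          next
            case False
            then have xy: "2 \<le> count d x" "2 \<le> count d y"
              using x y(1) by (metis One_nat_def Suc_1 Suc_leI count_greater_zero_iff le_neq_implies_less)+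
            have "replicate_mset (count d x) x + replicate_mset (count d y) y \<subseteq># d"
              using y(2) by (auto simp: subseteq_mset_def)
            from size_mset_mono[OF this] xy have n4: "4 \<le> n" using n by simp
            define n' where "n' = n - count d x"
            have n': "n' < n" using xy n4 by (simp add: n'_def)
            have cn: "count d x \<le> n" using n count_le_size[of d x] by simp
            have np: "\<not> set_mset d \<subseteq> {x}" using y by auto
            have "\<exists>r. s = tE x r \<and> tproj (\<lambda>e. size e = n') r = r" using s(1)
            proof (induction s rule: tproj_induct)
              case zero
              show ?case by (rule exI[of _ 0]) simp
            next
              case (pr I J)
              have "(\<lambda>e. size e + count (lm I + lm J) x = size (lm I + lm J)) = (\<lambda>e::nat multiset. size e = n')"
                using pr[symmetric] n cn by (auto simp: n'_def)
              then show ?case using pr_in_image_tE[of I J x] n4 n np pr by simp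
            next
              case (diff a b)
              then obtain r r' where "a = tE x r \<and> tproj (\<lambda>e. size e = n') r = r" "b = tE x r' \<and> tproj (\<lambda>e. size e = n') r' = r'" by blast
              then show ?case by (intro exI[of _ "r - r'"]) simp
            qed
            then obtain r where r: "s = tE x r" "tproj (\<lambda>e. size e = n') r = r" by blast
            \<comment> \<open>Only the coinvariants of the vertex sum of \<open>r\<close> are known
              to vanish, so it is a value of \<open>vD\<close>.\<close>
            have "Gam (eta r) = 0" using Theta_eta_tE[of x r] r s(2) by simp
            then obtain q where "eta r = vD q" using Gam_eq_0D by blast
            moreover define q' where "q' = vproj (\<lambda>e. size e = n') q"
            ultimately have q': "eta r = vD q'"
              using eta_tproj[of "\<lambda>e. size e = n'" r] r(2) vproj_vD[of "\<lambda>k. k = n'" q] by simp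
            have "D (vbr q') = 0" using q' vbr_vD[of q'] vbr_eta[of r] by simp
            \<comment> \<open>Were \<open>D\<close> injective, \<open>q'\<close> would itself be a
              vertex sum. The squares in its kernel are the reason for the extra term in
              \<open>Y\<close>.\<close>
            then obtain Y where Y: "vbr q' = br Y Y" using D_eq_0D by blast
            have "vbr (q' - lq Y Y) = 0" by (simp add: Y vbr_lq)
            then obtain t' where t': "q' - lq Y Y = eta t'" using vbr_eq_0_iff by blast
            \<comment> \<open>\<open>lq Y Y\<close> has the same bracket [Y,Y] as \<open>q'\<close>,
              and \<open>vD\<close> takes it to the vertex sum of <D Y,Y>; the three terms therefore
              cancel under \<open>eta\<close>.\<close>
            define p where "p = r - tD t' - pr (D Y) Y"
            have "eta p = 0"
              using q' arg_cong[OF t', of vD] by (simp add: p_def eta_tD eta_pr vD_lq algebra_simps)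
            then have "eta (tproj (\<lambda>e. size e = n') p) = 0" by (simp add: eta_tproj)
            then have "tproj (\<lambda>e. size e = n') p = 0" using less(1)[OF n'] by simp
            then have r_eq: "r = tD (tproj (\<lambda>e. size e = n') t') + tproj (\<lambda>e. size e = n') (pr (D Y) Y)"
              using r(2) tproj_tD[of "\<lambda>k. k = n'" t'] by (simp add: p_def diff_eq_eq add.commute)
            \<comment> \<open>The function taking Y to <D Y,Y> is quadratic, and its polarization at
              a, b is \<open>tD\<close> of <a,b>. So its part with \<open>n'\<close> leaves is again
              of this form modulo the image of \<open>tD\<close>.\<close>
            have "\<exists>Z t''. tproj (\<lambda>e. size e = n') (pr (D Y) Y) = pr (D Z) Z + tD t''"
            proof (induction Y rule: qlie_induct)
              case zero
              show ?case by (rule exI[of _ 0], rule exI[of _ 0]) simp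
            next
              case (tree J)
              have a: "tproj (\<lambda>e. size e = n') (pr (D (qt J)) (qt J)) =
                  (if size (lm J) + size (lm J) = n' then pr (D (qt J)) (qt J) else 0)"
              proof -
                have "qproj (\<lambda>e. size e = size (lm J)) (D (qt J)) = D (qt J)"
                  using qproj_D[of "\<lambda>k. k = size (lm J)" "qt J"] by (simp add: qproj_qt)
                then have b: "tproj (\<lambda>e. size e = size (lm J) + size (lm J)) (pr (D (qt J)) (qt J)) = pr (D (qt J)) (qt J)"
                  by (rule tproj_pr[where Q = "\<lambda>e. size e = size (lm J)"]) (simp_all add: qproj_qt)
                have "tproj (\<lambda>e. size e = n') z = (if k = n' then z else 0)"
                  if "tproj (\<lambda>e. size e = k) z = z" for z k
                  using that by (induction z rule: tproj_induct) (auto simp: tproj_pr_qt)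
                from this[OF b] show ?thesis .
              qed
              show ?case
              proof (cases "size (lm J) + size (lm J) = n'")
                case True
                show ?thesis by (rule exI[of _ "qt J"], rule exI[of _ 0]) (simp add: a True)
              next
                case False
                show ?thesis by (rule exI[of _ 0], rule exI[of _ 0]) (simp add: a False)
              qed
            next
              case (diff a b)
              then obtain Z t1 Z' t2 where
                "tproj (\<lambda>e. size e = n') (pr (D a) a) = pr (D Z) Z + tD t1"
                "tproj (\<lambda>e. size e = n') (pr (D b) b) = pr (D Z') Z' + tD t2" by blast
              moreover have e: "pr (D (a - b)) (a - b) = pr (D a) a + pr (D b) b - tD (pr a b)" for a b
                by (simp add: tD_pr pr_sym[of "D b"] algebra_simps)
              ultimately have "tproj (\<lambda>e. size e = n') (pr (D (a - b)) (a - b)) =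
                  (pr (D Z) Z + tD t1) + (pr (D Z') Z' + tD t2) - tD (tproj (\<lambda>e. size e = n') (pr a b))"
                by (simp only: e additive.add[OF additive_tproj] additive.diff[OF additive_tproj] tproj_tD[of "\<lambda>k. k = n'"])
              also have "\<dots> = pr (D (Z - Z')) (Z - Z') + tD (t1 + t2 - tproj (\<lambda>e. size e = n') (pr a b) + pr Z Z')"
                unfolding e additive.add[OF additive_tD] additive.diff[OF additive_tD] by simp
              finally have "tproj (\<lambda>e. size e = n') (pr (D (a - b)) (a - b)) =
                  pr (D (Z - Z')) (Z - Z') + tD (t1 + t2 - tproj (\<lambda>e. size e = n') (pr a b) + pr Z Z')" .
              then show ?case by blast
            qed
            then obtain Z t1 where "tproj (\<lambda>e. size e = n') (pr (D Y) Y) = pr (D Z) Z + tD t1" by blast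
            then have "r = tD (tproj (\<lambda>e. size e = n') t' + t1) + pr (D Z) Z" using r_eq by simp
            then obtain t'' where Z: "r = tD t'' + pr (D Z) Z" by blast
            let ?X = "qt (Leaf x)" and ?e = "E x Z"
            \<comment> \<open>\<open>tE\<close> kills the image of \<open>tD\<close> and takes <D
              Z,Z> to <[x,e],e> = <x,[e,e]>.\<close>
            have "s = pr ?X (br ?e ?e)"
              using r(1) Z by (simp add: tE_tD tE_pr E_D pr_inv)
            moreover from this have "br ?e ?e = 0"
            proof -
              \<comment> \<open>The leaves in the two copies of \<open>e\<close> see [e,x] and [x,e]
                and cancel; only the leaf \<open>x\<close> remains.\<close>
              have "lq (br ?e ?e) ?X = 0" using br_anti[of ?X ?e] by (simp add: lq_br)
              then have "Poly_Mapping.single x (br ?e ?e) = 0"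
                using s(2) \<open>s = pr ?X (br ?e ?e)\<close> by (simp add: eta_pr)
              then show ?thesis by (metis lookup_single_eq lookup_zero)
            qed
            ultimately show ?thesis by simp
          qed
        qed
      qed
      then show "tproj ((=) d) t = 0" by (simp add: s_def)
    qed
  qed
  show ?thesis
  proof (rule decomp)
    fix d
    have "tproj (\<lambda>e. size e = size d) (tproj ((=) d) t) = tproj ((=) d) t"
      by (rule tq_additive_eqI[of "\<lambda>t. tproj (\<lambda>e. size e = size d) (tproj ((=) d) t)"])
         (auto simp: additive_def tproj_pr_qt)
    then show "tproj ((=) d) t = 0" using main assms by (simp add: eta_tproj)
  qed
qed

section \<open>Walks in unitrivalent trees\<close>

lemma ut_adjD:
  assumes "unitrivalent_tree t" "adj t u v"
  shows "u \<in> verts t" "v \<in> verts t" "u \<noteq> v" "adj t v u"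
  using assms unfolding unitrivalent_tree_def by blast+

lemma ut_nbrs_finite: "unitrivalent_tree t \<Longrightarrow> finite {u. adj t v u}"
  by (rule finite_subset[of _ "verts t"]) (auto simp: unitrivalent_tree_def)

lemma ut_cases:
  assumes "unitrivalent_tree t" "v \<in> verts t"
  obtains "univalent t v" "\<not> trivalent t v" | "trivalent t v" "\<not> univalent t v"
proof -
  have "univalent t v \<or> trivalent t v" using assms unfolding unitrivalent_tree_def by blast
  moreover have "\<not> (univalent t v \<and> trivalent t v)" by (simp add: univalent_def trivalent_def)
  ultimately show thesis using that by blast
qed

lemma univalent_nbrs:
  assumes "univalent t v" "adj t v u"
  shows "{x. adj t v x} = {u}"
proof -
  obtain x where "{x. adj t v x} = {x}" using assms(1) by (auto simp: univalent_def card_1_singleton_iff)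
  moreover from this have "u = x" using assms(2) by blast
  ultimately show ?thesis by blast
qed

lemma trivalent_nbrs:
  assumes t: "unitrivalent_tree t" and v: "trivalent t v" "adj t v u"
  shows "adj t v (nxt t v u)" "adj t v (nxt t v (nxt t v u))"
    "nxt t v u \<noteq> u" "nxt t v (nxt t v u) \<noteq> u" "nxt t v (nxt t v u) \<noteq> nxt t v u"
    "nxt t v (nxt t v (nxt t v u)) = u"
    "{x. adj t v x} = {u, nxt t v u, nxt t v (nxt t v u)}"
proof -
  have n: "adj t v (nxt t v x)" "nxt t v x \<noteq> x" "nxt t v (nxt t v (nxt t v x)) = x" if "adj t v x" for x
    using t v(1) that unfolding unitrivalent_tree_def by blast+
  show 1: "adj t v (nxt t v u)" "adj t v (nxt t v (nxt t v u))" "nxt t v u \<noteq> u"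
    "nxt t v (nxt t v u) \<noteq> nxt t v u" "nxt t v (nxt t v (nxt t v u)) = u"
    using n[OF v(2)] n[OF n(1)[OF v(2)]] by blast+
  show 2: "nxt t v (nxt t v u) \<noteq> u" using n(3)[OF v(2)] 1(3) by metis
  have "{u, nxt t v u, nxt t v (nxt t v u)} \<subseteq> {x. adj t v x}" using 1 v(2) by auto
  moreover have "card {u, nxt t v u, nxt t v (nxt t v u)} = 3" using 1 2 by simp
  ultimately show "{x. adj t v x} = {u, nxt t v u, nxt t v (nxt t v u)}"
    using v(1) ut_nbrs_finite[OF t] by (metis card_subset_eq trivalent_def)
qed

text \<open>Walks that never turn back along the edge just traversed. That they are free of
  repetitions is the form in which acyclicity is used below.\<close>

fun nbw :: "otree \<Rightarrow> nat list \<Rightarrow> bool" where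
  "nbw t [] = True"
| "nbw t [a] = True"
| "nbw t [a, b] = adj t a b"
| "nbw t (a # b # c # p) = (adj t a b \<and> a \<noteq> c \<and> nbw t (b # c # p))"

lemma nbw_tl: "nbw t (a # p) \<Longrightarrow> nbw t p"
  by (cases "(t, a # p)" rule: nbw.cases) auto

lemma nbw_glue: "nbw t (p @ [a, b]) \<Longrightarrow> nbw t (a # b # q) \<Longrightarrow> nbw t (p @ a # b # q)"
proof (induction p)
  case (Cons x p)
  have "nbw t (p @ [a, b])" using Cons.prems(1) nbw_tl[of t x "p @ [a, b]"] by simp
  then have IH: "nbw t (p @ a # b # q)" using Cons by blast
  show ?case
  proof (cases p)
    case Nil
    then show ?thesis using Cons.prems by simp
  next
    case (Cons y p')
    then show ?thesis using IH Cons.prems(1) by (cases p') auto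
  qed
qed simp

lemma nbw_rev:
  assumes "unitrivalent_tree t"
  shows "nbw t p \<Longrightarrow> nbw t (rev p)"
proof (induction p rule: length_induct)
  case (1 p)
  show ?case
  proof (cases "(t, p)" rule: nbw.cases)
    case (3 t' a b)
    then show ?thesis using 1 ut_adjD(4)[OF assms] by simp
  next
    case (4 t' a b c q)
    then have p: "adj t a b" "a \<noteq> c" "nbw t (b # c # q)" using 1 by simp_all
    then have "nbw t (rev q @ [c, b])" using 1 4 by (metis append_Cons append_Nil append_assoc length_Cons lessI prod.inject rev.simps(2))
    moreover have "adj t b c" using p(3) by (cases q) auto
    then have "nbw t (c # b # [a])" using p(1,2) ut_adjD(4)[OF assms] by simp
    ultimately show ?thesis using nbw_glue[of t "rev q" c b "[a]"] 4 by simp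
  qed simp_all
qed

lemma nbw_successively: "nbw t p \<Longrightarrow> successively (adj t) p"
  by (induction t p rule: nbw.induct) auto

lemma nbw_appendD: "nbw t (p @ q) \<Longrightarrow> nbw t q" "nbw t (p @ q) \<Longrightarrow> nbw t p"
proof -
  show "nbw t (p @ q) \<Longrightarrow> nbw t q" by (induction p) (auto dest: nbw_tl)
  show "nbw t (p @ q) \<Longrightarrow> nbw t p"
  proof (induction p rule: length_induct)
    case (1 p)
    then show ?case by (cases "(t, p)" rule: nbw.cases) (auto, (cases q; simp)+)
  qed
qed

text \<open>In a shortest counterexample the only repetition is that the last vertex equals the
  first. This closes a cycle, and the absence of backtracking and of loops makes it have at least
  three vertices.\<close>

lemma nbw_distinct:
  assumes t: "unitrivalent_tree t"
  shows "nbw t p \<Longrightarrow> distinct p"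
proof (induction p rule: length_induct)
  case (1 p)
  show ?case
  proof (rule ccontr)
    assume nd: "\<not> distinct p"
    then obtain y q where p: "p = y # q" by (cases p) auto
    then have "distinct q" using 1 nbw_tl by auto
    then have "y \<in> set q" using nd p by simp
    then obtain q1 q2 where q: "q = q1 @ y # q2" by (meson split_list)
    have q2: "q2 = []"
    proof (rule ccontr)
      assume "q2 \<noteq> []"
      then have "length (y # q1 @ [y]) < length p" using p q by simp
      moreover have "nbw t (y # q1 @ [y])"
        using 1(2) p q nbw_appendD(2)[of t "y # q1 @ [y]" q2] by simp
      ultimately have "distinct (y # q1 @ [y])" using 1(1) by blast
      then show False by simp
    qed
    have d: "distinct (y # q1)" using \<open>distinct q\<close> q q2 by auto
    have w: "nbw t (y # q1 @ [y])" using 1(2) p q q2 by simp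
    then have s: "successively (adj t) (y # q1 @ [y])" by (rule nbw_successively)
    have len: "2 \<le> length q1"
    proof (rule ccontr)
      assume "\<not> 2 \<le> length q1"
      then consider "q1 = []" | a where "q1 = [a]" by (cases q1; cases "tl q1") auto
      then show False
      proof cases
        case 1
        then show ?thesis using w ut_adjD(3)[OF t, of y y] by simp
      next
        case 2
        then show ?thesis using w by simp
      qed
    qed
    then have ne: "q1 \<noteq> []" by auto
    have "successively (adj t) ((y # q1) @ [y])" using s by simp
    then have "successively (adj t) (y # q1)" "adj t (last (y # q1)) y"
      using successively_append_iff[of "adj t" "y # q1" "[y]"] by simp_all
    moreover have "3 \<le> length (y # q1)" using len by simp
    ultimately show False using t d unfolding unitrivalent_tree_def by (metis list.sel(1))
  qed
qed

lemma nbw_verts: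
  assumes t: "unitrivalent_tree t"
  shows "nbw t p \<Longrightarrow> 2 \<le> length p \<Longrightarrow> set p \<subseteq> verts t"
proof (induction p rule: length_induct)
  case (1 p)
  show ?case
  proof (cases "(t, p)" rule: nbw.cases)
    case (3 t' a b)
    then show ?thesis using 1 ut_adjD[OF t] by simp
  next
    case (4 t' a b c q)
    then have "length (b # c # q) < length p" "nbw t (b # c # q)" "2 \<le> length (b # c # q)" using 1(2) by auto
    then have "set (b # c # q) \<subseteq> verts t" using 1(1) by blast
    then show ?thesis using 1 4 ut_adjD[OF t, of a b] by simp
  qed (use 1 in simp_all)
qed

text \<open>\<open>reach t u v w\<close>: the vertex \<open>w\<close> lies on the side of \<open>v\<close> of the edge \<open>uv\<close>.\<close>

inductive reach :: "otree \<Rightarrow> nat \<Rightarrow> nat \<Rightarrow> nat \<Rightarrow> bool" for t where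
  reach_start: "adj t u v \<Longrightarrow> reach t u v v"
| reach_step: "adj t u v \<Longrightarrow> adj t v x \<Longrightarrow> x \<noteq> u \<Longrightarrow> reach t v x w \<Longrightarrow> reach t u v w"

lemma reach_adj: "reach t u v w \<Longrightarrow> adj t u v"
  by (auto elim: reach.cases)

lemma reach_walk: "reach t u v w \<Longrightarrow> \<exists>p. nbw t (u # v # p) \<and> last (v # p) = w"
proof (induction rule: reach.induct)
  case (reach_start u v)
  then show ?case by (intro exI[of _ "[]"]) simp
next
  case (reach_step u v x w)
  then obtain p where "nbw t (v # x # p)" "last (x # p) = w" by blast
  then show ?case using reach_step by (intro exI[of _ "x # p"]) auto
qed

context
  fixes t assumes t: "unitrivalent_tree t"
begin

lemma reach_neq: "reach t u v w \<Longrightarrow> w \<noteq> u"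
proof
  assume "reach t u v w" "w = u"
  then obtain p where "nbw t (u # v # p)" "last (v # p) = u" using reach_walk by blast
  then show False using nbw_distinct[OF t, of "u # v # p"] by (metis distinct.simps(2) last_in_set list.distinct(1))
qed

text \<open>Otherwise the two walks, joined across the edge, form a walk without backtracking that
  visits \<open>w\<close> twice.\<close>

lemma reach_disjoint: "reach t u v w \<Longrightarrow> \<not> reach t v u w"
proof
  assume "reach t u v w" "reach t v u w"
  then obtain p q where p: "nbw t (u # v # p)" "last (v # p) = w" and q: "nbw t (v # u # q)" "last (u # q) = w"
    using reach_walk by metis
  have "nbw t (rev p @ [v, u])" using nbw_rev[OF t p(1)] by simp
  then have "nbw t (rev p @ v # u # q)" using nbw_glue q(1) by blast
  then have "distinct (rev p @ v # u # q)" by (rule nbw_distinct[OF t])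
  moreover have "w \<in> set (v # p)" "w \<in> set (u # q)" 
    using p(2) q(2) last_in_set[of "v # p"] last_in_set[of "u # q"] by simp_all
  ultimately show False by auto
qed

lemma reach_disjoint2:
  assumes "reach t v x w" "reach t v y w"
  shows "x = y"
proof (rule ccontr)
  assume "x \<noteq> y"
  then have "reach t x v w"
    using reach_step[of t x v y w] reach_adj assms ut_adjD(4)[OF t] by metis
  then show False using reach_disjoint assms(1) by blast
qed

lemma reach_adj_closed: "reach t u v w \<Longrightarrow> adj t w y \<Longrightarrow> reach t u v y \<or> reach t v u y"
proof (induction rule: reach.induct)
  case (reach_start u v)
  show ?case
  proof (cases "y = u")
    case True
    then show ?thesis using reach_start reach.reach_start ut_adjD(4)[OF t] by metis
  next
    case False
    then show ?thesis using reach_start reach.intros by metis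
  qed
next
  case (reach_step u v x w)
  then consider "reach t v x y" | "reach t x v y" by blast
  then show ?case
  proof cases
    case 1
    then show ?thesis using reach_step reach.reach_step by metis
  next
    case 2
    then show ?thesis
    proof cases
      case reach_start
      then show ?thesis using reach_step(1) reach.reach_start by metis
    next
      case (reach_step z)
      then show ?thesis using \<open>adj t u v\<close> reach.reach_step[of t u v z y] by metis
    qed
  qed
qed

lemma reach_cover:
  assumes "adj t u v" "w \<in> verts t"
  shows "reach t u v w \<or> reach t v u w"
proof -
  have "(adj t)\<^sup>*\<^sup>* v w" using t assms ut_adjD(2)[OF t assms(1)] unfolding unitrivalent_tree_def by blast
  then show ?thesis
  proof induction
    case base
    then show ?case using assms(1) reach_start by metis
  next
    case (step y z)
    then show ?case using reach_adj_closed by metis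
  qed
qed

lemma reach_verts: "reach t u v w \<Longrightarrow> w \<in> verts t"
  by (induction rule: reach.induct) (auto dest: ut_adjD[OF t])

lemma reach_univalent:
  assumes "adj t u v" "univalent t v"
  shows "{w. reach t u v w} = {v}"
proof -
  have "x = u" if "adj t v x" for x
    using univalent_nbrs[OF assms(2) ut_adjD(4)[OF t assms(1)]] that by blast
  then show ?thesis using assms(1) reach_start by (auto elim: reach.cases)
qed

lemma reach_trivalent:
  assumes "adj t u v" "trivalent t v"
  shows "{w. reach t u v w} = insert v ({w. reach t v (nxt t v u) w} \<union> {w. reach t v (nxt t v (nxt t v u)) w})"
proof -
  note n = trivalent_nbrs[OF t assms(2) ut_adjD(4)[OF t assms(1)]]
  show ?thesis
  proof (intro equalityI subsetI)
    fix w assume "w \<in> {w. reach t u v w}"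
    then have "reach t u v w" by simp
    then show "w \<in> insert v ({w. reach t v (nxt t v u) w} \<union> {w. reach t v (nxt t v (nxt t v u)) w})"
    proof cases
      case (reach_step x)
      then show ?thesis using n(7) by blast
    qed simp
  next
    fix w assume "w \<in> insert v ({w. reach t v (nxt t v u) w} \<union> {w. reach t v (nxt t v (nxt t v u)) w})"
    then show "w \<in> {w. reach t u v w}" using n(1-4) assms(1) reach.intros[of t u v] by auto
  qed
qed

text \<open>The descent terminates because the walk leading to the current edge has distinct
  vertices, hence is no longer than the number of vertices.\<close>

lemma branch_exists_aux: "nbw t (p @ [u, v]) \<Longrightarrow> \<exists>J. branch t u v J"
proof (induction "card (verts t) - length p" arbitrary: p u v rule: less_induct)
  case less
  have uv: "adj t u v" using nbw_appendD(1)[OF less(2)] by simp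
  have sub: "set (p @ [u, v]) \<subseteq> verts t" using nbw_verts[OF t less(2)] by simp
  have "distinct (p @ [u, v])" using less(2) by (rule nbw_distinct[OF t])
  then have "length (p @ [u, v]) \<le> card (verts t)"
    using sub card_mono[OF _ sub] distinct_card[of "p @ [u, v]"] t by (simp add: unitrivalent_tree_def)
  then have len: "length p + 2 \<le> card (verts t)" by simp
  have v: "v \<in> verts t" using ut_adjD[OF t uv] by blast
  show ?case
  proof (rule ut_cases[OF t v])
    assume "univalent t v"
    then show ?thesis using branch.intros(1)[OF uv] by blast
  next
    assume tv: "trivalent t v"
    note n = trivalent_nbrs[OF t tv ut_adjD(4)[OF t uv]]
    have "\<exists>J. branch t v x J" if "adj t v x" "x \<noteq> u" for x
    proof (rule less(1)[of "p @ [u]"])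
      show "card (verts t) - length (p @ [u]) < card (verts t) - length p" using len by simp
      have "nbw t (u # v # [x])" using uv that by simp
      then show "nbw t ((p @ [u]) @ [v, x])" using nbw_glue[OF less(2), of "[x]"] by simp
    qed
    then obtain I J where "branch t v (nxt t v u) I" "branch t v (nxt t v (nxt t v u)) J" using n by metis
    then show ?thesis using branch.intros(2)[OF uv tv] by blast
  qed
qed

lemma branch_exists: "adj t u v \<Longrightarrow> \<exists>J. branch t u v J"
  using branch_exists_aux[of "[]" u v] by simp

end

lemma branch_adj: "branch t u v J \<Longrightarrow> adj t u v"
  by (auto elim: branch.cases)

lemma branch_leafD:
  assumes "unitrivalent_tree t" "branch t u v (Leaf i)"
  shows "univalent t v" "lab t v = i"
  using assms(2) by (auto elim: branch.cases)

lemma branch_nodeD: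
  assumes "branch t u v (Node I J)"
  shows "trivalent t v" "branch t v (nxt t v u) I" "branch t v (nxt t v (nxt t v u)) J"
  using assms by (auto elim: branch.cases)

lemma branch_unique:
  assumes "unitrivalent_tree t"
  shows "branch t u v J \<Longrightarrow> branch t u v K \<Longrightarrow> J = K"
proof (induction arbitrary: K rule: branch.induct)
  case (1 u v)
  from 1(3) show ?case
    by cases (use 1(2) in \<open>auto simp: univalent_def trivalent_def\<close>)
next
  case (2 u v I J)
  from 2(7) show ?case
  proof cases
    case 1
    then show ?thesis using 2(2) by (auto simp: univalent_def trivalent_def)
  next
    case (2 I' J')
    then show ?thesis using "2.IH" by blast
  qed
qed

section \<open>Inner products of rooted trees\<close>

lemma otree_equiv_refl_iff: "otree_equiv t t \<longleftrightarrow> unitrivalent_tree t"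
  using is_otree_iso_refl unfolding otree_equiv_def by blast

lemma abs_utree_eqI: "otree_equiv s t \<Longrightarrow> abs_utree s = abs_utree t"
  using Quotient_rel[OF Quotient_utree, of s t] by simp

lemma utree_obtain:
  obtains t where "unitrivalent_tree t" "T = abs_utree t"
proof -
  have "otree_equiv (rep_utree T) (rep_utree T)" by (rule Quotient_rep_reflp[OF Quotient_utree])
  moreover have "T = abs_utree (rep_utree T)" using Quotient_abs_rep[OF Quotient_utree, of T] by simp
  ultimately show thesis using that otree_equiv_refl_iff by blast
qed

lemma ut_nbr_exists:
  assumes "unitrivalent_tree t" "v \<in> verts t"
  shows "\<exists>u. adj t v u"
proof (rule ccontr)
  assume "\<nexists>u. adj t v u"
  then have "card {u. adj t v u} = 0" by simp
  then show False using assms unfolding unitrivalent_tree_def univalent_def trivalent_def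
    by (metis zero_neq_numeral zero_neq_one)
qed

text \<open>A morphism of unitrivalent trees is an isomorphism: non-backtracking walks map to such walks, hence have distinct ends.\<close>

lemma covering_iso:
  assumes s: "unitrivalent_tree s" and t: "unitrivalent_tree t"
    and adj: "\<And>u v. adj s u v \<Longrightarrow> adj t (f u) (f v)"
    and uni: "\<And>v. univalent s v \<Longrightarrow> univalent t (f v) \<and> lab t (f v) = lab s v"
    and tri: "\<And>v. trivalent s v \<Longrightarrow> trivalent t (f v)"
    and nxt: "\<And>v u. trivalent s v \<Longrightarrow> adj s v u \<Longrightarrow> f (nxt s v u) = nxt t (f v) (f u)"
    and ne: "adj s a b"
  shows "is_otree_iso f s t"
proof -
  \<comment> \<open>Locally \<open>f\<close> is bijective: at a trivalent vertex it respects the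
    cyclic order, so the three neighbors go to three distinct ones.\<close>
  have nbrs: "{x. adj t (f v) x} = f ` {x. adj s v x} \<and> inj_on f {x. adj s v x}" if uv: "adj s v u" for u v
  proof -
    have v: "v \<in> verts s" using ut_adjD[OF s uv] by blast
    show ?thesis
    proof (rule ut_cases[OF s v])
      assume "univalent s v"
      then show ?thesis
        using univalent_nbrs[of s v u] univalent_nbrs[of t "f v" "f u"] uni[of v] adj[OF uv] uv by simp
    next
      assume sv: "trivalent s v"
      then have tv: "trivalent t (f v)" by (rule tri)
      note a = trivalent_nbrs[OF s sv uv] and b = trivalent_nbrs[OF t tv adj[OF uv]]
      have e: "f (nxt s v u) = nxt t (f v) (f u)" "f (nxt s v (nxt s v u)) = nxt t (f v) (nxt t (f v) (f u))"
        using nxt[OF sv uv] nxt[OF sv a(1)] by simp_all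
      have "inj_on f {x, y, z}" if "f x \<noteq> f y" "f x \<noteq> f z" "f y \<noteq> f z" for x y z
        using that by (auto simp: inj_on_def)
      moreover have "f u \<noteq> f (nxt s v u)" "f u \<noteq> f (nxt s v (nxt s v u))" "f (nxt s v u) \<noteq> f (nxt s v (nxt s v u))"
        unfolding e using b(3-5) by metis+
      ultimately have "inj_on f {x. adj s v x}" unfolding a(7) by blast
      moreover have "{x. adj t (f v) x} = f ` {x. adj s v x}" unfolding a(7) b(7) image_insert image_empty e ..
      ultimately show ?thesis by blast
    qed
  qed
  have walk: "nbw s p \<Longrightarrow> nbw t (map f p)" for p
  proof (induction p rule: length_induct)
    case (1 p)
    show ?case
    proof (cases "(s, p)" rule: nbw.cases)
      case (4 s' a b c q)
      then have abc: "adj s a b" "a \<noteq> c" "nbw s (b # c # q)" using 1(2) by auto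
      then have "adj s b c" "adj s b a" using nbw_successively[OF abc(3)] ut_adjD(4)[OF s] by simp_all
      then have "f a \<noteq> f c" using nbrs[of b c] abc(2) by (auto simp: inj_on_def)
      moreover have "nbw t (map f (b # c # q))" 
        using 1(1)[rule_format, of "b # c # q"] 4 abc(3) by auto
      ultimately show ?thesis using 4 adj[OF abc(1)] by simp
    qed (use 1(2) adj in auto)
  qed
  have inj: "inj_on f (verts s)"
  proof (rule inj_onI, rule ccontr)
    fix x y assume xy: "x \<in> verts s" "y \<in> verts s" "f x = f y" "x \<noteq> y"
    obtain n where n: "adj s x n" using ut_nbr_exists[OF s xy(1)] by blast
    have "\<exists>p. nbw s (x # p) \<and> p \<noteq> [] \<and> last p = y"
      using reach_cover[OF s n xy(2)]
    proof
      assume "reach s x n y"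
      then show ?thesis using reach_walk by fastforce
    next
      assume "reach s n x y"
      then obtain p where p: "nbw s (n # x # p)" "last (x # p) = y" using reach_walk by blast
      then have "p \<noteq> []" using xy(4) by auto
      then show ?thesis using p nbw_tl[of s n "x # p"] by auto
    qed
    then obtain p where p: "nbw s (x # p)" "p \<noteq> []" "last p = y" by blast
    have "distinct (map f (x # p))" using nbw_distinct[OF t walk[OF p(1)]] .
    moreover have "f y \<in> set (map f p)" using p(2,3) by auto
    ultimately show False using xy(3) by simp
  qed
  have sub: "f ` verts s \<subseteq> verts t"
  proof
    fix y assume "y \<in> f ` verts s"
    then obtain x where x: "x \<in> verts s" "y = f x" by blast
    show "y \<in> verts t"
      by (rule ut_cases[OF s x(1)]) (use uni[of x] tri[of x] x(2) in \<open>auto simp: univalent_def trivalent_def\<close>)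
  qed
  note nbr = ut_nbr_exists[OF s]
  have sur: "verts t \<subseteq> f ` verts s"
  proof
    fix y assume y: "y \<in> verts t"
    have a: "a \<in> verts s" using ut_adjD[OF s ne] by blast
    then have "(adj t)\<^sup>*\<^sup>* (f a) y" using t y sub unfolding unitrivalent_tree_def by blast
    then show "y \<in> f ` verts s"
    proof induction
      case base
      then show ?case using a by blast
    next
      case (step y z)
      then obtain x where x: "x \<in> verts s" "y = f x" by blast
      obtain u where "adj s x u" using nbr[OF x(1)] by blast
      then have "z \<in> f ` {u. adj s x u}" using nbrs step(2) x(2) by blast
      then show ?case using ut_adjD[OF s] by blast
    qed
  qed
  show ?thesis unfolding is_otree_iso_def
  proof (intro conjI allI ballI impI)
    show "bij_betw f (verts s) (verts t)" using inj sub sur by (auto simp: bij_betw_def)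
    fix u v assume uv: "u \<in> verts s" "v \<in> verts s"
    show "adj s u v \<longleftrightarrow> adj t (f u) (f v)"
    proof
      assume "adj t (f u) (f v)"
      moreover obtain w where "adj s u w" using nbr[OF uv(1)] by blast
      ultimately have "f v \<in> f ` {x. adj s u x}" using nbrs by blast
      then obtain x where "adj s u x" "f v = f x" by blast
      then show "adj s u v" using inj uv ut_adjD(2)[OF s] by (metis inj_onD)
    qed (rule adj)
  qed (use nxt uni in auto)
qed

text \<open>
  The canonical tree with an edge along which it cuts into \<open>I\<close> and \<open>J\<close> has the edge \<open>{2, 3}\<close>;
  away from that edge, the children of \<open>n\<close> are \<open>2 n\<close> and \<open>2 n + 1\<close>.
\<close>

fun sub :: "rtree \<Rightarrow> rtree \<Rightarrow> nat \<Rightarrow> rtree option" where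
  "sub I J n = (if n < 2 then None else if n = 2 then Some J else if n = 3 then Some I
     else case sub I J (n div 2) of Some (Node A B) \<Rightarrow> Some (if even n then A else B) | _ \<Rightarrow> None)"

declare sub.simps [simp del]

lemma sub_2 [simp]: "sub I J 2 = Some J" and sub_3 [simp]: "sub I J 3 = Some I"
  by (simp_all add: sub.simps)

lemma sub_less_2: "n < 2 \<Longrightarrow> sub I J n = None"
  by (simp add: sub.simps)

lemma sub_ge_2: "sub I J n = Some X \<Longrightarrow> 2 \<le> n"
  using sub_less_2[of n I J] by (cases "n < 2") auto

lemma sub_children:
  assumes "2 \<le> n"
  shows "sub I J (2 * n) = (case sub I J n of Some (Node A B) \<Rightarrow> Some A | _ \<Rightarrow> None)"
    "sub I J (Suc (2 * n)) = (case sub I J n of Some (Node A B) \<Rightarrow> Some B | _ \<Rightarrow> None)"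
  using assms by (subst sub.simps; auto split: option.split rtree.split)+

text \<open>The indices 2 and 3 are parents of each other, so the edge between them needs no special
  treatment as an edge.\<close>

definition par :: "nat \<Rightarrow> nat" where
  "par n = (if n = 2 then 3 else if n = 3 then 2 else n div 2)"

lemma sub_par:
  assumes "sub I J n = Some X"
  shows "\<exists>Y. sub I J (par n) = Some Y"
proof (cases "n = 2 \<or> n = 3")
  case False
  moreover have "2 \<le> n" using assms by (rule sub_ge_2)
  ultimately show ?thesis using assms by (subst (asm) sub.simps) (auto simp: par_def split: option.splits)
qed (auto simp: par_def)

text \<open>Makes the vertex set finite: a step to a child at most doubles n + 1 and lowers the
  order by at least one, so the product does not grow.\<close>

lemma sub_bound:
  "sub I J n = Some X \<Longrightarrow> (n + 1) * 2 ^ rorder X \<le> 4 * 2 ^ (rorder I + rorder J)"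
proof (induction n arbitrary: X rule: less_induct)
  case (less n)
  have n2: "2 \<le> n" using less(2) by (rule sub_ge_2)
  show ?case
  proof (cases "n = 2 \<or> n = 3")
    case True
    then show ?thesis
    proof
      assume "n = 2"
      then have "X = J" using less(2) by simp
      have "(3::nat) * 2 ^ rorder J \<le> 4 * 2 ^ (rorder I + rorder J)"
        by (intro mult_mono power_increasing) simp_all
      then show ?thesis using \<open>n = 2\<close> \<open>X = J\<close> by simp
    next
      assume "n = 3"
      then have "X = I" using less(2) by simp
      have "(4::nat) * 2 ^ rorder I \<le> 4 * 2 ^ (rorder I + rorder J)"
        by (intro mult_mono power_increasing) simp_all
      then show ?thesis using \<open>n = 3\<close> \<open>X = I\<close> by simp
    qed
  next
    case False
    then obtain A B where AB: "sub I J (n div 2) = Some (Node A B)" "X = A \<or> X = B"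
      using less(2) n2 by (subst (asm) sub.simps) (auto split: option.splits rtree.splits if_splits)
    have "n div 2 < n" using n2 by simp
    from less(1)[OF this AB(1)] have IH: "(n div 2 + 1) * 2 ^ Suc (rorder A + rorder B) \<le> 4 * 2 ^ (rorder I + rorder J)"
      by simp
    have "(n + 1) * 2 ^ rorder X \<le> (2 * (n div 2 + 1)) * 2 ^ (rorder A + rorder B)"
      using AB(2) by (intro mult_mono power_increasing) auto
    then show ?thesis using IH by simp
  qed
qed

text \<open>The cyclic order is parent, first child, second child; this is the order in which
  \<open>branch\<close> reads a \<open>Node\<close> when coming from the parent.\<close>

definition can :: "rtree \<Rightarrow> rtree \<Rightarrow> otree" where
  "can I J = \<lparr>verts = {n. sub I J n \<noteq> None},
     adj = (\<lambda>a b. sub I J a \<noteq> None \<and> sub I J b \<noteq> None \<and> (b = par a \<or> a = par b)),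
     nxt = (\<lambda>n q. if q = par n then 2 * n else if q = 2 * n then Suc (2 * n) else par n),
     lab = (\<lambda>n. case sub I J n of Some (Leaf i) \<Rightarrow> i | _ \<Rightarrow> 0)\<rparr>"

lemma can_simps [simp]:
  "verts (can I J) = {n. sub I J n \<noteq> None}"
  "adj (can I J) a b \<longleftrightarrow> sub I J a \<noteq> None \<and> sub I J b \<noteq> None \<and> (b = par a \<or> a = par b)"
  "nxt (can I J) n q = (if q = par n then 2 * n else if q = 2 * n then Suc (2 * n) else par n)"
  "lab (can I J) n = (case sub I J n of Some (Leaf i) \<Rightarrow> i | _ \<Rightarrow> 0)"
  by (simp_all add: can_def)

lemma par_children: "2 \<le> n \<Longrightarrow> par (2 * n) = n" "2 \<le> n \<Longrightarrow> par (Suc (2 * n)) = n"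
  by (auto simp: par_def)

lemma par_less: "par n < 2 * n \<or> n < 2"
  by (auto simp: par_def)

lemma par_eqD: "n = par b \<Longrightarrow> 2 \<le> b \<Longrightarrow> b = par n \<or> b = 2 * n \<or> b = Suc (2 * n)"
  by (auto simp: par_def split: if_splits)

lemma can_nbrs:
  assumes "sub I J n = Some X"
  shows "{b. adj (can I J) n b} = (case X of Leaf i \<Rightarrow> {par n} | Node A B \<Rightarrow> {par n, 2 * n, Suc (2 * n)})"
proof -
  have n: "2 \<le> n" using assms by (rule sub_ge_2)
  have p: "\<exists>Y. sub I J (par n) = Some Y" by (rule sub_par[OF assms])
  have b: "x = par n \<or> x = 2 * n \<or> x = Suc (2 * n)" if "adj (can I J) n x" for x
  proof -
    have "2 \<le> x" "x = par n \<or> n = par x" using that sub_ge_2[of I J x] by auto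
    then show ?thesis using par_eqD by blast
  qed
  show ?thesis
  proof (cases X)
    case (Leaf i)
    then have "sub I J (2 * n) = None" "sub I J (Suc (2 * n)) = None"
      using sub_children[OF n, of I J] assms by simp_all
    then have "{b. adj (can I J) n b} \<subseteq> {par n}" using b by fastforce
    then show ?thesis using Leaf p assms by auto
  next
    case (Node A B)
    then have "sub I J (2 * n) = Some A" "sub I J (Suc (2 * n)) = Some B"
      using sub_children[OF n, of I J] assms by simp_all
    then have "{par n, 2 * n, Suc (2 * n)} \<subseteq> {b. adj (can I J) n b}" using p assms par_children[OF n] by auto
    moreover have "{b. adj (can I J) n b} \<subseteq> {par n, 2 * n, Suc (2 * n)}" using b by blast
    ultimately show ?thesis using Node by auto
  qed
qed

lemma can_valence:
  assumes "sub I J n = Some X"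
  shows "univalent (can I J) n \<longleftrightarrow> (\<exists>i. X = Leaf i)" "trivalent (can I J) n \<longleftrightarrow> (\<exists>A B. X = Node A B)"
proof -
  have n: "2 \<le> n" using assms by (rule sub_ge_2)
  then have "par n < 2 * n" using par_less[of n] by auto
  then have "card {b. adj (can I J) n b} = (case X of Leaf i \<Rightarrow> 1 | Node A B \<Rightarrow> 3)"
    unfolding can_nbrs[OF assms] by (auto split: rtree.split)
  then show "univalent (can I J) n \<longleftrightarrow> (\<exists>i. X = Leaf i)" "trivalent (can I J) n \<longleftrightarrow> (\<exists>A B. X = Node A B)"
    using assms unfolding univalent_def trivalent_def by (auto split: rtree.splits simp del: can_simps(2))
qed

text \<open>To be applied to the largest index on a supposed cycle: its children are excluded there,
  so both neighbors would have to be its parent.\<close>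

lemma cycle_nbrs:
  assumes sym: "\<And>x y. R x y \<Longrightarrow> R y x"
    and p: "3 \<le> length p" "distinct p" "successively R p" "R (last p) (hd p)" "n \<in> set p"
  shows "\<exists>x\<in>set p. \<exists>y\<in>set p. x \<noteq> y \<and> R n x \<and> R n y"
proof -
  obtain a b where ab: "p = a @ n # b" using p(5) by (meson split_list)
  have succ: "R n (hd b)" if "b \<noteq> []"
    using p(3) that by (cases b) (auto simp: ab successively_append_iff)
  have pred: "R n (last a)" if "a \<noteq> []"
    using p(3) that sym by (auto simp: ab successively_append_iff)
  consider "a = []" "b \<noteq> []" | "b = []" "a \<noteq> []" | "a \<noteq> []" "b \<noteq> []" using p(1) ab by fastforce
  then show ?thesis
  proof cases
    case 1
    then have "hd b \<noteq> last b" using p(1,2) ab by (cases b) auto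
    moreover have "R n (last b)" using p(4) 1 ab sym by simp
    ultimately show ?thesis using succ 1 ab by (metis hd_in_set last_in_set list.set_intros(2) append_Nil)
  next
    case 2
    then have "hd a \<noteq> last a" using p(1,2) ab by (cases a) auto
    moreover have "R n (hd a)" using p(4) 2 ab by simp
    ultimately show ?thesis using pred 2 ab by (metis hd_in_set last_in_set Un_iff set_append)
  next
    case 3
    then have "hd b \<in> set b" "last a \<in> set a" by simp_all
    moreover from this have "hd b \<noteq> last a" using p(2) unfolding ab by (metis distinct_append disjoint_iff list.set_intros(2))
    moreover from calculation have "hd b \<in> set p" "last a \<in> set p" unfolding ab by simp_all
    ultimately show ?thesis using succ pred 3 by blast
  qed
qed

lemma par_neq: "2 \<le> n \<Longrightarrow> par n \<noteq> n"
  by (auto simp: par_def)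

lemma unitrivalent_tree_can: "unitrivalent_tree (can I J)"
proof -
  let ?t = "can I J"
  have fin: "finite (verts ?t)"
  proof (rule finite_subset)
    show "verts ?t \<subseteq> {.. 4 * 2 ^ (rorder I + rorder J)}"
    proof
      fix n assume "n \<in> verts ?t"
      then obtain X where "sub I J n = Some X" by auto
      then have "(n + 1) * 2 ^ rorder X \<le> 4 * 2 ^ (rorder I + rorder J)" by (rule sub_bound)
      moreover have "(n + 1) * 1 \<le> (n + 1) * 2 ^ rorder X" by (intro mult_le_mono2) simp
      ultimately show "n \<in> {.. 4 * 2 ^ (rorder I + rorder J)}" by simp
    qed
  qed simp
  have adj: "u \<in> verts ?t \<and> v \<in> verts ?t \<and> u \<noteq> v \<and> adj ?t v u" if "adj ?t u v" for u v
    using that par_neq sub_ge_2 by fastforce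
  have to2: "(adj ?t)\<^sup>*\<^sup>* n 2 \<and> (adj ?t)\<^sup>*\<^sup>* 2 n" if "sub I J n = Some X" for n X
    using that
  proof (induction n arbitrary: X rule: less_induct)
    case (less n)
    have n2: "2 \<le> n" using less(2) by (rule sub_ge_2)
    obtain Y where Y: "sub I J (par n) = Some Y" using sub_par[OF less(2)] by blast
    have e: "adj ?t n (par n)" "adj ?t (par n) n" using less(2) Y by simp_all
    show ?case
    proof (cases "n = 2")
      case False
      then have "par n < n" using n2 by (auto simp: par_def)
      then show ?thesis using less(1)[OF _ Y] e by (meson converse_rtranclp_into_rtranclp rtranclp.rtrancl_into_rtrancl)
    qed simp
  qed
  have acyc: False if p: "3 \<le> length p" "distinct p" "successively (adj ?t) p" "adj ?t (last p) (hd p)" for p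
  proof -
    have ne: "p \<noteq> []" using p(1) by auto
    define n where "n = Max (set p)"
    have n: "n \<in> set p" "\<And>x. x \<in> set p \<Longrightarrow> x \<le> n" using ne by (simp_all add: n_def)
    obtain x y where xy: "x \<in> set p" "y \<in> set p" "x \<noteq> y" "adj ?t n x" "adj ?t n y"
      using cycle_nbrs[of "adj ?t", OF _ p n(1)] adj by blast
    have "z = par n" if "z \<in> set p" "adj ?t n z" for z
    proof -
      have "2 \<le> z" "2 \<le> n" using that(2) sub_ge_2 by auto
      moreover have "z = par n \<or> n = par z" using that(2) by auto
      ultimately show ?thesis using par_eqD[of n z] n(2)[OF that(1)] by auto
    qed
    then show False using xy by blast
  qed
  have val: "univalent ?t v \<or> trivalent ?t v" if v: "v \<in> verts ?t" for v
  proof -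
    obtain X where "sub I J v = Some X" using v by auto
    then show ?thesis using can_valence[of I J v X] by (cases X) auto
  qed
  have nx: "adj ?t v (nxt ?t v u) \<and> nxt ?t v u \<noteq> u \<and> nxt ?t v (nxt ?t v (nxt ?t v u)) = u"
    if vu: "trivalent ?t v" "adj ?t v u" for u v
  proof -
    obtain X where X: "sub I J v = Some X" using vu(2) by auto
    then obtain A B where AB: "X = Node A B" using can_valence(2) vu(1) by blast
    have v: "2 \<le> v" "par v < 2 * v" using sub_ge_2[OF X] par_less[of v] by auto
    have N: "{b. adj ?t v b} = {par v, 2 * v, Suc (2 * v)}" using can_nbrs[OF X] AB by simp
    then have "u = par v \<or> u = 2 * v \<or> u = Suc (2 * v)" using vu(2) by blast
    then have "nxt ?t v u \<in> {par v, 2 * v, Suc (2 * v)} \<and> nxt ?t v u \<noteq> u \<and> nxt ?t v (nxt ?t v (nxt ?t v u)) = u"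
      using v by auto
    then show ?thesis using N by blast
  qed
  have ne: "verts ?t \<noteq> {}" using sub_2[of I J] by (metis (mono_tags, lifting) can_simps(1) empty_Collect_eq option.distinct(1))
  have conn: "(adj ?t)\<^sup>*\<^sup>* u v" if uv: "u \<in> verts ?t" "v \<in> verts ?t" for u v
  proof -
    obtain X Y where "sub I J u = Some X" "sub I J v = Some Y" using uv by auto
    then show ?thesis using to2[of u X] to2[of v Y] rtranclp_trans[of "adj ?t" u 2 v] by blast
  qed
  show ?thesis unfolding unitrivalent_tree_def
  proof (intro conjI)
    show "finite (verts ?t)" by (rule fin)
    show "verts ?t \<noteq> {}" by (rule ne)
    show "\<forall>u v. adj ?t u v \<longrightarrow> u \<in> verts ?t \<and> v \<in> verts ?t \<and> u \<noteq> v \<and> adj ?t v u" using adj by blast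
    show "\<forall>u\<in>verts ?t. \<forall>v\<in>verts ?t. (adj ?t)\<^sup>*\<^sup>* u v" using conn by blast
    show "\<nexists>p. 3 \<le> length p \<and> distinct p \<and> successively (adj ?t) p \<and> adj ?t (last p) (hd p)" using acyc by blast
    show "\<forall>v\<in>verts ?t. univalent ?t v \<or> trivalent ?t v" using val by blast
    show "\<forall>v u. trivalent ?t v \<longrightarrow> adj ?t v u \<longrightarrow>
        adj ?t v (nxt ?t v u) \<and> nxt ?t v u \<noteq> u \<and> nxt ?t v (nxt ?t v (nxt ?t v u)) = u" using nx by blast
  qed
qed

lemma can_branch: "sub I J n = Some X \<Longrightarrow> branch (can I J) (par n) n X"
proof (induction X arbitrary: n)
  case (Leaf i)
  obtain Y where "sub I J (par n) = Some Y" using sub_par[OF Leaf] by blast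
  then have "adj (can I J) (par n) n" using Leaf by simp
  moreover have "univalent (can I J) n" using can_valence[OF Leaf] by simp
  ultimately have "branch (can I J) (par n) n (Leaf (lab (can I J) n))" by (rule branch.intros)
  then show ?case using Leaf by simp
next
  case (Node A B)
  have n: "2 \<le> n" "par n < 2 * n" using sub_ge_2[OF Node(3)] par_less[of n] by auto
  have "sub I J (2 * n) = Some A" "sub I J (Suc (2 * n)) = Some B"
    using sub_children[OF n(1), of I J] Node(3) by simp_all
  then have b: "branch (can I J) n (2 * n) A" "branch (can I J) n (Suc (2 * n)) B"
    using Node.IH[of "2 * n"] Node.IH(2)[of "Suc (2 * n)"] par_children[OF n(1)] by auto
  obtain Y where "sub I J (par n) = Some Y" using sub_par[OF Node(3)] by blast
  then have "adj (can I J) (par n) n" using Node(3) by simp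
  moreover have "trivalent (can I J) n" using can_valence[OF Node(3)] by simp
  ultimately show ?case using b n(2) by (intro branch.intros(2)) auto
qed

lemma can_branches: "branch (can I J) 2 3 I" "branch (can I J) 3 2 J" "adj (can I J) 2 3"
  using can_branch[of I J 3] can_branch[of I J 2] by (auto simp: par_def)

text \<open>Carries the indices of the canonical tree over to \<open>t\<close>: the result is the
  directed edge from the image of the parent to the image of \<open>n\<close>. The value for
  \<open>n < 2\<close> is a dummy.\<close>

fun walk :: "otree \<Rightarrow> nat \<Rightarrow> nat \<Rightarrow> nat \<Rightarrow> nat \<times> nat" where
  "walk t u v n = (if n < 3 then (v, u) else if n = 3 then (u, v)
     else case walk t u v (n div 2) of (a, b) \<Rightarrow> (b, if even n then nxt t b a else nxt t b (nxt t b a)))"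

declare walk.simps [simp del]

lemma fst_walk:
  assumes "2 \<le> n" shows "fst (walk t u v n) = snd (walk t u v (par n))"
proof -
  consider "n = 2" | "n = 3" | "3 < n" using assms by linarith
  then show ?thesis
  proof cases
    case 3
    then have "par n = n div 2" by (simp add: par_def)
    then show ?thesis using 3 by (subst walk.simps) (simp split: prod.split)
  qed (simp_all add: par_def walk.simps)
qed

lemma walk_children:
  assumes "2 \<le> n"
  shows "snd (walk t u v (2 * n)) = nxt t (snd (walk t u v n)) (fst (walk t u v n))"
    "snd (walk t u v (Suc (2 * n))) =
       nxt t (snd (walk t u v n)) (nxt t (snd (walk t u v n)) (fst (walk t u v n)))"
  using assms by (subst walk.simps; simp split: prod.split)+

lemma walk_branch:
  assumes "branch t u v I" "branch t v u J"
  shows "sub I J n = Some X \<Longrightarrow> branch t (fst (walk t u v n)) (snd (walk t u v n)) X"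
proof (induction n arbitrary: X rule: less_induct)
  case (less n)
  have n2: "2 \<le> n" using less(2) by (rule sub_ge_2)
  consider "n = 2" | "n = 3" | "3 < n" using n2 by linarith
  then show ?case
  proof cases
    case 3
    define k where "k = n div 2"
    have k: "2 \<le> k" "k < n" "n = 2 * k \<or> n = Suc (2 * k)" using 3 by (auto simp: k_def)
    obtain A B where AB: "sub I J k = Some (Node A B)" "X = (if n = 2 * k then A else B)"
      using less(2) k(3) sub_children[OF k(1), of I J] by (auto split: option.splits rtree.splits)
    note b = branch_nodeD[OF less(1)[OF k(2) AB(1)]]
    have "par n = k" using par_children[OF k(1)] k(3) by auto
    then have "fst (walk t u v n) = snd (walk t u v k)" using fst_walk[OF n2] by simp
    then show ?thesis using b walk_children[OF k(1), of t u v] k(3) AB(2) by auto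
  qed (use less(2) assms in \<open>simp_all add: walk.simps\<close>)
qed

text \<open>A tree is determined by its two halves at any edge. This is what makes the definite
  description in \<open>tree_inner\<close> well defined.\<close>

lemma otree_equiv_can:
  assumes t: "unitrivalent_tree t" and b: "branch t u v I" "branch t v u J"
  shows "otree_equiv (can I J) t"
proof -
  let ?s = "can I J" and ?f = "\<lambda>n. snd (walk t u v n)"
  note s = unitrivalent_tree_can[of I J]
  have br: "branch t (?f (par n)) (?f n) X" if "sub I J n = Some X" for n X
    using walk_branch[OF b that] fst_walk[OF sub_ge_2[OF that]] by simp
  have "is_otree_iso ?f ?s t"
  proof (rule covering_iso[OF s t])
    show "adj ?s 2 3" by (rule can_branches)
  next
    fix a c assume "adj ?s a c"
    then have "adj ?s a c" "c = par a \<or> a = par c" by auto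
    then show "adj t (?f a) (?f c)"
      using br branch_adj ut_adjD(4)[OF t] by (metis can_simps(2) option.exhaust)
  next
    fix n assume n: "univalent ?s n"
    then obtain X where X: "sub I J n = Some X" by (auto simp: univalent_def)
    then obtain i where "X = Leaf i" using can_valence n by blast
    then show "univalent t (?f n) \<and> lab t (?f n) = lab ?s n"
      using branch_leafD[OF t, of "?f (par n)" "?f n" i] br[OF X] X by simp
  next
    fix n assume n: "trivalent ?s n"
    then obtain X where X: "sub I J n = Some X" by (auto simp: trivalent_def)
    then obtain A B where "X = Node A B" using can_valence n by blast
    then show "trivalent t (?f n)" using branch_nodeD(1) br[OF X] by blast
  next
    fix n q assume n: "trivalent ?s n" "adj ?s n q"
    then obtain X where X: "sub I J n = Some X" by (auto simp: trivalent_def)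
    then obtain A B where AB: "X = Node A B" using can_valence n by blast
    have n2: "2 \<le> n" "par n < 2 * n" using sub_ge_2[OF X] par_less[of n] by auto
    have "{b. adj ?s n b} = {par n, 2 * n, Suc (2 * n)}" using can_nbrs[OF X] AB by simp
    then consider "q = par n" | "q = 2 * n" | "q = Suc (2 * n)" using n(2) by blast
    moreover have tv: "trivalent t (?f n)" "adj t (?f n) (?f (par n))"
      using branch_nodeD(1) br[OF X] AB branch_adj ut_adjD(4)[OF t] by blast+
    ultimately show "?f (nxt ?s n q) = nxt t (?f n) (?f q)"
      using walk_children[OF n2(1), of t u v] fst_walk[OF n2(1), of t u v] n2 trivalent_nbrs(6)[OF t tv]
      by cases auto
  qed
  then show ?thesis unfolding otree_equiv_def using s t by blast
qed

lemma tree_inner_can: "tree_inner I J = abs_utree (can I J)"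
  unfolding tree_inner_def
proof (rule the_equality)
  show "\<exists>t u v. unitrivalent_tree t \<and> abs_utree (can I J) = abs_utree t \<and> adj t u v \<and> branch t u v I \<and> branch t v u J"
    using unitrivalent_tree_can can_branches by blast
  fix T assume "\<exists>t u v. unitrivalent_tree t \<and> T = abs_utree t \<and> adj t u v \<and> branch t u v I \<and> branch t v u J"
  then show "T = abs_utree (can I J)" using otree_equiv_can abs_utree_eqI by metis
qed

lemma tree_innerI:
  assumes "unitrivalent_tree t" "branch t u v I" "branch t v u J"
  shows "abs_utree t = tree_inner I J"
  using abs_utree_eqI[OF otree_equiv_can[OF assms]] by (simp add: tree_inner_can)

lemma tree_inner_obtain:
  obtains t u v where "unitrivalent_tree t" "tree_inner I J = abs_utree t" "branch t u v I" "branch t v u J"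
  using that unitrivalent_tree_can can_branches tree_inner_can by blast

lemma tree_inner_sym: "tree_inner I J = tree_inner J I"
  using tree_inner_obtain[of I J] tree_innerI by metis

text \<open>Moves the cut to the other two edges at \<open>v\<close>; that the third application of
  \<open>nxt\<close> returns to \<open>u\<close> fixes the order of the factors.\<close>

lemma branch_rotate:
  assumes t: "unitrivalent_tree t" and b: "branch t u v (Node A B)" "branch t v u C"
  shows "branch t v (nxt t v u) A" "branch t (nxt t v u) v (Node B C)"
    "branch t v (nxt t v (nxt t v u)) B" "branch t (nxt t v (nxt t v u)) v (Node C A)"
proof -
  note n = branch_nodeD[OF b(1)]
  show "branch t v (nxt t v u) A" "branch t v (nxt t v (nxt t v u)) B" by (rule n)+
  have vu: "adj t v u" using branch_adj[OF b(2)] .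
  note w = trivalent_nbrs[OF t n(1) vu]
  show "branch t (nxt t v u) v (Node B C)" "branch t (nxt t v (nxt t v u)) v (Node C A)"
    using n b(2) w(1,2,6) ut_adjD(4)[OF t] by (auto intro!: branch.intros(2))
qed

lemma tree_inner_rotate: "tree_inner (Node A B) C = tree_inner A (Node B C)"
proof (rule tree_inner_obtain[of "Node A B" C])
  fix t u v assume "unitrivalent_tree t" "tree_inner (Node A B) C = abs_utree t"
    "branch t u v (Node A B)" "branch t v u C"
  then show ?thesis using tree_innerI branch_rotate by metis
qed

lemma tree_inner_surj: "\<exists>I J. T = tree_inner I J"
proof (rule utree_obtain[of T])
  fix t assume t: "unitrivalent_tree t" "T = abs_utree t"
  then obtain v where v: "v \<in> verts t" unfolding unitrivalent_tree_def by blast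
  then obtain u where "adj t v u" using ut_nbr_exists[OF t(1)] by blast
  then obtain I J where "branch t v u I" "branch t u v J" using branch_exists[OF t(1)] ut_adjD(4)[OF t(1)] by metis
  then show ?thesis using tree_innerI t by metis
qed

text \<open>The terms of the vertex sum of \<open>\<langle>I,J\<rangle>\<close> at the leaves of \<open>I\<close>.\<close>

primrec lsum :: "rtree \<Rightarrow> rtree \<Rightarrow> (nat \<times> rtree) \<Rightarrow>\<^sub>0 int" where
  "lsum (Leaf i) K = frag_of (i, K)"
| "lsum (Node A B) K = lsum A (Node B K) + lsum B (Node K A)"

lemma reach_finite: "unitrivalent_tree t \<Longrightarrow> finite {w. reach t u v w \<and> P w}"
proof (rule finite_subset)
  assume t: "unitrivalent_tree t"
  then show "finite (verts t)" unfolding unitrivalent_tree_def by blast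
  show "{w. reach t u v w \<and> P w} \<subseteq> verts t" using reach_verts[OF t] by blast
qed

lemma reach_split:
  assumes t: "unitrivalent_tree t" and uv: "adj t u v" and v: "trivalent t v"
  defines "a \<equiv> nxt t v u" and "b \<equiv> nxt t v (nxt t v u)"
  shows "{w. reach t u v w \<and> P w} = {w. w = v \<and> P w} \<union> ({w. reach t v a w \<and> P w} \<union> {w. reach t v b w \<and> P w})"
    "{w. reach t v a w \<and> P w} \<inter> {w. reach t v b w \<and> P w} = {}"
    "v \<notin> {w. reach t v a w \<and> P w} \<union> {w. reach t v b w \<and> P w}"
proof -
  show "{w. reach t u v w \<and> P w} = {w. w = v \<and> P w} \<union> ({w. reach t v a w \<and> P w} \<union> {w. reach t v b w \<and> P w})"
    using reach_trivalent[OF t uv v] unfolding a_def b_def by blast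
  have "a \<noteq> b" using trivalent_nbrs(5)[OF t v ut_adjD(4)[OF t uv]] unfolding a_def b_def by metis
  then show "{w. reach t v a w \<and> P w} \<inter> {w. reach t v b w \<and> P w} = {}"
    using reach_disjoint2[OF t] by blast
  show "v \<notin> {w. reach t v a w \<and> P w} \<union> {w. reach t v b w \<and> P w}"
    using reach_neq[OF t] by blast
qed

lemma root_at_eq:
  assumes t: "unitrivalent_tree t" and v: "univalent t v" and b: "branch t v u K"
  shows "root_at t v = K"
  unfolding root_at_def
proof (rule the_equality)
  show "\<exists>w. adj t v w \<and> branch t v w K" using b branch_adj by blast
  fix J assume "\<exists>w. adj t v w \<and> branch t v w J"
  then obtain w where w: "adj t v w" "branch t v w J" by blast
  have "w = u" using univalent_nbrs[OF v branch_adj[OF b]] w(1) by blast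
  then show "J = K" using branch_unique[OF t] w(2) b by blast
qed

lemma reach_leaf:
  assumes t: "unitrivalent_tree t" and "adj t u v" "univalent t v" "P v"
  shows "{w. reach t u v w \<and> P w} = {v}"
  using reach_univalent[OF assms(1-3)] assms(4) by blast

lemma not_tri_uni: "univalent t v \<Longrightarrow> \<not> trivalent t v"
  by (simp add: univalent_def trivalent_def)

text \<open>On entering one subtree at \<open>v\<close>, the tree seen backwards acquires the other
  subtree, on the side given by the cyclic order; this is the recursion of
  \<open>lsum\<close>.\<close>

lemma vertex_sum_reach:
  assumes t: "unitrivalent_tree t"
  shows "branch t u v J \<Longrightarrow> branch t v u K \<Longrightarrow>
    (\<Sum>w | reach t u v w \<and> univalent t w. frag_of (lab t w, root_at t w)) = lsum J K"
proof (induction arbitrary: K rule: branch.induct)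
  case (1 u v)
  then show ?case using reach_leaf[OF t 1(1,2), of "univalent t"] root_at_eq[OF t 1(2,3)] by simp
next
  case (2 u v I J)
  let ?a = "nxt t v u" and ?b = "nxt t v (nxt t v u)"
  have b: "branch t u v (Node I J)" using 2(1-4) by (rule branch.intros)
  note r = branch_rotate[OF t b 2(7)]
  note s = reach_split[OF t 2(1,2), of "univalent t"]
  have e: "{w. w = v \<and> univalent t w} = {}" using not_tri_uni 2(2) by blast
  show ?case unfolding s(1) e Un_empty_left
    by (subst sum.union_disjoint) (simp_all add: reach_finite[OF t] s(2) "2.IH"(1)[OF r(2)] "2.IH"(2)[OF r(4)])
qed

lemma card_reach:
  assumes t: "unitrivalent_tree t"
  shows "branch t u v J \<Longrightarrow> card {w. reach t u v w \<and> trivalent t w} = rorder J"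
proof (induction rule: branch.induct)
  case (1 u v)
  then have "{w. reach t u v w \<and> trivalent t w} = {}"
    using reach_univalent[OF t 1(1,2)] not_tri_uni[OF 1(2)] by (auto simp: set_eq_iff)
  then show ?case by (simp only: card.empty rorder.simps)
next
  case (2 u v I J)
  note s = reach_split[OF t 2(1,2), of "trivalent t"]
  have e: "{w. w = v \<and> trivalent t w} = {v}" using 2(2) by blast
  have "card {w. reach t u v w \<and> trivalent t w} =
    Suc (card ({w. reach t v (nxt t v u) w \<and> trivalent t w} \<union> {w. reach t v (nxt t v (nxt t v u)) w \<and> trivalent t w}))"
    unfolding s(1) e using s(3) by (simp add: reach_finite[OF t])
  also have "\<dots> = Suc (rorder I + rorder J)"
    by (subst card_Un_disjoint) (simp_all add: reach_finite[OF t] s(2) "2.IH")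
  finally show ?case by simp
qed

lemma labels_reach:
  assumes t: "unitrivalent_tree t"
  shows "branch t u v J \<Longrightarrow> lab t ` {w. reach t u v w \<and> univalent t w} = rlabels J"
proof (induction rule: branch.induct)
  case (1 u v)
  then show ?case using reach_leaf[OF t 1(1,2), of "univalent t"] by simp
next
  case (2 u v I J)
  note s = reach_split[OF t 2(1,2), of "univalent t"]
  have e: "{w. w = v \<and> univalent t w} = {}" using not_tri_uni 2(2) by blast
  show ?case unfolding s(1) e by (simp add: image_Un "2.IH")
qed

lemma reach_all:
  assumes t: "unitrivalent_tree t" and uv: "adj t u v" and P: "\<And>w. P w \<Longrightarrow> w \<in> verts t"
  shows "{w. P w} = {w. reach t u v w \<and> P w} \<union> {w. reach t v u w \<and> P w}"
    "{w. reach t u v w \<and> P w} \<inter> {w. reach t v u w \<and> P w} = {}"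
  using reach_cover[OF t uv] P reach_disjoint[OF t] by blast+

lemma vertex_sum_tree_inner: "vertex_sum (tree_inner I J) = lsum I J + lsum J I"
proof (rule tree_inner_obtain[of I J])
  fix t u v assume t: "unitrivalent_tree t" and e: "tree_inner I J = abs_utree t"
    and b: "branch t u v I" "branch t v u J"
  have P: "univalent t w \<Longrightarrow> w \<in> verts t" for w by (simp add: univalent_def)
  have r: "{w. univalent t w} = {w. reach t u v w \<and> univalent t w} \<union> {w. reach t v u w \<and> univalent t w}"
    "{w. reach t u v w \<and> univalent t w} \<inter> {w. reach t v u w \<and> univalent t w} = {}"
    using reach_all[OF t branch_adj[OF b(1)], of "univalent t"] P by blast+
  have "vertex_sum (abs_utree t) = (\<Sum>w | univalent t w. frag_of (lab t w, root_at t w))"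
    by (rule vertex_sum.abs_eq) (simp add: otree_equiv_refl_iff t)
  also have "\<dots> = lsum I J + lsum J I"
    unfolding r(1)
    by (subst sum.union_disjoint)
       (simp_all add: reach_finite[OF t] r(2) vertex_sum_reach[OF t b] vertex_sum_reach[OF t b(2,1)])
  finally show ?thesis by (simp add: e)
qed

lemma uorder_tree_inner: "uorder (tree_inner I J) = rorder I + rorder J"
proof (rule tree_inner_obtain[of I J])
  fix t u v assume t: "unitrivalent_tree t" and e: "tree_inner I J = abs_utree t"
    and b: "branch t u v I" "branch t v u J"
  have P: "trivalent t w \<Longrightarrow> w \<in> verts t" for w by (simp add: trivalent_def)
  have r: "{w. trivalent t w} = {w. reach t u v w \<and> trivalent t w} \<union> {w. reach t v u w \<and> trivalent t w}"
    "{w. reach t u v w \<and> trivalent t w} \<inter> {w. reach t v u w \<and> trivalent t w} = {}"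
    using reach_all[OF t branch_adj[OF b(1)], of "trivalent t"] P by blast+
  have "uorder (abs_utree t) = card {w. trivalent t w}"
    by (rule uorder.abs_eq) (simp add: otree_equiv_refl_iff t)
  also have "\<dots> = rorder I + rorder J"
    unfolding r(1)
    by (subst card_Un_disjoint) (simp_all add: reach_finite[OF t] r(2) card_reach[OF t b(1)] card_reach[OF t b(2)])
  finally show ?thesis by (simp add: e)
qed

lemma ulabels_tree_inner: "ulabels (tree_inner I J) = rlabels I \<union> rlabels J"
proof (rule tree_inner_obtain[of I J])
  fix t u v assume t: "unitrivalent_tree t" and e: "tree_inner I J = abs_utree t"
    and b: "branch t u v I" "branch t v u J"
  have P: "univalent t w \<Longrightarrow> w \<in> verts t" for w by (simp add: univalent_def)
  have r: "{w. univalent t w} = {w. reach t u v w \<and> univalent t w} \<union> {w. reach t v u w \<and> univalent t w}"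
    "{w. reach t u v w \<and> univalent t w} \<inter> {w. reach t v u w \<and> univalent t w} = {}"
    using reach_all[OF t branch_adj[OF b(1)], of "univalent t"] P by blast+
  have "ulabels (abs_utree t) = lab t ` {w. univalent t w}"
    by (rule ulabels.abs_eq) (simp add: otree_equiv_refl_iff t)
  also have "\<dots> = rlabels I \<union> rlabels J"
    unfolding r(1) by (simp add: image_Un labels_reach[OF t b(1)] labels_reach[OF t b(2)])
  finally show ?thesis by (simp add: e)
qed

lemma utrees_tree_inner:
  "tree_inner I J \<in> utrees m n \<longleftrightarrow> rlabels I \<union> rlabels J \<subseteq> {1..m} \<and> rorder I + rorder J = n"
  by (simp add: utrees_def uorder_tree_inner ulabels_tree_inner)


section \<open>Reversal of the cyclic order at a vertex\<close>

lemma reverse_vertex_simps [simp]: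
  "verts (reverse_vertex v t) = verts t" "adj (reverse_vertex v t) = adj t" "lab (reverse_vertex v t) = lab t"
  "nxt (reverse_vertex v t) x y = (if x = v then nxt t v (nxt t v y) else nxt t x y)"
  by (simp_all add: reverse_vertex_def)

lemma valence_reverse_vertex [simp]:
  "univalent (reverse_vertex v t) = univalent t" "trivalent (reverse_vertex v t) = trivalent t"
  by (auto simp: univalent_def trivalent_def fun_eq_iff)

lemma unitrivalent_reverse_vertex:
  assumes "unitrivalent_tree t"
  shows "unitrivalent_tree (reverse_vertex v t)"
proof -
  have "adj t x (nxt (reverse_vertex v t) x y) \<and> nxt (reverse_vertex v t) x y \<noteq> y \<and>
      nxt (reverse_vertex v t) x (nxt (reverse_vertex v t) x (nxt (reverse_vertex v t) x y)) = y"
    if xy: "trivalent t x" "adj t x y" for x y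
  proof -
    note n = trivalent_nbrs[OF assms xy]
    have "nxt t x (nxt t x (nxt t x (nxt t x (nxt t x (nxt t x y))))) = y" using n(6) by simp
    then show ?thesis using n by auto
  qed
  then show ?thesis using assms unfolding unitrivalent_tree_def by simp
qed

lemma branch_reverse_vertex:
  assumes t: "unitrivalent_tree t"
  shows "branch t x y J \<Longrightarrow> \<not> reach t x y v \<Longrightarrow> branch (reverse_vertex v t) x y J"
proof (induction rule: branch.induct)
  case (1 x y)
  then show ?case using branch.intros(1)[of "reverse_vertex v t" x y] by simp
next
  case (2 x y I J)
  note n = trivalent_nbrs[OF t 2(2) ut_adjD(4)[OF t 2(1)]]
  have "y \<noteq> v" using 2(1,7) reach_start by metis
  moreover have "\<not> reach t y (nxt t y x) v" "\<not> reach t y (nxt t y (nxt t y x)) v"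
    using 2(1,7) reach_step[of t x y] n by metis+
  ultimately show ?case using 2 branch.intros(2)[of "reverse_vertex v t" x y I J] by simp
qed

lemma reverse_vertex_tree_inner:
  assumes t: "unitrivalent_tree t" and b: "branch t u v (Node A B)" "branch t v u C"
  shows "abs_utree (reverse_vertex v t) = tree_inner (Node B A) C"
proof -
  let ?t = "reverse_vertex v t"
  have v: "trivalent t v" using branch_nodeD[OF b(1)] by blast
  note n = trivalent_nbrs[OF t v branch_adj[OF b(2)]]
  note r = branch_rotate[OF t b]
  have no: "\<not> reach t v x v" for x using reach_neq[OF t] by blast
  have "branch ?t v (nxt t v u) A" "branch ?t v (nxt t v (nxt t v u)) B" "branch ?t v u C"
    using branch_reverse_vertex[OF t _ no] r b(2) by blast+
  then have "branch ?t u v (Node B A)"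
    using branch.intros(2)[of ?t u v B A] branch_adj[OF b(1)] v n(6) by simp
  then show ?thesis
    using tree_innerI[OF unitrivalent_reverse_vertex[OF t]] \<open>branch ?t v u C\<close> by blast
qed

text \<open>Cutting an edge at the reversed vertex puts that vertex at the root of one half, where
  the reversal exchanges the two factors.\<close>

lemma AS_relators_eq:
  "AS_relators m n = {frag_of (tree_inner (Node A B) C) + frag_of (tree_inner (Node B A) C) | A B C.
     tree_inner (Node A B) C \<in> utrees m n}"
proof (intro equalityI subsetI)
  fix r assume "r \<in> AS_relators m n"
  then obtain t v where t: "r = frag_of (abs_utree t) + frag_of (abs_utree (reverse_vertex v t))"
    "unitrivalent_tree t" "trivalent t v" "abs_utree t \<in> utrees m n"
    unfolding AS_relators_def by blast
  obtain u where u: "adj t v u" using ut_nbr_exists[OF t(2)] t(3) by (auto simp: trivalent_def)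
  obtain C where C: "branch t v u C" using branch_exists[OF t(2) u] by blast
  note n = trivalent_nbrs[OF t(2,3) u]
  obtain A where A: "branch t v (nxt t v u) A" using branch_exists[OF t(2) n(1)] by blast
  obtain B where B: "branch t v (nxt t v (nxt t v u)) B" using branch_exists[OF t(2) n(2)] by blast
  have N: "branch t u v (Node A B)" using branch.intros(2)[OF ut_adjD(4)[OF t(2) u] t(3) A B] .
  have "abs_utree t = tree_inner (Node A B) C" "abs_utree (reverse_vertex v t) = tree_inner (Node B A) C"
    by (rule tree_innerI[OF t(2) N C], rule reverse_vertex_tree_inner[OF t(2) N C])
  then show "r \<in> {frag_of (tree_inner (Node A B) C) + frag_of (tree_inner (Node B A) C) | A B C.
     tree_inner (Node A B) C \<in> utrees m n}" using t by auto
next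
  fix r assume "r \<in> {frag_of (tree_inner (Node A B) C) + frag_of (tree_inner (Node B A) C) | A B C.
     tree_inner (Node A B) C \<in> utrees m n}"
  then obtain A B C where r: "r = frag_of (tree_inner (Node A B) C) + frag_of (tree_inner (Node B A) C)"
    "tree_inner (Node A B) C \<in> utrees m n" by blast
  obtain t u v where t: "unitrivalent_tree t" "tree_inner (Node A B) C = abs_utree t"
    "branch t u v (Node A B)" "branch t v u C" by (rule tree_inner_obtain)
  have "r = frag_of (abs_utree t) + frag_of (abs_utree (reverse_vertex v t))"
    using r(1) t(2) reverse_vertex_tree_inner[OF t(1,3,4)] by simp
  moreover have "abs_utree t \<in> utrees m n" using r(2) t(2) by simp
  ultimately show "r \<in> AS_relators m n"
    unfolding AS_relators_def using t(1) branch_nodeD(1)[OF t(3)] by blast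
qed

declare zmul_frag [simp del]

section \<open>Groups realized inside additive types\<close>

text \<open>Groups of cosets, and cosets of cosets, are compared through injective additive maps
  into fixed abelian groups; identities between coset operations are then checked on the
  images.\<close>

definition realizes :: "('g, 'c) monoid_scheme \<Rightarrow> ('g \<Rightarrow> 'b::ab_group_add) \<Rightarrow> bool" where
  "realizes G r \<longleftrightarrow> \<one>\<^bsub>G\<^esub> \<in> carrier G \<and> r \<one>\<^bsub>G\<^esub> = 0 \<and>
     (\<forall>x\<in>carrier G. \<forall>y\<in>carrier G. x \<otimes>\<^bsub>G\<^esub> y \<in> carrier G \<and> r (x \<otimes>\<^bsub>G\<^esub> y) = r x + r y) \<and>
     (\<forall>x\<in>carrier G. \<exists>y\<in>carrier G. r y = - r x) \<and> inj_on r (carrier G)"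

lemma realizesD:
  assumes "realizes G r"
  shows "\<one>\<^bsub>G\<^esub> \<in> carrier G" "r \<one>\<^bsub>G\<^esub> = 0"
    "\<And>x y. x \<in> carrier G \<Longrightarrow> y \<in> carrier G \<Longrightarrow> x \<otimes>\<^bsub>G\<^esub> y \<in> carrier G"
    "\<And>x y. x \<in> carrier G \<Longrightarrow> y \<in> carrier G \<Longrightarrow> r (x \<otimes>\<^bsub>G\<^esub> y) = r x + r y"
    "\<And>x y. x \<in> carrier G \<Longrightarrow> y \<in> carrier G \<Longrightarrow> r x = r y \<Longrightarrow> x = y"
  using assms unfolding realizes_def inj_on_def by blast+

lemma realizes_comm_group:
  assumes "realizes G r"
  shows "comm_group G"
proof (rule comm_groupI)
  fix x y z assume x: "x \<in> carrier G" and y: "y \<in> carrier G" and z: "z \<in> carrier G"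
  show "x \<otimes>\<^bsub>G\<^esub> y \<in> carrier G" using realizesD[OF assms] x y by blast
  show "(x \<otimes>\<^bsub>G\<^esub> y) \<otimes>\<^bsub>G\<^esub> z = x \<otimes>\<^bsub>G\<^esub> (y \<otimes>\<^bsub>G\<^esub> z)"
    using x y z by (intro realizesD(5)[OF assms]) (simp_all add: realizesD[OF assms] add.assoc)
  show "x \<otimes>\<^bsub>G\<^esub> y = y \<otimes>\<^bsub>G\<^esub> x"
    using x y by (intro realizesD(5)[OF assms]) (simp_all add: realizesD[OF assms] add.commute)
  show "\<one>\<^bsub>G\<^esub> \<otimes>\<^bsub>G\<^esub> x = x"
    using x by (intro realizesD(5)[OF assms]) (simp_all add: realizesD[OF assms])
  obtain y where "y \<in> carrier G" "r y = - r x" using assms x unfolding realizes_def by blast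
  then show "\<exists>y\<in>carrier G. y \<otimes>\<^bsub>G\<^esub> x = \<one>\<^bsub>G\<^esub>"
    using x by (intro bexI[of _ y] realizesD(5)[OF assms]) (simp_all add: realizesD[OF assms])
qed (rule realizesD(1)[OF assms])

lemma realizesI:
  assumes "comm_group G" "\<And>x y. x \<in> carrier G \<Longrightarrow> y \<in> carrier G \<Longrightarrow> r (x \<otimes>\<^bsub>G\<^esub> y) = r x + r y"
    "\<And>x. x \<in> carrier G \<Longrightarrow> r x = 0 \<Longrightarrow> x = \<one>\<^bsub>G\<^esub>"
  shows "realizes G r"
proof -
  interpret comm_group G by fact
  have 1: "r \<one>\<^bsub>G\<^esub> = 0" using assms(2)[of "\<one>\<^bsub>G\<^esub>" "\<one>\<^bsub>G\<^esub>"] by simp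
  have i: "r (inv\<^bsub>G\<^esub> x) = - r x" if "x \<in> carrier G" for x
    using assms(2)[of "inv\<^bsub>G\<^esub> x" x] that 1 by (simp add: eq_neg_iff_add_eq_0)
  have "inj_on r (carrier G)"
  proof (rule inj_onI)
    fix x y assume xy: "x \<in> carrier G" "y \<in> carrier G" "r x = r y"
    then have "r (x \<otimes>\<^bsub>G\<^esub> inv\<^bsub>G\<^esub> y) = 0" using assms(2)[of x "inv\<^bsub>G\<^esub> y"] i by simp
    then have "x \<otimes>\<^bsub>G\<^esub> inv\<^bsub>G\<^esub> y = \<one>\<^bsub>G\<^esub>" using assms(3) xy by simp
    then show "x = y" using xy by (metis inv_equality inv_inv inv_closed)
  qed
  then show ?thesis unfolding realizes_def using 1 i assms(2) by (metis inv_closed m_closed one_closed)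
qed

lemma realizes_inv:
  assumes "realizes G r" "x \<in> carrier G"
  shows "inv\<^bsub>G\<^esub> x \<in> carrier G" "r (inv\<^bsub>G\<^esub> x) = - r x"
proof -
  interpret comm_group G by (rule realizes_comm_group[OF assms(1)])
  show i: "inv\<^bsub>G\<^esub> x \<in> carrier G" using assms(2) by simp
  have "r (inv\<^bsub>G\<^esub> x) + r x = r (inv\<^bsub>G\<^esub> x \<otimes>\<^bsub>G\<^esub> x)" using realizesD(4)[OF assms(1) i assms(2)] by simp
  then show "r (inv\<^bsub>G\<^esub> x) = - r x" using assms(2) realizesD(2)[OF assms(1)] by (simp add: eq_neg_iff_add_eq_0)
qed

lemma realizes_int_pow:
  assumes "realizes G r" "x \<in> carrier G"
  shows "x [^]\<^bsub>G\<^esub> (n::int) \<in> carrier G" "r (x [^]\<^bsub>G\<^esub> n) = zmul n (r x)"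
proof -
  interpret comm_group G by (rule realizes_comm_group[OF assms(1)])
  show c: "x [^]\<^bsub>G\<^esub> (n::int) \<in> carrier G" for n using assms(2) by simp
  show "r (x [^]\<^bsub>G\<^esub> n) = zmul n (r x)"
  proof (induction n rule: int_induct[of _ 0])
    case base
    then show ?case using realizesD(2)[OF assms(1)] by simp
  next
    case (step1 i)
    have "r (x [^]\<^bsub>G\<^esub> (i + 1)) = r (x [^]\<^bsub>G\<^esub> i) + r x"
      using realizesD(4)[OF assms(1) c assms(2), of i] assms(2) by (simp add: int_pow_mult)
    then show ?case using step1 by (simp add: zmul_plus_one)
  next
    case (step2 i)
    have "r (x [^]\<^bsub>G\<^esub> (i - 1)) + r x = r (x [^]\<^bsub>G\<^esub> i)"
      using realizesD(4)[OF assms(1) c assms(2), of "i - 1"] int_pow_mult[OF assms(2), of "i - 1" 1] assms(2) by simp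
    then show ?case using step2 by (simp add: zmul_minus_one eq_diff_eq)
  qed
qed

lemma realizes_lin_extend:
  assumes "realizes G r" "\<And>i. i \<in> Poly_Mapping.keys z \<Longrightarrow> b i \<in> carrier G"
  shows "lin_extend G b z \<in> carrier G" "r (lin_extend G b z) = ext (\<lambda>i. r (b i)) z"
proof -
  interpret comm_group G by (rule realizes_comm_group[OF assms(1)])
  have c: "b i [^]\<^bsub>G\<^esub> Poly_Mapping.lookup z i \<in> carrier G" if "i \<in> Poly_Mapping.keys z" for i
    using assms(2) that by simp
  have "finprod G (\<lambda>i. b i [^]\<^bsub>G\<^esub> Poly_Mapping.lookup z i) S \<in> carrier G \<and>
     r (finprod G (\<lambda>i. b i [^]\<^bsub>G\<^esub> Poly_Mapping.lookup z i) S) = (\<Sum>i\<in>S. zmul (Poly_Mapping.lookup z i) (r (b i)))"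
    if "finite S" "S \<subseteq> Poly_Mapping.keys z" for S
    using that
  proof induction
    case empty
    then show ?case using realizesD(2)[OF assms(1)] by simp
  next
    case (insert i S)
    then have "(\<lambda>i. b i [^]\<^bsub>G\<^esub> Poly_Mapping.lookup z i) \<in> S \<rightarrow> carrier G" "b i [^]\<^bsub>G\<^esub> Poly_Mapping.lookup z i \<in> carrier G"
      using c by auto
    moreover have "b i \<in> carrier G" using insert assms(2) by blast
    ultimately show ?case using insert realizesD(4)[OF assms(1)] realizes_int_pow(2)[OF assms(1)]
      by (simp add: finprod_insert)
  qed
  from this[of "Poly_Mapping.keys z"] show "lin_extend G b z \<in> carrier G" "r (lin_extend G b z) = ext (\<lambda>i. r (b i)) z"
    by (simp_all add: lin_extend_def ext_def)
qed

lemma realizes_subset: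
  assumes "realizes G r" "H \<subseteq> carrier G" "\<one>\<^bsub>G\<^esub> \<in> H"
    "\<And>x y. x \<in> H \<Longrightarrow> y \<in> H \<Longrightarrow> x \<otimes>\<^bsub>G\<^esub> y \<in> H" "\<And>x. x \<in> H \<Longrightarrow> \<exists>y\<in>H. r y = - r x"
  shows "realizes (G\<lparr>carrier := H\<rparr>) r"
  using assms unfolding realizes_def inj_on_def by (simp add: subset_eq)

text \<open>The form of all comparisons below: once \<open>f\<close> is known to correspond to
  \<open>p\<close> on the realizing elements, only injectivity of \<open>p\<close> there and the
  image of \<open>f\<close> remain to be determined.\<close>

lemma realizes_iso:
  assumes "realizes G r" "realizes H s" "f ` carrier G = carrier H" "additive p"
    "\<And>x. x \<in> carrier G \<Longrightarrow> s (f x) = p (r x)" "\<And>x. x \<in> carrier G \<Longrightarrow> p (r x) = 0 \<Longrightarrow> r x = 0"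
  shows "f \<in> iso G H"
proof -
  have h: "f x \<in> carrier H" if "x \<in> carrier G" for x using assms(3) that by blast
  have "f \<in> hom G H"
  proof (rule homI)
    fix x y assume xy: "x \<in> carrier G" "y \<in> carrier G"
    show "f (x \<otimes>\<^bsub>G\<^esub> y) = f x \<otimes>\<^bsub>H\<^esub> f y"
      using xy h realizesD(3,4)[OF assms(1)] realizesD(3,4)[OF assms(2)]
      by (intro realizesD(5)[OF assms(2)]) (simp_all add: assms(5) additive.add[OF assms(4)])
  qed (rule h)
  moreover have "inj_on f (carrier G)"
  proof (rule inj_onI)
    fix x y assume xy: "x \<in> carrier G" "y \<in> carrier G" "f x = f y"
    have i: "inv\<^bsub>G\<^esub> y \<in> carrier G" "r (inv\<^bsub>G\<^esub> y) = - r y" using realizes_inv[OF assms(1) xy(2)] .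
    have "p (r x) = p (r y)" using assms(5) xy by metis
    then have "p (r (x \<otimes>\<^bsub>G\<^esub> inv\<^bsub>G\<^esub> y)) = 0"
      using realizesD(4)[OF assms(1) xy(1) i(1)] i(2) by (simp add: additive.diff[OF assms(4)])
    then have "r (x \<otimes>\<^bsub>G\<^esub> inv\<^bsub>G\<^esub> y) = 0" using assms(6) realizesD(3)[OF assms(1) xy(1) i(1)] by blast
    then have "r x = r y" using realizesD(4)[OF assms(1) xy(1) i(1)] i(2) by simp
    then show "x = y" using realizesD(5)[OF assms(1)] xy by blast
  qed
  ultimately show ?thesis using assms(3) by (simp add: iso_def bij_betw_def)
qed

subsection \<open>Quotients of free abelian groups\<close>

definition frag_subgroup :: "'a set \<Rightarrow> ('a \<Rightarrow>\<^sub>0 int) set \<Rightarrow> bool" where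
  "frag_subgroup S N \<longleftrightarrow> N \<subseteq> carrier (free_Abelian_group S) \<and> 0 \<in> N \<and> (\<forall>x\<in>N. \<forall>y\<in>N. x - y \<in> N)"

lemma frag_subgroup_imp_subgroup:
  assumes "frag_subgroup S N" shows "subgroup N (free_Abelian_group S)"
proof (rule subgroup.intro)
  have minus: "- x \<in> N" if "x \<in> N" for x using assms that unfolding frag_subgroup_def by (metis diff_0)
  show "x \<otimes>\<^bsub>free_Abelian_group S\<^esub> y \<in> N" if "x \<in> N" "y \<in> N" for x y
    using assms minus[OF that(2)] that unfolding frag_subgroup_def by (metis diff_minus_eq_add mult_free_Abelian_group)
  show "inv\<^bsub>free_Abelian_group S\<^esub> x \<in> N" if "x \<in> N" for x
    using assms minus[OF that] that unfolding frag_subgroup_def by (auto simp: inv_free_Abelian_group)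
qed (use assms in \<open>auto simp: frag_subgroup_def\<close>)

lemma coset_FAG: "N #>\<^bsub>free_Abelian_group S\<^esub> x = (\<lambda>h. h + x) ` N"
  by (auto simp: r_coset_def)

lemma induced_eq:
  assumes "z \<in> X" "\<And>x. x \<in> X \<Longrightarrow> f x = f z"
  shows "induced f X = f z"
proof -
  have "f ` X = {f z}" using assms by blast
  then show ?thesis by (simp add: induced_def)
qed

lemma induced_coset:
  assumes "frag_subgroup S N" "\<And>n. n \<in> N \<Longrightarrow> f (n + z) = f z"
  shows "induced f (N #>\<^bsub>free_Abelian_group S\<^esub> z) = f z"
proof (rule induced_eq)
  have "0 + z \<in> N #>\<^bsub>free_Abelian_group S\<^esub> z" using assms(1) unfolding coset_FAG frag_subgroup_def by blast
  then show "z \<in> N #>\<^bsub>free_Abelian_group S\<^esub> z" by simp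
  fix x assume "x \<in> N #>\<^bsub>free_Abelian_group S\<^esub> z"
  then obtain n where "n \<in> N" "x = n + z" unfolding coset_FAG by blast
  then show "f x = f z" using assms(2) by blast
qed

lemma realizes_quotient:
  assumes N: "frag_subgroup S N" and F: "additive F"
    and ker: "\<And>z. Poly_Mapping.keys z \<subseteq> S \<Longrightarrow> F z = 0 \<longleftrightarrow> z \<in> N"
  shows "realizes (free_Abelian_group S Mod N) (induced F)"
    "Poly_Mapping.keys z \<subseteq> S \<Longrightarrow> induced F (N #>\<^bsub>free_Abelian_group S\<^esub> z) = F z"
    "carrier (free_Abelian_group S Mod N) = (\<lambda>z. N #>\<^bsub>free_Abelian_group S\<^esub> z) ` {z. Poly_Mapping.keys z \<subseteq> S}"
proof -
  let ?A = "free_Abelian_group S"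
  interpret A: comm_group ?A by (rule abelian_free_Abelian_group)
  have sg: "subgroup N ?A" by (rule frag_subgroup_imp_subgroup[OF N])
  then have nm: "N \<lhd> ?A" by (rule A.subgroup_imp_normal)
  then interpret N: normal N ?A .
  show carr: "carrier (?A Mod N) = (\<lambda>z. N #>\<^bsub>?A\<^esub> z) ` {z. Poly_Mapping.keys z \<subseteq> S}"
    by (auto simp: carrier_FactGroup)
  have kill: "F n = 0" if "n \<in> N" for n
  proof -
    have "n \<in> carrier (free_Abelian_group S)" using N that unfolding frag_subgroup_def by blast
    then have "Poly_Mapping.keys n \<subseteq> S" by simp
    then show ?thesis using ker that by blast
  qed
  show ind: "induced F (N #>\<^bsub>?A\<^esub> z) = F z" for z
    by (rule induced_coset[OF N]) (simp add: additive.add[OF F] kill)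
  show "realizes (?A Mod N) (induced F)"
  proof (rule realizesI)
    show "comm_group (?A Mod N)" by (rule A.abelian_FactGroup[OF sg])
    fix X Y assume "X \<in> carrier (?A Mod N)" "Y \<in> carrier (?A Mod N)"
    then obtain x y where xy: "X = N #>\<^bsub>?A\<^esub> x" "Y = N #>\<^bsub>?A\<^esub> y" "Poly_Mapping.keys x \<subseteq> S" "Poly_Mapping.keys y \<subseteq> S"
      unfolding carr by blast
    then have "X \<otimes>\<^bsub>?A Mod N\<^esub> Y = N #>\<^bsub>?A\<^esub> (x + y)" using N.rcos_sum[of x y] by simp
    then show "induced F (X \<otimes>\<^bsub>?A Mod N\<^esub> Y) = induced F X + induced F Y"
      using ind xy by (simp add: additive.add[OF F])
  next
    fix X assume "X \<in> carrier (?A Mod N)" "induced F X = 0"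
    then obtain x where x: "X = N #>\<^bsub>?A\<^esub> x" "Poly_Mapping.keys x \<subseteq> S" "F x = 0"
      unfolding carr using ind by auto
    then have "x \<in> N" using ker by blast
    then show "X = \<one>\<^bsub>?A Mod N\<^esub>" using x(1) A.coset_join2[of x N] sg x(2) by simp
  qed
qed

lemma zspan_frag_induct [consumes 1, case_names zero base diff]:
  assumes "x \<in> zmod.span R" "P 0" "\<And>r. r \<in> R \<Longrightarrow> P r" "\<And>x y. P x \<Longrightarrow> P y \<Longrightarrow> P (x - y)"
  shows "P x"
proof (rule zmod.span_induct[OF assms(1), of "\<lambda>x. P x"])
  have minus: "P (- x)" if "P x" for x using assms(4)[OF assms(2) that] by simp
  have add: "P (x + y)" if "P x" "P y" for x y using assms(4)[OF that(1) minus[OF that(2)]] by simp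
  show "zmod.subspace (Collect P)"
  proof (rule zmod.subspaceI)
    show "zmul c x \<in> Collect P" if "x \<in> Collect P" for c x
      by (induction c rule: int_induct[of _ 0]) (use that in \<open>simp_all add: assms zmul_plus_one zmul_minus_one add del: zmul_frag\<close>)
  qed (simp_all add: assms(2) add)
qed (use assms(3) in auto)

lemma keys_zspan:
  assumes "\<And>r. r \<in> R \<Longrightarrow> Poly_Mapping.keys r \<subseteq> S" "x \<in> zmod.span R"
  shows "Poly_Mapping.keys x \<subseteq> S"
  using assms(2)
proof (induction rule: zspan_frag_induct)
  case (diff x y)
  then show ?case using keys_diff[of x y] by blast
qed (use assms(1) in auto)

lemma frag_subgroup_zspan:
  assumes "\<And>r. r \<in> R \<Longrightarrow> Poly_Mapping.keys r \<subseteq> S"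
  shows "frag_subgroup S (zmod.span R)"
  unfolding frag_subgroup_def using keys_zspan[OF assms] zmod.span_zero zmod.span_diff by auto

lemma relator_subgroup_eq:
  assumes "\<And>r. r \<in> R \<Longrightarrow> Poly_Mapping.keys r \<subseteq> S"
  shows "relator_subgroup S R = zmod.span R"
proof (intro equalityI subsetI)
  fix x assume "x \<in> relator_subgroup S R"
  then have "x \<in> generate (free_Abelian_group S) R" by (simp add: relator_subgroup_def)
  then show "x \<in> zmod.span R"
  proof induction
    case (inv h)
    then show ?case using assms by (simp add: zmod.span_neg zmod.span_base)
  qed (auto intro: zmod.span_zero zmod.span_base zmod.span_add)
next
  fix x assume x: "x \<in> zmod.span R"
  let ?A = "free_Abelian_group S"
  have R: "R \<subseteq> carrier ?A" using assms by auto
  interpret A: comm_group ?A by (rule abelian_free_Abelian_group)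
  have sg: "subgroup (generate ?A R) ?A" by (rule A.generate_is_subgroup[OF R])
  from x have "x \<in> generate ?A R"
  proof (induction rule: zspan_frag_induct)
    case zero
    then show ?case using generate.one[of ?A R] by simp
  next
    case (diff x y)
    have "y \<in> carrier ?A" using diff(2) subgroup.mem_carrier[OF sg] by blast
    then have "- y \<in> generate ?A R" using subgroup.m_inv_closed[OF sg diff(2)] by simp
    then show ?case using generate.eng[OF diff(1)] by fastforce
  qed (rule generate.incl)
  then show "x \<in> relator_subgroup S R" by (simp add: relator_subgroup_def)
qed

lemma realizes_presented:
  assumes R: "\<And>r. r \<in> R \<Longrightarrow> Poly_Mapping.keys r \<subseteq> S" and F: "additive F"
    and ker: "\<And>z. Poly_Mapping.keys z \<subseteq> S \<Longrightarrow> F z = 0 \<longleftrightarrow> z \<in> zmod.span R"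
  shows "realizes (presented S R) (induced F)"
    "Poly_Mapping.keys z \<subseteq> S \<Longrightarrow> induced F (presented_class S R z) = F z"
    "carrier (presented S R) = presented_class S R ` {z. Poly_Mapping.keys z \<subseteq> S}"
  using realizes_quotient[OF frag_subgroup_zspan[OF R] F ker]
  by (simp_all add: presented_def presented_class_def relator_subgroup_eq[OF R])

lemma induced_lin_extend:
  assumes R: "\<And>r. r \<in> R \<Longrightarrow> Poly_Mapping.keys r \<subseteq> S"
    and K: "realizes K s" and b: "\<And>i. i \<in> S \<Longrightarrow> b i \<in> carrier K"
    and kill: "\<And>r. r \<in> R \<Longrightarrow> ext (\<lambda>i. s (b i)) r = 0"
    and z: "Poly_Mapping.keys z \<subseteq> S"
  shows "induced (lin_extend K b) (presented_class S R z) = lin_extend K b z"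
    "s (induced (lin_extend K b) (presented_class S R z)) = ext (\<lambda>i. s (b i)) z"
    "induced (lin_extend K b) (presented_class S R z) \<in> carrier K"
proof -
  have kill': "ext (\<lambda>i. s (b i)) n = 0" if "n \<in> zmod.span R" for n
    using that by (induction rule: zspan_frag_induct) (simp_all add: kill)
  have rel: "relator_subgroup S R = zmod.span R" by (rule relator_subgroup_eq) (rule R)
  show e: "induced (lin_extend K b) (presented_class S R z) = lin_extend K b z"
    unfolding presented_class_def rel
  proof (rule induced_coset[OF frag_subgroup_zspan[OF R]])
    fix n assume n: "n \<in> zmod.span R"
    have "Poly_Mapping.keys (n + z) \<subseteq> S" using keys_zspan[OF R n] z keys_add[of n z] by blast
    then have "\<And>i. i \<in> Poly_Mapping.keys (n + z) \<Longrightarrow> b i \<in> carrier K" "\<And>i. i \<in> Poly_Mapping.keys z \<Longrightarrow> b i \<in> carrier K"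
      using b z by blast+
    then show "lin_extend K b (n + z) = lin_extend K b z"
      using realizes_lin_extend[OF K, of "n + z" b] realizes_lin_extend[OF K, of z b] kill'[OF n]
      by (intro realizesD(5)[OF K]) simp_all
  qed
  have "b i \<in> carrier K" if "i \<in> Poly_Mapping.keys z" for i using b z that by blast
  note l = realizes_lin_extend[where z = z and b = b, OF K this]
  show "s (induced (lin_extend K b) (presented_class S R z)) = ext (\<lambda>i. s (b i)) z"
    "induced (lin_extend K b) (presented_class S R z) \<in> carrier K" unfolding e using l by simp_all
qed

section \<open>The Lie and quasi-Lie groups\<close>

lemma set_mset_lm: "set_mset (lm J) = rlabels J" and size_lm: "size (lm J) = Suc (rorder J)"
  by (induction J) auto

text \<open>A rooted tree of order \<open>n\<close> has n + 1 leaves, hence the \<open>Suc\<close>;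
  in terms of brackets the degree is n + 1.\<close>

definition gdeg :: "nat \<Rightarrow> nat \<Rightarrow> nat multiset \<Rightarrow> bool" where
  "gdeg m n d \<longleftrightarrow> set_mset d \<subseteq> {1..m} \<and> size d = Suc n"

lemma rtrees_iff: "J \<in> rtrees m n \<longleftrightarrow> gdeg m n (lm J)"
  by (simp add: rtrees_def gdeg_def set_mset_lm size_lm)

lemma reversal_lm: "reversal p J J' \<Longrightarrow> lm J' = lm J"
  by (induction rule: reversal.induct) auto

lemma reversal_qt: "reversal p J J' \<Longrightarrow> qt J' = (if even p then qt J else - qt J)"
proof (induction rule: reversal.induct)
  case (2 p I I' q J J')
  then have "br (qt I') (qt J') = (if even (p + q) then br (qt I) (qt J) else - br (qt I) (qt J))"
    by (auto simp del: br_qt)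
  then show ?case by simp
next
  case (3 p I I' q J J')
  then have "br (qt J') (qt I') = (if even (Suc (p + q)) then br (qt I) (qt J) else - br (qt I) (qt J))"
    using br_anti[of "qt J" "qt I"] by (auto simp del: br_qt)
  then show ?case by simp
qed simp

lemma reversal_refl: "reversal 0 J J"
proof (induction J)
  case (Node A B)
  then show ?case using reversal.intros(2)[of 0 A A 0 B B] by simp
qed (rule reversal.intros)

lemma IHX_triple_lm: "IHX_triple I H X \<Longrightarrow> lm H = lm I \<and> lm X = lm I"
  by (induction rule: IHX_triple.induct) (auto simp: add_ac)

lemma IHX_triple_qt: "IHX_triple I H X \<Longrightarrow> qt I = qt H - qt X"
proof (induction rule: IHX_triple.induct)
  case (1 A B C)
  show ?case using br_jacobi[of "qt A" "qt B" "qt C"] by simp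
next
  case (2 I H X K)
  then have "br (qt I) (qt K) = br (qt H) (qt K) - br (qt X) (qt K)" by (simp del: br_qt)
  then show ?case by simp
next
  case (3 I H X K)
  then have "br (qt K) (qt I) = br (qt K) (qt H) - br (qt K) (qt X)" by (simp del: br_qt)
  then show ?case by simp
qed

definition all_quasi_relators :: "(rtree \<Rightarrow>\<^sub>0 int) set" where
  "all_quasi_relators = {frag_of J + frag_of J' | J J'. reversal 1 J J'} \<union>
     {frag_of I - frag_of H + frag_of X | I H X. IHX_triple I H X}"

text \<open>\<open>reversal\<close> and \<open>IHX_triple\<close> reach every subtree, so the
  relators are closed under products with a tree, and the ideal rules of \<open>qrel\<close> produce
  nothing beyond their span.\<close>

lemma qrel_in_span: "r \<in> qrel \<Longrightarrow> r \<in> zmod.span all_quasi_relators"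
proof (induction rule: qrel.induct)
  case (qrel_AS I J)
  have "reversal (Suc (0 + 0)) (Node I J) (Node J I)" by (intro reversal.intros reversal_refl)
  then have "frag_of (Node I J) + frag_of (Node J I) \<in> all_quasi_relators" unfolding all_quasi_relators_def by force
  then show ?case by (rule zmod.span_base)
next
  case (qrel_IHX A B C)
  have "IHX_triple (Node (Node A B) C) (Node A (Node B C)) (Node B (Node A C))" by (rule IHX_triple.intros)
  then have "frag_of (Node (Node A B) C) - frag_of (Node A (Node B C)) + frag_of (Node B (Node A C)) \<in> all_quasi_relators"
    unfolding all_quasi_relators_def by blast
  then show ?case by (rule zmod.span_base)
next
  case (qrel_left x J)
  from qrel_left(2) show ?case
  proof (induction rule: zspan_frag_induct)
    case (base r)
    have "magma_mult r (frag_of J) \<in> all_quasi_relators" using base unfolding all_quasi_relators_def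
    proof (elim UnE)
      assume "r \<in> {frag_of J + frag_of J' | J J'. reversal 1 J J'}"
      then obtain K K' where K: "r = frag_of K + frag_of K'" "reversal 1 K K'" by blast
      have "reversal (1 + 0) (Node K J) (Node K' J)" by (intro reversal.intros reversal_refl K)
      then show "magma_mult r (frag_of J) \<in> {frag_of J + frag_of J' | J J'. reversal 1 J J'} \<union>
          {frag_of I - frag_of H + frag_of X | I H X. IHX_triple I H X}"
        using K(1) by (intro UnI1) force
    next
      assume "r \<in> {frag_of I - frag_of H + frag_of X | I H X. IHX_triple I H X}"
      then obtain I H X where K: "r = frag_of I - frag_of H + frag_of X" "IHX_triple I H X" by blast
      have "IHX_triple (Node I J) (Node H J) (Node X J)" by (intro IHX_triple.intros K)
      then show "magma_mult r (frag_of J) \<in> {frag_of J + frag_of J' | J J'. reversal 1 J J'} \<union>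
          {frag_of I - frag_of H + frag_of X | I H X. IHX_triple I H X}"
        using K(1) by (intro UnI2) force
    qed
    then show ?case by (rule zmod.span_base)
  qed (simp_all add: zmod.span_zero zmod.span_diff)
next
  case (qrel_right x J)
  from qrel_right(2) show ?case
  proof (induction rule: zspan_frag_induct)
    case (base r)
    have "magma_mult (frag_of J) r \<in> all_quasi_relators" using base unfolding all_quasi_relators_def
    proof (elim UnE)
      assume "r \<in> {frag_of J + frag_of J' | J J'. reversal 1 J J'}"
      then obtain K K' where K: "r = frag_of K + frag_of K'" "reversal 1 K K'" by blast
      have "reversal (0 + 1) (Node J K) (Node J K')" by (intro reversal.intros reversal_refl K)
      then show "magma_mult (frag_of J) r \<in> {frag_of J + frag_of J' | J J'. reversal 1 J J'} \<union>
          {frag_of I - frag_of H + frag_of X | I H X. IHX_triple I H X}"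
        using K(1) by (intro UnI1) force
    next
      assume "r \<in> {frag_of I - frag_of H + frag_of X | I H X. IHX_triple I H X}"
      then obtain I H X where K: "r = frag_of I - frag_of H + frag_of X" "IHX_triple I H X" by blast
      have "IHX_triple (Node J I) (Node J H) (Node J X)" by (intro IHX_triple.intros K)
      then show "magma_mult (frag_of J) r \<in> {frag_of J + frag_of J' | J J'. reversal 1 J J'} \<union>
          {frag_of I - frag_of H + frag_of X | I H X. IHX_triple I H X}"
        using K(1) by (intro UnI2) force
    qed
    then show ?case by (rule zmod.span_base)
  qed (simp_all add: zmod.span_zero zmod.span_diff)
qed (simp_all add: zmod.span_zero zmod.span_diff)

lemma quasi_relators_props:
  assumes "r \<in> quasi_relators m n"
  shows "Poly_Mapping.keys r \<subseteq> rtrees m (n - 1)" "qc r = 0"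
proof -
  have k3: "Poly_Mapping.keys (frag_of a - frag_of b + frag_of c) \<subseteq> {a, b, c}"
    "Poly_Mapping.keys (frag_of a + frag_of b) \<subseteq> {a, b}" for a b c :: rtree
    using keys_add[of "frag_of a - frag_of b" "frag_of c"] keys_diff[of "frag_of a" "frag_of b"] keys_add[of "frag_of a" "frag_of b"]
    by auto
  consider J J' where "r = frag_of J + frag_of J'" "J \<in> rtrees m (n - 1)" "reversal 1 J J'"
    | I H X where "r = frag_of I - frag_of H + frag_of X" "I \<in> rtrees m (n - 1)" "IHX_triple I H X"
    using assms unfolding quasi_relators_def by blast
  then have "Poly_Mapping.keys r \<subseteq> rtrees m (n - 1) \<and> qc r = 0"
  proof cases
    case 1
    then have "J' \<in> rtrees m (n - 1)" using reversal_lm[OF 1(3)] by (simp add: rtrees_iff)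
    moreover have "qt J' = - qt J" using reversal_qt[OF 1(3)] by simp
    ultimately show ?thesis using 1 k3(2)[of J J'] by auto
  next
    case 2
    then have "H \<in> rtrees m (n - 1)" "X \<in> rtrees m (n - 1)" using IHX_triple_lm[OF 2(3)] by (simp_all add: rtrees_iff)
    then show ?thesis using 2 k3(1)[of I H X] IHX_triple_qt[OF 2(3)] by auto
  qed
  then show "Poly_Mapping.keys r \<subseteq> rtrees m (n - 1)" "qc r = 0" by blast+
qed

text \<open>An element of \<open>qrel\<close> may a priori combine relators of all degrees and
  labels. All trees of one relator have the same multidegree, so truncation to \<open>rtrees\<close>
  either keeps a relator or deletes it.\<close>

lemma quasi_span_iff:
  assumes "Poly_Mapping.keys z \<subseteq> rtrees m (n - 1)"
  shows "qc z = 0 \<longleftrightarrow> z \<in> zmod.span (quasi_relators m n)"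
proof
  assume "z \<in> zmod.span (quasi_relators m n)"
  then show "qc z = 0"
    by (induction rule: zspan_frag_induct) (simp_all add: quasi_relators_props)
next
  assume "qc z = 0"
  then have "z \<in> zmod.span all_quasi_relators" by (intro qrel_in_span) (simp add: qc_eq_0_iff)
  then have "restr (rtrees m (n - 1)) z \<in> zmod.span (quasi_relators m n)"
  proof (induction rule: zspan_frag_induct)
    case (base r)
    then show ?case unfolding all_quasi_relators_def
    proof (elim UnE)
      assume "r \<in> {frag_of J + frag_of J' | J J'. reversal 1 J J'}"
      then obtain K K' where K: "r = frag_of K + frag_of K'" "reversal 1 K K'" by blast
      have "K' \<in> rtrees m (n - 1) \<longleftrightarrow> K \<in> rtrees m (n - 1)" using reversal_lm[OF K(2)] by (simp add: rtrees_iff)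
      moreover have "r \<in> quasi_relators m n" if "K \<in> rtrees m (n - 1)" using K that unfolding quasi_relators_def by blast
      ultimately show ?thesis by (auto simp: K(1) restr_frag_of zmod.span_zero intro: zmod.span_base)
    next
      assume "r \<in> {frag_of I - frag_of H + frag_of X | I H X. IHX_triple I H X}"
      then obtain I H X where K: "r = frag_of I - frag_of H + frag_of X" "IHX_triple I H X" by blast
      have "(H \<in> rtrees m (n - 1) \<longleftrightarrow> I \<in> rtrees m (n - 1)) \<and> (X \<in> rtrees m (n - 1) \<longleftrightarrow> I \<in> rtrees m (n - 1))"
        using IHX_triple_lm[OF K(2)] by (simp add: rtrees_iff)
      moreover have "r \<in> quasi_relators m n" if "I \<in> rtrees m (n - 1)" using K that unfolding quasi_relators_def by blast
      ultimately show ?thesis by (auto simp: K(1) restr_frag_of zmod.span_zero intro: zmod.span_base)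
    qed
  qed (simp_all add: zmod.span_zero zmod.span_diff)
  then show "z \<in> zmod.span (quasi_relators m n)" using restr_id[OF assms] by simp
qed

definition rQ :: "(rtree \<Rightarrow>\<^sub>0 int) set \<Rightarrow> qlie" where "rQ = induced qc"

lemma realizes_quasiL: "realizes (quasiL_group m n) rQ"
  and rQ_class: "Poly_Mapping.keys z \<subseteq> rtrees m (n - 1) \<Longrightarrow> rQ (quasi_class m n z) = qc z"
  and carrier_quasiL: "carrier (quasiL_group m n) = quasi_class m n ` {z. Poly_Mapping.keys z \<subseteq> rtrees m (n - 1)}"
  using realizes_presented[OF quasi_relators_props(1) additive_qc quasi_span_iff, of m n]
  by (simp_all add: quasiL_group_def quasi_class_def rQ_def)

lemma qproj_gdeg_iff: "qproj (gdeg m n) u = u \<longleftrightarrow> (\<exists>z. Poly_Mapping.keys z \<subseteq> rtrees m n \<and> u = qc z)"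
proof
  assume u: "qproj (gdeg m n) u = u"
  obtain z where z: "u = qc z" using qc_surj by blast
  have "u = qc (restr {J. gdeg m n (lm J)} z)" using u z by (simp add: qproj_qc)
  moreover have "Poly_Mapping.keys (restr {J. gdeg m n (lm J)} z) \<subseteq> rtrees m n"
    by (auto simp: keys_restr rtrees_iff)
  ultimately show "\<exists>z. Poly_Mapping.keys z \<subseteq> rtrees m n \<and> u = qc z" by blast
next
  assume "\<exists>z. Poly_Mapping.keys z \<subseteq> rtrees m n \<and> u = qc z"
  then obtain z where z: "Poly_Mapping.keys z \<subseteq> rtrees m n" "u = qc z" by blast
  then have "restr {J. gdeg m n (lm J)} z = z" by (intro restr_id) (auto simp: rtrees_iff)
  then show "qproj (gdeg m n) u = u" using z by (simp add: qproj_qc)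
qed

lemma rQ_image: "rQ ` carrier (quasiL_group m n) = {u. qproj (gdeg m (n - 1)) u = u}"
proof -
  have "rQ ` carrier (quasiL_group m n) = qc ` {z. Poly_Mapping.keys z \<subseteq> rtrees m (n - 1)}"
    unfolding carrier_quasiL image_image by (intro image_cong) (simp_all add: rQ_class)
  also have "\<dots> = {u. qproj (gdeg m (n - 1)) u = u}" unfolding qproj_gdeg_iff by blast
  finally show ?thesis .
qed

lemma rQ_closed: "x \<in> carrier (quasiL_group m n) \<Longrightarrow> qproj (gdeg m (n - 1)) (rQ x) = rQ x"
  using rQ_image[of m n] by blast

lemma quasi_class_closed: "Poly_Mapping.keys z \<subseteq> rtrees m (n - 1) \<Longrightarrow> quasi_class m n z \<in> carrier (quasiL_group m n)"
  unfolding carrier_quasiL by blast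

lemma keys_magma_mult:
  assumes "K \<in> Poly_Mapping.keys (magma_mult x y)"
  shows "\<exists>I\<in>Poly_Mapping.keys x. \<exists>J\<in>Poly_Mapping.keys y. K = Node I J"
proof -
  obtain I where I: "I \<in> Poly_Mapping.keys x" "K \<in> Poly_Mapping.keys (frag_extend (\<lambda>J. frag_of (Node I J)) y)"
    using assms keys_frag_extend[of "\<lambda>I. frag_extend (\<lambda>J. frag_of (Node I J)) y" x] unfolding magma_mult_def by blast
  then obtain J where "J \<in> Poly_Mapping.keys y" "K \<in> Poly_Mapping.keys (frag_of (Node I J))"
    using keys_frag_extend[of "\<lambda>J. frag_of (Node I J)" y] by blast
  then show ?thesis using I(1) by auto
qed

text \<open>The class of a product of representatives has the realization [rQ X, rQ Y], whatever the
  representatives; so the set in the definition of the bracket has one element.\<close>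

lemma quasi_bracket_closed:
  assumes "1 \<le> a" "1 \<le> b" "X \<in> carrier (quasiL_group m a)" "Y \<in> carrier (quasiL_group m b)"
  shows "quasi_bracket m a b X Y \<in> carrier (quasiL_group m (a + b))" "rQ (quasi_bracket m a b X Y) = br (rQ X) (rQ Y)"
proof -
  have c: "Poly_Mapping.keys (magma_mult x y) \<subseteq> rtrees m (a + b - 1)"
    if xy: "Poly_Mapping.keys x \<subseteq> rtrees m (a - 1)" "Poly_Mapping.keys y \<subseteq> rtrees m (b - 1)" for x y
  proof
    fix K assume "K \<in> Poly_Mapping.keys (magma_mult x y)"
    then obtain I J where "K = Node I J" "I \<in> rtrees m (a - 1)" "J \<in> rtrees m (b - 1)"
      using keys_magma_mult[of K x y] xy by blast
    then show "K \<in> rtrees m (a + b - 1)" using assms(1,2) by (auto simp: rtrees_def)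
  qed
  have mem: "x \<in> X \<Longrightarrow> Poly_Mapping.keys x \<subseteq> rtrees m (k - 1) \<and> qc x = rQ X"
    and rep: "\<exists>x. x \<in> X" if X: "X \<in> carrier (quasiL_group m k)" for X x k
  proof -
    obtain z where z: "X = quasi_class m k z" "Poly_Mapping.keys z \<subseteq> rtrees m (k - 1)" using X unfolding carrier_quasiL by blast
    have X_eq: "X = (\<lambda>h. h + z) ` zmod.span (quasi_relators m k)"
      unfolding z(1) quasi_class_def presented_class_def coset_FAG
      by (subst relator_subgroup_eq) (rule quasi_relators_props(1), assumption, rule refl)
    show "\<exists>x. x \<in> X" unfolding X_eq using zmod.span_zero by blast
    assume "x \<in> X"
    then obtain h where h: "h \<in> zmod.span (quasi_relators m k)" "x = h + z" unfolding X_eq by blast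
    have "Poly_Mapping.keys h \<subseteq> rtrees m (k - 1)" using keys_zspan[OF quasi_relators_props(1) h(1)] .
    moreover from this have "qc h = 0" using quasi_span_iff h(1) by blast
    ultimately show "Poly_Mapping.keys x \<subseteq> rtrees m (k - 1) \<and> qc x = rQ X"
      using h(2) z rQ_class[OF z(2)] keys_add[of h z] by auto
  qed
  obtain x y where xy: "x \<in> X" "y \<in> Y" using rep[OF assms(3)] rep[OF assms(4)] by blast
  define f where "f = (\<lambda>(x, y). quasi_class m (a + b) (magma_mult x y))"
  have f: "f p \<in> carrier (quasiL_group m (a + b)) \<and> rQ (f p) = br (rQ X) (rQ Y)" if pXY: "p \<in> X \<times> Y" for p
  proof -
    obtain x y where p: "p = (x, y)" "x \<in> X" "y \<in> Y" using pXY by blast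
    have k: "Poly_Mapping.keys (magma_mult x y) \<subseteq> rtrees m (a + b - 1)"
      using c mem[OF assms(3) p(2)] mem[OF assms(4) p(3)] by blast
    then show ?thesis
      using quasi_class_closed[OF k] rQ_class[OF k] mem[OF assms(3) p(2)] mem[OF assms(4) p(3)] p(1)
      by (simp add: f_def br_qc[symmetric])
  qed
  have "quasi_bracket m a b X Y = induced f (X \<times> Y)" by (simp add: quasi_bracket_def induced_def f_def)
  also have "\<dots> = f (x, y)"
  proof (rule induced_eq)
    fix p assume p: "p \<in> X \<times> Y"
    have q: "(x, y) \<in> X \<times> Y" using xy by blast
    show "f p = f (x, y)" using realizesD(5)[OF realizes_quasiL] f[OF p] f[OF q] by metis
  qed (use xy in blast)
  finally have e: "quasi_bracket m a b X Y = f (x, y)" .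
  have q: "(x, y) \<in> X \<times> Y" using xy by blast
  show "quasi_bracket m a b X Y \<in> carrier (quasiL_group m (a + b))" "rQ (quasi_bracket m a b X Y) = br (rQ X) (rQ Y)"
    using f[OF q] e by simp_all
qed

subsection \<open>The free Lie ring\<close>

definition mtrees :: "nat \<Rightarrow> rtree set" where "mtrees m = {J. rlabels J \<subseteq> {1..m}}"

lemma mtrees_Node [simp]: "Node I J \<in> mtrees m \<longleftrightarrow> I \<in> mtrees m \<and> J \<in> mtrees m"
  by (auto simp: mtrees_def)

lemma carrier_magma_ring: "x \<in> carrier (magma_ring m) \<longleftrightarrow> Poly_Mapping.keys x \<subseteq> mtrees m"
  by (simp add: magma_ring_def mtrees_def)

lemma magma_mult_closed:
  "x \<in> carrier (magma_ring m) \<Longrightarrow> y \<in> carrier (magma_ring m) \<Longrightarrow> magma_mult x y \<in> carrier (magma_ring m)"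
  unfolding carrier_magma_ring by (rule subsetI, drule keys_magma_mult) auto

lemma carrier_magma_ring_diff:
  "x \<in> carrier (magma_ring m) \<Longrightarrow> y \<in> carrier (magma_ring m) \<Longrightarrow> x - y \<in> carrier (magma_ring m)"
  "x \<in> carrier (magma_ring m) \<Longrightarrow> y \<in> carrier (magma_ring m) \<Longrightarrow> x + y \<in> carrier (magma_ring m)"
  unfolding carrier_magma_ring using keys_diff[of x y] keys_add[of x y] by blast+

lemma restr_mtrees_mult: "restr (mtrees m) (magma_mult x y) = magma_mult (restr (mtrees m) x) (restr (mtrees m) y)"
proof (induction x rule: frag_induct)
  case (one I)
  show ?case by (induction y rule: frag_induct) (auto simp: restr_frag_of)
qed simp_all

lemma restr_mtrees_closed: "restr (mtrees m) x \<in> carrier (magma_ring m)"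
  by (simp add: carrier_magma_ring keys_restr)

lemma Lie_ideal_add: "x \<in> Lie_ideal m \<Longrightarrow> y \<in> Lie_ideal m \<Longrightarrow> x + y \<in> Lie_ideal m"
  using Lie_ideal.intros(2)[of x m "0 - y"] Lie_ideal.intros(2)[of 0 m y] Lie_ideal.intros(1) by simp

lemma Lie_ideal_anti:
  assumes "x \<in> carrier (magma_ring m)" "y \<in> carrier (magma_ring m)"
  shows "magma_mult x y + magma_mult y x \<in> Lie_ideal m"
proof -
  have "magma_mult (x + y) (x + y) - magma_mult x x - magma_mult y y \<in> Lie_ideal m"
    using assms by (intro Lie_ideal.intros carrier_magma_ring_diff)
  then show ?thesis by (simp add: algebra_simps)
qed

lemma qrel_Lie_ideal: "r \<in> qrel \<Longrightarrow> restr (mtrees m) r \<in> Lie_ideal m"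
proof (induction rule: qrel.induct)
  case (qrel_AS I J)
  show ?case
    using Lie_ideal_anti[OF restr_mtrees_closed[of m "frag_of I"] restr_mtrees_closed[of m "frag_of J"]]
    by (simp add: restr_mtrees_mult[symmetric])
next
  case (qrel_IHX A B C)
  let ?r = "\<lambda>X. restr (mtrees m) (frag_of X)"
  have c: "?r X \<in> carrier (magma_ring m)" for X by (rule restr_mtrees_closed)
  \<comment> \<open>The cyclic Jacobi expression, with multiples of antisymmetry expressions added
    so that the last two summands take the form of the IHX relation.\<close>
  have "magma_mult (magma_mult (?r A) (?r B)) (?r C) + magma_mult (magma_mult (?r B) (?r C)) (?r A) + magma_mult (magma_mult (?r C) (?r A)) (?r B)
     - (magma_mult (?r A) (magma_mult (?r B) (?r C)) + magma_mult (magma_mult (?r B) (?r C)) (?r A))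
     - (magma_mult (magma_mult (?r A) (?r C) + magma_mult (?r C) (?r A)) (?r B))
     + (magma_mult (?r B) (magma_mult (?r A) (?r C)) + magma_mult (magma_mult (?r A) (?r C)) (?r B)) \<in> Lie_ideal m"
    by (intro Lie_ideal_add Lie_ideal.intros(2) Lie_ideal.intros(3,6) Lie_ideal_anti c magma_mult_closed)
  then have "magma_mult (magma_mult (?r A) (?r B)) (?r C) - magma_mult (?r A) (magma_mult (?r B) (?r C))
      + magma_mult (?r B) (magma_mult (?r A) (?r C)) \<in> Lie_ideal m"
    by (simp add: algebra_simps)
  then show ?case by (simp add: restr_mtrees_mult[symmetric])
next
  case (qrel_left x J)
  then show ?case unfolding restr_mtrees_mult by (intro Lie_ideal.intros(3) restr_mtrees_closed)
next
  case (qrel_right x J)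
  then show ?case unfolding restr_mtrees_mult by (intro Lie_ideal.intros(4) restr_mtrees_closed)
qed (simp_all add: Lie_ideal.intros(1,2))

definition kz :: "(rtree \<Rightarrow>\<^sub>0 int) \<Rightarrow> assoc" where "kz z = kap (qc z)"

lemma additive_kz: "additive kz"
  by (simp add: additive_def kz_def)

lemma kz_mult: "kz (magma_mult x y) = kz x * kz y - kz y * kz x"
  by (simp add: kz_def br_qc[symmetric] kap_br)

lemma Lie_ideal_props: "x \<in> Lie_ideal m \<Longrightarrow> x \<in> carrier (magma_ring m) \<and> kz x = 0"
proof (induction rule: Lie_ideal.induct)
  case 1
  then show ?case by (simp add: carrier_magma_ring additive.zero[OF additive_kz])
next
  case (2 x y)
  then show ?case by (simp add: carrier_magma_ring_diff additive.diff[OF additive_kz])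
next
  case (3 x y)
  then show ?case by (simp add: magma_mult_closed kz_mult)
next
  case (4 x y)
  then show ?case by (simp add: magma_mult_closed kz_mult)
next
  case (5 x)
  then show ?case by (simp add: magma_mult_closed kz_mult)
next
  case (6 x y z)
  then show ?case
    by (auto intro!: magma_mult_closed carrier_magma_ring_diff simp: kz_mult additive.add[OF additive_kz] algebra_simps)
qed

text \<open>Identifies the free Lie ring with its image in the associative ring. An element killed
  by \<open>kap\<close> is a square modulo \<open>qrel\<close> by \<open>kap_eq_0D\<close>, and both
  squares and truncated quasi-Lie relations belong to the ideal.\<close>

lemma Lie_ideal_iff:
  assumes "Poly_Mapping.keys z \<subseteq> mtrees m"
  shows "kz z = 0 \<longleftrightarrow> z \<in> Lie_ideal m"
proof
  assume "kz z = 0"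
  then obtain y where "qc z = br y y" using kap_eq_0D unfolding kz_def by blast
  moreover obtain w where w: "y = qc w" using qc_surj by blast
  ultimately have "z - magma_mult w w \<in> qrel" by (simp add: br_qc qc_eq_iff)
  then have "restr (mtrees m) (z - magma_mult w w) \<in> Lie_ideal m" by (rule qrel_Lie_ideal)
  then have "z - magma_mult (restr (mtrees m) w) (restr (mtrees m) w) \<in> Lie_ideal m"
    using restr_id[OF assms] by (simp add: restr_mtrees_mult)
  from Lie_ideal_add[OF this Lie_ideal.intros(5)[OF restr_mtrees_closed[of m w]]] show "z \<in> Lie_ideal m" by simp
qed (use Lie_ideal_props in blast)

lemma frag_subgroup_Lie_ideal: "frag_subgroup (mtrees m) (Lie_ideal m)"
  unfolding frag_subgroup_def using Lie_ideal_props Lie_ideal.intros(1,2) by (auto simp: carrier_magma_ring)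

definition rL :: "(rtree \<Rightarrow>\<^sub>0 int) set \<Rightarrow> assoc" where "rL = induced kz"

lemma realizes_free_Lie: "realizes (free_Lie m) rL"
  and rL_class: "Poly_Mapping.keys z \<subseteq> mtrees m \<Longrightarrow> rL (Lie_class m z) = kz z"
  and carrier_free_Lie: "carrier (free_Lie m) = Lie_class m ` {z. Poly_Mapping.keys z \<subseteq> mtrees m}"
  using realizes_quotient[OF frag_subgroup_Lie_ideal additive_kz Lie_ideal_iff, of m]
  by (simp_all add: free_Lie_def Lie_class_def magma_ring_def rL_def mtrees_def)

lemma rtrees_mtrees: "rtrees m n \<subseteq> mtrees m"
  by (auto simp: rtrees_def mtrees_def)

lemma carrier_L_group: "carrier (L_group m n) = Lie_class m ` {z. Poly_Mapping.keys z \<subseteq> rtrees m (n - 1)}"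
  by (auto simp: L_group_def)

lemma rL_class': "Poly_Mapping.keys z \<subseteq> rtrees m n \<Longrightarrow> rL (Lie_class m z) = kz z"
  using rL_class rtrees_mtrees by blast

lemma Lie_class_eqI:
  assumes "X \<in> carrier (free_Lie m)" "Poly_Mapping.keys z \<subseteq> mtrees m" "rL X = kz z"
  shows "X = Lie_class m z"
proof (rule realizesD(5)[OF realizes_free_Lie assms(1)])
  show "Lie_class m z \<in> carrier (free_Lie m)" unfolding carrier_free_Lie using assms(2) by blast
  show "rL X = rL (Lie_class m z)" using assms(2,3) by (simp add: rL_class)
qed

lemma realizes_L: "realizes (L_group m n) rL"
  unfolding L_group_def
proof (rule realizes_subset[OF realizes_free_Lie])
  let ?H = "Lie_class m ` carrier (free_Abelian_group (rtrees m (n - 1)))"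
  note k = subset_trans[OF _ rtrees_mtrees]
  show "?H \<subseteq> carrier (free_Lie m)" 
    unfolding carrier_free_Lie
  proof (rule image_mono)
    show "carrier (free_Abelian_group (rtrees m (n - 1))) \<subseteq> {z. Poly_Mapping.keys z \<subseteq> mtrees m}"
    proof
      fix x assume "x \<in> carrier (free_Abelian_group (rtrees m (n - 1)))"
      then show "x \<in> {z. Poly_Mapping.keys z \<subseteq> mtrees m}" using k[of "Poly_Mapping.keys x" m "n - 1"] by simp
    qed
  qed
  show "\<one>\<^bsub>free_Lie m\<^esub> \<in> ?H"
  proof (rule image_eqI)
    show "\<one>\<^bsub>free_Lie m\<^esub> = Lie_class m 0"
      by (rule Lie_class_eqI) (simp_all add: realizesD[OF realizes_free_Lie] additive.zero[OF additive_kz])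
  qed simp
  fix X assume "X \<in> ?H"
  then obtain x where x: "X = Lie_class m x" "Poly_Mapping.keys x \<subseteq> rtrees m (n - 1)" by auto
  have X: "X \<in> carrier (free_Lie m)" "rL X = kz x" unfolding carrier_free_Lie using x k[OF x(2)] rL_class by auto
  show "\<exists>Y\<in>?H. rL Y = - rL X"
    using x rL_class'[OF x(2)] rL_class'[of "- x" m "n - 1"]
    by (intro bexI[of _ "Lie_class m (- x)"]) (auto simp: additive.minus[OF additive_kz])
  fix Y assume "Y \<in> ?H"
  then obtain y where y: "Y = Lie_class m y" "Poly_Mapping.keys y \<subseteq> rtrees m (n - 1)" by auto
  have Y: "Y \<in> carrier (free_Lie m)" "rL Y = kz y" unfolding carrier_free_Lie using y k[OF y(2)] rL_class by auto
  have xy: "Poly_Mapping.keys (x + y) \<subseteq> rtrees m (n - 1)" using keys_add[of x y] x y by blast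
  have "X \<otimes>\<^bsub>free_Lie m\<^esub> Y = Lie_class m (x + y)"
    using X Y k[OF xy] by (intro Lie_class_eqI) (simp_all add: realizesD[OF realizes_free_Lie] additive.add[OF additive_kz])
  then show "X \<otimes>\<^bsub>free_Lie m\<^esub> Y \<in> ?H" using xy by auto
qed

lemma rL_image: "rL ` carrier (L_group m n) = kap ` {u. qproj (gdeg m (n - 1)) u = u}"
proof -
  have "rL ` carrier (L_group m n) = kap ` qc ` {z. Poly_Mapping.keys z \<subseteq> rtrees m (n - 1)}"
    unfolding carrier_L_group image_image by (intro image_cong) (simp_all add: rL_class' kz_def)
  also have "qc ` {z. Poly_Mapping.keys z \<subseteq> rtrees m (n - 1)} = {u. qproj (gdeg m (n - 1)) u = u}"
    unfolding qproj_gdeg_iff by blast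
  finally show ?thesis .
qed

lemma Lie_class_closed: "Poly_Mapping.keys z \<subseteq> rtrees m (n - 1) \<Longrightarrow> Lie_class m z \<in> carrier (L_group m n)"
  unfolding carrier_L_group by blast

lemma mem_Lie_class:
  assumes "Poly_Mapping.keys z \<subseteq> mtrees m"
  shows "z \<in> Lie_class m z" "x \<in> Lie_class m z \<Longrightarrow> Poly_Mapping.keys x \<subseteq> mtrees m \<and> kz x = kz z"
proof -
  have e: "Lie_class m z = (\<lambda>h. h + z) ` Lie_ideal m"
    by (simp add: Lie_class_def magma_ring_def coset_FAG)
  show "z \<in> Lie_class m z" unfolding e using Lie_ideal.intros(1)[of m] by (metis add_0 image_eqI)
  assume "x \<in> Lie_class m z"
  then obtain h where h: "h \<in> Lie_ideal m" "x = h + z" unfolding e by blast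
  then show "Poly_Mapping.keys x \<subseteq> mtrees m \<and> kz x = kz z"
    using Lie_ideal_props[OF h(1)] assms keys_add[of h z] by (auto simp: carrier_magma_ring additive.add[OF additive_kz])
qed

lemma Lie_bracket_closed:
  assumes "1 \<le> a" "1 \<le> b" "X \<in> carrier (L_group m a)" "Y \<in> carrier (L_group m b)"
  shows "Lie_bracket m X Y \<in> carrier (L_group m (a + b))" "rL (Lie_bracket m X Y) = rL X * rL Y - rL Y * rL X"
proof -
  obtain x y where x: "X = Lie_class m x" "Poly_Mapping.keys x \<subseteq> rtrees m (a - 1)"
    and y: "Y = Lie_class m y" "Poly_Mapping.keys y \<subseteq> rtrees m (b - 1)" using assms(3,4) unfolding carrier_L_group by blast
  note kx = subset_trans[OF x(2) rtrees_mtrees] and ky = subset_trans[OF y(2) rtrees_mtrees]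
  define f where "f = (\<lambda>(x, y). Lie_class m (magma_mult x y))"
  have k: "Poly_Mapping.keys (magma_mult u w) \<subseteq> mtrees m" if "Poly_Mapping.keys u \<subseteq> mtrees m" "Poly_Mapping.keys w \<subseteq> mtrees m" for u w
    using magma_mult_closed[of u m w] that by (simp add: carrier_magma_ring)
  have "Lie_bracket m X Y = induced f (X \<times> Y)" by (simp add: Lie_bracket_def induced_def f_def)
  also have "\<dots> = f (x, y)"
  proof (rule induced_eq)
    show "(x, y) \<in> X \<times> Y" using mem_Lie_class(1)[OF kx] mem_Lie_class(1)[OF ky] x(1) y(1) by blast
    fix p assume "p \<in> X \<times> Y"
    then obtain u w where p: "p = (u, w)" "u \<in> Lie_class m x" "w \<in> Lie_class m y" using x(1) y(1) by blast
    have u: "Poly_Mapping.keys u \<subseteq> mtrees m" "kz u = kz x" and w: "Poly_Mapping.keys w \<subseteq> mtrees m" "kz w = kz y"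
      using mem_Lie_class(2)[OF kx p(2)] mem_Lie_class(2)[OF ky p(3)] by auto
    have "Lie_class m (magma_mult u w) = Lie_class m (magma_mult x y)"
      using k[OF u(1) w(1)] k[OF kx ky] by (intro Lie_class_eqI) (auto simp: carrier_free_Lie rL_class kz_mult u w)
    then show "f p = f (x, y)" by (simp add: f_def p(1))
  qed
  finally have e: "Lie_bracket m X Y = Lie_class m (magma_mult x y)" by (simp add: f_def)
  have "Poly_Mapping.keys (magma_mult x y) \<subseteq> rtrees m (a + b - 1)"
  proof
    fix K assume "K \<in> Poly_Mapping.keys (magma_mult x y)"
    then obtain I J where "K = Node I J" "I \<in> rtrees m (a - 1)" "J \<in> rtrees m (b - 1)"
      using keys_magma_mult[of K x y] x(2) y(2) by blast
    then show "K \<in> rtrees m (a + b - 1)" using assms(1,2) by (auto simp: rtrees_def)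
  qed
  then show "Lie_bracket m X Y \<in> carrier (L_group m (a + b))" unfolding e by (rule Lie_class_closed)
  show "rL (Lie_bracket m X Y) = rL X * rL Y - rL Y * rL X"
    unfolding e rL_class[OF k[OF kx ky]] unfolding x(1) y(1) rL_class[OF kx] rL_class[OF ky] by (rule kz_mult)
qed

lemma quasi_proj_closed:
  assumes "X \<in> carrier (quasiL_group m n)"
  shows "quasi_proj m X \<in> carrier (L_group m n)" "rL (quasi_proj m X) = kap (rQ X)"
proof -
  obtain z where z: "X = quasi_class m n z" "Poly_Mapping.keys z \<subseteq> rtrees m (n - 1)" using assms unfolding carrier_quasiL by blast
  note kz = subset_trans[OF z(2) rtrees_mtrees]
  have rel: "relator_subgroup (rtrees m (n - 1)) (quasi_relators m n) = zmod.span (quasi_relators m n)"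
    by (rule relator_subgroup_eq) (rule quasi_relators_props(1))
  have "quasi_proj m X = Lie_class m z"
    unfolding quasi_proj_def z(1) quasi_class_def presented_class_def rel
  proof (rule induced_coset[OF frag_subgroup_zspan[OF quasi_relators_props(1)]])
    fix h assume h: "h \<in> zmod.span (quasi_relators m n)"
    have "Poly_Mapping.keys h \<subseteq> rtrees m (n - 1)" using keys_zspan[OF quasi_relators_props(1) h] .
    moreover from this have "qc h = 0" using quasi_span_iff h by blast
    moreover have "Poly_Mapping.keys (h + z) \<subseteq> Poly_Mapping.keys h \<union> Poly_Mapping.keys z" by (rule keys_add)
    ultimately have "kz (h + z) = kz z" "Poly_Mapping.keys (h + z) \<subseteq> mtrees m"
      using kz rtrees_mtrees[of m "n - 1"] by (simp add: kz_def, blast)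
    then show "Lie_class m (h + z) = Lie_class m z"
      using kz by (intro Lie_class_eqI) (auto simp: carrier_free_Lie rL_class)
  qed
  then show "quasi_proj m X \<in> carrier (L_group m n)" "rL (quasi_proj m X) = kap (rQ X)"
    using Lie_class_closed[OF z(2)] rL_class'[OF z(2)] rQ_class[OF z(2)] z(1) by (simp_all add: kz_def)
qed

section \<open>Tensor products\<close>

lemma realizes_gen:
  assumes G: "realizes G r" and F: "additive F"
    and carr: "carrier G = cl ` {z. Poly_Mapping.keys z \<subseteq> S}"
    and cl: "\<And>z. Poly_Mapping.keys z \<subseteq> S \<Longrightarrow> r (cl z) = F z"
    and P: "P \<one>\<^bsub>G\<^esub>" "\<And>s. s \<in> S \<Longrightarrow> P (cl (frag_of s))"
      "\<And>x y. x \<in> carrier G \<Longrightarrow> y \<in> carrier G \<Longrightarrow> P x \<Longrightarrow> P y \<Longrightarrow> P (x \<otimes>\<^bsub>G\<^esub> inv\<^bsub>G\<^esub> y)"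
    and x: "x \<in> carrier G"
  shows "P x"
proof -
  obtain z where z: "x = cl z" "Poly_Mapping.keys z \<subseteq> S" using x carr by blast
  have "Poly_Mapping.keys z \<subseteq> S \<and> P (cl z)" using z(2)
  proof (induction z rule: frag_induction)
    case zero
    have "cl 0 = \<one>\<^bsub>G\<^esub>"
      using carr cl[of 0] realizesD[OF G] by (intro realizesD(5)[OF G]) (auto simp: additive.zero[OF F])
    then show ?case using P(1) by simp
  next
    case (one s)
    then show ?case using P(2) by simp
  next
    case (diff a b)
    have k: "Poly_Mapping.keys (a - b) \<subseteq> S" using diff keys_diff[of a b] by blast
    have c: "cl a \<in> carrier G" "cl b \<in> carrier G" "cl (a - b) \<in> carrier G" using carr diff k by auto
    have "cl (a - b) = cl a \<otimes>\<^bsub>G\<^esub> inv\<^bsub>G\<^esub> cl b"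
      using c diff k cl realizes_inv[OF G c(2)] realizesD(3,4)[OF G c(1)]
      by (intro realizesD(5)[OF G c(3)]) (simp_all add: additive.diff[OF F])
    then show ?case using P(3)[OF c(1,2)] diff k by simp
  qed
  then show ?thesis using z(1) by simp
qed

lemma keys_tensor_relators:
  assumes "\<And>x y. x \<in> carrier G \<Longrightarrow> y \<in> carrier G \<Longrightarrow> x \<otimes>\<^bsub>G\<^esub> y \<in> carrier G"
    "\<And>x y. x \<in> carrier H \<Longrightarrow> y \<in> carrier H \<Longrightarrow> x \<otimes>\<^bsub>H\<^esub> y \<in> carrier H"
    "r \<in> tensor_relators G H"
  shows "Poly_Mapping.keys r \<subseteq> carrier G \<times> carrier H"
proof -
  have k: "Poly_Mapping.keys (frag_of a - frag_of b - frag_of c) \<subseteq> {a, b, c}" for a b c :: "'x"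
    using keys_diff[of "frag_of a - frag_of b" "frag_of c"] keys_diff[of "frag_of a" "frag_of b"] by auto
  from assms(3) consider x x' y where "r = frag_of (x \<otimes>\<^bsub>G\<^esub> x', y) - frag_of (x, y) - frag_of (x', y)"
      "x \<in> carrier G" "x' \<in> carrier G" "y \<in> carrier H"
    | x y y' where "r = frag_of (x, y \<otimes>\<^bsub>H\<^esub> y') - frag_of (x, y) - frag_of (x, y')"
      "x \<in> carrier G" "y \<in> carrier H" "y' \<in> carrier H"
    unfolding tensor_relators_def by blast
  then show ?thesis
  proof cases
    case 1
    then show ?thesis using k[of "(x \<otimes>\<^bsub>G\<^esub> x', y)" "(x, y)" "(x', y)"] assms(1) by auto
  next
    case 2
    then show ?thesis using k[of "(x, y \<otimes>\<^bsub>H\<^esub> y')" "(x, y)" "(x, y')"] assms(2) by auto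
  qed
qed

lemma tensor_relators_kill:
  assumes "\<And>x x' y. x \<in> carrier G \<Longrightarrow> x' \<in> carrier G \<Longrightarrow> y \<in> carrier H \<Longrightarrow> f (x \<otimes>\<^bsub>G\<^esub> x') y = f x y + f x' y"
    "\<And>x y y'. x \<in> carrier G \<Longrightarrow> y \<in> carrier H \<Longrightarrow> y' \<in> carrier H \<Longrightarrow> f x (y \<otimes>\<^bsub>H\<^esub> y') = f x y + f x y'"
    "r \<in> tensor_relators G H"
  shows "ext (\<lambda>(x, y). f x y) r = 0"
  using assms unfolding tensor_relators_def by auto

lemma zspan_ext_eq_0: "n \<in> zmod.span R \<Longrightarrow> (\<And>r. r \<in> R \<Longrightarrow> ext f r = 0) \<Longrightarrow> ext f n = 0"
  by (induction rule: zspan_frag_induct) simp_all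

context
  fixes G :: "('g, 'c) monoid_scheme" and H :: "('h, 'd) monoid_scheme"
  assumes G: "comm_group G" and H: "comm_group H"
begin

lemma tensor_span_add1:
  "x \<in> carrier G \<Longrightarrow> x' \<in> carrier G \<Longrightarrow> y \<in> carrier H \<Longrightarrow> frag_of (x \<otimes>\<^bsub>G\<^esub> x', y) - frag_of (x, y) - frag_of (x', y) \<in> zmod.span (tensor_relators G H)"
  by (rule zmod.span_base) (auto simp: tensor_relators_def)

lemma tensor_span_add2:
  "x \<in> carrier G \<Longrightarrow> y \<in> carrier H \<Longrightarrow> y' \<in> carrier H \<Longrightarrow> frag_of (x, y \<otimes>\<^bsub>H\<^esub> y') - frag_of (x, y) - frag_of (x, y') \<in> zmod.span (tensor_relators G H)"
  by (rule zmod.span_base) (auto simp: tensor_relators_def)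

lemma tensor_span_one:
  "y \<in> carrier H \<Longrightarrow> frag_of (\<one>\<^bsub>G\<^esub>, y) \<in> zmod.span (tensor_relators G H)" "x \<in> carrier G \<Longrightarrow> frag_of (x, \<one>\<^bsub>H\<^esub>) \<in> zmod.span (tensor_relators G H)"
proof -
  interpret G: comm_group G by (rule G)
  interpret H: comm_group H by (rule H)
  show "y \<in> carrier H \<Longrightarrow> frag_of (\<one>\<^bsub>G\<^esub>, y) \<in> zmod.span (tensor_relators G H)"
    using zmod.span_neg[OF tensor_span_add1[of "\<one>\<^bsub>G\<^esub>" "\<one>\<^bsub>G\<^esub>" y]] by simp
  show "x \<in> carrier G \<Longrightarrow> frag_of (x, \<one>\<^bsub>H\<^esub>) \<in> zmod.span (tensor_relators G H)"
    using zmod.span_neg[OF tensor_span_add2[of x "\<one>\<^bsub>H\<^esub>" "\<one>\<^bsub>H\<^esub>"]] by simp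
qed

lemma tensor_span_diff:
  "x \<in> carrier G \<Longrightarrow> x' \<in> carrier G \<Longrightarrow> y \<in> carrier H \<Longrightarrow> frag_of (x \<otimes>\<^bsub>G\<^esub> inv\<^bsub>G\<^esub> x', y) - (frag_of (x, y) - frag_of (x', y)) \<in> zmod.span (tensor_relators G H)"
  "x \<in> carrier G \<Longrightarrow> y \<in> carrier H \<Longrightarrow> y' \<in> carrier H \<Longrightarrow> frag_of (x, y \<otimes>\<^bsub>H\<^esub> inv\<^bsub>H\<^esub> y') - (frag_of (x, y) - frag_of (x, y')) \<in> zmod.span (tensor_relators G H)"
proof -
  interpret G: comm_group G by (rule G)
  interpret H: comm_group H by (rule H)
  show "frag_of (x \<otimes>\<^bsub>G\<^esub> inv\<^bsub>G\<^esub> x', y) - (frag_of (x, y) - frag_of (x', y)) \<in> zmod.span (tensor_relators G H)"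
    if "x \<in> carrier G" "x' \<in> carrier G" "y \<in> carrier H"
    using zmod.span_neg[OF tensor_span_add1[of "x \<otimes>\<^bsub>G\<^esub> inv\<^bsub>G\<^esub> x'" x' y]] that by (simp add: G.m_assoc algebra_simps)
  show "frag_of (x, y \<otimes>\<^bsub>H\<^esub> inv\<^bsub>H\<^esub> y') - (frag_of (x, y) - frag_of (x, y')) \<in> zmod.span (tensor_relators G H)"
    if "x \<in> carrier G" "y \<in> carrier H" "y' \<in> carrier H"
    using zmod.span_neg[OF tensor_span_add2[of x "y \<otimes>\<^bsub>H\<^esub> inv\<^bsub>H\<^esub> y'" y']] that by (simp add: H.m_assoc algebra_simps)
qed

end

lemma lookup_sum_single:
  "finite S \<Longrightarrow> Poly_Mapping.lookup (\<Sum>i\<in>S. Poly_Mapping.single i (h i)) j = (if j \<in> S then h j else 0)"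
  by (simp add: lookup_sum lookup_single when_def sum.delta)

text \<open>For G free of rank \<open>m\<close>, G tensor H is a sum of \<open>m\<close> copies of
  H; the coordinate functions \<open>cf\<close> of G select the copy.\<close>

definition rT :: "nat \<Rightarrow> ('g \<Rightarrow> nat \<Rightarrow> int) \<Rightarrow> ('h \<Rightarrow> 'b::ab_group_add) \<Rightarrow> ('g \<times> 'h \<Rightarrow>\<^sub>0 int) set \<Rightarrow> nat \<Rightarrow>\<^sub>0 'b" where
  "rT m cf rH = induced (ext (\<lambda>(x, y). \<Sum>i\<in>{1..m}. Poly_Mapping.single i (zmul (cf x i) (rH y))))"

text \<open>\<open>G\<close> is free with basis \<open>e\<close> and coordinate functions \<open>cf\<close>.\<close>

locale free_basis =
  fixes G :: "('g, 'c) monoid_scheme" and rG :: "'g \<Rightarrow> 'a::ab_group_add"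
    and m :: nat and e :: "nat \<Rightarrow> 'g" and cf :: "'g \<Rightarrow> nat \<Rightarrow> int"
  assumes G: "realizes G rG"
    and e: "\<And>i. i \<in> {1..m} \<Longrightarrow> e i \<in> carrier G"
    and gen: "\<And>P x. P \<one>\<^bsub>G\<^esub> \<Longrightarrow> (\<And>i. i \<in> {1..m} \<Longrightarrow> P (e i)) \<Longrightarrow>
      (\<And>x y. x \<in> carrier G \<Longrightarrow> y \<in> carrier G \<Longrightarrow> P x \<Longrightarrow> P y \<Longrightarrow> P (x \<otimes>\<^bsub>G\<^esub> inv\<^bsub>G\<^esub> y)) \<Longrightarrow> x \<in> carrier G \<Longrightarrow> P x"
    and cf_add: "\<And>x y i. x \<in> carrier G \<Longrightarrow> y \<in> carrier G \<Longrightarrow> cf (x \<otimes>\<^bsub>G\<^esub> y) i = cf x i + cf y i"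
    and cf_e: "\<And>i j. i \<in> {1..m} \<Longrightarrow> j \<in> {1..m} \<Longrightarrow> cf (e i) j = (if i = j then 1 else 0)"
begin

context
  fixes H :: "('h, 'd) monoid_scheme" and rH :: "'h \<Rightarrow> 'b::ab_group_add"
  assumes H: "realizes H rH"
begin

abbreviation (input) "TN \<equiv> zmod.span (tensor_relators G H)"

lemma tensor_keys: "r \<in> tensor_relators G H \<Longrightarrow> Poly_Mapping.keys r \<subseteq> carrier G \<times> carrier H"
  using keys_tensor_relators realizesD(3)[OF G] realizesD(3)[OF H] by blast

lemmas TN_one = tensor_span_one[OF realizes_comm_group[OF G] realizes_comm_group[OF H]]
  and TN_diff = tensor_span_diff[OF realizes_comm_group[OF G] realizes_comm_group[OF H]]

text \<open>A normal form modulo the tensor relators, with one summand for each basis element. It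
  bounds the kernel of the coordinate map from above.\<close>

definition decomposed :: "('g \<times> 'h \<Rightarrow>\<^sub>0 int) \<Rightarrow> bool" where
  "decomposed z \<longleftrightarrow> (\<exists>w. (\<forall>i\<in>{1..m}. w i \<in> carrier H) \<and> z - (\<Sum>i\<in>{1..m}. frag_of (e i, w i)) \<in> TN)"

lemma decomposed_cong:
  assumes "decomposed z" "z' - z \<in> TN"
  shows "decomposed z'"
proof -
  obtain w where w: "\<forall>i\<in>{1..m}. w i \<in> carrier H" "z - (\<Sum>i\<in>{1..m}. frag_of (e i, w i)) \<in> TN"
    using assms(1) unfolding decomposed_def by blast
  from zmod.span_add[OF assms(2) w(2)] have "z' - (\<Sum>i\<in>{1..m}. frag_of (e i, w i)) \<in> TN" by simp
  then show ?thesis unfolding decomposed_def using w(1) by (intro exI[of _ w] conjI)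
qed

lemma decomposed_diff:
  assumes "decomposed z" "decomposed z'"
  shows "decomposed (z - z')"
proof -
  interpret H: comm_group H by (rule realizes_comm_group[OF H])
  obtain w w' where w: "\<forall>i\<in>{1..m}. w i \<in> carrier H" "z - (\<Sum>i\<in>{1..m}. frag_of (e i, w i)) \<in> TN"
    and w': "\<forall>i\<in>{1..m}. w' i \<in> carrier H" "z' - (\<Sum>i\<in>{1..m}. frag_of (e i, w' i)) \<in> TN"
    using assms unfolding decomposed_def by blast
  let ?v = "\<lambda>i. w i \<otimes>\<^bsub>H\<^esub> inv\<^bsub>H\<^esub> w' i"
  let ?S = "\<lambda>u. \<Sum>i\<in>{1..m}. frag_of (e i, u i)"
  have "(\<Sum>i\<in>{1..m}. frag_of (e i, ?v i) - (frag_of (e i, w i) - frag_of (e i, w' i))) \<in> TN"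
    using w(1) w'(1) e by (intro zmod.span_sum TN_diff(2)) auto
  then have "?S ?v - (?S w - ?S w') \<in> TN" by (simp add: sum_subtractf)
  from zmod.span_diff[OF zmod.span_diff[OF w(2) w'(2)] this]
  have "(z - ?S w) - (z' - ?S w') - (?S ?v - (?S w - ?S w')) \<in> TN" .
  moreover have "(a - b) - (a' - b') - (c - (b - b')) = (a - a') - c" for a a' b b' c :: "'g \<times> 'h \<Rightarrow>\<^sub>0 int"
    by (simp add: algebra_simps)
  ultimately have "(z - z') - ?S ?v \<in> TN" by metis
  moreover have "\<forall>i\<in>{1..m}. ?v i \<in> carrier H" using w(1) w'(1) by auto
  ultimately show ?thesis unfolding decomposed_def by (intro exI[of _ ?v] conjI)
qed

lemma decomposed_0: "z \<in> TN \<Longrightarrow> decomposed z"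
proof -
  assume z: "z \<in> TN"
  have "(\<Sum>i\<in>{1..m}. frag_of (e i, \<one>\<^bsub>H\<^esub>)) \<in> TN" using e by (intro zmod.span_sum TN_one(2)) auto
  then have "z - (\<Sum>i\<in>{1..m}. frag_of (e i, \<one>\<^bsub>H\<^esub>)) \<in> TN" using z by (intro zmod.span_diff)
  then show ?thesis unfolding decomposed_def using realizesD(1)[OF H] by (intro exI[of _ "\<lambda>_. \<one>\<^bsub>H\<^esub>"]) simp
qed

lemma decomposed_basis:
  assumes "j \<in> {1..m}" "y \<in> carrier H"
  shows "decomposed (frag_of (e j, y))"
proof -
  let ?w = "\<lambda>i. if i = j then y else \<one>\<^bsub>H\<^esub>"
  have "(\<Sum>i\<in>{1..m}. frag_of (e i, ?w i)) = frag_of (e j, y) + (\<Sum>i\<in>{1..m} - {j}. frag_of (e i, ?w i))"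
    using assms(1) by (subst sum.remove[of _ j]) auto
  moreover have "(\<Sum>i\<in>{1..m} - {j}. frag_of (e i, ?w i)) \<in> TN"
    using e TN_one(2) by (intro zmod.span_sum) auto
  ultimately have "frag_of (e j, y) - (\<Sum>i\<in>{1..m}. frag_of (e i, ?w i)) \<in> TN"
    by (simp add: zmod.span_neg)
  then show ?thesis unfolding decomposed_def using assms(2) realizesD(1)[OF H]
    by (intro exI[of _ ?w]) auto
qed

lemma decomposed_pure:
  assumes "x \<in> carrier G" "y \<in> carrier H"
  shows "decomposed (frag_of (x, y))"
proof (rule gen[of "\<lambda>x. decomposed (frag_of (x, y))"])
  show "decomposed (frag_of (\<one>\<^bsub>G\<^esub>, y))" by (intro decomposed_0 TN_one(1) assms(2))
  show "decomposed (frag_of (e i, y))" if "i \<in> {1..m}" for i using decomposed_basis[OF that assms(2)] .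
  fix a b assume ab: "a \<in> carrier G" "b \<in> carrier G" "decomposed (frag_of (a, y))" "decomposed (frag_of (b, y))"
  show "decomposed (frag_of (a \<otimes>\<^bsub>G\<^esub> inv\<^bsub>G\<^esub> b, y))"
    using decomposed_cong[OF decomposed_diff[OF ab(3,4)] TN_diff(1)[OF ab(1,2) assms(2)]] .
qed (rule assms(1))

lemma decomposed_all:
  assumes "Poly_Mapping.keys z \<subseteq> carrier G \<times> carrier H"
  shows "decomposed z"
  using assms
proof (induction z rule: frag_induction)
  case zero
  then show ?case by (intro decomposed_0 zmod.span_zero)
next
  case (one p)
  then show ?case using decomposed_pure by auto
next
  case (diff a b)
  then show ?case by (intro decomposed_diff)
qed

lemma rT_aux:
  defines "f \<equiv> \<lambda>x y. \<Sum>i\<in>{1..m}. Poly_Mapping.single i (zmul (cf x i) (rH y))"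
  shows "r \<in> tensor_relators G H \<Longrightarrow> ext (\<lambda>(x, y). f x y) r = 0"
    "i \<in> {1..m} \<Longrightarrow> f (e i) y = Poly_Mapping.single i (rH y)"
proof -
  show "r \<in> tensor_relators G H \<Longrightarrow> ext (\<lambda>(x, y). f x y) r = 0"
    by (rule tensor_relators_kill)
       (simp_all add: f_def cf_add realizesD(4)[OF H] zmod.scale_left_distrib zmod.scale_right_distrib single_add sum.distrib)
  assume i: "i \<in> {1..m}"
  have "f (e i) y = (\<Sum>j\<in>{1..m}. if j = i then Poly_Mapping.single j (rH y) else 0)"
    unfolding f_def using i by (intro sum.cong) (auto simp: cf_e)
  then show "f (e i) y = Poly_Mapping.single i (rH y)" using i by simp
qed

lemma rT_sum:
  "ext (\<lambda>(x, y). \<Sum>i\<in>{1..m}. Poly_Mapping.single i (zmul (cf x i) (rH y))) (\<Sum>i\<in>{1..m}. frag_of (e i, w i)) =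
     (\<Sum>i\<in>{1..m}. Poly_Mapping.single i (rH (w i)))"
  unfolding additive.sum[OF additive_ext] by (intro sum.cong refl) (simp only: ext_frag_of prod.case rT_aux(2))

lemma rT_ker:
  assumes z: "Poly_Mapping.keys z \<subseteq> carrier G \<times> carrier H"
  shows "ext (\<lambda>(x, y). \<Sum>i\<in>{1..m}. Poly_Mapping.single i (zmul (cf x i) (rH y))) z = 0 \<longleftrightarrow> z \<in> TN" (is "ext ?f z = 0 \<longleftrightarrow> _")
proof
  assume "z \<in> TN"
  then show "ext ?f z = 0" by (rule zspan_ext_eq_0) (rule rT_aux(1))
next
  assume z0: "ext ?f z = 0"
  obtain w where w: "\<forall>i\<in>{1..m}. w i \<in> carrier H" "z - (\<Sum>i\<in>{1..m}. frag_of (e i, w i)) \<in> TN"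
    using decomposed_all[OF z] unfolding decomposed_def by blast
  have "ext ?f (z - (\<Sum>i\<in>{1..m}. frag_of (e i, w i))) = 0" using w(2) by (rule zspan_ext_eq_0) (rule rT_aux(1))
  then have "(\<Sum>i\<in>{1..m}. Poly_Mapping.single i (rH (w i))) = 0"
    using z0 by (simp only: ext_simps rT_sum) simp
  then have "rH (w j) = 0" if "j \<in> {1..m}" for j
    using that lookup_sum_single[of "{1..m}" "\<lambda>i. rH (w i)" j] by simp
  then have "w j = \<one>\<^bsub>H\<^esub>" if "j \<in> {1..m}" for j
    using that w(1) realizesD[OF H] by (intro realizesD(5)[OF H]) auto
  then have "(\<Sum>i\<in>{1..m}. frag_of (e i, w i)) \<in> TN" using e by (intro zmod.span_sum) (simp add: TN_one(2))
  from zmod.span_add[OF w(2) this] show "z \<in> TN" by simp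
qed

lemma realizes_tensor: "realizes (tensor G H) (rT m cf rH)"
  and rT_class: "Poly_Mapping.keys z \<subseteq> carrier G \<times> carrier H \<Longrightarrow>
    rT m cf rH (presented_class (carrier G \<times> carrier H) (tensor_relators G H) z) =
      ext (\<lambda>(x, y). \<Sum>i\<in>{1..m}. Poly_Mapping.single i (zmul (cf x i) (rH y))) z"
  and carrier_tensor: "carrier (tensor G H) =
    presented_class (carrier G \<times> carrier H) (tensor_relators G H) ` {z. Poly_Mapping.keys z \<subseteq> carrier G \<times> carrier H}"
  using realizes_presented[OF tensor_keys additive_ext rT_ker] by (simp_all add: tensor_def rT_def)

lemma rT_pure:
  assumes "x \<in> carrier G" "y \<in> carrier H"
  shows "pure_tensor G H x y \<in> carrier (tensor G H)"
    "rT m cf rH (pure_tensor G H x y) = (\<Sum>i\<in>{1..m}. Poly_Mapping.single i (zmul (cf x i) (rH y)))"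
    "x = e i \<Longrightarrow> i \<in> {1..m} \<Longrightarrow> rT m cf rH (pure_tensor G H x y) = Poly_Mapping.single i (rH y)"
proof -
  have k: "Poly_Mapping.keys (frag_of (x, y)) \<subseteq> carrier G \<times> carrier H" using assms by simp
  show "pure_tensor G H x y \<in> carrier (tensor G H)" unfolding carrier_tensor pure_tensor_def using k by blast
  show r: "rT m cf rH (pure_tensor G H x y) = (\<Sum>i\<in>{1..m}. Poly_Mapping.single i (zmul (cf x i) (rH y)))"
    unfolding pure_tensor_def rT_class[OF k] by simp
  show "x = e i \<Longrightarrow> i \<in> {1..m} \<Longrightarrow> rT m cf rH (pure_tensor G H x y) = Poly_Mapping.single i (rH y)"
    unfolding r using rT_aux(2) by simp
qed

lemma tensor_obtain:
  assumes "X \<in> carrier (tensor G H)"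
  shows "\<exists>z w. X = presented_class (carrier G \<times> carrier H) (tensor_relators G H) z \<and>
    Poly_Mapping.keys z \<subseteq> carrier G \<times> carrier H \<and> (\<forall>i\<in>{1..m}. w i \<in> carrier H) \<and>
    z - (\<Sum>i\<in>{1..m}. frag_of (e i, w i)) \<in> TN \<and> rT m cf rH X = (\<Sum>i\<in>{1..m}. Poly_Mapping.single i (rH (w i)))"
proof -
  obtain z where z: "X = presented_class (carrier G \<times> carrier H) (tensor_relators G H) z"
    "Poly_Mapping.keys z \<subseteq> carrier G \<times> carrier H" using assms unfolding carrier_tensor by blast
  obtain w where w: "\<forall>i\<in>{1..m}. w i \<in> carrier H" "z - (\<Sum>i\<in>{1..m}. frag_of (e i, w i)) \<in> TN"
    using decomposed_all[OF z(2)] unfolding decomposed_def by blast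
  let ?f = "\<lambda>(x, y). \<Sum>i\<in>{1..m}. Poly_Mapping.single i (zmul (cf x i) (rH y))"
  have "ext ?f (z - (\<Sum>i\<in>{1..m}. frag_of (e i, w i))) = 0" using w(2) by (rule zspan_ext_eq_0) (rule rT_aux(1))
  then have "ext ?f z = (\<Sum>i\<in>{1..m}. Poly_Mapping.single i (rH (w i)))"
    by (simp only: ext_simps rT_sum right_minus_eq)
  then show ?thesis using z w rT_class[OF z(2)] by (intro exI[of _ z] exI[of _ w]) simp
qed

lemma rT_image:
  "rT m cf rH ` carrier (tensor G H) =
     {s. Poly_Mapping.keys s \<subseteq> {1..m} \<and> (\<forall>i\<in>{1..m}. Poly_Mapping.lookup s i \<in> rH ` carrier H)}"
proof (intro equalityI subsetI)
  fix s assume "s \<in> rT m cf rH ` carrier (tensor G H)"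
  then obtain X where X: "X \<in> carrier (tensor G H)" "s = rT m cf rH X" by blast
  from tensor_obtain[OF X(1)] obtain w where w: "\<forall>i\<in>{1..m}. w i \<in> carrier H"
    "rT m cf rH X = (\<Sum>i\<in>{1..m}. Poly_Mapping.single i (rH (w i)))" by blast
  have l: "Poly_Mapping.lookup s j = (if j \<in> {1..m} then rH (w j) else 0)" for j
    unfolding X(2) w(2) by (rule lookup_sum_single) simp
  then show "s \<in> {s. Poly_Mapping.keys s \<subseteq> {1..m} \<and> (\<forall>i\<in>{1..m}. Poly_Mapping.lookup s i \<in> rH ` carrier H)}"
    using w(1) by (auto simp: in_keys_iff split: if_splits)
next
  fix s assume s: "s \<in> {s. Poly_Mapping.keys s \<subseteq> {1..m} \<and> (\<forall>i\<in>{1..m}. Poly_Mapping.lookup s i \<in> rH ` carrier H)}"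
  then have "\<forall>i\<in>{1..m}. \<exists>y\<in>carrier H. Poly_Mapping.lookup s i = rH y" by auto
  then obtain w where w: "\<And>i. i \<in> {1..m} \<Longrightarrow> w i \<in> carrier H \<and> Poly_Mapping.lookup s i = rH (w i)" by metis
  let ?z = "\<Sum>i\<in>{1..m}. frag_of (e i, w i)"
  have k: "Poly_Mapping.keys ?z \<subseteq> carrier G \<times> carrier H"
  proof
    fix p assume "p \<in> Poly_Mapping.keys ?z"
    then obtain i where "i \<in> {1..m}" "p \<in> Poly_Mapping.keys (frag_of (e i, w i))" using keys_sum[of _ "{1..m}"] by fastforce
    then show "p \<in> carrier G \<times> carrier H" using e w by auto
  qed
  have "s = (\<Sum>i\<in>{1..m}. Poly_Mapping.single i (rH (w i)))"
  proof (rule poly_mapping_eqI)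
    fix j
    show "Poly_Mapping.lookup s j = Poly_Mapping.lookup (\<Sum>i\<in>{1..m}. Poly_Mapping.single i (rH (w i))) j"
      using s w[of j] lookup_sum_single[of "{1..m}" "\<lambda>i. rH (w i)" j] by (auto simp: in_keys_iff)
  qed
  also have "\<dots> = rT m cf rH (presented_class (carrier G \<times> carrier H) (tensor_relators G H) ?z)"
    unfolding rT_class[OF k] rT_sum ..
  finally show "s \<in> rT m cf rH ` carrier (tensor G H)" unfolding carrier_tensor using k by blast
qed

lemma tensor_lift_rT:
  assumes K: "realizes K s" and f: "\<And>x y. x \<in> carrier G \<Longrightarrow> y \<in> carrier H \<Longrightarrow> f x y \<in> carrier K"
    and f1: "\<And>x x' y. x \<in> carrier G \<Longrightarrow> x' \<in> carrier G \<Longrightarrow> y \<in> carrier H \<Longrightarrow> s (f (x \<otimes>\<^bsub>G\<^esub> x') y) = s (f x y) + s (f x' y)"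
    and f2: "\<And>x y y'. x \<in> carrier G \<Longrightarrow> y \<in> carrier H \<Longrightarrow> y' \<in> carrier H \<Longrightarrow> s (f x (y \<otimes>\<^bsub>H\<^esub> y')) = s (f x y) + s (f x y')"
    and g: "\<And>i. additive (g i)" "\<And>i y. i \<in> {1..m} \<Longrightarrow> y \<in> carrier H \<Longrightarrow> s (f (e i) y) = g i (rH y)"
    and X: "X \<in> carrier (tensor G H)"
  shows "tensor_lift K f X \<in> carrier K" "s (tensor_lift K f X) = vext g (rT m cf rH X)"
proof -
  from tensor_obtain[OF X] obtain z w where z: "X = presented_class (carrier G \<times> carrier H) (tensor_relators G H) z"
    "Poly_Mapping.keys z \<subseteq> carrier G \<times> carrier H" and w: "\<forall>i\<in>{1..m}. w i \<in> carrier H"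
    "z - (\<Sum>i\<in>{1..m}. frag_of (e i, w i)) \<in> TN" "rT m cf rH X = (\<Sum>i\<in>{1..m}. Poly_Mapping.single i (rH (w i)))"
    by blast
  have kill: "ext (\<lambda>p. s ((\<lambda>(x, y). f x y) p)) r = 0" if "r \<in> tensor_relators G H" for r
    using tensor_relators_kill[OF f1 f2 that] by (simp add: case_prod_unfold)
  have b: "(\<lambda>(x, y). f x y) p \<in> carrier K" if "p \<in> carrier G \<times> carrier H" for p using f that by auto
  note i = induced_lin_extend[OF tensor_keys K b kill z(2)]
  show "tensor_lift K f X \<in> carrier K" unfolding tensor_lift_def z(1) by (rule i(3))
  have "s (tensor_lift K f X) = ext (\<lambda>p. s ((\<lambda>(x, y). f x y) p)) z" unfolding tensor_lift_def z(1) by (rule i(2))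
  also have "\<dots> = ext (\<lambda>p. s ((\<lambda>(x, y). f x y) p)) (\<Sum>i\<in>{1..m}. frag_of (e i, w i))"
    using zspan_ext_eq_0[OF w(2) kill] by simp
  also have "\<dots> = (\<Sum>i\<in>{1..m}. g i (rH (w i)))"
    unfolding additive.sum[OF additive_ext] using w(1) g(2) by (intro sum.cong) simp_all
  also have "\<dots> = vext g (rT m cf rH X)"
    unfolding w(3) additive.sum[OF additive_vext[OF g(1)]] by (simp add: vext_single[OF g(1)])
  finally show "s (tensor_lift K f X) = vext g (rT m cf rH X)" .
qed

end

end

section \<open>The groups \<open>D\<close>\<close>

lemma rtrees_0: "rtrees m 0 = Leaf ` {1..m}"
proof (intro equalityI subsetI)
  fix J assume "J \<in> rtrees m 0"
  then show "J \<in> Leaf ` {1..m}" by (cases J) (auto simp: rtrees_def)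
qed (auto simp: rtrees_def)

lemma lookup_letter: "Poly_Mapping.lookup (letter i) (Word [j]) = (if i = j then 1 else 0)"
  by (simp add: letter_def lookup_single when_def)

text \<open>In degree 1 the coordinates are the coefficients of the one-letter words.\<close>

definition cL :: "(rtree \<Rightarrow>\<^sub>0 int) set \<Rightarrow> nat \<Rightarrow> int" where
  "cL x i = Poly_Mapping.lookup (rL x) (Word [i])"

definition cQ :: "(rtree \<Rightarrow>\<^sub>0 int) set \<Rightarrow> nat \<Rightarrow> int" where
  "cQ x i = Poly_Mapping.lookup (kap (rQ x)) (Word [i])"

lemma basis_L: "free_basis (L_group m 1) rL m (\<lambda>i. Lie_class m (frag_of (Leaf i))) cL"
proof
  show "realizes (L_group m 1) rL" by (rule realizes_L)
  have r: "Poly_Mapping.keys (frag_of (Leaf i)) \<subseteq> rtrees m 0" if "i \<in> {1..m}" for i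
    using that by (simp add: rtrees_0)
  show "Lie_class m (frag_of (Leaf i)) \<in> carrier (L_group m 1)" if "i \<in> {1..m}" for i
    using Lie_class_closed[of _ m 1] r[OF that] by simp
  show "P x" if "P \<one>\<^bsub>L_group m 1\<^esub>" "\<And>i. i \<in> {1..m} \<Longrightarrow> P (Lie_class m (frag_of (Leaf i)))"
    "\<And>x y. x \<in> carrier (L_group m 1) \<Longrightarrow> y \<in> carrier (L_group m 1) \<Longrightarrow> P x \<Longrightarrow> P y \<Longrightarrow>
       P (x \<otimes>\<^bsub>L_group m 1\<^esub> inv\<^bsub>L_group m 1\<^esub> y)" "x \<in> carrier (L_group m 1)" for P x
    by (rule realizes_gen[OF realizes_L additive_kz carrier_L_group rL_class'[where n = "1 - 1"] that(1) _ that(3) that(4)])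
       (auto simp: rtrees_0 intro: that(2))
  show "cL (x \<otimes>\<^bsub>L_group m 1\<^esub> y) i = cL x i + cL y i"
    if "x \<in> carrier (L_group m 1)" "y \<in> carrier (L_group m 1)" for x y i
    using that by (simp only: cL_def realizesD(4)[OF realizes_L] lookup_add)
  show "cL (Lie_class m (frag_of (Leaf i))) j = (if i = j then 1 else 0)"
    if "i \<in> {1..m}" "j \<in> {1..m}" for i j
    using rL_class'[OF r[OF that(1)]] by (simp add: cL_def kz_def lookup_letter)
qed

lemma basis_Q: "free_basis (quasiL_group m 1) rQ m (\<lambda>i. quasi_class m 1 (frag_of (Leaf i))) cQ"
proof
  show "realizes (quasiL_group m 1) rQ" by (rule realizes_quasiL)
  have r: "Poly_Mapping.keys (frag_of (Leaf i)) \<subseteq> rtrees m (1 - 1)" if "i \<in> {1..m}" for i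
    using that by (simp add: rtrees_0)
  show "quasi_class m 1 (frag_of (Leaf i)) \<in> carrier (quasiL_group m 1)" if "i \<in> {1..m}" for i
    by (rule quasi_class_closed) (rule r[OF that])
  show "P x" if "P \<one>\<^bsub>quasiL_group m 1\<^esub>" "\<And>i. i \<in> {1..m} \<Longrightarrow> P (quasi_class m 1 (frag_of (Leaf i)))"
    "\<And>x y. x \<in> carrier (quasiL_group m 1) \<Longrightarrow> y \<in> carrier (quasiL_group m 1) \<Longrightarrow> P x \<Longrightarrow> P y \<Longrightarrow>
       P (x \<otimes>\<^bsub>quasiL_group m 1\<^esub> inv\<^bsub>quasiL_group m 1\<^esub> y)" "x \<in> carrier (quasiL_group m 1)" for P x
    by (rule realizes_gen[OF realizes_quasiL additive_qc carrier_quasiL rQ_class that(1) _ that(3) that(4)])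
       (auto simp: rtrees_0 intro: that(2)[simplified])
  show "cQ (x \<otimes>\<^bsub>quasiL_group m 1\<^esub> y) i = cQ x i + cQ y i"
    if "x \<in> carrier (quasiL_group m 1)" "y \<in> carrier (quasiL_group m 1)" for x y i
    using that by (simp only: cQ_def realizesD(4)[OF realizes_quasiL] lookup_add additive.add[OF additive_kap])
  show "cQ (quasi_class m 1 (frag_of (Leaf i))) j = (if i = j then 1 else 0)"
    if "i \<in> {1..m}" "j \<in> {1..m}" for i j
    using rQ_class[OF r[OF that(1)]] by (simp add: cQ_def lookup_letter)
qed

definition rLL :: "nat \<Rightarrow> rtensor \<Rightarrow> nat \<Rightarrow>\<^sub>0 assoc" where "rLL m = rT m cL rL"
definition rQQ :: "nat \<Rightarrow> rtensor \<Rightarrow> vlie" where "rQQ m = rT m cQ rQ"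

lemma realizes_LL: "realizes (LL_group m n) (rLL m)"
  unfolding LL_group_def rLL_def by (rule free_basis.realizes_tensor[OF basis_L realizes_L])

lemma realizes_QQ: "realizes (quasiLL_group m n) (rQQ m)"
  unfolding quasiLL_group_def rQQ_def by (rule free_basis.realizes_tensor[OF basis_Q realizes_quasiL])

text \<open>The projection of W tensor L' to W tensor L, with L seen inside the associative
  ring.\<close>

definition vk :: "vlie \<Rightarrow> nat \<Rightarrow>\<^sub>0 assoc" where "vk = vext (\<lambda>i u. Poly_Mapping.single i (kap u))"

lemma additive_single_kap: "additive (\<lambda>u. Poly_Mapping.single i (kap u))"
  by (rule additive_comp[OF additive_single additive_kap])

lemma additive_vk: "additive vk"
  unfolding vk_def by (rule additive_vext) (rule additive_single_kap)

lemma vk_single: "vk (Poly_Mapping.single i u) = Poly_Mapping.single i (kap u)"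
  unfolding vk_def by (rule vext_single) (rule additive_single_kap)

lemmas vk_simps [simp] = additive.zero[OF additive_vk] additive.add[OF additive_vk]
  additive.diff[OF additive_vk] additive.minus[OF additive_vk]

lemma lookup_vk: "Poly_Mapping.lookup (vk s) i = kap (Poly_Mapping.lookup s i)"
  by (induction s rule: v_induct)
     (simp_all add: vk_single lookup_single when_def lookup_minus additive.zero[OF additive_kap] additive.diff[OF additive_kap])

text \<open>The copy of L'_1 tensor L'_(n+1), for labels up to \<open>m\<close>, inside W tensor
  L'.\<close>

definition vhom :: "nat \<Rightarrow> nat \<Rightarrow> vlie set" where
  "vhom m n = {s. Poly_Mapping.keys s \<subseteq> {1..m} \<and> (\<forall>i. qproj (gdeg m n) (Poly_Mapping.lookup s i) = Poly_Mapping.lookup s i)}"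

lemma vhom_diff: "s \<in> vhom m n \<Longrightarrow> t \<in> vhom m n \<Longrightarrow> s - t \<in> vhom m n"
  using keys_diff[of s t] unfolding vhom_def by (auto simp: lookup_minus)

lemma vhom_0: "0 \<in> vhom m n" by (simp add: vhom_def)

lemma rQQ_image: "rQQ m ` carrier (quasiLL_group m n) = vhom m n"
proof -
  have "rQQ m ` carrier (quasiLL_group m n) = {s. Poly_Mapping.keys s \<subseteq> {1..m} \<and>
      (\<forall>i\<in>{1..m}. Poly_Mapping.lookup s i \<in> rQ ` carrier (quasiL_group m (n + 1)))}"
    unfolding quasiLL_group_def rQQ_def by (rule free_basis.rT_image[OF basis_Q realizes_quasiL])
  also have "\<dots> = vhom m n"
    unfolding rQ_image vhom_def by (auto simp: in_keys_iff) (metis in_keys_iff qproj_simps(1) subsetD atLeastAtMost_iff)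
  finally show ?thesis .
qed

lemma rLL_image: "rLL m ` carrier (LL_group m n) = vk ` vhom m n"
proof -
  have "rLL m ` carrier (LL_group m n) = {s. Poly_Mapping.keys s \<subseteq> {1..m} \<and>
      (\<forall>i\<in>{1..m}. Poly_Mapping.lookup s i \<in> rL ` carrier (L_group m (n + 1)))}"
    unfolding LL_group_def rLL_def by (rule free_basis.rT_image[OF basis_L realizes_L])
  also have "\<dots> = vk ` vhom m n"
  proof (intro equalityI subsetI)
    fix s assume s: "s \<in> {s. Poly_Mapping.keys s \<subseteq> {1..m} \<and>
      (\<forall>i\<in>{1..m}. Poly_Mapping.lookup s i \<in> rL ` carrier (L_group m (n + 1)))}"
    then have "\<forall>i\<in>{1..m}. \<exists>u. qproj (gdeg m n) u = u \<and> Poly_Mapping.lookup s i = kap u"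
      unfolding rL_image by auto
    then obtain h where h: "\<And>i. i \<in> {1..m} \<Longrightarrow> qproj (gdeg m n) (h i) = h i \<and> Poly_Mapping.lookup s i = kap (h i)"
      by metis
    let ?t = "\<Sum>i\<in>{1..m}. Poly_Mapping.single i (h i)"
    have l: "Poly_Mapping.lookup ?t j = (if j \<in> {1..m} then h j else 0)" for j by (rule lookup_sum_single) simp
    then have "?t \<in> vhom m n" using h unfolding vhom_def by (auto simp: in_keys_iff split: if_splits)
    moreover have "s = vk ?t"
    proof (rule poly_mapping_eqI)
      fix j
      show "Poly_Mapping.lookup s j = Poly_Mapping.lookup (vk ?t) j"
        unfolding lookup_vk l using h[of j] s by (auto simp: in_keys_iff additive.zero[OF additive_kap])
    qed
    ultimately show "s \<in> vk ` vhom m n" by blast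
  next
    fix s assume "s \<in> vk ` vhom m n"
    then obtain t where t: "t \<in> vhom m n" "s = vk t" by blast
    have "j \<in> {1..m}" if "j \<in> Poly_Mapping.keys s" for j
    proof -
      have "Poly_Mapping.lookup t j \<noteq> 0"
        using that unfolding t(2) in_keys_iff lookup_vk by (auto simp: additive.zero[OF additive_kap])
      then show ?thesis using t(1) unfolding vhom_def in_keys_iff[symmetric] by blast
    qed
    moreover have "Poly_Mapping.lookup s j \<in> rL ` carrier (L_group m (n + 1))" for j
      unfolding rL_image t(2) lookup_vk using t(1) by (simp add: vhom_def)
    ultimately show "s \<in> {s. Poly_Mapping.keys s \<subseteq> {1..m} \<and>
      (\<forall>i\<in>{1..m}. Poly_Mapping.lookup s i \<in> rL ` carrier (L_group m (n + 1)))}" by blast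
  qed
  finally show ?thesis .
qed

lemma LL_pure:
  assumes "i \<in> {1..m}" "y \<in> carrier (L_group m (n + 1))"
  shows "pure_tensor (L_group m 1) (L_group m (n + 1)) (Lie_class m (frag_of (Leaf i))) y \<in> carrier (LL_group m n)"
    "rLL m (pure_tensor (L_group m 1) (L_group m (n + 1)) (Lie_class m (frag_of (Leaf i))) y) = Poly_Mapping.single i (rL y)"
  unfolding LL_group_def rLL_def
  using free_basis.rT_pure(1,3)[OF basis_L realizes_L free_basis.e[OF basis_L assms(1)] assms(2)] assms(1) by simp_all

lemma QQ_pure:
  assumes "i \<in> {1..m}" "y \<in> carrier (quasiL_group m (n + 1))"
  shows "pure_tensor (quasiL_group m 1) (quasiL_group m (n + 1)) (quasi_class m 1 (frag_of (Leaf i))) y \<in> carrier (quasiLL_group m n)"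
    "rQQ m (pure_tensor (quasiL_group m 1) (quasiL_group m (n + 1)) (quasi_class m 1 (frag_of (Leaf i))) y) = Poly_Mapping.single i (rQ y)"
  unfolding quasiLL_group_def rQQ_def
  using free_basis.rT_pure(1,3)[OF basis_Q realizes_quasiL free_basis.e[OF basis_Q assms(1)] assms(2)] assms(1) by simp_all

definition avbr :: "(nat \<Rightarrow>\<^sub>0 assoc) \<Rightarrow> assoc" where "avbr = vext (\<lambda>i a. letter i * a - a * letter i)"

lemma additive_commutator: "additive (\<lambda>a. letter i * a - a * letter i)"
  by (simp add: additive_def algebra_simps)

lemma additive_avbr: "additive avbr"
  unfolding avbr_def by (rule additive_vext) (rule additive_commutator)

lemma avbr_vk: "avbr (vk s) = kap (vbr s)"
proof (rule v_additive_eqI[of "\<lambda>s. avbr (vk s)" "\<lambda>s. kap (vbr s)"])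
  show "additive (\<lambda>s. avbr (vk s))" by (rule additive_comp[OF additive_avbr additive_vk])
  show "additive (\<lambda>s. kap (vbr s))" by (rule additive_comp[OF additive_kap additive_vbr])
  show "avbr (vk (Poly_Mapping.single i u)) = kap (vbr (Poly_Mapping.single i u))" for i u
    unfolding vk_single avbr_def vext_single[OF additive_commutator] by (simp add: kap_br)
qed

lemma LL_bracket:
  assumes "X \<in> carrier (LL_group m n)"
  shows "tensor_lift (L_group m (n + 2)) (Lie_bracket m) X \<in> carrier (L_group m (n + 2))"
    "rL (tensor_lift (L_group m (n + 2)) (Lie_bracket m) X) = avbr (rLL m X)"
proof -
  note X = assms[unfolded LL_group_def]
  have b: "Lie_bracket m x y \<in> carrier (L_group m (n + 2))" "rL (Lie_bracket m x y) = rL x * rL y - rL y * rL x"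
    if "x \<in> carrier (L_group m 1)" "y \<in> carrier (L_group m (n + 1))" for x y
    using Lie_bracket_closed[OF _ _ that] by simp_all
  have m1: "x \<otimes>\<^bsub>L_group m k\<^esub> y \<in> carrier (L_group m k)" "rL (x \<otimes>\<^bsub>L_group m k\<^esub> y) = rL x + rL y"
    if "x \<in> carrier (L_group m k)" "y \<in> carrier (L_group m k)" for x y k
    using realizesD(3,4)[OF realizes_L] that by blast+
  have e: "rL (Lie_bracket m (Lie_class m (frag_of (Leaf i))) y) = letter i * rL y - rL y * letter i"
    if "i \<in> {1..m}" "y \<in> carrier (L_group m (n + 1))" for i y
    using b(2)[OF free_basis.e[OF basis_L that(1)] that(2)] rL_class'[of "frag_of (Leaf i)" m 0] that
    by (simp add: kz_def rtrees_0)
  have f1: "rL (Lie_bracket m (x \<otimes>\<^bsub>L_group m 1\<^esub> x') y) = rL (Lie_bracket m x y) + rL (Lie_bracket m x' y)"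
    if "x \<in> carrier (L_group m 1)" "x' \<in> carrier (L_group m 1)" "y \<in> carrier (L_group m (n + 1))" for x x' y
    unfolding b(2)[OF m1(1)[OF that(1,2)] that(3)] b(2)[OF that(1,3)] b(2)[OF that(2,3)] m1(2)[OF that(1,2)]
    by (simp add: algebra_simps)
  have f2: "rL (Lie_bracket m x (y \<otimes>\<^bsub>L_group m (n + 1)\<^esub> y')) = rL (Lie_bracket m x y) + rL (Lie_bracket m x y')"
    if "x \<in> carrier (L_group m 1)" "y \<in> carrier (L_group m (n + 1))" "y' \<in> carrier (L_group m (n + 1))" for x y y'
    unfolding b(2)[OF that(1) m1(1)[OF that(2,3)]] b(2)[OF that(1,2)] b(2)[OF that(1,3)] m1(2)[OF that(2,3)]
    by (simp add: algebra_simps)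
  note lift = free_basis.tensor_lift_rT[where f = "Lie_bracket m" and g = "\<lambda>i a. letter i * a - a * letter i",
    OF basis_L realizes_L realizes_L b(1) f1 f2 additive_commutator e X]
  show "tensor_lift (L_group m (n + 2)) (Lie_bracket m) X \<in> carrier (L_group m (n + 2))" by (rule lift(1))
  show "rL (tensor_lift (L_group m (n + 2)) (Lie_bracket m) X) = avbr (rLL m X)"
    unfolding avbr_def rLL_def by (rule lift(2))
qed

lemma QQ_bracket:
  assumes "X \<in> carrier (quasiLL_group m n)"
  shows "quasiLL_bracket m n X \<in> carrier (quasiL_group m (n + 2))"
    "rQ (quasiLL_bracket m n X) = vbr (rQQ m X)"
proof -
  note X = assms[unfolded quasiLL_group_def]
  have b: "quasi_bracket m 1 (n + 1) x y \<in> carrier (quasiL_group m (n + 2))" "rQ (quasi_bracket m 1 (n + 1) x y) = br (rQ x) (rQ y)"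
    if "x \<in> carrier (quasiL_group m 1)" "y \<in> carrier (quasiL_group m (n + 1))" for x y
    using quasi_bracket_closed[OF _ _ that] by simp_all
  have m1: "x \<otimes>\<^bsub>quasiL_group m k\<^esub> y \<in> carrier (quasiL_group m k)" "rQ (x \<otimes>\<^bsub>quasiL_group m k\<^esub> y) = rQ x + rQ y"
    if "x \<in> carrier (quasiL_group m k)" "y \<in> carrier (quasiL_group m k)" for x y k
    using realizesD(3,4)[OF realizes_quasiL] that by blast+
  have e: "rQ (quasi_bracket m 1 (n + 1) (quasi_class m 1 (frag_of (Leaf i))) y) = br (qt (Leaf i)) (rQ y)"
    if "i \<in> {1..m}" "y \<in> carrier (quasiL_group m (n + 1))" for i y
    using b(2)[OF free_basis.e[OF basis_Q that(1)] that(2)] rQ_class[of "frag_of (Leaf i)" m 1] that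
    by (simp add: rtrees_0)
  have f1: "rQ (quasi_bracket m 1 (n + 1) (x \<otimes>\<^bsub>quasiL_group m 1\<^esub> x') y) =
      rQ (quasi_bracket m 1 (n + 1) x y) + rQ (quasi_bracket m 1 (n + 1) x' y)"
    if "x \<in> carrier (quasiL_group m 1)" "x' \<in> carrier (quasiL_group m 1)" "y \<in> carrier (quasiL_group m (n + 1))" for x x' y
    unfolding b(2)[OF m1(1)[OF that(1,2)] that(3)] b(2)[OF that(1,3)] b(2)[OF that(2,3)] m1(2)[OF that(1,2)] by simp
  have f2: "rQ (quasi_bracket m 1 (n + 1) x (y \<otimes>\<^bsub>quasiL_group m (n + 1)\<^esub> y')) =
      rQ (quasi_bracket m 1 (n + 1) x y) + rQ (quasi_bracket m 1 (n + 1) x y')"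
    if "x \<in> carrier (quasiL_group m 1)" "y \<in> carrier (quasiL_group m (n + 1))" "y' \<in> carrier (quasiL_group m (n + 1))" for x y y'
    unfolding b(2)[OF that(1) m1(1)[OF that(2,3)]] b(2)[OF that(1,2)] b(2)[OF that(1,3)] m1(2)[OF that(2,3)] by simp
  note lift = free_basis.tensor_lift_rT[where f = "quasi_bracket m 1 (n + 1)" and g = "\<lambda>i. br (qt (Leaf i))",
    OF basis_Q realizes_quasiL realizes_quasiL b(1) f1 f2 additive_br(2) e X]
  show "quasiLL_bracket m n X \<in> carrier (quasiL_group m (n + 2))" unfolding quasiLL_bracket_def by (rule lift(1))
  show "rQ (quasiLL_bracket m n X) = vbr (rQQ m X)"
    unfolding vbr_def rQQ_def quasiLL_bracket_def by (rule lift(2))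
qed

lemma QQ_proj:
  assumes "X \<in> carrier (quasiLL_group m n)"
  shows "tensor_map (L_group m 1) (L_group m (n + 1)) (quasi_proj m) (quasi_proj m) X \<in> carrier (LL_group m n)"
    "rLL m (tensor_map (L_group m 1) (L_group m (n + 1)) (quasi_proj m) (quasi_proj m) X) = vk (rQQ m X)"
proof -
  note X = assms[unfolded quasiLL_group_def]
  let ?f = "\<lambda>x y. pure_tensor (L_group m 1) (L_group m (n + 1)) (quasi_proj m x) (quasi_proj m y)"
  have b: "?f x y \<in> carrier (LL_group m n)" "rLL m (?f x y) = (\<Sum>i\<in>{1..m}. Poly_Mapping.single i (zmul (cQ x i) (kap (rQ y))))"
    if "x \<in> carrier (quasiL_group m 1)" "y \<in> carrier (quasiL_group m (n + 1))" for x y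
    unfolding LL_group_def rLL_def
    using free_basis.rT_pure(1,2)[OF basis_L realizes_L quasi_proj_closed(1)[OF that(1)] quasi_proj_closed(1)[OF that(2)]]
    by (simp_all add: cL_def cQ_def quasi_proj_closed(2)[OF that(1)] quasi_proj_closed(2)[OF that(2)])
  have m1: "x \<otimes>\<^bsub>quasiL_group m k\<^esub> y \<in> carrier (quasiL_group m k)" "rQ (x \<otimes>\<^bsub>quasiL_group m k\<^esub> y) = rQ x + rQ y"
    if "x \<in> carrier (quasiL_group m k)" "y \<in> carrier (quasiL_group m k)" for x y k
    using realizesD(3,4)[OF realizes_quasiL] that by blast+
  have e: "rLL m (?f (quasi_class m 1 (frag_of (Leaf i))) y) = Poly_Mapping.single i (kap (rQ y))"
    if i: "i \<in> {1..m}" and y: "y \<in> carrier (quasiL_group m (n + 1))" for i y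
  proof -
    have "rLL m (?f (quasi_class m 1 (frag_of (Leaf i))) y) = (\<Sum>j\<in>{1..m}. if j = i then Poly_Mapping.single j (kap (rQ y)) else 0)"
      unfolding b(2)[OF free_basis.e[OF basis_Q i] y] using i free_basis.cf_e[OF basis_Q i] by (intro sum.cong) auto
    then show ?thesis using i by simp
  qed
  have f1: "rLL m (?f (x \<otimes>\<^bsub>quasiL_group m 1\<^esub> x') y) = rLL m (?f x y) + rLL m (?f x' y)"
    if "x \<in> carrier (quasiL_group m 1)" "x' \<in> carrier (quasiL_group m 1)" "y \<in> carrier (quasiL_group m (n + 1))" for x x' y
    unfolding b(2)[OF m1(1)[OF that(1,2)] that(3)] b(2)[OF that(1,3)] b(2)[OF that(2,3)] free_basis.cf_add[OF basis_Q that(1,2)]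
    by (simp only: zmul_add_left single_add sum.distrib)
  have f2: "rLL m (?f x (y \<otimes>\<^bsub>quasiL_group m (n + 1)\<^esub> y')) = rLL m (?f x y) + rLL m (?f x y')"
    if "x \<in> carrier (quasiL_group m 1)" "y \<in> carrier (quasiL_group m (n + 1))" "y' \<in> carrier (quasiL_group m (n + 1))" for x y y'
    unfolding b(2)[OF that(1) m1(1)[OF that(2,3)]] b(2)[OF that(1,2)] b(2)[OF that(1,3)] m1(2)[OF that(2,3)]
    by (simp only: additive.add[OF additive_kap] zmul_add_right single_add sum.distrib)
  note lift = free_basis.tensor_lift_rT[where f = ?f and g = "\<lambda>i u. Poly_Mapping.single i (kap u)",
    OF basis_Q realizes_quasiL realizes_LL b(1) f1 f2 additive_single_kap e X]
  show "tensor_map (L_group m 1) (L_group m (n + 1)) (quasi_proj m) (quasi_proj m) X \<in> carrier (LL_group m n)"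
    unfolding tensor_map_def LL_group_def[symmetric] by (rule lift(1))
  show "rLL m (tensor_map (L_group m 1) (L_group m (n + 1)) (quasi_proj m) (quasi_proj m) X) = vk (rQQ m X)"
    unfolding vk_def rQQ_def tensor_map_def LL_group_def[symmetric] by (rule lift(2))
qed

section \<open>The kernels of the bracket maps\<close>

lemma realizes_kernel:
  assumes G: "realizes G r" and H: "realizes H s" and F: "additive F"
    and f: "\<And>x. x \<in> carrier G \<Longrightarrow> f x \<in> carrier H" "\<And>x. x \<in> carrier G \<Longrightarrow> s (f x) = F (r x)"
  shows "realizes (G\<lparr>carrier := kernel G H f\<rparr>) r" "x \<in> kernel G H f \<longleftrightarrow> x \<in> carrier G \<and> F (r x) = 0"
proof -
  have k: "x \<in> kernel G H f \<longleftrightarrow> x \<in> carrier G \<and> F (r x) = 0" for x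
  proof -
    have "f x = \<one>\<^bsub>H\<^esub> \<longleftrightarrow> s (f x) = 0" if "x \<in> carrier G"
      using realizesD(2)[OF H] realizesD(5)[OF H f(1)[OF that] realizesD(1)[OF H]] by metis
    then show ?thesis using f(2) by (auto simp: kernel_def)
  qed
  then show "x \<in> kernel G H f \<longleftrightarrow> x \<in> carrier G \<and> F (r x) = 0" .
  show "realizes (G\<lparr>carrier := kernel G H f\<rparr>) r"
  proof (rule realizes_subset[OF G])
    show "kernel G H f \<subseteq> carrier G" by (auto simp: kernel_def)
    show "\<one>\<^bsub>G\<^esub> \<in> kernel G H f" using realizesD(1,2)[OF G] by (simp add: k additive.zero[OF F])
    show "x \<otimes>\<^bsub>G\<^esub> y \<in> kernel G H f" if "x \<in> kernel G H f" "y \<in> kernel G H f" for x y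
      using that realizesD(3,4)[OF G] by (simp add: k additive.add[OF F])
    show "\<exists>y\<in>kernel G H f. r y = - r x" if "x \<in> kernel G H f" for x
      using that realizes_inv[OF G, of x] by (intro bexI[of _ "inv\<^bsub>G\<^esub> x"]) (simp_all add: k additive.minus[OF F])
  qed
qed

lemma realizes_D: "realizes (D_group m n) (rLL m)"
  and carrier_D: "X \<in> carrier (D_group m n) \<longleftrightarrow> X \<in> carrier (LL_group m n) \<and> avbr (rLL m X) = 0"
  using realizes_kernel[OF realizes_LL realizes_L additive_avbr LL_bracket] unfolding D_group_def by simp_all

lemma realizes_quasiD: "realizes (quasiD_group m n) (rQQ m)"
  and carrier_quasiD: "X \<in> carrier (quasiD_group m n) \<longleftrightarrow> X \<in> carrier (quasiLL_group m n) \<and> vbr (rQQ m X) = 0"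
  using realizes_kernel[OF realizes_QQ realizes_quasiL additive_vbr QQ_bracket] unfolding quasiD_group_def by simp_all

lemma rLL_D_image: "rLL m ` carrier (D_group m n) = vk ` {s \<in> vhom m n. kap (vbr s) = 0}"
proof -
  have "rLL m ` carrier (D_group m n) = {s \<in> rLL m ` carrier (LL_group m n). avbr s = 0}"
    by (auto simp: carrier_D)
  then show ?thesis unfolding rLL_image by (auto simp: avbr_vk)
qed

lemma rQQ_D_image: "rQQ m ` carrier (quasiD_group m n) = {s \<in> vhom m n. vbr s = 0}"
proof -
  have "rQQ m ` carrier (quasiD_group m n) = {s \<in> rQQ m ` carrier (quasiLL_group m n). vbr s = 0}"
    by (auto simp: carrier_quasiD)
  then show ?thesis unfolding rQQ_image .
qed

section \<open>Tree groups\<close>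

definition vsum :: "utree \<Rightarrow> vlie" where
  "vsum T = ext (\<lambda>(i, J). Poly_Mapping.single i (qt J)) (vertex_sum T)"

lemma ext_lsum: "ext (\<lambda>(i, J). Poly_Mapping.single i (qt J)) (lsum I K) = ls I (qt K)"
  by (induction I arbitrary: K) simp_all

lemma vsum_tree_inner: "vsum (tree_inner I J) = eta (pr (qt I) (qt J))"
  by (simp add: vsum_def vertex_sum_tree_inner ext_lsum eta_pr lq_qt)

lemma vsum_tree_inner_ls: "vsum (tree_inner I J) = ls I (qt J) + ls J (qt I)"
  by (simp add: vsum_tree_inner eta_pr lq_qt)

definition glue :: "(rtree \<times> rtree \<Rightarrow>\<^sub>0 int) \<Rightarrow> utree \<Rightarrow>\<^sub>0 int" where
  "glue = ext (\<lambda>(I, J). frag_of (tree_inner I J))"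

lemma additive_glue: "additive glue" unfolding glue_def by (rule additive_ext)

lemma ext_vsum_glue: "ext vsum (glue z) = eta (tc z)"
  by (rule additive_eqI[of "\<lambda>z. ext vsum (glue z)"])
     (auto simp: glue_def vsum_tree_inner pr_qt intro: additive_comp[OF additive_ext additive_ext] additive_comp[OF additive_eta additive_tc])

lemma glue_surj: "\<exists>z. x = glue z"
proof -
  have "\<forall>T. \<exists>p. T = tree_inner (fst p) (snd p)" using tree_inner_surj by (metis fst_conv snd_conv)
  then obtain c where c: "\<And>T. T = tree_inner (fst (c T)) (snd (c T))" by metis
  have "glue (ext (\<lambda>T. frag_of (c T)) x) = ext frag_of x"
    unfolding additive_ext_apply[OF additive_glue] using c
    by (intro ext_cong) (simp add: glue_def case_prod_unfold)
  then show ?thesis by (intro exI[of _ "ext (\<lambda>T. frag_of (c T)) x"]) simp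
qed

definition all_relators :: "(utree \<Rightarrow>\<^sub>0 int) set" where
  "all_relators = {frag_of (tree_inner (Node A B) C) + frag_of (tree_inner (Node B A) C) | A B C. True} \<union>
     {frag_of (tree_inner (Node (Node A B) C) K) - frag_of (tree_inner (Node A (Node B C)) K)
        + frag_of (tree_inner (Node B (Node A C)) K) | A B C K. True}"

lemma ext_magma_mult_frag:
  "ext f (magma_mult x (frag_of K)) = ext (\<lambda>I. f (Node I K)) x"
  "ext f (magma_mult (frag_of K) x) = ext (\<lambda>I. f (Node K I)) x"
  by (rule additive_eqI[of "\<lambda>x. ext f (magma_mult x (frag_of K))"],
      auto intro: additive_comp[OF additive_ext additive_magma_mult(1)] additive_ext)
     (rule additive_eqI[of "\<lambda>x. ext f (magma_mult (frag_of K) x)"],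
      auto intro: additive_comp[OF additive_ext additive_magma_mult(2)] additive_ext)

text \<open>A relation inside a larger rooted tree is brought to the root by moving the cut edge,
  which changes the other half; therefore \<open>K\<close> is arbitrary in the induction.\<close>

lemma qrel_all_relators: "r \<in> qrel \<Longrightarrow> ext (\<lambda>I. frag_of (tree_inner I K)) r \<in> zmod.span all_relators"
proof (induction arbitrary: K rule: qrel.induct)
  case qrel_0
  show ?case using zmod.span_zero by simp
next
  case (qrel_diff x y)
  show ?case unfolding additive.diff[OF additive_ext] by (rule zmod.span_diff[OF qrel_diff.IH])
next
  case (qrel_AS I J)
  show ?case unfolding additive.add[OF additive_ext] ext_frag_of
    by (rule zmod.span_base) (unfold all_relators_def, blast)
next
  case (qrel_IHX A B C)
  show ?case unfolding additive.add[OF additive_ext] additive.diff[OF additive_ext] ext_frag_of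
    by (rule zmod.span_base) (unfold all_relators_def, blast)
next
  case (qrel_left x J)
  show ?case unfolding ext_magma_mult_frag tree_inner_rotate by (rule qrel_left.IH)
next
  case (qrel_right x J)
  have "tree_inner (Node J I) K = tree_inner I (Node K J)" for I
    by (metis tree_inner_rotate tree_inner_sym)
  then show ?case unfolding ext_magma_mult_frag using qrel_right.IH by simp
qed

lemma trel_all_relators: "r \<in> trel \<Longrightarrow> glue r \<in> zmod.span all_relators"
proof (induction rule: trel.induct)
  case trel_0
  show ?case using zmod.span_zero by (simp add: additive.zero[OF additive_glue])
next
  case (trel_diff x y)
  show ?case unfolding additive.diff[OF additive_glue] by (rule zmod.span_diff[OF trel_diff.IH])
next
  case (trel_sym I J)
  show ?case using zmod.span_zero by (simp add: glue_def tree_inner_sym[of I J])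
next
  case (trel_rot A B C)
  show ?case using zmod.span_zero by (simp add: glue_def tree_inner_rotate)
next
  case (trel_qrel r J)
  have "glue (ext (\<lambda>I. frag_of (I, J)) r) = ext (\<lambda>I. frag_of (tree_inner I J)) r"
    unfolding additive_ext_apply[OF additive_glue] by (simp add: glue_def)
  then show ?case using qrel_all_relators[OF trel_qrel] by simp
qed

lemma keys_add_subset: "Poly_Mapping.keys a \<subseteq> S \<Longrightarrow> Poly_Mapping.keys b \<subseteq> S \<Longrightarrow> Poly_Mapping.keys (a + b) \<subseteq> S"
  and keys_diff_subset: "Poly_Mapping.keys a \<subseteq> S \<Longrightarrow> Poly_Mapping.keys b \<subseteq> S \<Longrightarrow> Poly_Mapping.keys (a - b) \<subseteq> S"
  for a b :: "'x \<Rightarrow>\<^sub>0 int"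
  using Poly_Mapping.keys_add[of a b] keys_diff[of a b] by blast+

lemma tree_relators_props:
  assumes "r \<in> AS_relators m n \<union> IHX_relators m n"
  shows "Poly_Mapping.keys r \<subseteq> utrees m n" "ext vsum r = 0"
proof -
  have "Poly_Mapping.keys r \<subseteq> utrees m n \<and> ext vsum r = 0"
    using assms
  proof
    assume "r \<in> AS_relators m n"
    then obtain A B C where r: "r = frag_of (tree_inner (Node A B) C) + frag_of (tree_inner (Node B A) C)"
      "tree_inner (Node A B) C \<in> utrees m n" unfolding AS_relators_eq by blast
    have "tree_inner (Node B A) C \<in> utrees m n" using r(2) unfolding utrees_tree_inner by auto
    moreover have "ext vsum r = eta (pr (br (qt A) (qt B) + br (qt B) (qt A)) (qt C))"
      unfolding r(1) by (simp add: vsum_tree_inner)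
    then have "ext vsum r = 0" using br_anti[of "qt A" "qt B"] by simp
    ultimately show ?thesis using r(2) unfolding r(1) by (intro conjI keys_add_subset) simp_all
  next
    assume "r \<in> IHX_relators m n"
    then obtain A B C K where r: "r = frag_of (tree_inner (Node (Node A B) C) K) - frag_of (tree_inner (Node A (Node B C)) K)
        + frag_of (tree_inner (Node B (Node A C)) K)" "tree_inner (Node (Node A B) C) K \<in> utrees m n"
      unfolding IHX_relators_def by blast
    have "tree_inner (Node A (Node B C)) K \<in> utrees m n" "tree_inner (Node B (Node A C)) K \<in> utrees m n"
      using r(2) unfolding utrees_tree_inner by auto
    moreover have "ext vsum r = eta (pr (br (br (qt A) (qt B)) (qt C) - br (qt A) (br (qt B) (qt C)) + br (qt B) (br (qt A) (qt C))) (qt K))"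
      unfolding r(1) by (simp add: vsum_tree_inner)
    then have "ext vsum r = 0" using br_jacobi[of "qt A" "qt B" "qt C"] by simp
    ultimately show ?thesis using r(2) unfolding r(1) by (intro conjI keys_add_subset keys_diff_subset) simp_all
  qed
  then show "Poly_Mapping.keys r \<subseteq> utrees m n" "ext vsum r = 0" by blast+
qed

lemma restr_all_relators:
  assumes "x \<in> zmod.span all_relators"
  shows "restr (utrees m n) x \<in> zmod.span (AS_relators m n \<union> IHX_relators m n)"
  using assms
proof (induction rule: zspan_frag_induct)
  case zero
  show ?case using zmod.span_zero by simp
next
  case (diff x y)
  show ?case unfolding restr_simps by (rule zmod.span_diff[OF diff])
next
  case (base r)
  then consider A B C where "r = frag_of (tree_inner (Node A B) C) + frag_of (tree_inner (Node B A) C)"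
    | A B C K where "r = frag_of (tree_inner (Node (Node A B) C) K) - frag_of (tree_inner (Node A (Node B C)) K)
        + frag_of (tree_inner (Node B (Node A C)) K)"
    unfolding all_relators_def by blast
  then show ?case
  proof cases
    case 1
    have e: "tree_inner (Node B A) C \<in> utrees m n \<longleftrightarrow> tree_inner (Node A B) C \<in> utrees m n"
      unfolding utrees_tree_inner by auto
    show ?thesis
    proof (cases "tree_inner (Node A B) C \<in> utrees m n")
      case True
      then have "r \<in> AS_relators m n" unfolding AS_relators_eq 1 by blast
      moreover have "restr (utrees m n) r = r" using True e by (simp add: 1 restr_frag_of)
      ultimately show ?thesis by (simp add: zmod.span_base)
    next
      case False
      then show ?thesis using e zmod.span_zero by (simp add: 1 restr_frag_of)
    qed
  next
    case 2
    have e: "tree_inner (Node A (Node B C)) K \<in> utrees m n \<longleftrightarrow> tree_inner (Node (Node A B) C) K \<in> utrees m n"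
      "tree_inner (Node B (Node A C)) K \<in> utrees m n \<longleftrightarrow> tree_inner (Node (Node A B) C) K \<in> utrees m n"
      unfolding utrees_tree_inner by auto
    show ?thesis
    proof (cases "tree_inner (Node (Node A B) C) K \<in> utrees m n")
      case True
      then have "r \<in> IHX_relators m n" unfolding IHX_relators_def 2 by blast
      moreover have "restr (utrees m n) r = r" using True e by (simp add: 2 restr_frag_of)
      ultimately show ?thesis by (simp add: zmod.span_base)
    next
      case False
      then show ?thesis using e zmod.span_zero by (simp add: 2 restr_frag_of)
    qed
  qed
qed

text \<open>Here injectivity of \<open>eta\<close> enters. It first yields a combination of relators
  of all orders and labels; truncation to \<open>utrees\<close> then keeps those of order
  \<open>n\<close> with labels up to \<open>m\<close>.\<close>

lemma ext_vsum_eq_0_iff: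
  assumes z: "Poly_Mapping.keys z \<subseteq> utrees m n"
  shows "ext vsum z = 0 \<longleftrightarrow> z \<in> zmod.span (AS_relators m n \<union> IHX_relators m n)"
proof
  assume z0: "ext vsum z = 0"
  obtain z' where z': "z = glue z'" using glue_surj by blast
  then have "tc z' = 0" using z0 eta_eq_0D by (simp add: ext_vsum_glue)
  then have "z \<in> zmod.span all_relators" using trel_all_relators z' by (simp add: tc_eq_0_iff)
  then show "z \<in> zmod.span (AS_relators m n \<union> IHX_relators m n)"
    using restr_all_relators[of z m n] restr_id[OF z] by simp
next
  assume "z \<in> zmod.span (AS_relators m n \<union> IHX_relators m n)"
  then show "ext vsum z = 0" by (rule zspan_ext_eq_0) (rule tree_relators_props(2))
qed

definition rU :: "(utree \<Rightarrow>\<^sub>0 int) set \<Rightarrow> vlie" where "rU = induced (ext vsum)"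

lemma realizes_T: "realizes (T_group m n) rU"
  and rU_class: "Poly_Mapping.keys z \<subseteq> utrees m n \<Longrightarrow> rU (T_class m n z) = ext vsum z"
  and carrier_T: "carrier (T_group m n) = T_class m n ` {z. Poly_Mapping.keys z \<subseteq> utrees m n}"
  unfolding T_group_def T_class_def rU_def
  using realizes_presented[OF tree_relators_props(1) additive_ext ext_vsum_eq_0_iff] by blast+

lemma lookup_vproj: "Poly_Mapping.lookup (vproj P s) i = qproj (\<lambda>d. P (add_mset i d)) (Poly_Mapping.lookup s i)"
  by (induction s rule: v_induct) (simp_all add: vproj_single lookup_single when_def lookup_minus)

text \<open>The label in the first factor counts as one more leaf, which shifts the index of
  \<open>gdeg\<close>; a tree of order \<open>n\<close> has n + 2 leaves.\<close>

lemma vhom_iff: "s \<in> vhom m n \<longleftrightarrow> vproj (gdeg m (Suc n)) s = s"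
proof -
  have z: "qproj (\<lambda>d. False) u = 0" for u
    using qproj_disjoint[of "\<lambda>d. False" "qproj (\<lambda>d. False) u" "\<lambda>d. False"] by simp
  have g: "(\<lambda>d. gdeg m (Suc n) (add_mset i d)) = (if i \<in> {1..m} then gdeg m n else (\<lambda>d. False))" for i
    by (auto simp: gdeg_def fun_eq_iff)
  have "vproj (gdeg m (Suc n)) s = s \<longleftrightarrow> (\<forall>i. Poly_Mapping.lookup (vproj (gdeg m (Suc n)) s) i = Poly_Mapping.lookup s i)"
    by (auto intro: poly_mapping_eqI)
  also have "\<dots> \<longleftrightarrow> (\<forall>i. (if i \<in> {1..m} then qproj (gdeg m n) (Poly_Mapping.lookup s i) else 0) = Poly_Mapping.lookup s i)"
    unfolding lookup_vproj g by (auto simp: z)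
  also have "\<dots> \<longleftrightarrow> s \<in> vhom m n"
    unfolding vhom_def subset_iff in_keys_iff by (auto split: if_splits) (metis qproj_simps(1))+
  finally show ?thesis ..
qed

lemma pair_utrees_iff: "gdeg m (Suc n) (lm I + lm J) \<longleftrightarrow> tree_inner I J \<in> utrees m n"
  unfolding gdeg_def utrees_tree_inner by (simp add: set_mset_lm size_lm)

lemma ls_vhom: "tree_inner I J \<in> utrees m n \<Longrightarrow> ls I (qt J) \<in> vhom m n"
  by (simp add: vhom_iff vproj_ls pair_utrees_iff)

lemma vsum_vhom:
  assumes "T \<in> utrees m n"
  shows "vsum T \<in> vhom m n" "vbr (vsum T) = 0"
proof -
  obtain I J where T: "T = tree_inner I J" using tree_inner_surj by blast
  have "vproj (gdeg m (Suc n)) (vsum T) = vsum T"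
    using assms unfolding T vsum_tree_inner eta_tproj[symmetric] tproj_pr_qt pair_utrees_iff by simp
  then show "vsum T \<in> vhom m n" by (simp add: vhom_iff)
  show "vbr (vsum T) = 0" by (simp add: T vsum_tree_inner)
qed

text \<open>Exactness in the middle, cut down to one degree: a preimage under \<open>eta\<close> may
  be projected to that degree because \<open>eta\<close> commutes with the projections.\<close>

lemma vsum_image: "ext vsum ` {z. Poly_Mapping.keys z \<subseteq> utrees m n} = {s \<in> vhom m n. vbr s = 0}"
proof (intro equalityI subsetI)
  fix s assume "s \<in> ext vsum ` {z. Poly_Mapping.keys z \<subseteq> utrees m n}"
  then obtain z where z: "s = ext vsum z" "Poly_Mapping.keys z \<subseteq> utrees m n" by blast
  have "ext vsum z \<in> vhom m n \<and> vbr (ext vsum z) = 0" using z(2)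
    by (induction z rule: frag_induction) (auto simp: vhom_0 vhom_diff vsum_vhom)
  then show "s \<in> {s \<in> vhom m n. vbr s = 0}" using z by simp
next
  fix s assume "s \<in> {s \<in> vhom m n. vbr s = 0}"
  then have s: "vproj (gdeg m (Suc n)) s = s" "vbr s = 0" by (simp_all add: vhom_iff)
  obtain t where "s = eta t" using s(2) vbr_eq_0_iff by blast
  moreover obtain z where "t = tc z" using tc_surj by blast
  ultimately have e: "s = eta (tc (restr {(I, J). gdeg m (Suc n) (lm I + lm J)} z))"
    using s(1) by (simp add: eta_tproj[symmetric] tproj_tc)
  let ?z = "glue (restr {(I, J). gdeg m (Suc n) (lm I + lm J)} z)"
  have "Poly_Mapping.keys ?z \<subseteq> utrees m n"
    using keys_frag_extend[of "\<lambda>(I, J). frag_of (tree_inner I J)" "restr {(I, J). gdeg m (Suc n) (lm I + lm J)} z"]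
    unfolding glue_def frag_extend_eq_ext keys_restr by (force simp: pair_utrees_iff)
  then show "s \<in> ext vsum ` {z. Poly_Mapping.keys z \<subseteq> utrees m n}"
    using e by (auto simp: ext_vsum_glue[symmetric])
qed

lemma rU_image: "rU ` carrier (T_group m n) = {s \<in> vhom m n. vbr s = 0}"
proof -
  have "rU ` carrier (T_group m n) = ext vsum ` {z. Poly_Mapping.keys z \<subseteq> utrees m n}"
    unfolding carrier_T image_image by (intro image_cong) (auto simp: rU_class)
  then show ?thesis by (simp only: vsum_image)
qed

section \<open>Homomorphisms and isomorphisms of quotients obtained from realizations\<close>

lemma realizes_hom:
  assumes G: "realizes G r" and H: "realizes H s" and p: "additive p"
    and f: "\<And>x. x \<in> carrier G \<Longrightarrow> f x \<in> carrier H" "\<And>x. x \<in> carrier G \<Longrightarrow> s (f x) = p (r x)"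
  shows "group_hom G H f"
proof -
  interpret G: comm_group G by (rule realizes_comm_group[OF G])
  interpret H: comm_group H by (rule realizes_comm_group[OF H])
  show ?thesis
  proof
    show "f \<in> hom G H"
    proof (rule homI)
      show "f x \<in> carrier H" if "x \<in> carrier G" for x using f(1)[OF that] .
      fix x y assume xy: "x \<in> carrier G" "y \<in> carrier G"
      have "s (f (x \<otimes>\<^bsub>G\<^esub> y)) = s (f x \<otimes>\<^bsub>H\<^esub> f y)"
        using xy f realizesD(4)[OF G xy] realizesD(4)[OF H f(1)[OF xy(1)] f(1)[OF xy(2)]] by (simp add: additive.add[OF p])
      then show "f (x \<otimes>\<^bsub>G\<^esub> y) = f x \<otimes>\<^bsub>H\<^esub> f y" using xy f(1) by (intro realizesD(5)[OF H]) simp_all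
    qed
  qed
qed

lemma realizes_image_eq:
  assumes "realizes K s" "\<And>x. x \<in> C \<Longrightarrow> f x \<in> carrier K" "B \<subseteq> carrier K" "\<And>x. x \<in> C \<Longrightarrow> s (f x) = p (r x)"
    "p ` r ` C = s ` B"
  shows "f ` C = B"
proof -
  have "inj_on s (carrier K)" using assms(1) by (simp add: realizes_def)
  moreover have "s ` f ` C = s ` B" unfolding assms(5)[symmetric] image_image using assms(4) by (intro image_cong) simp_all
  ultimately show ?thesis using assms(2,3) by (metis image_subsetI inj_on_image_eq_iff)
qed

lemma induced_iso_Mod:
  assumes h: "group_hom G H h" and surj: "h ` carrier G = carrier H" and N: "kernel G H h = N"
  shows "induced h \<in> iso (G Mod N) H"
proof -
  have "induced h = (\<lambda>X. the_elem (h ` X))" by (simp add: induced_def fun_eq_iff)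
  then show ?thesis using group_hom.FactGroup_iso_set[OF h surj] N by simp
qed

lemma induced_iso_Mod_image:
  assumes G: "comm_group G" and H: "comm_group H" and h: "h \<in> iso G H" and N: "subgroup N G"
  shows "induced (\<lambda>x. (h ` N) #>\<^bsub>H\<^esub> h x) \<in> iso (G Mod N) (H Mod (h ` N))"
proof -
  interpret G: comm_group G by (rule G)
  interpret H: comm_group H by (rule H)
  interpret h: group_hom G H h using h by unfold_locales (simp add: iso_def)
  have bij: "bij_betw h (carrier G) (carrier H)" using h by (simp add: iso_def)
  have sub: "subgroup (h ` N) H" using h.subgroup_img_is_subgroup[OF N] .
  interpret hN: normal "h ` N" H using H.subgroup_imp_normal[OF sub] .
  have N_sub: "N \<subseteq> carrier G" using subgroup.subset[OF N] .
  show ?thesis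
  proof (rule induced_iso_Mod)
    have "(\<lambda>x. (h ` N) #>\<^bsub>H\<^esub> x) \<in> hom H (H Mod (h ` N))" by (rule hN.r_coset_hom_Mod)
    then have "(\<lambda>x. (h ` N) #>\<^bsub>H\<^esub> h x) \<in> hom G (H Mod (h ` N))"
      using hom_compose[OF h.homh] by (simp add: comp_def)
    then show "group_hom G (H Mod (h ` N)) (\<lambda>x. (h ` N) #>\<^bsub>H\<^esub> h x)"
      unfolding group_hom_def group_hom_axioms_def using G.is_group hN.factorgroup_is_group by blast
    have "carrier (H Mod (h ` N)) = (\<lambda>x. (h ` N) #>\<^bsub>H\<^esub> x) ` carrier H"
      by (auto simp: FactGroup_def RCOSETS_def)
    also have "\<dots> = (\<lambda>x. (h ` N) #>\<^bsub>H\<^esub> h x) ` carrier G"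
      using bij by (simp add: bij_betw_def flip: image_image[of "\<lambda>x. (h ` N) #>\<^bsub>H\<^esub> x" h])
    finally show "(\<lambda>x. (h ` N) #>\<^bsub>H\<^esub> h x) ` carrier G = carrier (H Mod (h ` N))" ..
    have "(h ` N) #>\<^bsub>H\<^esub> h x = h ` N \<longleftrightarrow> x \<in> N" if "x \<in> carrier G" for x
    proof -
      have "(h ` N) #>\<^bsub>H\<^esub> h x = h ` N \<longleftrightarrow> h x \<in> h ` N"
        using that H.coset_join1[OF _ _ sub] H.coset_join2[OF _ sub] by auto
      also have "\<dots> \<longleftrightarrow> x \<in> N" using bij that N_sub by (auto simp: bij_betw_def inj_on_def)
      finally show ?thesis .
    qed
    then show "kernel G (H Mod (h ` N)) (\<lambda>x. (h ` N) #>\<^bsub>H\<^esub> h x) = N"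
      using N_sub by (auto simp: kernel_def FactGroup_def)
  qed
qed

section \<open>The maps \<open>\<eta>\<close>\<close>

lemma keys_lsum:
  assumes "(i, K) \<in> Poly_Mapping.keys (lsum I J)"
  shows "i \<in> rlabels I \<union> rlabels J" "rlabels K \<subseteq> rlabels I \<union> rlabels J" "rorder K = rorder I + rorder J"
proof -
  have "i \<in> rlabels I \<union> rlabels J \<and> rlabels K \<subseteq> rlabels I \<union> rlabels J \<and> rorder K = rorder I + rorder J"
    using assms
  proof (induction I arbitrary: J)
    case (Node A B)
    then have "(i, K) \<in> Poly_Mapping.keys (lsum A (Node B J)) \<or> (i, K) \<in> Poly_Mapping.keys (lsum B (Node J A))"
      using Poly_Mapping.keys_add[of "lsum A (Node B J)" "lsum B (Node J A)"] by auto
    then show ?case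
    proof
      assume "(i, K) \<in> Poly_Mapping.keys (lsum A (Node B J))"
      from Node.IH(1)[OF this] show ?thesis by auto
    next
      assume "(i, K) \<in> Poly_Mapping.keys (lsum B (Node J A))"
      from Node.IH(2)[OF this] show ?thesis by auto
    qed
  qed auto
  then show "i \<in> rlabels I \<union> rlabels J" "rlabels K \<subseteq> rlabels I \<union> rlabels J" "rorder K = rorder I + rorder J"
    by blast+
qed

lemma keys_vertex_sum:
  assumes "T \<in> utrees m n"
  shows "Poly_Mapping.keys (vertex_sum T) \<subseteq> {1..m} \<times> rtrees m n"
proof
  fix p assume p: "p \<in> Poly_Mapping.keys (vertex_sum T)"
  obtain I J where T: "T = tree_inner I J" using tree_inner_surj by blast
  have u: "rlabels I \<union> rlabels J \<subseteq> {1..m}" "rorder I + rorder J = n" using assms unfolding T utrees_tree_inner by auto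
  obtain i K where iK: "p = (i, K)" by (cases p)
  have "(i, K) \<in> Poly_Mapping.keys (lsum I J) \<or> (i, K) \<in> Poly_Mapping.keys (lsum J I)"
    using p Poly_Mapping.keys_add[of "lsum I J" "lsum J I"] by (auto simp: T iK vertex_sum_tree_inner)
  then have "i \<in> rlabels I \<union> rlabels J" "rlabels K \<subseteq> rlabels I \<union> rlabels J" "rorder K = n"
    using keys_lsum[of i K I J] keys_lsum[of i K J I] u(2) by auto
  then show "p \<in> {1..m} \<times> rtrees m n" using u(1) by (auto simp: iK rtrees_def)
qed

lemma quasi_eta_tree:
  assumes "T \<in> utrees m n"
  shows "quasi_eta_tree m n T \<in> carrier (quasiLL_group m n)" "rQQ m (quasi_eta_tree m n T) = vsum T"
proof -
  let ?b = "\<lambda>(i, J). pure_tensor (quasiL_group m 1) (quasiL_group m (n + 1))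
        (quasi_class m 1 (frag_of (Leaf i))) (quasi_class m (n + 1) (frag_of J))"
  have b: "?b (i, J) \<in> carrier (quasiLL_group m n)" "rQQ m (?b (i, J)) = Poly_Mapping.single i (qt J)"
    if "(i, J) \<in> Poly_Mapping.keys (vertex_sum T)" for i J
  proof -
    have iJ: "i \<in> {1..m}" "Poly_Mapping.keys (frag_of J) \<subseteq> rtrees m (n + 1 - 1)"
      using keys_vertex_sum[OF assms] that by auto
    show "?b (i, J) \<in> carrier (quasiLL_group m n)" "rQQ m (?b (i, J)) = Poly_Mapping.single i (qt J)"
      using QQ_pure[OF iJ(1) quasi_class_closed[OF iJ(2)]] rQ_class[OF iJ(2)] by simp_all
  qed
  note l = realizes_lin_extend[OF realizes_QQ, of "vertex_sum T" ?b]
  show "quasi_eta_tree m n T \<in> carrier (quasiLL_group m n)"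
    unfolding quasi_eta_tree_def using b(1) by (intro l(1)) auto
  have "rQQ m (quasi_eta_tree m n T) = ext (\<lambda>p. rQQ m (?b p)) (vertex_sum T)"
    unfolding quasi_eta_tree_def using b(1) by (intro l(2)) auto
  also have "\<dots> = vsum T" unfolding vsum_def using b(2) by (intro ext_cong) auto
  finally show "rQQ m (quasi_eta_tree m n T) = vsum T" .
qed

lemma eta_tree:
  assumes "T \<in> utrees m n"
  shows "eta_tree m n T \<in> carrier (LL_group m n)" "rLL m (eta_tree m n T) = vk (vsum T)"
proof -
  let ?b = "\<lambda>(i, J). pure_tensor (L_group m 1) (L_group m (n + 1))
        (Lie_class m (frag_of (Leaf i))) (Lie_class m (frag_of J))"
  have b: "?b (i, J) \<in> carrier (LL_group m n)" "rLL m (?b (i, J)) = vk (Poly_Mapping.single i (qt J))"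
    if "(i, J) \<in> Poly_Mapping.keys (vertex_sum T)" for i J
  proof -
    have iJ: "i \<in> {1..m}" "Poly_Mapping.keys (frag_of J) \<subseteq> rtrees m (n + 1 - 1)"
      using keys_vertex_sum[OF assms] that by auto
    show "?b (i, J) \<in> carrier (LL_group m n)" "rLL m (?b (i, J)) = vk (Poly_Mapping.single i (qt J))"
      using LL_pure[OF iJ(1) Lie_class_closed[OF iJ(2)]] rL_class'[OF iJ(2)] by (simp_all add: vk_single kz_def)
  qed
  note l = realizes_lin_extend[OF realizes_LL, of "vertex_sum T" ?b]
  show "eta_tree m n T \<in> carrier (LL_group m n)"
    unfolding eta_tree_def using b(1) by (intro l(1)) auto
  have "rLL m (eta_tree m n T) = ext (\<lambda>p. rLL m (?b p)) (vertex_sum T)"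
    unfolding eta_tree_def using b(1) by (intro l(2)) auto
  also have "\<dots> = vk (vsum T)"
    unfolding vsum_def additive_ext_apply[OF additive_vk] using b(2) by (intro ext_cong) auto
  finally show "rLL m (eta_tree m n T) = vk (vsum T)" .
qed

lemma quasi_eta:
  assumes "X \<in> carrier (T_group m n)"
  shows "quasi_eta m n X \<in> carrier (quasiLL_group m n)" "rQQ m (quasi_eta m n X) = rU X"
proof -
  obtain z where z: "X = T_class m n z" "Poly_Mapping.keys z \<subseteq> utrees m n" using assms unfolding carrier_T by blast
  have e: "ext (\<lambda>T. rQQ m (quasi_eta_tree m n T)) z = ext vsum z" if "Poly_Mapping.keys z \<subseteq> utrees m n" for z
    using that by (intro ext_cong quasi_eta_tree(2)) auto
  note i = induced_lin_extend[OF tree_relators_props(1) realizes_QQ quasi_eta_tree(1) _ z(2)]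
  have kill: "ext (\<lambda>T. rQQ m (quasi_eta_tree m n T)) r = 0" if "r \<in> AS_relators m n \<union> IHX_relators m n" for r
    using tree_relators_props[OF that] by (simp add: e)
  show "quasi_eta m n X \<in> carrier (quasiLL_group m n)"
    unfolding quasi_eta_def z(1) T_class_def by (rule i(3)[OF _ _ kill])
  have "rQQ m (quasi_eta m n X) = ext (\<lambda>T. rQQ m (quasi_eta_tree m n T)) z"
    unfolding quasi_eta_def z(1) T_class_def by (rule i(2)[OF _ _ kill])
  then show "rQQ m (quasi_eta m n X) = rU X" by (simp add: e z rU_class)
qed

definition eta_T :: "nat \<Rightarrow> nat \<Rightarrow> (utree \<Rightarrow>\<^sub>0 int) set \<Rightarrow> rtensor" where
  "eta_T m n = induced (lin_extend (LL_group m n) (eta_tree m n))"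

lemma eta_T:
  assumes "X \<in> carrier (T_group m n)"
  shows "eta_T m n X \<in> carrier (LL_group m n)" "rLL m (eta_T m n X) = vk (rU X)"
proof -
  obtain z where z: "X = T_class m n z" "Poly_Mapping.keys z \<subseteq> utrees m n" using assms unfolding carrier_T by blast
  have e: "ext (\<lambda>T. rLL m (eta_tree m n T)) z = vk (ext vsum z)" if "Poly_Mapping.keys z \<subseteq> utrees m n" for z
    unfolding additive_ext_apply[OF additive_vk] using that by (intro ext_cong eta_tree(2)) auto
  note i = induced_lin_extend[OF tree_relators_props(1) realizes_LL eta_tree(1) _ z(2)]
  have kill: "ext (\<lambda>T. rLL m (eta_tree m n T)) r = 0" if "r \<in> AS_relators m n \<union> IHX_relators m n" for r
    using tree_relators_props[OF that] by (simp add: e)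
  show "eta_T m n X \<in> carrier (LL_group m n)"
    unfolding eta_T_def z(1) T_class_def by (rule i(3)[OF _ _ kill])
  have "rLL m (eta_T m n X) = ext (\<lambda>T. rLL m (eta_tree m n T)) z"
    unfolding eta_T_def z(1) T_class_def by (rule i(2)[OF _ _ kill])
  then show "rLL m (eta_T m n X) = vk (rU X)" by (simp add: e z rU_class)
qed

text \<open>Source and target are realized by the same elements of W tensor L', the kernel of the
  bracket in that degree, and on these the map is the identity.\<close>

lemma quasi_eta_iso: "quasi_eta m n \<in> iso (T_group m n) (quasiD_group m n)"
proof (rule realizes_iso[OF realizes_T realizes_quasiD])
  show "quasi_eta m n ` carrier (T_group m n) = carrier (quasiD_group m n)"
    by (rule realizes_image_eq[where K = "quasiLL_group m n" and s = "rQQ m" and p = "\<lambda>x. x" and r = rU])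
       (auto simp: realizes_QQ quasi_eta carrier_quasiD rU_image rQQ_D_image)
qed (auto simp: additive_ident quasi_eta(2))

definition vsq :: "vlie \<Rightarrow> vlie" where "vsq = vext (\<lambda>i u. Poly_Mapping.single i (br u u))"

lemma additive_single_square: "additive (\<lambda>u. Poly_Mapping.single i (br u u))"
  by (rule additive_comp[OF additive_single additive_square])

lemma additive_vsq: "additive vsq"
  unfolding vsq_def by (rule additive_vext) (rule additive_single_square)

text \<open>The leaves in the two copies of \<open>J\<close> see [J,i] and [i,J] and cancel, so only
  the leaf \<open>i\<close> contributes. After a rotation the same tree is <(i,J),J>.\<close>

lemma vsum_square: "vsum (tree_inner (Leaf i) (Node J J)) = Poly_Mapping.single i (br (qt J) (qt J))"
proof -
  have "ls J (br (qt J) (qt (Leaf i))) + ls J (br (qt (Leaf i)) (qt J)) = 0"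
    unfolding additive.add[OF additive_ls, symmetric] using br_anti[of "qt J" "qt (Leaf i)"] by (simp del: br_qt)
  then show ?thesis by (simp add: vsum_tree_inner_ls)
qed

lemma Delta_tree:
  assumes "T \<in> utrees m (k - 1)" "1 \<le> k"
  shows "Poly_Mapping.keys (Delta_tree T) \<subseteq> utrees m (2 * k - 1)" "ext vsum (Delta_tree T) = vsq (vsum T)"
proof -
  have "tree_inner (Leaf i) (Node J J) \<in> utrees m (2 * k - 1)" if "(i, J) \<in> Poly_Mapping.keys (vertex_sum T)" for i J
    using keys_vertex_sum[OF assms(1)] that assms(2) unfolding utrees_tree_inner by (auto simp: rtrees_def)
  then show "Poly_Mapping.keys (Delta_tree T) \<subseteq> utrees m (2 * k - 1)"
    using keys_frag_extend[of "\<lambda>(i, J). frag_of (tree_inner (Leaf i) (Node J J))" "vertex_sum T"]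
    unfolding Delta_tree_def by fastforce
  show "ext vsum (Delta_tree T) = vsq (vsum T)"
    unfolding Delta_tree_def frag_extend_eq_ext vsum_def[of T] additive_ext_apply[OF additive_ext] additive_ext_apply[OF additive_vsq]
    by (intro ext_cong) (auto simp: vsum_square vsq_def vext_single[OF additive_single_square])
qed

lemma Delta:
  assumes "1 \<le> k" "X \<in> carrier (T_group m (k - 1))"
  shows "Delta m k X \<in> carrier (T_group m (2 * k - 1))" "rU (Delta m k X) = vsq (rU X)"
proof -
  let ?R = "AS_relators m (k - 1) \<union> IHX_relators m (k - 1)"
  obtain z where z: "X = T_class m (k - 1) z" "Poly_Mapping.keys z \<subseteq> utrees m (k - 1)" using assms(2) unfolding carrier_T by blast
  have k: "Poly_Mapping.keys (ext Delta_tree z) \<subseteq> utrees m (2 * k - 1)" if "Poly_Mapping.keys z \<subseteq> utrees m (k - 1)" for z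
    using keys_frag_extend[of Delta_tree z] Delta_tree(1)[OF _ assms(1)] that unfolding frag_extend_eq_ext by blast
  have e: "ext vsum (ext Delta_tree z) = vsq (ext vsum z)" if "Poly_Mapping.keys z \<subseteq> utrees m (k - 1)" for z
    unfolding additive_ext_apply[OF additive_ext] additive_ext_apply[OF additive_vsq]
    using that by (intro ext_cong Delta_tree(2)[OF _ assms(1)]) auto
  have c: "T_class m (2 * k - 1) (ext Delta_tree z) \<in> carrier (T_group m (2 * k - 1))"
    "rU (T_class m (2 * k - 1) (ext Delta_tree z)) = vsq (ext vsum z)" if "Poly_Mapping.keys z \<subseteq> utrees m (k - 1)" for z
    using k[OF that] e[OF that] unfolding carrier_T by (auto simp: rU_class)
  have rel: "relator_subgroup (utrees m (k - 1)) ?R = zmod.span ?R"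
    by (rule relator_subgroup_eq) (rule tree_relators_props(1))
  have "Delta m k X = T_class m (2 * k - 1) (ext Delta_tree z)"
    unfolding Delta_def z(1) T_class_def[of m "k - 1"] presented_class_def frag_extend_eq_ext rel
  proof (rule induced_coset[OF frag_subgroup_zspan[OF tree_relators_props(1)]])
    fix r assume r: "r \<in> zmod.span ?R"
    then have kr: "Poly_Mapping.keys r \<subseteq> utrees m (k - 1)"
      using keys_zspan[of ?R "utrees m (k - 1)" r] tree_relators_props(1)[of _ m "k - 1"] by blast
    then have krz: "Poly_Mapping.keys (r + z) \<subseteq> utrees m (k - 1)" using z(2) by (intro keys_add_subset)
    have "ext vsum (r + z) = ext vsum z" using r ext_vsum_eq_0_iff[OF kr] by simp
    then show "T_class m (2 * k - 1) (ext Delta_tree (r + z)) = T_class m (2 * k - 1) (ext Delta_tree z)"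
      using c[OF krz] c[OF z(2)] by (intro realizesD(5)[OF realizes_T]) simp_all
  qed
  then show "Delta m k X \<in> carrier (T_group m (2 * k - 1))" "rU (Delta m k X) = vsq (rU X)"
    using c[OF z(2)] rU_class[OF z(2)] z(1) by simp_all
qed

text \<open>\<open>quasi_eta\<close> is an isomorphism already, and the target is divided by the
  image of the subgroup by which the source is divided.\<close>

lemma eta_tilde_iso:
  assumes "1 \<le> k"
  shows "eta_tilde m k \<in> iso (T_tilde m k) (D_tilde m k)"
proof -
  interpret Delta: group_hom "T_group m (k - 1)" "T_group m (2 * k - 1)" "Delta m k"
    using realizes_hom[OF realizes_T realizes_T additive_vsq Delta[OF assms]] .
  have "subgroup (Im_Delta m k) (T_group m (2 * k - 1))" unfolding Im_Delta_def by (rule Delta.img_is_subgroup)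
  from induced_iso_Mod_image[OF realizes_comm_group[OF realizes_T] realizes_comm_group[OF realizes_quasiD] quasi_eta_iso this]
  show ?thesis unfolding eta_tilde_def T_tilde_def D_tilde_def .
qed

lemma sum_single_lookup:
  "(\<Sum>i\<in>Poly_Mapping.keys s. Poly_Mapping.single i (Poly_Mapping.lookup s i)) = s"
  by (rule poly_mapping_eqI) (simp add: lookup_sum_single in_keys_iff)

lemma vbr_vhom:
  assumes "s \<in> vhom m n"
  shows "qproj (gdeg m (n + 1)) (vbr s) = vbr s"
proof -
  have "qproj (gdeg m (n + 1)) (br (qt (Leaf i)) (Poly_Mapping.lookup s i)) = br (qt (Leaf i)) (Poly_Mapping.lookup s i)"
    if "i \<in> Poly_Mapping.keys s" for i
  proof (rule qproj_br)
    show "qproj ((=) {#i#}) (qt (Leaf i)) = qt (Leaf i)" by (simp add: qproj_qt)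
    show "qproj (gdeg m n) (Poly_Mapping.lookup s i) = Poly_Mapping.lookup s i" using assms by (simp add: vhom_def)
    show "gdeg m (n + 1) (d + e)" if "{#i#} = d" "gdeg m n e" for d e
      using that \<open>i \<in> Poly_Mapping.keys s\<close> assms by (auto simp: gdeg_def vhom_def)
  qed
  then show ?thesis unfolding vbr_def vext_def additive.sum[OF additive_qproj] by (intro sum.cong) auto
qed

lemma kap_eq_0_homogeneous:
  assumes "kap u = 0" "qproj P u = u"
  obtains y where "u = br y y" "qproj (\<lambda>d. P (d + d)) y = y"
proof -
  obtain y where y: "u = br y y" using kap_eq_0D[OF assms(1)] by blast
  have "u = br (qproj (\<lambda>d. P (d + d)) y) (qproj (\<lambda>d. P (d + d)) y)"
    using assms(2) unfolding y qproj_square by simp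
  then show thesis by (rule that) simp
qed

text \<open>The point where parity enters: a square has an even number of leaves, and order
  \<open>n\<close> means n + 1 leaves.\<close>

lemma gdeg_double: "gdeg m (2 * j + 1) (d + d) \<longleftrightarrow> gdeg m j d" "\<not> gdeg m (2 * j) (d + d)"
proof -
  show "gdeg m (2 * j + 1) (d + d) \<longleftrightarrow> gdeg m j d" by (auto simp: gdeg_def)
  have "size (d + d) \<noteq> Suc (2 * j)" by (simp; presburger)
  then show "\<not> gdeg m (2 * j) (d + d)" by (simp add: gdeg_def)
qed

lemma kap_eq_0_odd:
  assumes "kap u = 0" "qproj (gdeg m (2 * j)) u = u"
  shows "u = 0"
proof -
  obtain y where y: "u = br y y" "qproj (\<lambda>d. gdeg m (2 * j) (d + d)) y = y" using kap_eq_0_homogeneous[OF assms] .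
  have "y = 0" using qproj_disjoint[OF y(2), of "\<lambda>d. gdeg m (2 * j) (d + d)"] y(2) by (simp add: gdeg_double(2))
  then show ?thesis using y(1) by simp
qed

lemma kap_eq_0_even:
  assumes "kap u = 0" "qproj (gdeg m (2 * j + 1)) u = u"
  obtains y where "u = br y y" "qproj (gdeg m j) y = y"
proof -
  obtain y where y: "u = br y y" "qproj (\<lambda>d. gdeg m (2 * j + 1) (d + d)) y = y" using kap_eq_0_homogeneous[OF assms] .
  then show thesis by (intro that) (simp_all only: gdeg_double(1))
qed

lemma eta_T_hom: "group_hom (T_group m n) (D_group m n) (eta_T m n)"
proof (rule realizes_hom[OF realizes_T realizes_D additive_vk])
  fix X assume X: "X \<in> carrier (T_group m n)"
  have "vbr (rU X) = 0" using rU_image[of m n] X by blast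
  then show "eta_T m n X \<in> carrier (D_group m n)"
    using eta_T[OF X] by (simp add: carrier_D avbr_vk additive.zero[OF additive_kap])
qed (rule eta_T(2))

text \<open>The order is \<open>n\<close> = 2 j + 1. The second factors have the even degree 2 j +
  2, in which the kernel of L' to L consists of the squares of elements of degree j + 1; by
  \<open>vsum_square\<close> the relators <(i,J),J> generate exactly these. The bracket lands in the
  odd degree 2 j + 3, where L' and L agree, so the conditions defining D' and D coincide.\<close>

lemma eta_odd_iso:
  assumes "1 \<le> k"
  shows "eta_odd m k \<in> iso (Tinf_odd m k) (D_group m (2 * k - 1))"
proof -
  obtain j where k: "k = Suc j" using assms by (cases k) auto
  define n where "n = 2 * j + 1"
  have n: "2 * k - 1 = n" "k - 1 = j" by (simp_all add: n_def k)
  let ?T = "T_group m n"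
  let ?gens = "{T_class m n (frag_of (tree_inner (Node (Leaf i) J) J)) | i J. i \<in> {1..m} \<and> J \<in> rtrees m j}"
  interpret h: group_hom ?T "D_group m n" "eta_T m n" by (rule eta_T_hom)
  have gen: "T_class m n (frag_of (tree_inner (Node (Leaf i) J) J)) \<in> carrier ?T"
    "rU (T_class m n (frag_of (tree_inner (Node (Leaf i) J) J))) = Poly_Mapping.single i (br (qt J) (qt J))"
    if "i \<in> {1..m}" "J \<in> rtrees m j" for i J
  proof -
    have k: "Poly_Mapping.keys (frag_of (tree_inner (Node (Leaf i) J) J)) \<subseteq> utrees m n"
      using that by (auto simp: utrees_tree_inner rtrees_def n_def)
    then show "T_class m n (frag_of (tree_inner (Node (Leaf i) J) J)) \<in> carrier ?T" unfolding carrier_T by blast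
    show "rU (T_class m n (frag_of (tree_inner (Node (Leaf i) J) J))) = Poly_Mapping.single i (br (qt J) (qt J))"
      using rU_class[OF k] vsum_square[of i J] by (simp add: tree_inner_rotate del: br_qt)
  qed
  have gens: "?gens \<subseteq> carrier ?T" using gen(1) by auto
  define S where "S = generate ?T ?gens"
  interpret S: subgroup S ?T unfolding S_def by (rule h.G.generate_is_subgroup[OF gens])
  have rS_0: "\<exists>Y\<in>S. rU Y = 0" using S.one_closed realizesD(2)[OF realizes_T] by blast
  have rS_diff: "\<exists>Y\<in>S. rU Y = a - b" if a: "\<exists>Y\<in>S. rU Y = a" and b: "\<exists>Y\<in>S. rU Y = b" for a b
  proof -
    obtain Y Z where YZ: "Y \<in> S" "rU Y = a" "Z \<in> S" "rU Z = b" using a b by blast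
    have c: "Y \<in> carrier ?T" "Z \<in> carrier ?T" using YZ S.mem_carrier by auto
    have "rU (Y \<otimes>\<^bsub>?T\<^esub> inv\<^bsub>?T\<^esub> Z) = a - b"
      using realizesD(4)[OF realizes_T c(1) realizes_inv(1)[OF realizes_T c(2)]] realizes_inv(2)[OF realizes_T c(2)] YZ by simp
    then show ?thesis using YZ by blast
  qed
  have rS_add: "\<exists>Y\<in>S. rU Y = a + b" if "\<exists>Y\<in>S. rU Y = a" "\<exists>Y\<in>S. rU Y = b" for a b
    using rS_diff[OF that(1) rS_diff[OF rS_0 that(2)]] by simp
  \<comment> \<open>Squaring is additive, so the squares of trees, which are the given generators,
    yield all squares.\<close>
  have rS_square: "\<exists>Y\<in>S. rU Y = Poly_Mapping.single i (br y y)" if i: "i \<in> {1..m}" and y: "qproj (gdeg m j) y = y" for i y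
    using y
  proof (induction y rule: qproj_induct)
    case zero
    show ?case using rS_0 by simp
  next
    case (tree J)
    then have "T_class m n (frag_of (tree_inner (Node (Leaf i) J) J)) \<in> S"
      unfolding S_def using i by (intro generate.incl) (auto simp: rtrees_iff)
    then show ?case using gen(2)[OF i, of J] tree by (auto simp: rtrees_iff)
  next
    case (diff x y)
    show ?case using rS_diff[OF diff.IH] unfolding square_diff single_diff .
  qed
  have kernel: "kernel ?T (D_group m n) (eta_T m n) = S"
  proof (intro equalityI subsetI)
    fix X assume "X \<in> kernel ?T (D_group m n) (eta_T m n)"
    then have X: "X \<in> carrier ?T" and "eta_T m n X = \<one>\<^bsub>D_group m n\<^esub>" by (auto simp: kernel_def)
    then have v: "vk (rU X) = 0" using eta_T(2)[OF X] realizesD(2)[OF realizes_D] by metis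
    have s: "rU X \<in> vhom m n" using rU_image[of m n] X by blast
    have comp: "\<exists>Y\<in>S. rU Y = Poly_Mapping.single i (Poly_Mapping.lookup (rU X) i)" if i: "i \<in> Poly_Mapping.keys (rU X)" for i
    proof -
      have "kap (Poly_Mapping.lookup (rU X) i) = 0" using lookup_vk[of "rU X" i] v by simp
      moreover have "qproj (gdeg m (2 * j + 1)) (Poly_Mapping.lookup (rU X) i) = Poly_Mapping.lookup (rU X) i"
        using s by (simp add: vhom_def n_def)
      ultimately obtain y where "Poly_Mapping.lookup (rU X) i = br y y" "qproj (gdeg m j) y = y" by (rule kap_eq_0_even)
      then show ?thesis using rS_square[of i y] i s by (auto simp: vhom_def)
    qed
    have "\<exists>Y\<in>S. rU Y = (\<Sum>i\<in>A. Poly_Mapping.single i (Poly_Mapping.lookup (rU X) i))"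
      if "finite A" "A \<subseteq> Poly_Mapping.keys (rU X)" for A
      using that
    proof (induction A rule: finite_induct)
      case empty
      show ?case using rS_0 by simp
    next
      case (insert i A)
      then show ?case using rS_add[OF comp[of i] insert.IH] by simp
    qed
    from this[OF finite_keys subset_refl] obtain Y where Y: "Y \<in> S" "rU Y = rU X"
      unfolding sum_single_lookup by blast
    then have "Y = X" using X S.mem_carrier by (intro realizesD(5)[OF realizes_T]) auto
    then show "X \<in> S" using Y(1) by simp
  next
    have "?gens \<subseteq> kernel ?T (D_group m n) (eta_T m n)"
    proof
      fix X assume "X \<in> ?gens"
      then obtain i J where X: "X = T_class m n (frag_of (tree_inner (Node (Leaf i) J) J))" "i \<in> {1..m}" "J \<in> rtrees m j"
        by blast
      have c: "X \<in> carrier ?T" using gen(1)[OF X(2,3)] X(1) by simp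
      have "vk (rU X) = 0" unfolding X(1) gen(2)[OF X(2,3)] by (simp add: vk_single kap_br del: br_qt)
      then have "eta_T m n X = \<one>\<^bsub>D_group m n\<^esub>"
        using eta_T(2)[OF c] realizesD(2)[OF realizes_D[of m n]]
        by (intro realizesD(5)[OF realizes_D h.hom_closed[OF c] h.H.one_closed]) simp
      then show "X \<in> kernel ?T (D_group m n) (eta_T m n)" using c by (simp add: kernel_def)
    qed
    then have "S \<subseteq> kernel ?T (D_group m n) (eta_T m n)"
      unfolding S_def by (rule h.G.generate_subgroup_incl[OF _ h.subgroup_kernel])
    then show "X \<in> kernel ?T (D_group m n) (eta_T m n)" if "X \<in> S" for X using that by blast
  qed
  have image: "eta_T m n ` carrier ?T = carrier (D_group m n)"
  proof (rule realizes_image_eq[where K = "LL_group m n" and s = "rLL m" and p = vk and r = rU])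
    have "{s \<in> vhom m n. vbr s = 0} = {s \<in> vhom m n. kap (vbr s) = 0}"
    proof (intro Collect_cong conj_cong refl iffI)
      fix s assume s: "s \<in> vhom m n" "kap (vbr s) = 0"
      show "vbr s = 0" using kap_eq_0_odd[OF s(2), of m "j + 1"] vbr_vhom[OF s(1)] by (simp add: n_def)
    qed (simp add: additive.zero[OF additive_kap])
    then show "vk ` rU ` carrier ?T = rLL m ` carrier (D_group m n)" unfolding rU_image rLL_D_image by simp
  qed (auto simp: realizes_LL eta_T carrier_D)
  have "induced (eta_T m n) \<in> iso (?T Mod S) (D_group m n)"
    by (rule induced_iso_Mod[OF eta_T_hom image kernel])
  then show ?thesis unfolding eta_odd_def Tinf_odd_def n S_def eta_T_def .
qed

section \<open>Twisted trees of even order\<close>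

text \<open>On a twisted tree this is half of the vertex sum of <J,J>: the leaves of only one copy
  of \<open>J\<close>.\<close>

definition tgen_sum :: "tgen \<Rightarrow> vlie" where
  "tgen_sum g = (case g of Tree T \<Rightarrow> vsum T | Twisted J \<Rightarrow> ls J (qt J))"

text \<open>The invariant that \<open>tgen_sum\<close> leaves out: a combination is zero in the
  twisted group exactly if its \<open>tgen_sum\<close> vanishes and its twisted part is a double in
  L'.\<close>

definition twisted_part :: "(tgen \<Rightarrow>\<^sub>0 int) \<Rightarrow> qlie" where
  "twisted_part = ext (\<lambda>g. case g of Tree T \<Rightarrow> 0 | Twisted J \<Rightarrow> qt J)"

definition of_trees :: "(utree \<Rightarrow>\<^sub>0 int) \<Rightarrow> tgen \<Rightarrow>\<^sub>0 int" where "of_trees = ext (\<lambda>T. frag_of (Tree T))"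
definition of_twisted :: "(rtree \<Rightarrow>\<^sub>0 int) \<Rightarrow> tgen \<Rightarrow>\<^sub>0 int" where "of_twisted = ext (\<lambda>J. frag_of (Twisted J))"

lemma tgen_sum_simps [simp]: "tgen_sum (Tree T) = vsum T" "tgen_sum (Twisted J) = ls J (qt J)" by (simp_all add: tgen_sum_def)

lemma additive_twisted_part: "additive twisted_part" unfolding twisted_part_def by (rule additive_ext)
lemma additive_of_trees: "additive of_trees" unfolding of_trees_def by (rule additive_ext)
lemma additive_of_twisted: "additive of_twisted" unfolding of_twisted_def by (rule additive_ext)

lemmas em_simps [simp] = additive.zero[OF additive_twisted_part] additive.add[OF additive_twisted_part] additive.diff[OF additive_twisted_part]
  additive.minus[OF additive_twisted_part]
  additive.zero[OF additive_of_trees] additive.add[OF additive_of_trees] additive.diff[OF additive_of_trees]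
  additive.zero[OF additive_of_twisted] additive.add[OF additive_of_twisted] additive.diff[OF additive_of_twisted]

lemma em_frag_of [simp]:
  "twisted_part (frag_of (Tree T)) = 0" "twisted_part (frag_of (Twisted J)) = qt J"
  "of_trees (frag_of T) = frag_of (Tree T)" "of_twisted (frag_of J) = frag_of (Twisted J)"
  by (simp_all add: twisted_part_def of_trees_def of_twisted_def)

lemma ext_tgen_sum_of_trees: "ext tgen_sum (of_trees x) = ext vsum x"
  unfolding of_trees_def additive_ext_apply[OF additive_ext] by simp

lemma twisted_part_of_trees: "twisted_part (of_trees x) = 0"
  unfolding of_trees_def additive_ext_apply[OF additive_twisted_part] by simp

lemma twisted_part_of_twisted: "twisted_part (of_twisted v) = qc v"
  unfolding of_twisted_def additive_ext_apply[OF additive_twisted_part] by (simp add: qc_eq_ext)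

lemma keys_ext_frag_of: "Poly_Mapping.keys (ext (\<lambda>i. frag_of (f i)) x) \<subseteq> f ` Poly_Mapping.keys x"
  using keys_frag_extend[of "\<lambda>i. frag_of (f i)" x] unfolding frag_extend_eq_ext by auto

lemma keys_of_trees: "Poly_Mapping.keys x \<subseteq> utrees m (2 * j) \<Longrightarrow> Poly_Mapping.keys (of_trees x) \<subseteq> tgens m j"
  using keys_ext_frag_of[of Tree x] unfolding of_trees_def tgens_def by blast

lemma keys_of_twisted: "Poly_Mapping.keys v \<subseteq> rtrees m j \<Longrightarrow> Poly_Mapping.keys (of_twisted v) \<subseteq> tgens m j"
  using keys_ext_frag_of[of Twisted v] unfolding of_twisted_def tgens_def by blast

lemma tgens_split:
  assumes "Poly_Mapping.keys z \<subseteq> tgens m j"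
  obtains x v where "z = of_trees x + of_twisted v" "Poly_Mapping.keys x \<subseteq> utrees m (2 * j)" "Poly_Mapping.keys v \<subseteq> rtrees m j"
proof -
  have "\<exists>x v. z = of_trees x + of_twisted v \<and> Poly_Mapping.keys x \<subseteq> utrees m (2 * j) \<and> Poly_Mapping.keys v \<subseteq> rtrees m j"
    using assms
  proof (induction z rule: frag_induction)
    case zero
    show ?case by (intro exI[of _ 0]) simp
  next
    case (one g)
    then consider T where "g = Tree T" "T \<in> utrees m (2 * j)" | J where "g = Twisted J" "J \<in> rtrees m j"
      unfolding tgens_def by blast
    then show ?case
    proof cases
      case 1
      then show ?thesis by (intro exI[of _ "frag_of T"] exI[of _ 0]) simp
    next
      case 2
      then show ?thesis by (intro exI[of _ 0] exI[of _ "frag_of J"]) simp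
    qed
  next
    case (diff a b)
    then obtain x v x' v' where "a = of_trees x + of_twisted v" "Poly_Mapping.keys x \<subseteq> utrees m (2 * j)" "Poly_Mapping.keys v \<subseteq> rtrees m j"
      "b = of_trees x' + of_twisted v'" "Poly_Mapping.keys x' \<subseteq> utrees m (2 * j)" "Poly_Mapping.keys v' \<subseteq> rtrees m j" by blast
    then show ?case by (intro exI[of _ "x - x'"] exI[of _ "v - v'"]) (simp add: keys_diff_subset)
  qed
  then show thesis using that by blast
qed

lemma tgen_sum_vhom: "g \<in> tgens m j \<Longrightarrow> tgen_sum g \<in> vhom m (2 * j)"
  unfolding tgens_def by (auto simp: vsum_vhom utrees_tree_inner rtrees_def intro!: ls_vhom)

lemma ext_tgen_sum_vhom: "Poly_Mapping.keys z \<subseteq> tgens m j \<Longrightarrow> ext tgen_sum z \<in> vhom m (2 * j)"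
  by (induction z rule: frag_induction) (simp_all add: vhom_0 vhom_diff tgen_sum_vhom)

lemma vbr_ext_tgen_sum: "vbr (ext tgen_sum z) = br (twisted_part z) (twisted_part z)"
proof (induction z rule: frag_induct)
  case (one g)
  show ?case
  proof (cases g)
    case (Tree T)
    obtain I J where "T = tree_inner I J" using tree_inner_surj by blast
    then show ?thesis by (simp add: Tree vsum_tree_inner)
  next
    case (Twisted J)
    then show ?thesis using vbr_lq[of "qt J" "qt J"] by (simp add: lq_qt)
  qed
next
  case (diff x y)
  then show ?case by (simp only: ext_simps vbr_simps em_simps square_diff)
qed simp

lemma twisted_part_hom: "Poly_Mapping.keys z \<subseteq> tgens m j \<Longrightarrow> qproj (gdeg m j) (twisted_part z) = twisted_part z"
  by (induction z rule: frag_induction) (auto simp: tgens_def qproj_qt rtrees_iff)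

text \<open>The twisted parts of the four kinds of relators are 0, -2 J, -2 X and 2 J; in the third
  kind \<open>I\<close> is H - X in L', whereas the relator has H + X.\<close>

lemma twisted_relators_props:
  assumes "r \<in> twisted_relators m j"
  shows "Poly_Mapping.keys r \<subseteq> tgens m j" "ext tgen_sum r = 0" "\<exists>h. twisted_part r = h + h"
proof -
  have "Poly_Mapping.keys r \<subseteq> tgens m j \<and> ext tgen_sum r = 0 \<and> (\<exists>h. twisted_part r = h + h)"
  proof -
    from assms consider x where "r = of_trees x" "x \<in> AS_relators m (2 * j) \<union> IHX_relators m (2 * j)"
      | J J' p where "r = frag_of (Twisted J') - frag_of (Twisted J)" "J \<in> rtrees m j" "odd p" "reversal p J J'"
      | I H X where "r = frag_of (Twisted I) - frag_of (Twisted H) - frag_of (Twisted X) + frag_of (Tree (tree_inner H X))"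
        "I \<in> rtrees m j" "IHX_triple I H X"
      | J where "r = frag_cmul 2 (frag_of (Twisted J)) - frag_of (Tree (tree_inner J J))" "J \<in> rtrees m j"
      unfolding twisted_relators_def of_trees_def frag_extend_eq_ext by blast
    then show ?thesis
    proof cases
      case 1
      then show ?thesis using tree_relators_props[OF 1(2)] by (auto simp: keys_of_trees ext_tgen_sum_of_trees twisted_part_of_trees intro: exI[of _ 0])
    next
      case 2
      have J': "J' \<in> rtrees m j" using 2 reversal_lm[OF 2(4)] by (simp add: rtrees_iff)
      have q: "qt J' = - qt J" using reversal_qt[OF 2(4)] 2(3) by simp
      have "ls J' (qt J') = ls J (qt J)" unfolding lq_qt[symmetric] q by simp
      then have "ext tgen_sum r = 0" unfolding 2(1) ext_simps ext_frag_of tgen_sum_simps by (simp only: diff_self)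
      moreover have "twisted_part r = - qt J + - qt J" unfolding 2(1) by (simp add: q)
      moreover have "Poly_Mapping.keys r \<subseteq> tgens m j"
        unfolding 2(1) using 2(2) J' by (intro keys_diff_subset) (auto simp: tgens_def)
      ultimately show ?thesis by blast
    next
      case 3
      have HX: "H \<in> rtrees m j" "X \<in> rtrees m j" using 3 IHX_triple_lm[OF 3(3)] by (simp_all add: rtrees_iff)
      have q: "qt I = qt H - qt X" using IHX_triple_qt[OF 3(3)] .
      have "ls I (qt I) - ls H (qt H) - ls X (qt X) + (ls H (qt X) + ls X (qt H)) = 0"
        unfolding lq_qt[symmetric] q by simp
      then have "ext tgen_sum r = 0" unfolding 3(1) by (simp add: vsum_tree_inner_ls)
      moreover have "twisted_part r = - qt X + - qt X" unfolding 3(1) by (simp add: q)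
      moreover have "Poly_Mapping.keys r \<subseteq> tgens m j"
        unfolding 3(1) using 3(2) HX
        by (intro keys_diff_subset keys_add_subset) (auto simp: tgens_def utrees_tree_inner rtrees_def)
      ultimately show ?thesis by blast
    next
      case 4
      have "frag_cmul 2 (frag_of (Twisted J)) = frag_of (Twisted J) + frag_of (Twisted J)"
        using zmul_2[of "frag_of (Twisted J)"] by (simp add: zmul_frag)
      then have r: "r = (frag_of (Twisted J) + frag_of (Twisted J)) - frag_of (Tree (tree_inner J J))" using 4(1) by simp
      have "ext tgen_sum r = 0" unfolding r by (simp add: vsum_tree_inner_ls)
      moreover have "twisted_part r = qt J + qt J" unfolding r by simp
      moreover have "Poly_Mapping.keys r \<subseteq> tgens m j"
        unfolding r using 4(2) by (intro keys_diff_subset keys_add_subset) (auto simp: tgens_def utrees_tree_inner rtrees_def)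
      ultimately show ?thesis by blast
    qed
  qed
  then show "Poly_Mapping.keys r \<subseteq> tgens m j" "ext tgen_sum r = 0" "\<exists>h. twisted_part r = h + h" by blast+
qed

text \<open>Modulo the relators, twisted trees that cancel or are doubled can be traded for untwisted trees.\<close>

definition untwistable :: "nat \<Rightarrow> nat \<Rightarrow> (rtree \<Rightarrow>\<^sub>0 int) \<Rightarrow> bool" where
  "untwistable m j v \<longleftrightarrow> (\<exists>x. Poly_Mapping.keys x \<subseteq> utrees m (2 * j) \<and> of_twisted v - of_trees x \<in> zmod.span (twisted_relators m j))"

lemma untwistable_diff:
  assumes "untwistable m j v" "untwistable m j w"
  shows "untwistable m j (v - w)"
proof -
  obtain x y where x: "Poly_Mapping.keys x \<subseteq> utrees m (2 * j)" "of_twisted v - of_trees x \<in> zmod.span (twisted_relators m j)"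
    and y: "Poly_Mapping.keys y \<subseteq> utrees m (2 * j)" "of_twisted w - of_trees y \<in> zmod.span (twisted_relators m j)"
    using assms unfolding untwistable_def by blast
  have "of_twisted (v - w) - of_trees (x - y) = (of_twisted v - of_trees x) - (of_twisted w - of_trees y)" by simp
  then show ?thesis unfolding untwistable_def
    using zmod.span_diff[OF x(2) y(2)] keys_diff_subset[OF x(1) y(1)] by (intro exI[of _ "x - y"]) (simp only:)
qed

lemma untwistable_0: "untwistable m j 0"
  unfolding untwistable_def by (intro exI[of _ 0]) (simp add: zmod.span_zero)

lemma twisted_double:
  assumes "J \<in> rtrees m j"
  shows "frag_of (Twisted J) + frag_of (Twisted J) - frag_of (Tree (tree_inner J J)) \<in> zmod.span (twisted_relators m j)"
proof -
  have "frag_cmul 2 (frag_of (Twisted J)) - frag_of (Tree (tree_inner J J)) \<in> zmod.span (twisted_relators m j)"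
    using assms by (intro zmod.span_base) (auto simp: twisted_relators_def)
  moreover have "frag_cmul 2 (frag_of (Twisted J)) = frag_of (Twisted J) + frag_of (Twisted J)"
    using zmul_2[of "frag_of (Twisted J)"] by (simp add: zmul_frag)
  ultimately show ?thesis by simp
qed

lemma untwistable_double:
  assumes "Poly_Mapping.keys v \<subseteq> rtrees m j"
  shows "untwistable m j (v + v)"
  using assms
proof (induction v rule: frag_induction)
  case zero
  show ?case using untwistable_0 by simp
next
  case (one J)
  then have J: "J \<in> rtrees m j" by simp
  then show ?case unfolding untwistable_def using twisted_double[OF J]
    by (intro exI[of _ "frag_of (tree_inner J J)"]) (simp add: utrees_tree_inner rtrees_def)
next
  case (diff a b)
  have "a - b + (a - b) = (a + a) - (b + b)" by simp
  then show ?case using untwistable_diff[OF diff] by (simp only:)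
qed

text \<open>Up to signs, a relator of L' and the corresponding twisted relator differ by a doubled
  tree: J + J' = (J' - J) + 2 J, and I - H + X = (I - H - X) + 2 X. The doubled twisted tree is an
  inner product.\<close>

lemma untwistable_relators:
  assumes "v \<in> zmod.span (quasi_relators m (Suc j))"
  shows "untwistable m j v"
  using assms
proof (induction rule: zspan_frag_induct)
  case zero
  show ?case by (rule untwistable_0)
next
  case (diff x y)
  then show ?case by (rule untwistable_diff)
next
  case (base r)
  let ?R = "zmod.span (twisted_relators m j)"
  from base consider J J' where "r = frag_of J + frag_of J'" "J \<in> rtrees m j" "reversal 1 J J'"
    | I H X where "r = frag_of I - frag_of H + frag_of X" "I \<in> rtrees m j" "IHX_triple I H X"
    unfolding quasi_relators_def by auto
  then show ?case
  proof cases
    case 1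
    have "frag_of (Twisted J') - frag_of (Twisted J) \<in> ?R"
      using 1 odd_one by (intro zmod.span_base) (unfold twisted_relators_def, blast)
    from zmod.span_add[OF this twisted_double[OF 1(2)]]
    have "of_twisted r - of_trees (frag_of (tree_inner J J)) \<in> ?R" by (simp add: 1(1) algebra_simps)
    then show ?thesis unfolding untwistable_def using 1(2)
      by (intro exI[of _ "frag_of (tree_inner J J)"]) (simp add: utrees_tree_inner rtrees_def)
  next
    case 2
    have HX: "H \<in> rtrees m j" "X \<in> rtrees m j" using 2 IHX_triple_lm[OF 2(3)] by (simp_all add: rtrees_iff)
    have "frag_of (Twisted I) - frag_of (Twisted H) - frag_of (Twisted X) + frag_of (Tree (tree_inner H X)) \<in> ?R"
      using 2 by (intro zmod.span_base) (unfold twisted_relators_def, blast)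
    from zmod.span_add[OF this twisted_double[OF HX(2)]]
    have "of_twisted r - of_trees (frag_of (tree_inner X X) - frag_of (tree_inner H X)) \<in> ?R" by (simp add: 2(1) algebra_simps)
    moreover have "Poly_Mapping.keys (frag_of (tree_inner X X) - frag_of (tree_inner H X)) \<subseteq> utrees m (2 * j)"
      using HX by (intro keys_diff_subset) (simp_all add: utrees_tree_inner rtrees_def)
    ultimately show ?thesis unfolding untwistable_def by blast
  qed
qed

text \<open>A twisted part that is a double allows all twisted trees to be traded for untwisted
  ones. The resulting combination of untwisted trees has vertex sum zero, so it consists of relators
  by \<open>ext_vsum_eq_0_iff\<close>.\<close>

lemma span_twistedI:
  assumes z: "Poly_Mapping.keys z \<subseteq> tgens m j" and F0: "ext tgen_sum z = 0" and h: "twisted_part z = h + h"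
  shows "z \<in> zmod.span (twisted_relators m j)"
proof -
  let ?R = "zmod.span (twisted_relators m j)"
  obtain x v where xv: "z = of_trees x + of_twisted v" "Poly_Mapping.keys x \<subseteq> utrees m (2 * j)" "Poly_Mapping.keys v \<subseteq> rtrees m j"
    using tgens_split[OF z] .
  \<comment> \<open>The half \<open>h\<close> may have parts of other degrees or with labels beyond
    \<open>m\<close>; its projection is a half as well and comes from \<open>rtrees\<close>.\<close>
  have "qproj (gdeg m j) h + qproj (gdeg m j) h = qproj (gdeg m j) (twisted_part z)" by (simp add: h)
  then have h': "qproj (gdeg m j) h + qproj (gdeg m j) h = twisted_part z" using twisted_part_hom[OF z] by simp
  have "qproj (gdeg m j) (qproj (gdeg m j) h) = qproj (gdeg m j) h" by simp
  then obtain w where w: "Poly_Mapping.keys w \<subseteq> rtrees m j" "qproj (gdeg m j) h = qc w"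
    unfolding qproj_gdeg_iff by blast
  have "qc (v - (w + w)) = 0" using h' w(2) by (simp add: xv(1) twisted_part_of_trees twisted_part_of_twisted)
  then have "v - (w + w) \<in> zmod.span (quasi_relators m (Suc j))"
    using quasi_span_iff[of "v - (w + w)" m "Suc j"] xv(3) w(1) by (simp add: keys_diff_subset keys_add_subset)
  then have "untwistable m j (v - (w + w))" by (rule untwistable_relators)
  from untwistable_diff[OF this untwistable_diff[OF untwistable_0 untwistable_double[OF w(1)]]]
  have "untwistable m j v" by simp
  then obtain y where y: "Poly_Mapping.keys y \<subseteq> utrees m (2 * j)" "of_twisted v - of_trees y \<in> ?R"
    unfolding untwistable_def by blast
  have k: "Poly_Mapping.keys (x + y) \<subseteq> utrees m (2 * j)" using xv(2) y(1) by (rule keys_add_subset)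
  have "ext tgen_sum (of_twisted v - of_trees y) = 0" using y(2) by (rule zspan_ext_eq_0) (rule twisted_relators_props(2))
  then have "ext vsum (x + y) = 0" using F0 by (simp add: xv(1) ext_tgen_sum_of_trees)
  then have "x + y \<in> zmod.span (AS_relators m (2 * j) \<union> IHX_relators m (2 * j))" using ext_vsum_eq_0_iff[OF k] by simp
  then have "of_trees (x + y) \<in> ?R"
  proof (induction rule: zspan_frag_induct)
    case zero
    show ?case by (simp add: zmod.span_zero)
  next
    case (base r)
    then show ?case by (intro zmod.span_base) (auto simp: twisted_relators_def of_trees_def frag_extend_eq_ext)
  next
    case (diff a b)
    show ?case unfolding additive.diff[OF additive_of_trees] by (rule zmod.span_diff[OF diff])
  qed
  from zmod.span_add[OF this y(2)] show ?thesis by (simp add: xv(1) algebra_simps)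
qed

lemma twisted_part_span: "z \<in> zmod.span (twisted_relators m j) \<Longrightarrow> ext tgen_sum z = 0 \<and> (\<exists>h. twisted_part z = h + h)"
proof (induction rule: zspan_frag_induct)
  case zero
  show ?case by (auto intro: exI[of _ 0])
next
  case (base r)
  then show ?case using twisted_relators_props by blast
next
  case (diff x y)
  then obtain h k where "twisted_part x = h + h" "twisted_part y = k + k" by blast
  then have "twisted_part (x - y) = (h - k) + (h - k)" by simp
  then show ?case using diff by auto
qed

text \<open>Twisted trees with twisted part \<open>y\<close> account for the bracket [y,y]; what is
  left of \<open>s\<close> has bracket zero and is a vertex sum of untwisted trees.\<close>

lemma ext_tgen_sum_image:
  assumes s: "s \<in> vhom m (2 * j)" and y: "vbr s = br y y" "qproj (gdeg m j) y = y"
  obtains z where "Poly_Mapping.keys z \<subseteq> tgens m j" "ext tgen_sum z = s" "twisted_part z = y"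
proof -
  obtain v where v: "Poly_Mapping.keys v \<subseteq> rtrees m j" "y = qc v" using y(2) unfolding qproj_gdeg_iff by blast
  have "s - ext tgen_sum (of_twisted v) \<in> vhom m (2 * j)" using s keys_of_twisted[OF v(1)] by (intro vhom_diff ext_tgen_sum_vhom)
  moreover have "vbr (s - ext tgen_sum (of_twisted v)) = 0" by (simp add: vbr_ext_tgen_sum twisted_part_of_twisted y(1) v(2))
  ultimately have "s - ext tgen_sum (of_twisted v) \<in> ext vsum ` {z. Poly_Mapping.keys z \<subseteq> utrees m (2 * j)}" unfolding vsum_image by blast
  then obtain x where x: "s - ext tgen_sum (of_twisted v) = ext vsum x" "Poly_Mapping.keys x \<subseteq> utrees m (2 * j)" by blast
  show thesis
  proof (rule that[of "of_twisted v + of_trees x"])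
    show "Poly_Mapping.keys (of_twisted v + of_trees x) \<subseteq> tgens m j" by (intro keys_add_subset keys_of_twisted keys_of_trees v(1) x(2))
    show "ext tgen_sum (of_twisted v + of_trees x) = s" using x(1) by (simp add: ext_tgen_sum_of_trees algebra_simps)
    show "twisted_part (of_twisted v + of_trees x) = y" by (simp add: twisted_part_of_twisted twisted_part_of_trees v(2))
  qed
qed

text \<open>The second factors have the odd degree 2 j + 1, in which there are no squares.\<close>

lemma vk_eq_0_even:
  assumes "s \<in> vhom m (2 * j)" "vk s = 0"
  shows "s = 0"
proof (rule poly_mapping_eqI)
  fix i
  have "kap (Poly_Mapping.lookup s i) = 0" using assms(2) by (simp flip: lookup_vk)
  then have "Poly_Mapping.lookup s i = 0" using kap_eq_0_odd[of _ m j] assms(1) by (simp add: vhom_def)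
  then show "Poly_Mapping.lookup s i = Poly_Mapping.lookup 0 i" by simp
qed

text \<open>Halves are unique because elements are realized by integer coefficients of
  words.\<close>

lemma half_LL:
  assumes J: "J \<in> rtrees m j"
  shows "half (LL_group m (2 * j)) (eta_tree m (2 * j) (tree_inner J J)) \<in> carrier (LL_group m (2 * j))"
    "rLL m (half (LL_group m (2 * j)) (eta_tree m (2 * j) (tree_inner J J))) = vk (ls J (qt J))"
proof -
  let ?G = "LL_group m (2 * j)"
  have u: "tree_inner J J \<in> utrees m (2 * j)" using J by (simp add: utrees_tree_inner rtrees_def)
  have "vk (ls J (qt J)) \<in> rLL m ` carrier ?G" unfolding rLL_image using ls_vhom[OF u] by blast
  then obtain y where y: "y \<in> carrier ?G" "rLL m y = vk (ls J (qt J))" by force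
  have e: "rLL m (eta_tree m (2 * j) (tree_inner J J)) = vk (ls J (qt J)) + vk (ls J (qt J))"
    using eta_tree(2)[OF u] by (simp add: vsum_tree_inner_ls)
  have yy: "y \<otimes>\<^bsub>?G\<^esub> y = eta_tree m (2 * j) (tree_inner J J)"
    using y e eta_tree(1)[OF u] realizesD(3,4)[OF realizes_LL[of m "2 * j"] y(1) y(1)] by (intro realizesD(5)[OF realizes_LL[of m "2 * j"]]) simp_all
  have dbl: "a = b" if "a + a = b + b" for a b :: "nat \<Rightarrow>\<^sub>0 assoc"
  proof (rule poly_mapping_eqI, rule poly_mapping_eqI)
    fix i w
    have "Poly_Mapping.lookup (Poly_Mapping.lookup (a + a) i) w = Poly_Mapping.lookup (Poly_Mapping.lookup (b + b) i) w"
      using that by simp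
    then show "Poly_Mapping.lookup (Poly_Mapping.lookup a i) w = Poly_Mapping.lookup (Poly_Mapping.lookup b i) w"
      by (simp add: lookup_add)
  qed
  have "half ?G (eta_tree m (2 * j) (tree_inner J J)) = y" unfolding half_def
  proof (rule the_equality)
    fix x assume x: "x \<in> carrier ?G \<and> x \<otimes>\<^bsub>?G\<^esub> x = eta_tree m (2 * j) (tree_inner J J)"
    then have "rLL m x + rLL m x = vk (ls J (qt J)) + vk (ls J (qt J))"
      using realizesD(4)[OF realizes_LL[of m "2 * j"], of x x] e by simp
    from dbl[OF this] have "rLL m x = rLL m y" using y(2) by simp
    then show "x = y" by (rule realizesD(5)[OF realizes_LL[of m "2 * j"] conjunct1[OF x] y(1)])
  qed (use y yy in simp)
  then show "half ?G (eta_tree m (2 * j) (tree_inner J J)) \<in> carrier ?G"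
    "rLL m (half ?G (eta_tree m (2 * j) (tree_inner J J))) = vk (ls J (qt J))" using y by simp_all
qed

lemma eta_even:
  assumes z: "Poly_Mapping.keys z \<subseteq> tgens m j"
  shows "eta_even m j (presented_class (tgens m j) (twisted_relators m j) z) \<in> carrier (LL_group m (2 * j))"
    "rLL m (eta_even m j (presented_class (tgens m j) (twisted_relators m j) z)) = vk (ext tgen_sum z)"
proof -
  let ?b = "\<lambda>g. case g of Tree t \<Rightarrow> eta_tree m (2 * j) t
          | Twisted J \<Rightarrow> half (LL_group m (2 * j)) (eta_tree m (2 * j) (tree_inner J J))"
  have b: "?b g \<in> carrier (LL_group m (2 * j))" "rLL m (?b g) = vk (tgen_sum g)" if "g \<in> tgens m j" for g
    using that unfolding tgens_def by (auto simp: eta_tree half_LL)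
  have e: "ext (\<lambda>g. rLL m (?b g)) z = vk (ext tgen_sum z)" if "Poly_Mapping.keys z \<subseteq> tgens m j" for z
    unfolding additive_ext_apply[OF additive_vk] using that by (intro ext_cong b(2)) auto
  have kill: "ext (\<lambda>g. rLL m (?b g)) r = 0" if "r \<in> twisted_relators m j" for r
    using twisted_relators_props[OF that] by (simp add: e)
  note i = induced_lin_extend[OF twisted_relators_props(1) realizes_LL b(1) kill z]
  show "eta_even m j (presented_class (tgens m j) (twisted_relators m j) z) \<in> carrier (LL_group m (2 * j))"
    unfolding eta_even_def by (rule i(3))
  show "rLL m (eta_even m j (presented_class (tgens m j) (twisted_relators m j) z)) = vk (ext tgen_sum z)"
    unfolding eta_even_def using i(2) e[OF z] by simp
qed

text \<open>Kernel: the twisted part u satisfies [u,u] = 0, so it is a double plus a square; its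
  degree 2 k + 1 is odd, so the square drops out in that degree. Image: if the bracket of
  \<open>s\<close> vanishes in L, it is a square [y,y] in L', realized with \<open>y\<close> as
  twisted part.\<close>

lemma eta_even_iso: "eta_even m (2 * k) \<in> iso (Tinf_even m (2 * k)) (D_group m (4 * k))"
proof -
  define j where "j = 2 * k"
  have j: "4 * k = 2 * j" by (simp add: j_def)
  have ker: "vk (ext tgen_sum z) = 0 \<longleftrightarrow> z \<in> zmod.span (twisted_relators m j)" if z: "Poly_Mapping.keys z \<subseteq> tgens m j" for z
  proof
    assume "vk (ext tgen_sum z) = 0"
    then have F0: "ext tgen_sum z = 0" using vk_eq_0_even[OF ext_tgen_sum_vhom[OF z]] by simp
    then have "br (twisted_part z) (twisted_part z) = 0" by (simp flip: vbr_ext_tgen_sum)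
    then obtain a y where "twisted_part z = a + a + br y y" using square_eq_0D by blast
    then have "twisted_part z = qproj (gdeg m j) a + qproj (gdeg m j) a + qproj (gdeg m j) (br y y)"
      using twisted_part_hom[OF z] by (metis qproj_simps(2))
    moreover have "qproj (gdeg m j) (br y y) = 0"
    proof (rule kap_eq_0_odd)
      show "kap (qproj (gdeg m j) (br y y)) = 0" by (simp add: qproj_square kap_br)
      show "qproj (gdeg m (2 * k)) (qproj (gdeg m j) (br y y)) = qproj (gdeg m j) (br y y)" by (simp add: j_def)
    qed
    ultimately show "z \<in> zmod.span (twisted_relators m j)" using span_twistedI[OF z F0] by simp
  qed (use twisted_part_span in simp)
  have r: "realizes (Tinf_even m j) (induced (\<lambda>z. vk (ext tgen_sum z)))"
    "Poly_Mapping.keys z \<subseteq> tgens m j \<Longrightarrow> induced (\<lambda>z. vk (ext tgen_sum z)) (presented_class (tgens m j) (twisted_relators m j) z) = vk (ext tgen_sum z)"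
    "carrier (Tinf_even m j) = presented_class (tgens m j) (twisted_relators m j) ` {z. Poly_Mapping.keys z \<subseteq> tgens m j}" for z
    using realizes_presented[OF twisted_relators_props(1) additive_comp[OF additive_vk additive_ext] ker]
    unfolding Tinf_even_def by blast+
  have D: "X \<in> carrier (D_group m (2 * j)) \<longleftrightarrow> X \<in> carrier (LL_group m (2 * j)) \<and> avbr (rLL m X) = 0" for X by (rule carrier_D)
  show ?thesis unfolding j j_def[symmetric]
  proof (rule realizes_iso[OF r(1) realizes_D _ additive_ident])
    fix X assume "X \<in> carrier (Tinf_even m j)"
    then obtain z where "X = presented_class (tgens m j) (twisted_relators m j) z" "Poly_Mapping.keys z \<subseteq> tgens m j"
      unfolding r(3) by blast
    then show "rLL m (eta_even m j X) = induced (\<lambda>z. vk (ext tgen_sum z)) X" by (simp add: r(2) eta_even)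
  next
    let ?C = "{z. Poly_Mapping.keys z \<subseteq> tgens m j}"
    have "(\<lambda>z. eta_even m j (presented_class (tgens m j) (twisted_relators m j) z)) ` ?C = carrier (D_group m (2 * j))"
    proof (rule realizes_image_eq[OF realizes_LL, where r = "ext tgen_sum" and p = vk])
      have "ext tgen_sum ` ?C = {s \<in> vhom m (2 * j). kap (vbr s) = 0}"
      proof (intro equalityI subsetI)
        fix s assume "s \<in> {s \<in> vhom m (2 * j). kap (vbr s) = 0}"
        then have s: "s \<in> vhom m (2 * j)" "kap (vbr s) = 0" by simp_all
        obtain y where "vbr s = br y y" "qproj (gdeg m j) y = y" using kap_eq_0_even[OF s(2) vbr_vhom[OF s(1)]] .
        then show "s \<in> ext tgen_sum ` ?C" using ext_tgen_sum_image[OF s(1)] by blast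
      qed (auto simp: ext_tgen_sum_vhom vbr_ext_tgen_sum kap_br)
      then show "vk ` ext tgen_sum ` ?C = rLL m ` carrier (D_group m (2 * j))" unfolding rLL_D_image by simp
    qed (auto simp: eta_even D)
    then show "eta_even m j ` carrier (Tinf_even m j) = carrier (D_group m (2 * j))" unfolding r(3) image_image .
  qed
qed

section \<open>Tensor products with \<open>Z2\<close>\<close>

lemma carrier_Z2: "carrier Z2 = {0, 1}"
  by (auto simp: carrier_integer_mod_group)

lemma zmul_Z2:
  assumes "u + u = 0"
  shows "zmul (a mod 2) u = zmul a u"
proof -
  have "zmul a u = zmul (a div 2) (zmul 2 u) + zmul (a mod 2) u"
    by (simp flip: zmul_mult zmul_add_left)
  then show ?thesis using assms by (simp add: zmul_2)
qed

text \<open>An additive \<open>g\<close> that kills exactly the doubles detects \<open>Z2 \<otimes> H\<close>.\<close>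

locale mod2_embedding =
  fixes H :: "('h, 'd) monoid_scheme" and g :: "'h \<Rightarrow> 'b::ab_group_add"
  assumes H: "comm_group H"
    and g_add: "\<And>x y. x \<in> carrier H \<Longrightarrow> y \<in> carrier H \<Longrightarrow> g (x \<otimes>\<^bsub>H\<^esub> y) = g x + g y"
    and g_double: "\<And>x. x \<in> carrier H \<Longrightarrow> g x + g x = 0"
    and g_ker: "\<And>x. x \<in> carrier H \<Longrightarrow> g x = 0 \<Longrightarrow> \<exists>h\<in>carrier H. x = h \<otimes>\<^bsub>H\<^esub> h"
begin

lemma Z2_keys: "r \<in> tensor_relators Z2 H \<Longrightarrow> Poly_Mapping.keys r \<subseteq> carrier Z2 \<times> carrier H"
proof (rule keys_tensor_relators)
  interpret H: comm_group H by (rule H)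
  show "x \<otimes>\<^bsub>H\<^esub> y \<in> carrier H" if "x \<in> carrier H" "y \<in> carrier H" for x y using that by simp
  show "x \<otimes>\<^bsub>Z2\<^esub> y \<in> carrier Z2" if "x \<in> carrier Z2" "y \<in> carrier Z2" for x y
    by (auto simp: carrier_Z2)
qed

lemma Z2_kill: "r \<in> tensor_relators Z2 H \<Longrightarrow> ext (\<lambda>(a, y). zmul a (g y)) r = 0"
  by (rule tensor_relators_kill)
     (simp_all add: g_add g_double zmul_Z2 zmul_add_left zmul_add_right del: zmul_frag)

lemma Z2_pure:
  assumes "Poly_Mapping.keys z \<subseteq> carrier Z2 \<times> carrier H"
  shows "\<exists>y\<in>carrier H. z - frag_of (1, y) \<in> zmod.span (tensor_relators Z2 H)"
  using assms
proof (induction z rule: frag_induction)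
  interpret H: comm_group H by (rule H)
  note one = tensor_span_one[OF abelian_integer_mod_group H]
  case zero
  show ?case using zmod.span_neg[OF one(2)[of 1]] by (intro bexI[of _ "\<one>\<^bsub>H\<^esub>"]) (simp_all add: carrier_Z2)
next
  interpret H: comm_group H by (rule H)
  note one = tensor_span_one[OF abelian_integer_mod_group H]
  case (one p)
  then obtain a y where p: "p = (a, y)" "a \<in> {0, 1}" "y \<in> carrier H" by (auto simp: carrier_Z2)
  show ?case
  proof (cases "a = 1")
    case True
    then show ?thesis using p zmod.span_zero by (intro bexI[of _ y]) simp_all
  next
    case False
    then have "frag_of p \<in> zmod.span (tensor_relators Z2 H)" using tensor_span_one(1)[OF abelian_integer_mod_group H p(3), of 2] p by simp
    from zmod.span_diff[OF this tensor_span_one(2)[OF abelian_integer_mod_group H, of 1 2]]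
    show ?thesis by (intro bexI[of _ "\<one>\<^bsub>H\<^esub>"]) (simp_all add: carrier_Z2)
  qed
next
  interpret H: comm_group H by (rule H)
  case (diff a b)
  then obtain x y where x: "x \<in> carrier H" "a - frag_of (1, x) \<in> zmod.span (tensor_relators Z2 H)"
    and y: "y \<in> carrier H" "b - frag_of (1, y) \<in> zmod.span (tensor_relators Z2 H)" by blast
  have "frag_of (1, x \<otimes>\<^bsub>H\<^esub> inv\<^bsub>H\<^esub> y) - (frag_of (1, x) - frag_of (1, y)) \<in> zmod.span (tensor_relators Z2 H)"
    using x(1) y(1) by (intro tensor_span_diff(2)[OF abelian_integer_mod_group H]) (simp_all add: carrier_Z2)
  from zmod.span_diff[OF zmod.span_diff[OF x(2) y(2)] this]
  have "a - b - frag_of (1, x \<otimes>\<^bsub>H\<^esub> inv\<^bsub>H\<^esub> y) \<in> zmod.span (tensor_relators Z2 H)"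
    by (simp add: algebra_simps)
  then show ?case using x(1) y(1) by (intro bexI[of _ "x \<otimes>\<^bsub>H\<^esub> inv\<^bsub>H\<^esub> y"]) simp_all
qed

text \<open>Modulo the relators it equals (1 + 1) tensor h, and 1 + 1 = 0 in
  \<open>Z2\<close>.\<close>

lemma Z2_double:
  assumes h: "h \<in> carrier H"
  shows "frag_of (1, h \<otimes>\<^bsub>H\<^esub> h) \<in> zmod.span (tensor_relators Z2 H)"
proof -
  let ?N = "zmod.span (tensor_relators Z2 H)"
  have 1: "1 \<in> carrier Z2" by (simp add: carrier_Z2)
  have "frag_of (1 \<otimes>\<^bsub>Z2\<^esub> 1, h) - frag_of (1, h) - frag_of (1, h) \<in> ?N"
    by (rule tensor_span_add1[OF abelian_integer_mod_group H 1 1 h])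
  then have a: "frag_of (0, h) - frag_of (1, h) - frag_of (1, h) \<in> ?N" by simp
  have b: "frag_of (1, h \<otimes>\<^bsub>H\<^esub> h) - frag_of (1, h) - frag_of (1, h) \<in> ?N"
    by (rule tensor_span_add2[OF abelian_integer_mod_group H 1 h h])
  have c: "frag_of (0, h) \<in> ?N" using tensor_span_one(1)[OF abelian_integer_mod_group H h, of 2] by simp
  from zmod.span_add[OF zmod.span_diff[OF b a] c] show ?thesis by simp
qed

lemma Z2_ker:
  assumes z: "Poly_Mapping.keys z \<subseteq> carrier Z2 \<times> carrier H"
  shows "ext (\<lambda>(a, y). zmul a (g y)) z = 0 \<longleftrightarrow> z \<in> zmod.span (tensor_relators Z2 H)"
proof
  assume z0: "ext (\<lambda>(a, y). zmul a (g y)) z = 0"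
  obtain y where y: "y \<in> carrier H" "z - frag_of (1, y) \<in> zmod.span (tensor_relators Z2 H)" using Z2_pure[OF z] by blast
  have "ext (\<lambda>(a, y). zmul a (g y)) (z - frag_of (1, y)) = 0" using y(2) by (rule zspan_ext_eq_0) (rule Z2_kill)
  then have "g y = 0" using z0 by simp
  then obtain h where "h \<in> carrier H" "y = h \<otimes>\<^bsub>H\<^esub> h" using g_ker y(1) by blast
  then have "frag_of (1, y) \<in> zmod.span (tensor_relators Z2 H)" using Z2_double by simp
  from zmod.span_add[OF y(2) this] show "z \<in> zmod.span (tensor_relators Z2 H)" by simp
next
  assume "z \<in> zmod.span (tensor_relators Z2 H)"
  then show "ext (\<lambda>(a, y). zmul a (g y)) z = 0" by (rule zspan_ext_eq_0) (rule Z2_kill)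
qed

lemma realizes_Z2: "realizes (tensor Z2 H) (induced (ext (\<lambda>(a, y). zmul a (g y))))"
  and Z2_class: "Poly_Mapping.keys z \<subseteq> carrier Z2 \<times> carrier H \<Longrightarrow>
    induced (ext (\<lambda>(a, y). zmul a (g y))) (presented_class (carrier Z2 \<times> carrier H) (tensor_relators Z2 H) z) =
      ext (\<lambda>(a, y). zmul a (g y)) z"
  and carrier_Z2_tensor: "carrier (tensor Z2 H) =
    presented_class (carrier Z2 \<times> carrier H) (tensor_relators Z2 H) ` {z. Poly_Mapping.keys z \<subseteq> carrier Z2 \<times> carrier H}"
  using realizes_presented[OF Z2_keys additive_ext Z2_ker] unfolding tensor_def by blast+

lemma Z2_pure_tensor:
  assumes "a \<in> carrier Z2" "y \<in> carrier H"
  shows "pure_tensor Z2 H a y \<in> carrier (tensor Z2 H)"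
    "induced (ext (\<lambda>(a, y). zmul a (g y))) (pure_tensor Z2 H a y) = zmul a (g y)"
proof -
  have k: "Poly_Mapping.keys (frag_of (a, y)) \<subseteq> carrier Z2 \<times> carrier H" using assms by simp
  then show "pure_tensor Z2 H a y \<in> carrier (tensor Z2 H)" unfolding carrier_Z2_tensor pure_tensor_def by blast
  show "induced (ext (\<lambda>(a, y). zmul a (g y))) (pure_tensor Z2 H a y) = zmul a (g y)"
    unfolding pure_tensor_def Z2_class[OF k] by simp
qed

lemma Z2_image: "induced (ext (\<lambda>(a, y). zmul a (g y))) ` carrier (tensor Z2 H) = g ` carrier H"
proof (intro equalityI subsetI)
  fix u assume "u \<in> induced (ext (\<lambda>(a, y). zmul a (g y))) ` carrier (tensor Z2 H)"
  then obtain z where z: "u = ext (\<lambda>(a, y). zmul a (g y)) z" "Poly_Mapping.keys z \<subseteq> carrier Z2 \<times> carrier H"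
    unfolding carrier_Z2_tensor by (auto simp: Z2_class)
  obtain y where y: "y \<in> carrier H" "z - frag_of (1, y) \<in> zmod.span (tensor_relators Z2 H)" using Z2_pure[OF z(2)] by blast
  have "ext (\<lambda>(a, y). zmul a (g y)) (z - frag_of (1, y)) = 0" using y(2) by (rule zspan_ext_eq_0) (rule Z2_kill)
  then have "u = g y" by (simp add: z(1))
  then show "u \<in> g ` carrier H" using y(1) by blast
next
  fix u assume "u \<in> g ` carrier H"
  then obtain y where y: "y \<in> carrier H" "u = g y" by blast
  have "1 \<in> carrier Z2" by (simp add: carrier_Z2)
  from Z2_pure_tensor[OF this y(1)] y(2) show "u \<in> induced (ext (\<lambda>(a, y). zmul a (g y))) ` carrier (tensor Z2 H)" by force
qed

end

section \<open>Quasi-Lie elements modulo two\<close>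

\<comment> \<open>L' modulo doubles, in which Z2 tensor L' is realized.\<close>
quotient_type qlie2 = qlie / "\<lambda>x y. \<exists>h. x - y = h + h"
proof (rule equivpI)
  show "reflp (\<lambda>x y :: qlie. \<exists>h. x - y = h + h)" by (rule reflpI) (auto intro: exI[of _ 0])
  show "symp (\<lambda>x y :: qlie. \<exists>h. x - y = h + h)"
  proof (rule sympI)
    fix x y :: qlie assume "\<exists>h. x - y = h + h"
    then obtain h where "x - y = h + h" by blast
    then have "- (x - y) = - h + - h" by simp
    then show "\<exists>h. y - x = h + h" unfolding minus_diff_eq by blast
  qed
  show "transp (\<lambda>x y :: qlie. \<exists>h. x - y = h + h)"
  proof (rule transpI)
    fix x y z :: qlie assume "\<exists>h. x - y = h + h" "\<exists>h. y - z = h + h"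
    then obtain h k where "x - y = h + h" "y - z = k + k" by blast
    then have "(x - y) + (y - z) = (h + k) + (h + k)" by simp
    then show "\<exists>h. x - z = h + h" by auto
  qed
qed

instantiation qlie2 :: ab_group_add
begin
lift_definition zero_qlie2 :: qlie2 is 0 .
lift_definition plus_qlie2 :: "qlie2 \<Rightarrow> qlie2 \<Rightarrow> qlie2" is "(+)"
proof -
  fix a b c d :: qlie
  assume "\<exists>h. a - b = h + h" "\<exists>h. c - d = h + h"
  then obtain h k where "a - b = h + h" "c - d = k + k" by blast
  then have "(a - b) + (c - d) = (h + k) + (h + k)" by simp
  then show "\<exists>h. a + c - (b + d) = h + h" by (auto simp: add_diff_add)
qed
lift_definition minus_qlie2 :: "qlie2 \<Rightarrow> qlie2 \<Rightarrow> qlie2" is "(-)"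
proof -
  fix a b c d :: qlie
  assume "\<exists>h. a - b = h + h" "\<exists>h. c - d = h + h"
  then obtain h k where "a - b = h + h" "c - d = k + k" by blast
  then have "(a - b) - (c - d) = (h - k) + (h - k)" by simp
  moreover have "(a - b) - (c - d) = a - c - (b - d)" by (simp add: algebra_simps)
  ultimately show "\<exists>h. a - c - (b - d) = h + h" by metis
qed
lift_definition uminus_qlie2 :: "qlie2 \<Rightarrow> qlie2" is "uminus"
proof -
  fix a b :: qlie
  assume "\<exists>h. a - b = h + h"
  then obtain h where "a - b = h + h" by blast
  then have "- a - - b = - h + - h" by (simp add: algebra_simps)
  then show "\<exists>h. - a - - b = h + h" by blast
qed
instance
  by standard (transfer; auto simp: algebra_simps intro: exI[of _ 0])+
end

definition q2 :: "qlie \<Rightarrow> qlie2" where "q2 = abs_qlie2"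

lemma additive_q2: "additive q2"
  by standard (simp add: q2_def plus_qlie2.abs_eq)

lemmas q2_simps [simp] = additive.zero[OF additive_q2] additive.add[OF additive_q2]
  additive.diff[OF additive_q2] additive.minus[OF additive_q2]

lemma q2_eq_iff: "q2 x = q2 y \<longleftrightarrow> (\<exists>h. x - y = h + h)"
  by (simp add: q2_def qlie2.abs_eq_iff)

lemma q2_double: "q2 x + q2 x = 0"
  using q2_eq_iff[of "x + x" 0] by auto

text \<open>Doubles have square zero, so the choice of the representative does not matter.\<close>

definition sq2 :: "qlie2 \<Rightarrow> qlie" where "sq2 w = (let u = rep_qlie2 w in br u u)"

lemma sq2_q2: "sq2 (q2 u) = br u u"
proof -
  have "q2 (rep_qlie2 (q2 u)) = q2 u" unfolding q2_def by (rule Quotient_abs_rep[OF Quotient_qlie2])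
  then obtain h where "rep_qlie2 (q2 u) - u = h + h" unfolding q2_eq_iff by blast
  then have "br (rep_qlie2 (q2 u) - u) (rep_qlie2 (q2 u) - u) = br h h + br h h" by (simp only: square_add)
  then show ?thesis by (simp add: square_diff square_double sq2_def del: br_simps)
qed

lemma additive_sq2: "additive sq2"
proof
  fix x y
  obtain u w where "x = q2 u" "y = q2 w" unfolding q2_def by (metis Quotient_abs_rep[OF Quotient_qlie2])
  then show "sq2 (x + y) = sq2 x + sq2 y" by (simp only: q2_simps(2)[symmetric] sq2_q2 square_add)
qed

definition rZQ :: "mod2_Lie \<Rightarrow> qlie2" where "rZQ = induced (ext (\<lambda>(a, y). zmul a (q2 (rQ y))))"

lemma q2_rQ:
  "x \<in> carrier (quasiL_group m n) \<Longrightarrow> y \<in> carrier (quasiL_group m n) \<Longrightarrow>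
     q2 (rQ (x \<otimes>\<^bsub>quasiL_group m n\<^esub> y)) = q2 (rQ x) + q2 (rQ y)"
  "x \<in> carrier (quasiL_group m n) \<Longrightarrow> q2 (rQ x) = 0 \<Longrightarrow> \<exists>h\<in>carrier (quasiL_group m n). x = h \<otimes>\<^bsub>quasiL_group m n\<^esub> h"
proof -
  show "x \<in> carrier (quasiL_group m n) \<Longrightarrow> y \<in> carrier (quasiL_group m n) \<Longrightarrow>
     q2 (rQ (x \<otimes>\<^bsub>quasiL_group m n\<^esub> y)) = q2 (rQ x) + q2 (rQ y)"
    by (simp add: realizesD(4)[OF realizes_quasiL])
  assume x: "x \<in> carrier (quasiL_group m n)" "q2 (rQ x) = 0"
  then obtain h where h: "rQ x = h + h" using q2_eq_iff[of "rQ x" 0] by auto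
  then have e: "rQ x = qproj (gdeg m (n - 1)) h + qproj (gdeg m (n - 1)) h" using rQ_closed[OF x(1)] by simp
  have "qproj (gdeg m (n - 1)) h \<in> rQ ` carrier (quasiL_group m n)" unfolding rQ_image by simp
  then obtain k where k: "k \<in> carrier (quasiL_group m n)" "rQ k = qproj (gdeg m (n - 1)) h" by force
  have "x = k \<otimes>\<^bsub>quasiL_group m n\<^esub> k"
    using e k(2) realizesD(4)[OF realizes_quasiL k(1) k(1)]
    by (intro realizesD(5)[OF realizes_quasiL x(1) realizesD(3)[OF realizes_quasiL k(1) k(1)]]) simp
  then show "\<exists>h\<in>carrier (quasiL_group m n). x = h \<otimes>\<^bsub>quasiL_group m n\<^esub> h" using k(1) by blast
qed

lemma mod2_quasiL: "mod2_embedding (quasiL_group m n) (\<lambda>y. q2 (rQ y))"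
  by (rule mod2_embedding.intro[OF realizes_comm_group[OF realizes_quasiL] q2_rQ(1) q2_double q2_rQ(2)])

lemma realizes_ZQ: "realizes (tensor Z2 (quasiL_group m n)) rZQ"
  unfolding rZQ_def by (rule mod2_embedding.realizes_Z2[OF mod2_quasiL])

lemma rZQ_class: "Poly_Mapping.keys z \<subseteq> carrier Z2 \<times> carrier (quasiL_group m n) \<Longrightarrow>
    rZQ (presented_class (carrier Z2 \<times> carrier (quasiL_group m n)) (tensor_relators Z2 (quasiL_group m n)) z) =
      ext (\<lambda>(a, y). zmul a (q2 (rQ y))) z"
  unfolding rZQ_def by (rule mod2_embedding.Z2_class[OF mod2_quasiL])

lemma carrier_ZQ: "carrier (tensor Z2 (quasiL_group m n)) =
    presented_class (carrier Z2 \<times> carrier (quasiL_group m n)) (tensor_relators Z2 (quasiL_group m n)) `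
      {z. Poly_Mapping.keys z \<subseteq> carrier Z2 \<times> carrier (quasiL_group m n)}"
  by (rule mod2_embedding.carrier_Z2_tensor[OF mod2_quasiL])

lemma rZQ_image: "rZQ ` carrier (tensor Z2 (quasiL_group m (Suc j))) = q2 ` {u. qproj (gdeg m j) u = u}"
proof -
  have "rZQ ` carrier (tensor Z2 (quasiL_group m (Suc j))) = (\<lambda>y. q2 (rQ y)) ` carrier (quasiL_group m (Suc j))"
    unfolding rZQ_def by (rule mod2_embedding.Z2_image[OF mod2_quasiL])
  also have "\<dots> = q2 ` rQ ` carrier (quasiL_group m (Suc j))" by (simp only: image_image)
  finally show ?thesis unfolding rQ_image by simp
qed

lemma ZQ_pure:
  assumes "Poly_Mapping.keys z \<subseteq> rtrees m j"
  shows "pure_tensor Z2 (quasiL_group m (Suc j)) 1 (quasi_class m (Suc j) z) \<in> carrier (tensor Z2 (quasiL_group m (Suc j)))"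
    "rZQ (pure_tensor Z2 (quasiL_group m (Suc j)) 1 (quasi_class m (Suc j) z)) = q2 (qc z)"
proof -
  have z: "Poly_Mapping.keys z \<subseteq> rtrees m (Suc j - 1)" using assms by simp
  have 1: "1 \<in> carrier Z2" by (simp add: carrier_Z2)
  note p = mod2_embedding.Z2_pure_tensor[OF mod2_quasiL 1 quasi_class_closed[OF z]]
  show "pure_tensor Z2 (quasiL_group m (Suc j)) 1 (quasi_class m (Suc j) z) \<in> carrier (tensor Z2 (quasiL_group m (Suc j)))"
    by (rule p(1))
  show "rZQ (pure_tensor Z2 (quasiL_group m (Suc j)) 1 (quasi_class m (Suc j) z)) = q2 (qc z)"
    unfolding rZQ_def p(2) by (simp only: zmul_1 rQ_class[OF z])
qed

section \<open>The pullback\<close>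

lemma quasi_proj_image: "quasi_proj m ` carrier (quasiL_group m n) = carrier (L_group m n)"
  by (rule realizes_image_eq[OF realizes_L, where r = rQ and p = kap])
     (auto simp: quasi_proj_closed rQ_image rL_image)

definition quasi_lift :: "nat \<Rightarrow> nat \<Rightarrow> (rtree \<Rightarrow>\<^sub>0 int) set \<Rightarrow> (rtree \<Rightarrow>\<^sub>0 int) set" where
  "quasi_lift m n = inv_into (carrier (quasiL_group m n)) (quasi_proj m)"

lemma quasi_lift:
  assumes "y \<in> carrier (L_group m n)"
  shows "quasi_lift m n y \<in> carrier (quasiL_group m n)" "kap (rQ (quasi_lift m n y)) = rL y"
proof -
  have y: "y \<in> quasi_proj m ` carrier (quasiL_group m n)" using assms by (simp add: quasi_proj_image)
  then show c: "quasi_lift m n y \<in> carrier (quasiL_group m n)" unfolding quasi_lift_def by (rule inv_into_into)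
  show "kap (rQ (quasi_lift m n y)) = rL y"
    using f_inv_into_f[OF y] quasi_proj_closed(2)[OF c] by (simp add: quasi_lift_def)
qed

text \<open>The value of the map sq on 1 tensor y, as an element of L'.\<close>

definition sqL :: "nat \<Rightarrow> nat \<Rightarrow> (rtree \<Rightarrow>\<^sub>0 int) set \<Rightarrow> qlie" where
  "sqL m n y = br (rQ (quasi_lift m n y)) (rQ (quasi_lift m n y))"

text \<open>Two lifts differ by a square, and squares are central.\<close>

lemma sqL_eq:
  assumes "y \<in> carrier (L_group m n)" "kap u = rL y"
  shows "sqL m n y = br u u"
proof -
  let ?v = "rQ (quasi_lift m n y)"
  have "kap (u - ?v) = 0" using quasi_lift(2)[OF assms(1)] assms(2) by (simp add: additive.diff[OF additive_kap])
  then obtain w where "u - ?v = br w w" using kap_eq_0D by blast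
  then have "br (u - ?v) (u - ?v) = 0" by (simp only: square_central)
  then show ?thesis by (simp add: square_diff sqL_def del: br_simps)
qed

text \<open>The condition on the kernel is the injectivity of sq: if a lift of \<open>x\<close> has
  square zero, it is a double plus a square by \<open>square_eq_0D\<close>, and the square vanishes
  in L.\<close>

lemma mod2_L: "mod2_embedding (L_group m n) (sqL m n)"
proof (rule mod2_embedding.intro)
  let ?L = "L_group m n" and ?U = "\<lambda>y. rQ (quasi_lift m n y)"
  show "comm_group ?L" by (rule realizes_comm_group[OF realizes_L])
  fix x assume x: "x \<in> carrier ?L"
  show "sqL m n (x \<otimes>\<^bsub>?L\<^esub> y) = sqL m n x + sqL m n y" if y: "y \<in> carrier ?L" for y
  proof -
    have "kap (?U x + ?U y) = rL (x \<otimes>\<^bsub>?L\<^esub> y)"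
      using quasi_lift(2)[OF x] quasi_lift(2)[OF y] realizesD(4)[OF realizes_L x y] by (simp add: additive.add[OF additive_kap])
    then have "sqL m n (x \<otimes>\<^bsub>?L\<^esub> y) = br (?U x + ?U y) (?U x + ?U y)" by (rule sqL_eq[OF realizesD(3)[OF realizes_L x y]])
    then show ?thesis by (simp only: square_add sqL_def)
  qed
  show "sqL m n x + sqL m n x = 0" by (simp only: sqL_def square_double)
  assume "sqL m n x = 0"
  then obtain a b where ab: "?U x = a + a + br b b" unfolding sqL_def using square_eq_0D by blast
  let ?P = "qproj (gdeg m (n - 1))"
  have "?U x = ?P (a + a + br b b)" using rQ_closed[OF quasi_lift(1)[OF x]] by (simp only: ab)
  then have "kap (?U x) = kap (?P a) + kap (?P a)" by (simp add: qproj_square additive.add[OF additive_kap] kap_br)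
  then have e: "rL x = kap (?P a) + kap (?P a)" using quasi_lift(2)[OF x] by simp
  have "kap (?P a) \<in> rL ` carrier ?L" unfolding rL_image by simp
  then obtain h where h: "h \<in> carrier ?L" "rL h = kap (?P a)" by force
  have "x = h \<otimes>\<^bsub>?L\<^esub> h"
    using e h(2) realizesD(4)[OF realizes_L h(1) h(1)]
    by (intro realizesD(5)[OF realizes_L x realizesD(3)[OF realizes_L h(1) h(1)]]) simp
  then show "\<exists>h\<in>carrier ?L. x = h \<otimes>\<^bsub>?L\<^esub> h" using h(1) by blast
qed

lemma realizes_pullback:
  assumes G: "realizes G r" and H: "realizes H s" and K: "realizes K t"
    and f: "\<And>x. x \<in> carrier G \<Longrightarrow> f x \<in> carrier K"
      "\<And>x y. x \<in> carrier G \<Longrightarrow> y \<in> carrier G \<Longrightarrow> t (f (x \<otimes>\<^bsub>G\<^esub> y)) = t (f x) + t (f y)"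
    and g: "\<And>x. x \<in> carrier H \<Longrightarrow> g x \<in> carrier K"
      "\<And>x y. x \<in> carrier H \<Longrightarrow> y \<in> carrier H \<Longrightarrow> t (g (x \<otimes>\<^bsub>H\<^esub> y)) = t (g x) + t (g y)"
  shows "realizes ((G \<times>\<times> H)\<lparr>carrier := {(x, y). x \<in> carrier G \<and> y \<in> carrier H \<and> f x = g y}\<rparr>) (map_prod r s)"
    "realizes (G \<times>\<times> H) (map_prod r s)"
proof -
  interpret G: comm_group G by (rule realizes_comm_group[OF G])
  interpret H: comm_group H by (rule realizes_comm_group[OF H])
  have eq: "f x = g y \<longleftrightarrow> t (f x) = t (g y)" if "x \<in> carrier G" "y \<in> carrier H" for x y
    using realizesD(5)[OF K f(1)[OF that(1)] g(1)[OF that(2)]] by metis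
  have one: "t (f \<one>\<^bsub>G\<^esub>) = 0" "t (g \<one>\<^bsub>H\<^esub>) = 0"
    using f(2)[of "\<one>\<^bsub>G\<^esub>" "\<one>\<^bsub>G\<^esub>"] g(2)[of "\<one>\<^bsub>H\<^esub>" "\<one>\<^bsub>H\<^esub>"] by simp_all
  have inv: "t (f (inv\<^bsub>G\<^esub> x)) = - t (f x)" if "x \<in> carrier G" for x
    using f(2)[of x "inv\<^bsub>G\<^esub> x"] that one by (simp add: eq_neg_iff_add_eq_0 add.commute)
  have inv': "t (g (inv\<^bsub>H\<^esub> x)) = - t (g x)" if "x \<in> carrier H" for x
    using g(2)[of x "inv\<^bsub>H\<^esub> x"] that one by (simp add: eq_neg_iff_add_eq_0 add.commute)
  have "comm_group (G \<times>\<times> H)"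
    by (rule group.group_comm_groupI[OF DirProd_group[OF G.is_group H.is_group]])
       (auto simp: G.m_comm H.m_comm)
  then show P: "realizes (G \<times>\<times> H) (map_prod r s)"
  proof (rule realizesI)
    show "map_prod r s (x \<otimes>\<^bsub>G \<times>\<times> H\<^esub> y) = map_prod r s x + map_prod r s y"
      if "x \<in> carrier (G \<times>\<times> H)" "y \<in> carrier (G \<times>\<times> H)" for x y
      using that realizesD(4)[OF G] realizesD(4)[OF H] by (auto simp: mult_DirProd')
    show "x = \<one>\<^bsub>G \<times>\<times> H\<^esub>" if x: "x \<in> carrier (G \<times>\<times> H)" "map_prod r s x = 0" for x
    proof -
      have "r (fst x) = r \<one>\<^bsub>G\<^esub>" "s (snd x) = s \<one>\<^bsub>H\<^esub>"
        using x(2) realizesD(2)[OF G] realizesD(2)[OF H] by (simp_all add: prod_eq_iff)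
      then have "fst x = \<one>\<^bsub>G\<^esub>" "snd x = \<one>\<^bsub>H\<^esub>"
        using realizesD(5)[OF G _ G.one_closed] realizesD(5)[OF H _ H.one_closed] x(1) by auto
      then show ?thesis by (simp add: prod_eq_iff)
    qed
  qed
  show "realizes ((G \<times>\<times> H)\<lparr>carrier := {(x, y). x \<in> carrier G \<and> y \<in> carrier H \<and> f x = g y}\<rparr>) (map_prod r s)"
  proof (rule realizes_subset[OF P])
    let ?C = "{(x, y). x \<in> carrier G \<and> y \<in> carrier H \<and> f x = g y}"
    show "?C \<subseteq> carrier (G \<times>\<times> H)" by auto
    show "\<one>\<^bsub>G \<times>\<times> H\<^esub> \<in> ?C" by (simp add: eq one)
    show "x \<otimes>\<^bsub>G \<times>\<times> H\<^esub> y \<in> ?C" if "x \<in> ?C" "y \<in> ?C" for x y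
      using that by (auto simp: eq f(2) g(2))
    show "\<exists>y\<in>?C. map_prod r s y = - map_prod r s x" if "x \<in> ?C" for x
    proof -
      obtain a b where x: "x = (a, b)" "a \<in> carrier G" "b \<in> carrier H" "f a = g b" using \<open>x \<in> ?C\<close> by auto
      have "(inv\<^bsub>G\<^esub> a, inv\<^bsub>H\<^esub> b) \<in> ?C" using x by (simp add: eq inv inv')
      moreover have "map_prod r s (inv\<^bsub>G\<^esub> a, inv\<^bsub>H\<^esub> b) = - map_prod r s x"
        using realizes_inv[OF G x(2)] realizes_inv[OF H x(3)] x(1) by simp
      ultimately show ?thesis by blast
    qed
  qed
qed

definition rZL :: "nat \<Rightarrow> nat \<Rightarrow> mod2_Lie \<Rightarrow> qlie" where
  "rZL m n = induced (ext (\<lambda>(a, y). zmul a (sqL m n y)))"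

lemma realizes_ZL: "realizes (tensor Z2 (L_group m n)) (rZL m n)"
  unfolding rZL_def by (rule mod2_embedding.realizes_Z2[OF mod2_L])

lemma sq:
  assumes "X \<in> carrier (tensor Z2 (L_group m (j + 1)))"
  shows "sq m j X \<in> carrier (quasiL_group m (2 * j + 2))" "rQ (sq m j X) = rZL m (j + 1) X"
proof -
  let ?L = "L_group m (j + 1)" and ?Q = "quasiL_group m (2 * j + 2)"
  have e: "2 * j + 2 = (j + 1) + (j + 1)" by simp
  let ?b = "\<lambda>a X. let X' = inv_into (carrier (quasiL_group m (j + 1))) (quasi_proj m) X
        in quasi_bracket m (j + 1) (j + 1) X' X' [^]\<^bsub>?Q\<^esub> a"
  have b: "?b a y \<in> carrier ?Q" "rQ (?b a y) = zmul a (sqL m (j + 1) y)" if "y \<in> carrier ?L" for a :: int and y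
  proof -
    have l: "1 \<le> j + 1" by simp
    note q = quasi_bracket_closed[OF l l quasi_lift(1)[OF that] quasi_lift(1)[OF that]]
    show "?b a y \<in> carrier ?Q" "rQ (?b a y) = zmul a (sqL m (j + 1) y)"
      using realizes_int_pow[OF realizes_quasiL q(1), of a] q(2)
      unfolding e Let_def quasi_lift_def[symmetric] sqL_def by simp_all
  qed
  obtain z where z: "X = presented_class (carrier Z2 \<times> carrier ?L) (tensor_relators Z2 ?L) z"
    "Poly_Mapping.keys z \<subseteq> carrier Z2 \<times> carrier ?L"
    using assms unfolding mod2_embedding.carrier_Z2_tensor[OF mod2_L] by blast
  have bc: "(case p of (a, y) \<Rightarrow> ?b a y) \<in> carrier ?Q" if "p \<in> carrier Z2 \<times> carrier ?L" for p
    using that b(1) by (auto simp del: Let_def)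
  have ext_eq: "ext (\<lambda>p. rQ (case p of (a, y) \<Rightarrow> ?b a y)) z = ext (\<lambda>(a, y). zmul a (sqL m (j + 1) y)) z"
    if kz: "Poly_Mapping.keys z \<subseteq> carrier Z2 \<times> carrier ?L" for z
  proof (rule ext_cong)
    fix p assume "p \<in> Poly_Mapping.keys z"
    then obtain a y where p: "p = (a, y)" "y \<in> carrier ?L" using kz by auto
    show "rQ (case p of (a, y) \<Rightarrow> ?b a y) = (case p of (a, y) \<Rightarrow> zmul a (sqL m (j + 1) y))"
      unfolding p(1) prod.case by (rule b(2)[OF p(2)])
  qed
  have kill: "ext (\<lambda>p. rQ (case p of (a, y) \<Rightarrow> ?b a y)) r = 0" if "r \<in> tensor_relators Z2 ?L" for r
    using ext_eq[OF mod2_embedding.Z2_keys[OF mod2_L that]] mod2_embedding.Z2_kill[OF mod2_L that] by simp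
  note i = induced_lin_extend[OF mod2_embedding.Z2_keys[OF mod2_L] realizes_quasiL bc kill z(2)]
  show "sq m j X \<in> carrier ?Q" unfolding sq_def tensor_lift_def z(1) by (rule i(3))
  have "rQ (sq m j X) = ext (\<lambda>p. rQ (case p of (a, y) \<Rightarrow> ?b a y)) z"
    unfolding sq_def tensor_lift_def z(1) by (rule i(2))
  also have "\<dots> = rZL m (j + 1) X" unfolding ext_eq[OF z(2)] z(1) rZL_def mod2_embedding.Z2_class[OF mod2_L z(2)] ..
  finally show "rQ (sq m j X) = rZL m (j + 1) X" .
qed

lemma mod2_proj:
  assumes "W \<in> carrier (tensor Z2 (quasiL_group m n))"
  shows "mod2_proj m n W \<in> carrier (tensor Z2 (L_group m n))" "rZL m n (mod2_proj m n W) = sq2 (rZQ W)"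
proof -
  let ?Q = "quasiL_group m n" and ?K = "tensor Z2 (L_group m n)"
  let ?b = "\<lambda>a y. pure_tensor Z2 (L_group m n) (id a) (quasi_proj m y)"
  have b: "?b a y \<in> carrier ?K" "rZL m n (?b a y) = sq2 (zmul a (q2 (rQ y)))" if "a \<in> carrier Z2" "y \<in> carrier ?Q" for a y
  proof -
    note q = quasi_proj_closed[OF that(2)]
    have "sqL m n (quasi_proj m y) = sq2 (q2 (rQ y))"
      using sqL_eq[OF q(1) q(2)[symmetric]] by (simp add: sq2_q2)
    then show "?b a y \<in> carrier ?K" "rZL m n (?b a y) = sq2 (zmul a (q2 (rQ y)))"
      using mod2_embedding.Z2_pure_tensor[OF mod2_L that(1) q(1)] additive_zmul[OF additive_sq2, of a]
      by (simp_all add: rZL_def)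
  qed
  obtain z where z: "W = presented_class (carrier Z2 \<times> carrier ?Q) (tensor_relators Z2 ?Q) z"
    "Poly_Mapping.keys z \<subseteq> carrier Z2 \<times> carrier ?Q"
    using assms unfolding carrier_ZQ by blast
  have bc: "(case p of (a, y) \<Rightarrow> ?b a y) \<in> carrier ?K" if "p \<in> carrier Z2 \<times> carrier ?Q" for p
    using that b(1) by auto
  have ext_eq: "ext (\<lambda>p. rZL m n (case p of (a, y) \<Rightarrow> ?b a y)) z = sq2 (ext (\<lambda>(a, y). zmul a (q2 (rQ y))) z)"
    if "Poly_Mapping.keys z \<subseteq> carrier Z2 \<times> carrier ?Q" for z
    unfolding additive_ext_apply[OF additive_sq2] using that b(2) by (intro ext_cong) auto
  have kill: "ext (\<lambda>p. rZL m n (case p of (a, y) \<Rightarrow> ?b a y)) r = 0" if "r \<in> tensor_relators Z2 ?Q" for r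
    using ext_eq[OF mod2_embedding.Z2_keys[OF mod2_quasiL that]] mod2_embedding.Z2_kill[OF mod2_quasiL that]
    by (simp add: additive.zero[OF additive_sq2])
  note i = induced_lin_extend[OF mod2_embedding.Z2_keys[OF mod2_quasiL] realizes_ZL bc kill z(2)]
  show "mod2_proj m n W \<in> carrier ?K" unfolding mod2_proj_def tensor_map_def tensor_lift_def z(1) by (rule i(3))
  have "rZL m n (mod2_proj m n W) = ext (\<lambda>p. rZL m n (case p of (a, y) \<Rightarrow> ?b a y)) z"
    unfolding mod2_proj_def tensor_map_def tensor_lift_def z(1) by (rule i(2))
  also have "\<dots> = sq2 (rZQ W)" unfolding ext_eq[OF z(2)] z(1) rZQ_class[OF z(2)] ..
  finally show "rZL m n (mod2_proj m n W) = sq2 (rZQ W)" .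
qed

lemma D_lift:
  assumes "Z \<in> carrier (D_group m n)"
  obtains s where "s \<in> vhom m n" "kap (vbr s) = 0" "vk s = rLL m Z"
proof -
  have "rLL m Z \<in> vk ` {s \<in> vhom m n. kap (vbr s) = 0}" using assms unfolding rLL_D_image[symmetric] by blast
  then show thesis using that by force
qed

text \<open>The second factors have odd degree 2 j + 1, where L' and L agree, so the lift of
  \<open>Z\<close> picked by \<open>inv_into\<close> is the only one. Its bracket dies in L and is a
  square [y,y]; injectivity of \<open>sq\<close> identifies the preimage as 1 tensor y.\<close>

lemma sl:
  assumes Z: "Z \<in> carrier (D_group m (2 * j))"
  shows "sl m j Z \<in> carrier (tensor Z2 (L_group m (j + 1)))"
    "\<And>t. t \<in> vhom m (2 * j) \<Longrightarrow> vk t = rLL m Z \<Longrightarrow> rZL m (j + 1) (sl m j Z) = vbr t"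
proof -
  let ?K = "tensor Z2 (L_group m (j + 1))" and ?tm = "tensor_map (L_group m 1) (L_group m (2 * j + 1)) (quasi_proj m) (quasi_proj m)"
  have "?tm ` carrier (quasiLL_group m (2 * j)) = carrier (LL_group m (2 * j))"
  proof (rule realizes_image_eq[OF realizes_LL, where r = "rQQ m" and p = vk])
    show "?tm X \<in> carrier (LL_group m (2 * j))" "rLL m (?tm X) = vk (rQQ m X)"
      if "X \<in> carrier (quasiLL_group m (2 * j))" for X
      using QQ_proj[OF that] .
    show "vk ` rQQ m ` carrier (quasiLL_group m (2 * j)) = rLL m ` carrier (LL_group m (2 * j))"
      unfolding rQQ_image rLL_image ..
  qed simp
  then have Z': "Z \<in> ?tm ` carrier (quasiLL_group m (2 * j))" using Z by (simp add: carrier_D)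
  define V where "V = inv_into (carrier (quasiLL_group m (2 * j))) ?tm Z"
  have V: "V \<in> carrier (quasiLL_group m (2 * j))" unfolding V_def by (rule inv_into_into[OF Z'])
  have vkV: "vk (rQQ m V) = rLL m Z" using QQ_proj(2)[OF V] f_inv_into_f[OF Z'] unfolding V_def by simp
  obtain s where s: "s \<in> vhom m (2 * j)" "kap (vbr s) = 0" "vk s = rLL m Z" using D_lift[OF Z] .
  have unique: "s' = rQQ m V" if "s' \<in> vhom m (2 * j)" "vk s' = rLL m Z" for s'
  proof -
    have "rQQ m V \<in> vhom m (2 * j)" using V rQQ_image by blast
    then have "s' - rQQ m V = 0" using that vkV by (intro vk_eq_0_even[of _ m j] vhom_diff) simp_all
    then show ?thesis by simp
  qed
  obtain y where y: "vbr s = br y y" "qproj (gdeg m j) y = y" using kap_eq_0_even[OF s(2) vbr_vhom[OF s(1)]] .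
  have "kap y \<in> rL ` carrier (L_group m (j + 1))" unfolding rL_image using y(2) by simp
  then obtain Y where Y: "Y \<in> carrier (L_group m (j + 1))" "kap y = rL Y" by blast
  let ?X = "pure_tensor Z2 (L_group m (j + 1)) 1 Y"
  have 1: "1 \<in> carrier Z2" by (simp add: carrier_Z2)
  note p = mod2_embedding.Z2_pure_tensor[OF mod2_L 1 Y(1)]
  have rX: "rZL m (j + 1) ?X = vbr s" unfolding rZL_def p(2) sqL_eq[OF Y] y(1) by simp
  have "rQ (sq m j ?X) = rQ (quasiLL_bracket m (2 * j) V)"
    unfolding sq(2)[OF p(1)] QQ_bracket(2)[OF V] rX unique[OF s(1,3)] ..
  then have "sq m j ?X = quasiLL_bracket m (2 * j) V"
    by (rule realizesD(5)[OF realizes_quasiL sq(1)[OF p(1)] QQ_bracket(1)[OF V]])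
  moreover have "inj_on (sq m j) (carrier ?K)"
  proof (rule inj_onI)
    fix a b assume ab: "a \<in> carrier ?K" "b \<in> carrier ?K" "sq m j a = sq m j b"
    then have "rZL m (j + 1) a = rZL m (j + 1) b" using sq(2)[OF ab(1)] sq(2)[OF ab(2)] by simp
    then show "a = b" by (rule realizesD(5)[OF realizes_ZL ab(1,2)])
  qed
  ultimately have "sl m j Z = ?X" unfolding sl_def V_def[symmetric] using inv_into_f_f[OF _ p(1), of "sq m j"] by simp
  then show "sl m j Z \<in> carrier ?K" using p(1) by simp
  show "rZL m (j + 1) (sl m j Z) = vbr t" if "t \<in> vhom m (2 * j)" "vk t = rLL m Z" for t
    using \<open>sl m j Z = ?X\<close> rX unique[OF s(1,3)] unique[OF that] by simp
qed

text \<open>With j odd, the twisted part u has even degree j + 1, where [u,u] = 0 no longer forces u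
  to be a double. The second component of the map records u modulo 2, and the pullback condition
  states that the bracket of the first component is [u,u].\<close>

lemma eta_inf_iso:
  assumes "1 \<le> k"
  shows "eta_inf m k \<in> iso (Tinf_even m (2 * k - 1)) (D_inf m k)"
proof -
  define j where "j = 2 * k - 1"
  have e1: "4 * k - 2 = 2 * j" and e2: "2 * k = j + 1" using assms by (simp_all add: j_def)
  let ?D = "D_group m (2 * j)" and ?Q = "tensor Z2 (quasiL_group m (j + 1))" and ?L = "tensor Z2 (L_group m (j + 1))"
  let ?C = "{(Z, W). Z \<in> carrier ?D \<and> W \<in> carrier ?Q \<and> sl m j Z = mod2_proj m (j + 1) W}"
  let ?cl = "presented_class (tgens m j) (twisted_relators m j)"
  let ?S = "{z. Poly_Mapping.keys z \<subseteq> tgens m j}"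
  have D_inf: "D_inf m k = (?D \<times>\<times> ?Q)\<lparr>carrier := ?C\<rparr>"
    unfolding D_inf_def j_def[symmetric] e1 unfolding e2 ..
  have sl_add: "rZL m (j + 1) (sl m j (x \<otimes>\<^bsub>?D\<^esub> y)) = rZL m (j + 1) (sl m j x) + rZL m (j + 1) (sl m j y)"
    if xy: "x \<in> carrier ?D" "y \<in> carrier ?D" for x y
  proof -
    obtain s where s: "s \<in> vhom m (2 * j)" "vk s = rLL m x" using D_lift[OF xy(1)] .
    obtain t where t: "t \<in> vhom m (2 * j)" "vk t = rLL m y" using D_lift[OF xy(2)] .
    have "s + t \<in> vhom m (2 * j)" using vhom_diff[OF s(1) vhom_diff[OF vhom_0 t(1)]] by simp
    then show ?thesis
      using sl(2)[OF xy(1) s] sl(2)[OF xy(2) t] sl(2)[OF realizesD(3)[OF realizes_D xy], of "s + t"] s t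
        realizesD(4)[OF realizes_D xy] by simp
  qed
  have proj_add: "rZL m (j + 1) (mod2_proj m (j + 1) (x \<otimes>\<^bsub>?Q\<^esub> y)) =
      rZL m (j + 1) (mod2_proj m (j + 1) x) + rZL m (j + 1) (mod2_proj m (j + 1) y)"
    if xy: "x \<in> carrier ?Q" "y \<in> carrier ?Q" for x y
    unfolding mod2_proj(2)[OF realizesD(3)[OF realizes_ZQ xy]] mod2_proj(2)[OF xy(1)] mod2_proj(2)[OF xy(2)]
      realizesD(4)[OF realizes_ZQ xy] additive.add[OF additive_sq2] ..
  note pb = realizes_pullback[where f = "sl m j" and g = "mod2_proj m (j + 1)" and K = ?L and t = "rZL m (j + 1)"
      and G = ?D and H = ?Q and r = "rLL m" and s = rZQ, OF realizes_D realizes_ZQ realizes_ZL sl(1) sl_add mod2_proj(1) proj_add]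
  \<comment> \<open>The pullback condition in realized form: both sides are compared in L', as the
    bracket of a lift of \<open>Z\<close> and as the square belonging to \<open>W\<close>.\<close>
  have mem: "(Z, W) \<in> ?C \<longleftrightarrow> Z \<in> carrier ?D \<and> W \<in> carrier ?Q \<and> vbr s = sq2 (rZQ W)"
    if "s \<in> vhom m (2 * j)" "vk s = rLL m Z" for Z W s
  proof -
    have "sl m j Z = mod2_proj m (j + 1) W \<longleftrightarrow> vbr s = sq2 (rZQ W)" if c: "Z \<in> carrier ?D" "W \<in> carrier ?Q"
      using realizesD(5)[OF realizes_ZL sl(1)[OF c(1)] mod2_proj(1)[OF c(2)]] sl(2)[OF c(1) \<open>s \<in> vhom m (2 * j)\<close> \<open>vk s = rLL m Z\<close>]
        mod2_proj(2)[OF c(2)] by metis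
    then show ?thesis by auto
  qed
  let ?F = "\<lambda>z. (vk (ext tgen_sum z), q2 (twisted_part z))"
  have add_F: "additive ?F"
    by standard (simp add: additive.add[OF additive_vk])
  have ker: "?F z = 0 \<longleftrightarrow> z \<in> zmod.span (twisted_relators m j)" if z: "Poly_Mapping.keys z \<subseteq> tgens m j" for z
  proof
    assume z0: "?F z = 0"
    then have "ext tgen_sum z = 0" using vk_eq_0_even[OF ext_tgen_sum_vhom[OF z]] by (simp add: prod_eq_iff)
    moreover obtain h where "twisted_part z = h + h" using z0 q2_eq_iff[of "twisted_part z" 0] by (auto simp: prod_eq_iff)
    ultimately show "z \<in> zmod.span (twisted_relators m j)" using span_twistedI[OF z] by blast
  next
    assume "z \<in> zmod.span (twisted_relators m j)"
    then obtain h where "ext tgen_sum z = 0" "twisted_part z = h + h" using twisted_part_span by blast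
    then show "?F z = 0" using q2_double[of h] by (simp add: prod_eq_iff)
  qed
  have r: "realizes (Tinf_even m j) (induced ?F)"
    "Poly_Mapping.keys z \<subseteq> tgens m j \<Longrightarrow> induced ?F (?cl z) = ?F z"
    "carrier (Tinf_even m j) = ?cl ` ?S" for z
    using realizes_presented[OF twisted_relators_props(1) add_F ker] unfolding Tinf_even_def by blast+
  let ?b = "\<lambda>g. case g of Tree t \<Rightarrow> \<one>\<^bsub>?Q\<^esub>
             | Twisted J \<Rightarrow> pure_tensor Z2 (quasiL_group m (j + 1)) 1 (quasi_class m (j + 1) (frag_of J))"
  have b: "?b g \<in> carrier ?Q" "rZQ (?b g) = q2 (case g of Tree T \<Rightarrow> 0 | Twisted J \<Rightarrow> qt J)" if "g \<in> tgens m j" for g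
    using that realizesD(1,2)[OF realizes_ZQ, of m "j + 1"] ZQ_pure[of "frag_of _" m j] unfolding tgens_def by auto
  have ext_eq: "ext (\<lambda>g. rZQ (?b g)) z = q2 (twisted_part z)" if "Poly_Mapping.keys z \<subseteq> tgens m j" for z
    unfolding twisted_part_def additive_ext_apply[OF additive_q2] using that by (intro ext_cong b(2)) auto
  have kill: "ext (\<lambda>g. rZQ (?b g)) r = 0" if "r \<in> twisted_relators m j" for r
    using ext_eq[OF twisted_relators_props(1)[OF that]] twisted_relators_props(3)[OF that] q2_double by auto
  have eta: "eta_inf m k (?cl z) \<in> carrier (LL_group m (2 * j)) \<times> carrier ?Q"
    "map_prod (rLL m) rZQ (eta_inf m k (?cl z)) = ?F z" if z: "Poly_Mapping.keys z \<subseteq> tgens m j" for z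
  proof -
    note i = induced_lin_extend[OF twisted_relators_props(1) realizes_ZQ b(1) kill z]
    have e: "eta_inf m k (?cl z) = (eta_even m j (?cl z), induced (lin_extend ?Q ?b) (?cl z))"
      unfolding eta_inf_def j_def[symmetric] unfolding e2 ..
    show "eta_inf m k (?cl z) \<in> carrier (LL_group m (2 * j)) \<times> carrier ?Q"
      unfolding e using eta_even(1)[OF z] i(3) by blast
    show "map_prod (rLL m) rZQ (eta_inf m k (?cl z)) = ?F z"
      unfolding e using eta_even(2)[OF z] i(2) ext_eq[OF z] by simp
  qed
  show ?thesis unfolding D_inf j_def[symmetric]
  proof (rule realizes_iso[OF r(1) pb(1) _ additive_ident])
    fix X assume "X \<in> carrier (Tinf_even m j)"
    then obtain z where "X = ?cl z" "Poly_Mapping.keys z \<subseteq> tgens m j" unfolding r(3) by blast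
    then show "map_prod (rLL m) rZQ (eta_inf m k X) = induced ?F X" by (simp add: r(2) eta)
  next
    have "(\<lambda>z. eta_inf m k (?cl z)) ` ?S = ?C"
    proof (rule realizes_image_eq[OF pb(2), where r = "\<lambda>z. z" and p = ?F])
      show "eta_inf m k (?cl z) \<in> carrier (?D \<times>\<times> ?Q)" if "z \<in> ?S" for z
      proof -
        have z: "Poly_Mapping.keys z \<subseteq> tgens m j" using that by simp
        obtain a b where ab: "eta_inf m k (?cl z) = (a, b)" by fastforce
        have "rLL m a = vk (ext tgen_sum z)" using eta(2)[OF z] by (simp add: ab)
        then show ?thesis using eta(1)[OF z] by (simp add: ab carrier_D avbr_vk vbr_ext_tgen_sum kap_br)
      qed
      show "?F ` (\<lambda>z. z) ` ?S = map_prod (rLL m) rZQ ` ?C"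
      proof (intro equalityI subsetI)
        fix q assume "q \<in> ?F ` (\<lambda>z. z) ` ?S"
        then obtain z where z: "q = ?F z" "Poly_Mapping.keys z \<subseteq> tgens m j" by auto
        have "vk (ext tgen_sum z) \<in> rLL m ` carrier ?D"
          unfolding rLL_D_image using ext_tgen_sum_vhom[OF z(2)] by (simp add: vbr_ext_tgen_sum kap_br)
        then obtain Z where Z: "Z \<in> carrier ?D" "vk (ext tgen_sum z) = rLL m Z" by blast
        have "q2 (twisted_part z) \<in> rZQ ` carrier (tensor Z2 (quasiL_group m (Suc j)))"
          unfolding rZQ_image using twisted_part_hom[OF z(2)] by simp
        then obtain W where W: "W \<in> carrier ?Q" "q2 (twisted_part z) = rZQ W" by auto
        have "(Z, W) \<in> ?C" using mem[OF ext_tgen_sum_vhom[OF z(2)] Z(2)] Z(1) W(1)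
          by (simp add: vbr_ext_tgen_sum W(2)[symmetric] sq2_q2)
        moreover have "q = map_prod (rLL m) rZQ (Z, W)" by (simp add: z(1) Z(2) W(2))
        ultimately show "q \<in> map_prod (rLL m) rZQ ` ?C" by blast
      next
        fix q assume "q \<in> map_prod (rLL m) rZQ ` ?C"
        then obtain Z W where ZW: "q = (rLL m Z, rZQ W)" "(Z, W) \<in> ?C" by auto
        have c: "Z \<in> carrier ?D" "W \<in> carrier ?Q" using ZW(2) by auto
        obtain s where s: "s \<in> vhom m (2 * j)" "vk s = rLL m Z" using D_lift[OF c(1)] .
        have "rZQ W \<in> q2 ` {u. qproj (gdeg m j) u = u}" using c(2) unfolding rZQ_image[symmetric] by simp
        then obtain u where u: "rZQ W = q2 u" "qproj (gdeg m j) u = u" by blast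
        have "vbr s = br u u" using mem[OF s] ZW(2) by (simp add: u(1) sq2_q2)
        then obtain z where z: "Poly_Mapping.keys z \<subseteq> tgens m j" "ext tgen_sum z = s" "twisted_part z = u"
          using ext_tgen_sum_image[OF s(1) _ u(2)] by blast
        then have "q = ?F z" by (simp add: ZW(1) s(2) u(1))
        then show "q \<in> ?F ` (\<lambda>z. z) ` ?S" using z(1) by blast
      qed
    qed (auto simp: eta(2))
    then show "eta_inf m k ` carrier (Tinf_even m j) = carrier ((?D \<times>\<times> ?Q)\<lparr>carrier := ?C\<rparr>)"
      unfolding r(3) image_image by simp
  qed
qed

theorem theorem6p5:
  fixes m k :: nat
  assumes "1 \<le> m" and "1 \<le> k"
  shows "eta_tilde m k \<in> iso (T_tilde m k) (D_tilde m k) \<and>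
         eta_odd m k \<in> iso (Tinf_odd m k) (D_group m (2 * k - 1)) \<and>
         eta_even m (2 * k) \<in> iso (Tinf_even m (2 * k)) (D_group m (4 * k)) \<and>
         eta_inf m k \<in> iso (Tinf_even m (2 * k - 1)) (D_inf m k)"
  using eta_tilde_iso[OF assms(2)] eta_odd_iso[OF assms(2)] eta_even_iso eta_inf_iso[OF assms(2)] by blast

end
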